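(* Let $F=\alpha+\beta$ be a non-Riemannian Randers metric on an $n(\ge 2)$-dimensional manifold $M$ and let $V$ be a $C^2$ vector field on $M$. Then $(M,F,V)$ is an almost Ricci soliton with soliton scalar $\kappa=\kappa(x)$ if and only if there are scalar functions $c=c(x)$ and $\sigma=\sigma(x)$ on $M$ such that $V$ is a conformal vector field of $\alpha$ with conformal factor $c$, i.e. $V_{i;j}+V_{j;i}=4c\,a_{ij}$, and the following identities hold on $TM$: $$e_{00}=2\sigma(\alpha^2-\beta^2),$$ $${}^{\alpha}\mathrm{Ric}=(\kappa-2c)(\alpha^2+\beta^2)+t^i_{\ i}\alpha^2+2t_{00}-(n-1)\sigma^2(3\alpha^2-\beta^2)+2(n-1)\sigma_0\beta-(n-1)(s_0^2+s_{0;0}),$$ where $\sigma_0:=\sigma_{x^i}y^i$ satisfies $$3(n-1)\sigma_0=2c\beta-\mathcal L_{\hat V}(\beta).$$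
   Context: A Randers metric is $F=\alpha+\beta$ with $\alpha=\sqrt{a_{ij}(x)y^iy^j}$ a Riemannian metric and $\beta=b_i(x)y^i$ a 1-form with $b:=\|\beta\|_\alpha<1$; $F$ is non-Riemannian when $\beta\neq0$. Ricci curvature of a Finsler metric $F$: with $g_{ij}=\frac12[F^2]_{y^iy^j}$, $G^i=\frac14 g^{il}\{[F^2]_{x^ky^l}y^k-[F^2]_{x^l}\}$ and $R^i_{\ k}=2\frac{\partial G^i}{\partial x^k}-\frac{\partial^2G^i}{\partial x^j\partial y^k}y^j+2G^j\frac{\partial^2G^i}{\partial y^j\partial y^k}-\frac{\partial G^i}{\partial y^j}\frac{\partial G^j}{\partial y^k}$, $\mathrm{Ric}(x,y)=R^i_{\ i}$. ${}^\alpha\mathrm{Ric}={}^\alpha\mathrm{Ric}_{ij}y^iy^j$ is the Ricci curvature of $\alpha$. Complete lift of $V=V^i\partial_{x^i}$: $\hat V=V^i\frac{\partial}{\partial x^i}+y^j\frac{\partial V^i}{\partial x^j}\frac{\partial}{\partial y^i}$; $\mathcal L_{\hat V}(\phi)=\hat V(\phi)$ for functions $\phi$ on $TM$. In particular $\mathcal L_{\hat V}(\beta)=(V^kb_{j;k}+b^kV_{k;j})y^j$ with $V_i=a_{ij}V^j$. $(M,F,V)$ is an almost Ricci soliton with soliton scalar $\kappa=\kappa(x)$ if $2\mathrm{Ric}+\mathcal L_{\hat V}(F^2)=2\kappa F^2$ on $TM$. Notation: ";" is covariant differentiation with respect to the Levi-Civita connection of $\alpha$; indices are raised and lowered with $a_{ij}$;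 $r_{ij}=\frac12(b_{i;j}+b_{j;i})$, $s_{ij}=\frac12(b_{i;j}-b_{j;i})$, $s^i_{\ j}=a^{ik}s_{kj}$, $s_j=b^is_{ij}$, $e_{ij}=r_{ij}+b_is_j+b_js_i$, $t_{ij}=s_{ik}s^k_{\ j}$, $t^i_{\ j}=a^{ik}t_{kj}$. A subscript $0$ denotes contraction with $y$: $e_{00}=e_{ij}y^iy^j$, $t_{00}=t_{ij}y^iy^j$, $s_0=s_jy^j$, $s_{0;0}=s_{i;j}y^iy^j$. *)

theory Defs
  imports "HOL-Analysis.Analysis"
begin

section \<open>Partial derivatives and classes of differentiability\<close>

definition pd :: "'n::finite \<Rightarrow> (real^'n \<Rightarrow> real) \<Rightarrow> real^'n \<Rightarrow> real" where
  "pd i f x = deriv (\<lambda>t. f (x + t *\<^sub>R axis i 1)) 0"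

text \<open>To be used on open sets \<open>S\<close> only.\<close>

primrec Ck_on :: "nat \<Rightarrow> (real^'n::finite) set \<Rightarrow> (real^'n \<Rightarrow> real) \<Rightarrow> bool" where
  "Ck_on 0 S f = continuous_on S f"
| "Ck_on (Suc k) S f = ((\<forall>x\<in>S. f differentiable (at x)) \<and> (\<forall>i. Ck_on k S (pd i f)))"

definition smooth_on :: "(real^'n::finite) set \<Rightarrow> (real^'n \<Rightarrow> real) \<Rightarrow> bool" where
  "smooth_on S f \<longleftrightarrow> (\<forall>k. Ck_on k S f)"

text \<open>Partial derivatives of a function \<open>f x y\<close> in local coordinates \<open>(x, y)\<close> of the tangent
  bundle, with respect to the base and to the fibre variables.\<close>

definition dx :: "'n::finite \<Rightarrow> (real^'n \<Rightarrow> real^'n \<Rightarrow> real) \<Rightarrow> real^'n \<Rightarrow> real^'n \<Rightarrow> real" where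
  "dx i f x y = pd i (\<lambda>x. f x y) x"

definition dy :: "'n::finite \<Rightarrow> (real^'n \<Rightarrow> real^'n \<Rightarrow> real) \<Rightarrow> real^'n \<Rightarrow> real^'n \<Rightarrow> real" where
  "dy i f x y = pd i (\<lambda>y. f x y) y"


section \<open>Smooth manifolds and tensor fields\<close>

text \<open>A chart consists of its domain and its coordinate map; the values of the coordinate map outside
  the domain are irrelevant. The dimension of the manifold is \<open>CARD('n)\<close>.\<close>

type_synonym ('m, 'n) chart = "'m set \<times> ('m \<Rightarrow> real^'n)"

abbreviation dom_of :: "('m, 'n::finite) chart \<Rightarrow> 'm set" where
  "dom_of \<equiv> fst"

abbreviation rng_of :: "('m, 'n::finite) chart \<Rightarrow> (real^'n) set" where
  "rng_of \<phi> \<equiv> snd \<phi> ` fst \<phi>"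

definition chart_inv :: "('m, 'n::finite) chart \<Rightarrow> real^'n \<Rightarrow> 'm" where
  "chart_inv \<phi> = inv_into (fst \<phi>) (snd \<phi>)"

definition is_chart :: "'m topology \<Rightarrow> ('m, 'n::finite) chart \<Rightarrow> bool" where
  "is_chart X \<phi> \<longleftrightarrow> openin X (dom_of \<phi>) \<and> open (rng_of \<phi>) \<and>
     homeomorphic_map (subtopology X (dom_of \<phi>)) (top_of_set (rng_of \<phi>)) (snd \<phi>)"

definition transition :: "('m, 'n::finite) chart \<Rightarrow> ('m, 'n) chart \<Rightarrow> real^'n \<Rightarrow> real^'n" where
  "transition \<phi> \<psi> x = snd \<psi> (chart_inv \<phi> x)"

definition overlap :: "('m, 'n::finite) chart \<Rightarrow> ('m, 'n) chart \<Rightarrow> (real^'n) set" where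
  "overlap \<phi> \<psi> = snd \<phi> ` (dom_of \<phi> \<inter> dom_of \<psi>)"

definition smooth_manifold :: "'m topology \<Rightarrow> ('m, 'n::finite) chart set \<Rightarrow> bool" where
  "smooth_manifold X A \<longleftrightarrow> Hausdorff_space X \<and> second_countable X \<and>
     (\<forall>\<phi>\<in>A. is_chart X \<phi>) \<and> (\<Union>\<phi>\<in>A. dom_of \<phi>) = topspace X \<and>
     (\<forall>\<phi>\<in>A. \<forall>\<psi>\<in>A. \<forall>i. smooth_on (overlap \<phi> \<psi>) (\<lambda>x. transition \<phi> \<psi> x $ i))"

definition jac :: "('m, 'n::finite) chart \<Rightarrow> ('m, 'n) chart \<Rightarrow> real^'n \<Rightarrow> real^'n^'n" where
  "jac \<phi> \<psi> x = (\<chi> i k. pd k (\<lambda>x. transition \<phi> \<psi> x $ i) x)"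

text \<open>A tensor field is the family of its components in the charts of the atlas, as functions of the
  coordinates, subject to the usual transformation law on overlaps. A function on \<open>TM\<close> is likewise
  given by its expressions \<open>f \<phi> x y\<close> in the induced coordinates of \<open>TM\<close>.\<close>

definition vector_field ::
    "nat \<Rightarrow> ('m, 'n::finite) chart set \<Rightarrow> (('m, 'n) chart \<Rightarrow> real^'n \<Rightarrow> real^'n) \<Rightarrow> bool" where
  "vector_field r A V \<longleftrightarrow>
     (\<forall>\<phi>\<in>A. \<forall>i. Ck_on r (rng_of \<phi>) (\<lambda>x. V \<phi> x $ i)) \<and>
     (\<forall>\<phi>\<in>A. \<forall>\<psi>\<in>A. \<forall>x\<in>overlap \<phi> \<psi>. \<forall>i.
        V \<psi> (transition \<phi> \<psi> x) $ i = (\<Sum>k\<in>UNIV. jac \<phi> \<psi> x $ i $ k * V \<phi> x $ k))"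

definition one_form ::
    "('m, 'n::finite) chart set \<Rightarrow> (('m, 'n) chart \<Rightarrow> real^'n \<Rightarrow> real^'n) \<Rightarrow> bool" where
  "one_form A b \<longleftrightarrow>
     (\<forall>\<phi>\<in>A. \<forall>i. smooth_on (rng_of \<phi>) (\<lambda>x. b \<phi> x $ i)) \<and>
     (\<forall>\<phi>\<in>A. \<forall>\<psi>\<in>A. \<forall>x\<in>overlap \<phi> \<psi>. \<forall>k.
        b \<phi> x $ k = (\<Sum>i\<in>UNIV. b \<psi> (transition \<phi> \<psi> x) $ i * jac \<phi> \<psi> x $ i $ k))"

definition riemannian_metric ::
    "('m, 'n::finite) chart set \<Rightarrow> (('m, 'n) chart \<Rightarrow> real^'n \<Rightarrow> real^'n^'n) \<Rightarrow> bool" where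
  "riemannian_metric A a \<longleftrightarrow>
     (\<forall>\<phi>\<in>A. \<forall>i j. smooth_on (rng_of \<phi>) (\<lambda>x. a \<phi> x $ i $ j)) \<and>
     (\<forall>\<phi>\<in>A. \<forall>x\<in>rng_of \<phi>. transpose (a \<phi> x) = a \<phi> x \<and>
        (\<forall>y. y \<noteq> 0 \<longrightarrow> (\<Sum>i\<in>UNIV. \<Sum>j\<in>UNIV. a \<phi> x $ i $ j * y $ i * y $ j) > 0)) \<and>
     (\<forall>\<phi>\<in>A. \<forall>\<psi>\<in>A. \<forall>x\<in>overlap \<phi> \<psi>. \<forall>k l.
        a \<phi> x $ k $ l = (\<Sum>i\<in>UNIV. \<Sum>j\<in>UNIV.
          a \<psi> (transition \<phi> \<psi> x) $ i $ j * jac \<phi> \<psi> x $ i $ k * jac \<phi> \<psi> x $ j $ l))"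

definition in_chart :: "('m, 'n::finite) chart \<Rightarrow> ('m \<Rightarrow> real) \<Rightarrow> real^'n \<Rightarrow> real" where
  "in_chart \<phi> f x = f (chart_inv \<phi> x)"

definition C1_scalar :: "('m, 'n::finite) chart set \<Rightarrow> ('m \<Rightarrow> real) \<Rightarrow> bool" where
  "C1_scalar A f \<longleftrightarrow> (\<forall>\<phi>\<in>A. Ck_on 1 (rng_of \<phi>) (in_chart \<phi> f))"


section \<open>Local Riemannian geometry\<close>

text \<open>Throughout, \<open>a\<close> is a metric, \<open>b\<close> and \<open>w\<close> are covector fields and \<open>V\<close> is a vector field, all given
  by components in one chart.\<close>

definition ainv :: "(real^'n::finite \<Rightarrow> real^'n^'n) \<Rightarrow> real^'n \<Rightarrow> real^'n^'n" where
  "ainv a x = matrix_inv (a x)"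

definition raise :: "(real^'n::finite \<Rightarrow> real^'n^'n) \<Rightarrow> (real^'n \<Rightarrow> real^'n) \<Rightarrow> real^'n \<Rightarrow> real^'n" where
  "raise a w x = (\<chi> i. \<Sum>j\<in>UNIV. ainv a x $ i $ j * w x $ j)"

definition lower :: "(real^'n::finite \<Rightarrow> real^'n^'n) \<Rightarrow> (real^'n \<Rightarrow> real^'n) \<Rightarrow> real^'n \<Rightarrow> real^'n" where
  "lower a V x = (\<chi> i. \<Sum>j\<in>UNIV. a x $ i $ j * V x $ j)"

text \<open>\<open>christoffel a k i j x\<close> is \<open>\<Gamma>\<^sup>k\<^sub>i\<^sub>j\<close> at \<open>x\<close>.\<close>

definition christoffel ::
    "(real^'n::finite \<Rightarrow> real^'n^'n) \<Rightarrow> 'n \<Rightarrow> 'n \<Rightarrow> 'n \<Rightarrow> real^'n \<Rightarrow> real" where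
  "christoffel a k i j x = (1/2) * (\<Sum>l\<in>UNIV. ainv a x $ k $ l *
     (pd i (\<lambda>x. a x $ j $ l) x + pd j (\<lambda>x. a x $ i $ l) x - pd l (\<lambda>x. a x $ i $ j) x))"

text \<open>\<open>cov a w x $ i $ j\<close> is \<open>w\<^sub>i\<^sub>;\<^sub>j\<close>: the second index is the direction of differentiation.\<close>

definition cov :: "(real^'n::finite \<Rightarrow> real^'n^'n) \<Rightarrow> (real^'n \<Rightarrow> real^'n) \<Rightarrow> real^'n \<Rightarrow> real^'n^'n" where
  "cov a w x = (\<chi> i j. pd j (\<lambda>x. w x $ i) x - (\<Sum>k\<in>UNIV. christoffel a k i j x * w x $ k))"

definition ric_tensor :: "(real^'n::finite \<Rightarrow> real^'n^'n) \<Rightarrow> real^'n \<Rightarrow> real^'n^'n" where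
  "ric_tensor a x = (\<chi> i j.
     (\<Sum>k\<in>UNIV. pd k (christoffel a k i j) x - pd j (christoffel a k i k) x) +
     (\<Sum>k\<in>UNIV. \<Sum>l\<in>UNIV. christoffel a k k l x * christoffel a l i j x
                          - christoffel a k j l x * christoffel a l i k x))"

definition quad :: "real^'n::finite^'n \<Rightarrow> real^'n \<Rightarrow> real" where
  "quad T y = (\<Sum>i\<in>UNIV. \<Sum>j\<in>UNIV. T $ i $ j * y $ i * y $ j)"

definition lin :: "real^'n::finite \<Rightarrow> real^'n \<Rightarrow> real" where
  "lin w y = (\<Sum>i\<in>UNIV. w $ i * y $ i)"

definition alpha :: "(real^'n::finite \<Rightarrow> real^'n^'n) \<Rightarrow> real^'n \<Rightarrow> real^'n \<Rightarrow> real" where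
  "alpha a x y = sqrt (quad (a x) y)"

definition beta :: "(real^'n::finite \<Rightarrow> real^'n) \<Rightarrow> real^'n \<Rightarrow> real^'n \<Rightarrow> real" where
  "beta b x y = lin (b x) y"

definition norm_beta :: "(real^'n::finite \<Rightarrow> real^'n^'n) \<Rightarrow> (real^'n \<Rightarrow> real^'n) \<Rightarrow> real^'n \<Rightarrow> real" where
  "norm_beta a b x = sqrt (quad (ainv a x) (b x))"

definition alpha_Ric :: "(real^'n::finite \<Rightarrow> real^'n^'n) \<Rightarrow> real^'n \<Rightarrow> real^'n \<Rightarrow> real" where
  "alpha_Ric a x y = quad (ric_tensor a x) y"

text \<open>The tensors attached to \<open>\<beta>\<close>; in \<open>s_up\<close> and \<open>t_up\<close> the first index is the raised one.\<close>

definition r_lo :: "(real^'n::finite \<Rightarrow> real^'n^'n) \<Rightarrow> (real^'n \<Rightarrow> real^'n) \<Rightarrow> real^'n \<Rightarrow> real^'n^'n" where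
  "r_lo a b x = (\<chi> i j. (1/2) * (cov a b x $ i $ j + cov a b x $ j $ i))"

definition s_lo :: "(real^'n::finite \<Rightarrow> real^'n^'n) \<Rightarrow> (real^'n \<Rightarrow> real^'n) \<Rightarrow> real^'n \<Rightarrow> real^'n^'n" where
  "s_lo a b x = (\<chi> i j. (1/2) * (cov a b x $ i $ j - cov a b x $ j $ i))"

definition s_up :: "(real^'n::finite \<Rightarrow> real^'n^'n) \<Rightarrow> (real^'n \<Rightarrow> real^'n) \<Rightarrow> real^'n \<Rightarrow> real^'n^'n" where
  "s_up a b x = (\<chi> i j. \<Sum>k\<in>UNIV. ainv a x $ i $ k * s_lo a b x $ k $ j)"

definition s_vec :: "(real^'n::finite \<Rightarrow> real^'n^'n) \<Rightarrow> (real^'n \<Rightarrow> real^'n) \<Rightarrow> real^'n \<Rightarrow> real^'n" where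
  "s_vec a b x = (\<chi> j. \<Sum>i\<in>UNIV. raise a b x $ i * s_lo a b x $ i $ j)"

definition e_lo :: "(real^'n::finite \<Rightarrow> real^'n^'n) \<Rightarrow> (real^'n \<Rightarrow> real^'n) \<Rightarrow> real^'n \<Rightarrow> real^'n^'n" where
  "e_lo a b x = (\<chi> i j. r_lo a b x $ i $ j + b x $ i * s_vec a b x $ j + b x $ j * s_vec a b x $ i)"

definition t_lo :: "(real^'n::finite \<Rightarrow> real^'n^'n) \<Rightarrow> (real^'n \<Rightarrow> real^'n) \<Rightarrow> real^'n \<Rightarrow> real^'n^'n" where
  "t_lo a b x = (\<chi> i j. \<Sum>k\<in>UNIV. s_lo a b x $ i $ k * s_up a b x $ k $ j)"

definition t_up :: "(real^'n::finite \<Rightarrow> real^'n^'n) \<Rightarrow> (real^'n \<Rightarrow> real^'n) \<Rightarrow> real^'n \<Rightarrow> real^'n^'n" where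
  "t_up a b x = (\<chi> i j. \<Sum>k\<in>UNIV. ainv a x $ i $ k * t_lo a b x $ k $ j)"

text \<open>The contractions \<open>e\<^sub>0\<^sub>0\<close>, \<open>t\<^sub>0\<^sub>0\<close>, \<open>s\<^sub>0\<close>, \<open>s\<^sub>0\<^sub>;\<^sub>0\<close>, \<open>\<sigma>\<^sub>0\<close> with \<open>y\<close>, and the trace \<open>t\<^sup>i\<^sub>i\<close>.\<close>

definition e00 :: "(real^'n::finite \<Rightarrow> real^'n^'n) \<Rightarrow> (real^'n \<Rightarrow> real^'n) \<Rightarrow> real^'n \<Rightarrow> real^'n \<Rightarrow> real" where
  "e00 a b x y = quad (e_lo a b x) y"

definition t00 :: "(real^'n::finite \<Rightarrow> real^'n^'n) \<Rightarrow> (real^'n \<Rightarrow> real^'n) \<Rightarrow> real^'n \<Rightarrow> real^'n \<Rightarrow> real" where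
  "t00 a b x y = quad (t_lo a b x) y"

definition s0 :: "(real^'n::finite \<Rightarrow> real^'n^'n) \<Rightarrow> (real^'n \<Rightarrow> real^'n) \<Rightarrow> real^'n \<Rightarrow> real^'n \<Rightarrow> real" where
  "s0 a b x y = lin (s_vec a b x) y"

definition s0_cov0 :: "(real^'n::finite \<Rightarrow> real^'n^'n) \<Rightarrow> (real^'n \<Rightarrow> real^'n) \<Rightarrow> real^'n \<Rightarrow> real^'n \<Rightarrow> real" where
  "s0_cov0 a b x y = quad (cov a (s_vec a b) x) y"

definition t_trace :: "(real^'n::finite \<Rightarrow> real^'n^'n) \<Rightarrow> (real^'n \<Rightarrow> real^'n) \<Rightarrow> real^'n \<Rightarrow> real" where
  "t_trace a b x = (\<Sum>i\<in>UNIV. t_up a b x $ i $ i)"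

definition d0 :: "(real^'n::finite \<Rightarrow> real) \<Rightarrow> real^'n \<Rightarrow> real^'n \<Rightarrow> real" where
  "d0 \<sigma> x y = (\<Sum>i\<in>UNIV. pd i \<sigma> x * y $ i)"


section \<open>Local Finsler geometry\<close>

definition fund_tensor :: "(real^'n::finite \<Rightarrow> real^'n \<Rightarrow> real) \<Rightarrow> real^'n \<Rightarrow> real^'n \<Rightarrow> real^'n^'n" where
  "fund_tensor F x y = (\<chi> i j. (1/2) * dy j (dy i (\<lambda>x y. (F x y)\<^sup>2)) x y)"

definition spray :: "(real^'n::finite \<Rightarrow> real^'n \<Rightarrow> real) \<Rightarrow> 'n \<Rightarrow> real^'n \<Rightarrow> real^'n \<Rightarrow> real" where
  "spray F i x y = (1/4) * (\<Sum>l\<in>UNIV. matrix_inv (fund_tensor F x y) $ i $ l *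
     ((\<Sum>k\<in>UNIV. dy l (dx k (\<lambda>x y. (F x y)\<^sup>2)) x y * y $ k) - dx l (\<lambda>x y. (F x y)\<^sup>2) x y))"

definition riem_curv ::
    "(real^'n::finite \<Rightarrow> real^'n \<Rightarrow> real) \<Rightarrow> 'n \<Rightarrow> 'n \<Rightarrow> real^'n \<Rightarrow> real^'n \<Rightarrow> real" where
  "riem_curv F i k x y =
     2 * dx k (spray F i) x y
     - (\<Sum>j\<in>UNIV. dx j (dy k (spray F i)) x y * y $ j)
     + 2 * (\<Sum>j\<in>UNIV. spray F j x y * dy j (dy k (spray F i)) x y)
     - (\<Sum>j\<in>UNIV. dy j (spray F i) x y * dy k (spray F j) x y)"

definition finsler_Ric :: "(real^'n::finite \<Rightarrow> real^'n \<Rightarrow> real) \<Rightarrow> real^'n \<Rightarrow> real^'n \<Rightarrow> real" where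
  "finsler_Ric F x y = (\<Sum>i\<in>UNIV. riem_curv F i i x y)"

text \<open>The Lie derivative of a function on \<open>TM\<close> along the complete lift of \<open>V\<close>.\<close>

definition lie_lift ::
    "(real^'n::finite \<Rightarrow> real^'n) \<Rightarrow> (real^'n \<Rightarrow> real^'n \<Rightarrow> real) \<Rightarrow> real^'n \<Rightarrow> real^'n \<Rightarrow> real" where
  "lie_lift V f x y = (\<Sum>i\<in>UNIV. V x $ i * dx i f x y) +
     (\<Sum>i\<in>UNIV. \<Sum>j\<in>UNIV. y $ j * pd j (\<lambda>x. V x $ i) x * dy i f x y)"


section \<open>Randers metrics and almost Ricci solitons on a manifold\<close>

definition randers_metric ::
    "('m, 'n::finite) chart set \<Rightarrow> (('m, 'n) chart \<Rightarrow> real^'n \<Rightarrow> real^'n^'n) \<Rightarrow>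
     (('m, 'n) chart \<Rightarrow> real^'n \<Rightarrow> real^'n) \<Rightarrow> (('m, 'n) chart \<Rightarrow> real^'n \<Rightarrow> real^'n \<Rightarrow> real) \<Rightarrow> bool" where
  "randers_metric A a b F \<longleftrightarrow> riemannian_metric A a \<and> one_form A b \<and>
     (\<forall>\<phi>\<in>A. \<forall>x\<in>rng_of \<phi>. norm_beta (a \<phi>) (b \<phi>) x < 1) \<and>
     (\<forall>\<phi>\<in>A. \<forall>x\<in>rng_of \<phi>. \<forall>y. F \<phi> x y = alpha (a \<phi>) x y + beta (b \<phi>) x y)"

text \<open>\<open>\<beta>\<close> does not vanish identically on any connected component of the manifold; on a connected
  manifold this says \<open>\<beta> \<noteq> 0\<close>. (A component on which \<open>\<beta>\<close> vanishes identically carries a Riemannian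
  metric, and Riemannian almost Ricci solitons need not have a conformal \<open>V\<close>.)\<close>

definition non_riemannian ::
    "'m topology \<Rightarrow> ('m, 'n::finite) chart set \<Rightarrow> (('m, 'n) chart \<Rightarrow> real^'n \<Rightarrow> real^'n) \<Rightarrow> bool" where
  "non_riemannian X A b \<longleftrightarrow> (\<forall>C\<in>connected_components_of X. \<exists>p\<in>C. \<exists>\<phi>\<in>A.
     p \<in> dom_of \<phi> \<and> b \<phi> (snd \<phi> p) \<noteq> 0)"

text \<open>The soliton equation is imposed for \<open>y \<noteq> 0\<close>, where a Finsler metric is smooth and its Ricci
  curvature is defined.\<close>

definition almost_ricci_soliton ::
    "('m, 'n::finite) chart set \<Rightarrow> (('m, 'n) chart \<Rightarrow> real^'n \<Rightarrow> real^'n \<Rightarrow> real) \<Rightarrow>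
     (('m, 'n) chart \<Rightarrow> real^'n \<Rightarrow> real^'n) \<Rightarrow> ('m \<Rightarrow> real) \<Rightarrow> bool" where
  "almost_ricci_soliton A F V \<kappa> \<longleftrightarrow> (\<forall>\<phi>\<in>A. \<forall>x\<in>rng_of \<phi>. \<forall>y. y \<noteq> 0 \<longrightarrow>
     2 * finsler_Ric (F \<phi>) x y + lie_lift (V \<phi>) (\<lambda>x y. (F \<phi> x y)\<^sup>2) x y
       = 2 * in_chart \<phi> \<kappa> x * (F \<phi> x y)\<^sup>2)"

definition conformal_field ::
    "('m, 'n::finite) chart set \<Rightarrow> (('m, 'n) chart \<Rightarrow> real^'n \<Rightarrow> real^'n^'n) \<Rightarrow>
     (('m, 'n) chart \<Rightarrow> real^'n \<Rightarrow> real^'n) \<Rightarrow> ('m \<Rightarrow> real) \<Rightarrow> bool" where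
  "conformal_field A a V c \<longleftrightarrow> (\<forall>\<phi>\<in>A. \<forall>x\<in>rng_of \<phi>. \<forall>i j.
     cov (a \<phi>) (lower (a \<phi>) (V \<phi>)) x $ i $ j + cov (a \<phi>) (lower (a \<phi>) (V \<phi>)) x $ j $ i
       = 4 * in_chart \<phi> c x * a \<phi> x $ i $ j)"

end

theory Submission
  imports Defs
begin

text \<open>
  The spray of \<open>F = \<alpha> + \<beta>\<close> is that of \<open>\<alpha>\<close> plus \<open>P y\<^sup>i + \<alpha> s\<^sup>i\<^sub>0\<close> with \<open>P = e\<^sub>0\<^sub>0/(2F) - s\<^sub>0\<close>, which gives
  \<open>Ric\<close> in terms of \<open>\<alpha>\<close> and polynomials in \<open>y\<close>. The substitution \<open>y \<mapsto> -y\<close> separates the soliton equation into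
  its parts even and odd in \<open>\<alpha>\<close>. After clearing denominators, these polynomial identities can be evaluated at complex
  vectors that are isotropic for \<open>\<alpha>\<^sup>2\<close> or for \<open>\<alpha>\<^sup>2 - \<beta>\<^sup>2\<close>; this yields that \<open>V\<close> is conformal and that
  \<open>e\<^sub>0\<^sub>0 = 2\<sigma>(\<alpha>\<^sup>2 - \<beta>\<^sup>2)\<close>. Given these two facts, the even part is the formula for the Ricci curvature of \<open>\<alpha>\<close>,
  and the Ricci identity for \<open>\<beta>\<close>, contracted, turns the odd part into the equation for \<open>\<sigma>\<^sub>0\<close>.

  The argument for \<open>V\<close> fails at points where \<open>\<beta> = 0\<close>. But \<open>\<beta>\<close>, its
  first derivatives and \<open>\<sigma>\<close> satisfy a closed first-order differential inequality, so by a Gronwall argument \<open>\<beta>\<close>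
  would vanish on a whole component of \<open>M\<close> if it vanished on an open set. Hence \<open>\<beta> \<noteq> 0\<close> on a dense set, from which the identities extend by
  continuity. Since \<open>\<sigma>\<close> and \<open>c\<close> are traces, they do not depend on the chart.
\<close>

text \<open>The even part of the soliton equation gives the Ricci tensor only up to a term
  \<open>X\<^sub>0 \<beta>\<close>, where X = 3(n-1)d\<sigma> - 2c\<beta> + L_V\<beta> is the defect
  of the equation for \<sigma>; the odd part gives the divergence of s up to X. So X is carried
  along: the contracted Ricci identity, applied to the even part with X in it, yields a second
  expression for the divergence, and comparison forces X = 0 because b < 1. At zeros of \<beta> the
  difficulty is one of order. The Gronwall argument needs the equations for e and d\<sigma> on a
  full neighbourhood, including the open part of the zero set that is to be excluded. There both
  sides of these equations vanish, whatever V does; only the conformality of V has to wait. The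
  system closes as for Killing fields: e prescribes the symmetric part of the first derivatives of
  \<beta>, which determines the second ones. But e contains s_j, so second derivatives return on the
  right side; their factor is quadratic in \<beta> and small near a zero.\<close>

section \<open>Partial derivatives\<close>

lemma pd_has_real_derivative:
  assumes "f differentiable (at x)"
  shows "((\<lambda>t. f (x + t *\<^sub>R axis i 1)) has_real_derivative pd i f x) (at 0)"
proof -
  have "(\<lambda>t. f (x + t *\<^sub>R axis i 1)) = f \<circ> (\<lambda>t. x + t *\<^sub>R axis i 1)" by auto
  moreover have "f \<circ> (\<lambda>t. x + t *\<^sub>R axis i 1) differentiable (at (0::real))"
    by (rule differentiable_chain_at) (use assms in \<open>auto intro!: derivative_intros\<close>)
  ultimately have "(\<lambda>t. f (x + t *\<^sub>R axis i 1)) field_differentiable (at 0)"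
    by (metis differentiable_def field_differentiable_def has_field_derivative_def
        real_differentiableE)
  thus ?thesis unfolding pd_def by (rule field_differentiable_derivI)
qed

lemma pd_unique:
  assumes "((\<lambda>t. f (x + t *\<^sub>R axis i 1)) has_real_derivative D) (at 0)"
  shows "pd i f x = D"
  unfolding pd_def using assms by (rule DERIV_imp_deriv)

lemma pd_frechet:
  assumes "(f has_derivative f') (at x)"
  shows "pd i f x = f' (axis i 1)"
proof (rule pd_unique)
  have "((\<lambda>t. f (x + t *\<^sub>R axis i 1)) has_derivative (\<lambda>t. f' (t *\<^sub>R axis i 1))) (at 0)"
    by (rule has_derivative_compose[where f="\<lambda>t. x + t *\<^sub>R axis i 1" and g=f])
      (use assms in \<open>auto intro!: derivative_eq_intros\<close>)
  moreover have "f' (t *\<^sub>R axis i 1) = t * f' (axis i 1)" for t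
    using assms has_derivative_bounded_linear linear_simps(5) by (metis real_scaleR_def)
  ultimately show "((\<lambda>t. f (x + t *\<^sub>R axis i 1)) has_real_derivative f' (axis i 1)) (at 0)"
    by (simp add: has_field_derivative_def mult.commute[of _ "f' (axis i 1)"] )
qed

lemma axis_nth_if: "axis k c $ i = (if i = k then c else 0)"
  by (simp add: axis_def)

lemma vec_eq_sum_axis: "v = (\<Sum>i\<in>UNIV. v $ i *\<^sub>R axis i (1::real))"
  by (simp add: vec_eq_iff axis_def if_distrib cong: if_cong)

lemma has_derivative_pd:
  fixes f :: "real^'n::finite \<Rightarrow> real"
  assumes "f differentiable (at x)"
  shows "(f has_derivative (\<lambda>v. \<Sum>i\<in>UNIV. v $ i * pd i f x)) (at x)"
proof -
  obtain f' where f': "(f has_derivative f') (at x)" using assms differentiable_def by blast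
  then interpret bounded_linear f' by (rule has_derivative_bounded_linear)
  have "f' v = (\<Sum>i\<in>UNIV. v $ i * pd i f x)" for v
  proof -
    have "f' v = f' (\<Sum>i\<in>UNIV. v $ i *\<^sub>R axis i 1)" using vec_eq_sum_axis by metis
    thus ?thesis by (simp add: sum scaleR pd_frechet[OF f'])
  qed
  hence "f' = (\<lambda>v. \<Sum>i\<in>UNIV. v $ i * pd i f x)" by blast
  thus ?thesis using f' by simp
qed

text \<open>Formulas for components hold only on the image of a chart; since that image is open,
  they may still be differentiated.\<close>

lemma pd_cong:
  assumes "open S" "x \<in> S" "\<And>z. z \<in> S \<Longrightarrow> f z = g z"
  shows "pd i f x = pd i g x"
proof -
  have "((\<lambda>t. x + t *\<^sub>R axis i 1) \<longlongrightarrow> x + 0 *\<^sub>R axis i 1) (nhds (0::real))"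
    by (intro tendsto_intros filterlim_ident)
  hence "\<forall>\<^sub>F t in nhds 0. x + t *\<^sub>R axis i 1 \<in> S"
    using assms by (intro topological_tendstoD) auto
  hence "\<forall>\<^sub>F t in nhds 0. f (x + t *\<^sub>R axis i 1) = g (x + t *\<^sub>R axis i 1)"
    by eventually_elim (use assms in auto)
  thus ?thesis unfolding pd_def by (intro deriv_cong_ev) auto
qed

lemma differentiable_cong:
  assumes "open S" "x \<in> S" "\<And>z. z \<in> S \<Longrightarrow> f z = g z" "f differentiable (at x)"
  shows "g differentiable (at x)"
  using assms unfolding differentiable_def
  by (meson has_derivative_transform_within_open)

lemma pd_const [simp]: "pd i (\<lambda>_. c) x = 0"
  by (simp add: pd_def)

lemma pd_add:
  "\<lbrakk>f differentiable (at x); g differentiable (at x)\<rbrakk> \<Longrightarrow> pd i (\<lambda>x. f x + g x) x = pd i f x + pd i g x"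
  by (rule pd_unique) (auto intro!: derivative_eq_intros pd_has_real_derivative)

lemma pd_diff:
  "\<lbrakk>f differentiable (at x); g differentiable (at x)\<rbrakk> \<Longrightarrow> pd i (\<lambda>x. f x - g x) x = pd i f x - pd i g x"
  by (rule pd_unique) (auto intro!: derivative_eq_intros pd_has_real_derivative)

lemma pd_mult:
  "\<lbrakk>f differentiable (at x); g differentiable (at x)\<rbrakk> \<Longrightarrow>
    pd i (\<lambda>x. f x * g x) x = pd i f x * g x + f x * pd i g x"
  by (rule pd_unique)
    (auto intro!: derivative_eq_intros pd_has_real_derivative)

lemma pd_sum:
  "(\<And>j. j \<in> J \<Longrightarrow> f j differentiable (at x)) \<Longrightarrow> pd i (\<lambda>x. \<Sum>j\<in>J. f j x) x = (\<Sum>j\<in>J. pd i (f j) x)"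
  by (rule pd_unique) (auto intro!: derivative_eq_intros pd_has_real_derivative)

lemma pd_inverse:
  "\<lbrakk>f differentiable (at x); f x \<noteq> 0\<rbrakk> \<Longrightarrow> pd i (\<lambda>x. inverse (f x)) x = - (inverse (f x) * inverse (f x) * pd i f x)"
  by (rule pd_unique) (auto intro!: derivative_eq_intros pd_has_real_derivative simp: mult_ac)

lemma pd_chain:
  fixes f :: "real^'m::finite \<Rightarrow> real" and T :: "real^'n::finite \<Rightarrow> real^'m"
  assumes "f differentiable (at (T x))" "\<And>i. (\<lambda>x. T x $ i) differentiable (at x)"
  shows "(\<lambda>x. f (T x)) differentiable (at x)"
    and "pd k (\<lambda>x. f (T x)) x = (\<Sum>i\<in>UNIV. pd i f (T x) * pd k (\<lambda>x. T x $ i) x)"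
proof -
  let ?T' = "\<lambda>v. \<chi> i. \<Sum>j\<in>UNIV. v $ j * pd j (\<lambda>x. T x $ i) x"
  have T: "(T has_derivative ?T') (at x)"
    by (subst has_derivative_componentwise_within)
      (auto simp: Basis_vec_def inner_axis intro!: has_derivative_pd assms)
  have *: "((\<lambda>x. f (T x)) has_derivative (\<lambda>v. \<Sum>i\<in>UNIV. ?T' v $ i * pd i f (T x))) (at x)"
    by (rule has_derivative_compose[OF T has_derivative_pd[OF assms(1)]])
  thus "(\<lambda>x. f (T x)) differentiable (at x)" using differentiable_def by blast
  show "pd k (\<lambda>x. f (T x)) x = (\<Sum>i\<in>UNIV. pd i f (T x) * pd k (\<lambda>x. T x $ i) x)"
    unfolding pd_frechet[OF *]
    by (intro sum.cong refl) (simp add: axis_nth_if if_distrib if_distribR mult.commute cong: if_cong)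
qed


section \<open>Functions of class \<open>C\<^sup>k\<close>\<close>

text \<open>Used to replace the partial derivative of a product or a quotient by its formula, which
  is available only on S.\<close>

lemma Ck_on_cong_imp:
  assumes "open S" "\<And>z. z \<in> S \<Longrightarrow> f z = g z" "Ck_on k S f"
  shows "Ck_on k S g"
  using assms(2,3)
proof (induction k arbitrary: f g)
  case 0
  thus ?case by (simp cong: continuous_on_cong)
next
  case (Suc k)
  have "\<forall>x\<in>S. g differentiable (at x)"
    using Suc.prems differentiable_cong[OF assms(1)] by (metis Ck_on.simps(2))
  moreover have "Ck_on k S (pd i g)" for i
    by (rule Suc.IH[of "pd i f"]) (auto intro: pd_cong[OF assms(1) _ Suc.prems(1)] simp: Suc.prems(2)[simplified])
  ultimately show ?case by simp
qed

lemma Ck_on_continuous: "Ck_on k S f \<Longrightarrow> continuous_on S f"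
proof (cases k)
  case (Suc k')
  assume "Ck_on k S f"
  hence "f differentiable_on S"
    by (simp add: Suc differentiable_on_def differentiable_at_withinI)
  thus ?thesis by (rule differentiable_imp_continuous_on)
qed simp

lemma Ck_on_Suc: "Ck_on (Suc k) S f \<Longrightarrow> Ck_on k S f"
proof (induction k arbitrary: f)
  case 0
  thus ?case using Ck_on_continuous[of 1] by simp
qed simp

lemma Ck_on_le: "k \<le> l \<Longrightarrow> Ck_on l S f \<Longrightarrow> Ck_on k S f"
  by (induction l rule: dec_induct) (auto simp del: Ck_on.simps dest: Ck_on_Suc)

lemma Ck_on_differentiable: "Ck_on k S f \<Longrightarrow> 0 < k \<Longrightarrow> x \<in> S \<Longrightarrow> f differentiable (at x)"
  by (cases k) auto

lemma Ck_on_const: "Ck_on k S (\<lambda>_. c)"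
proof (induction k arbitrary: c)
  case (Suc k)
  have "pd i (\<lambda>_. c) = (\<lambda>_. 0)" for i :: 'a by (rule ext) simp
  thus ?case using Suc by simp
qed simp

lemma Ck_on_add:
  assumes "open S"
  shows "Ck_on k S f \<Longrightarrow> Ck_on k S g \<Longrightarrow> Ck_on k S (\<lambda>x. f x + g x)"
proof (induction k arbitrary: f g)
  case (Suc k)
  have "Ck_on k S (pd i (\<lambda>x. f x + g x))" for i
    by (rule Ck_on_cong_imp[OF assms, of "\<lambda>x. pd i f x + pd i g x"])
      (use Suc in \<open>auto simp: pd_add\<close>)
  thus ?case using Suc.prems by auto
qed (simp add: continuous_on_add continuous_on_mult)

lemma Ck_on_mult:
  assumes "open S"
  shows "Ck_on k S f \<Longrightarrow> Ck_on k S g \<Longrightarrow> Ck_on k S (\<lambda>x. f x * g x)"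
proof (induction k arbitrary: f g)
  case (Suc k)
  have "Ck_on k S (pd i (\<lambda>x. f x * g x))" for i
    by (rule Ck_on_cong_imp[OF assms, of "\<lambda>x. pd i f x * g x + f x * pd i g x"])
      (use Suc Suc.prems[THEN Ck_on_Suc] in \<open>auto simp: pd_mult intro!: Ck_on_add[OF assms]\<close>)
  thus ?case using Suc.prems by auto
qed (simp add: continuous_on_add continuous_on_mult)

lemma Ck_on_inverse:
  assumes "open S"
  shows "Ck_on k S f \<Longrightarrow> (\<And>x. x \<in> S \<Longrightarrow> f x \<noteq> 0) \<Longrightarrow> Ck_on k S (\<lambda>x. inverse (f x))"
proof (induction k)
  case (Suc k)
  have "Ck_on k S (\<lambda>x. (-1) * (inverse (f x) * inverse (f x) * pd i f x))" for i
    using Suc Suc.prems(1)[THEN Ck_on_Suc] by (intro Ck_on_mult[OF assms] Ck_on_const) auto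
  hence "Ck_on k S (pd i (\<lambda>x. inverse (f x)))" for i
    by (rule Ck_on_cong_imp[OF assms, rotated]) (use Suc.prems in \<open>auto simp: pd_inverse\<close>)
  thus ?case using Suc.prems by auto
qed (simp add: continuous_on_inverse)

lemma Ck_on_diff: "open S \<Longrightarrow> Ck_on k S f \<Longrightarrow> Ck_on k S g \<Longrightarrow> Ck_on k S (\<lambda>x. f x - g x)"
  using Ck_on_add[of S k f "\<lambda>x. (-1) * g x"] Ck_on_mult[of S k "\<lambda>_. -1" g] by (simp add: Ck_on_const)

lemma Ck_on_uminus: "open S \<Longrightarrow> Ck_on k S f \<Longrightarrow> Ck_on k S (\<lambda>x. - f x)"
  using Ck_on_mult[of S k "\<lambda>_. -1" f] by (simp add: Ck_on_const)

lemma Ck_on_divide: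
  "open S \<Longrightarrow> Ck_on k S f \<Longrightarrow> Ck_on k S g \<Longrightarrow> (\<And>x. x \<in> S \<Longrightarrow> g x \<noteq> 0) \<Longrightarrow> Ck_on k S (\<lambda>x. f x / g x)"
  unfolding divide_inverse by (intro Ck_on_mult Ck_on_inverse)

lemma Ck_on_sum: "open S \<Longrightarrow> (\<And>j. j \<in> J \<Longrightarrow> Ck_on k S (f j)) \<Longrightarrow> Ck_on k S (\<lambda>x. \<Sum>j\<in>J. f j x)"
  by (induction J rule: infinite_finite_induct) (auto intro: Ck_on_const Ck_on_add)

lemma Ck_on_prod: "open S \<Longrightarrow> (\<And>j. j \<in> J \<Longrightarrow> Ck_on k S (f j)) \<Longrightarrow> Ck_on k S (\<lambda>x. \<Prod>j\<in>J. f j x)"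
  by (induction J rule: infinite_finite_induct) (auto intro: Ck_on_const Ck_on_mult)

lemma Ck_on_pd: "Ck_on (Suc k) S f \<Longrightarrow> Ck_on k S (pd i f)"
  by simp

lemmas Ck_intros = Ck_on_const Ck_on_add Ck_on_mult Ck_on_diff Ck_on_uminus Ck_on_divide Ck_on_sum Ck_on_prod

text \<open>The second difference of f over a small square in the directions i and j is symmetric in
  i and j. By the mean value theorem in each variable it equals \<open>h\<^sup>2\<close> times a
  mixed derivative at an intermediate point, and continuity gives the two mixed derivatives at x in
  the limit.\<close>

lemma pd_commute:
  fixes f :: "real^'n::finite \<Rightarrow> real"
  assumes S: "open S" "x \<in> S" and f: "Ck_on 2 S f"
  shows "pd i (pd j f) x = pd j (pd i f) x"
proof -
  let ?p = "\<lambda>i t z. z + t *\<^sub>R axis i (1::real) :: real^'n"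
  obtain r where r: "r > 0" "ball x r \<subseteq> S" using S open_contains_ball by blast
  have d1: "((\<lambda>t. f (?p i t z)) has_real_derivative pd i f (?p i t z)) (at t)" if "?p i t z \<in> S" for i t z
  proof -
    have "f differentiable (at (?p i t z))"
      using f that by (intro Ck_on_differentiable[where k=2]) auto
    from pd_has_real_derivative[OF this, of i]
    have "((\<lambda>h. f (?p i (h + t) z)) has_real_derivative pd i f (?p i t z)) (at 0)"
      by (simp add: algebra_simps)
    thus ?thesis using DERIV_shift[of "\<lambda>t. f (?p i t z)" _ 0 t] by simp
  qed
  have d2: "((\<lambda>t. pd k f (?p i t z)) has_real_derivative pd i (pd k f) (?p i t z)) (at t)"
    if "?p i t z \<in> S" for i k t z
  proof -
    have "pd k f differentiable (at (?p i t z))"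
      using f that by (auto simp: numeral_2_eq_2)
    from pd_has_real_derivative[OF this, of i]
    have "((\<lambda>h. pd k f (?p i (h + t) z)) has_real_derivative pd i (pd k f) (?p i t z)) (at 0)"
      by (simp add: algebra_simps)
    thus ?thesis using DERIV_shift[of "\<lambda>t. pd k f (?p i t z)" _ 0 t] by simp
  qed
  \<comment> \<open>Two increments shorter than r/2 cannot leave the ball of radius r.\<close>
  have inS: "?p j t (?p i s x) \<in> S" if "0 \<le> s" "s < r/2" "0 \<le> t" "t < r/2" for i j s t
  proof -
    have "dist x (?p j t (?p i s x)) = norm (s *\<^sub>R axis i (1::real) + t *\<^sub>R axis j 1 :: real^'n)"
      by (subst dist_commute) (simp add: dist_norm algebra_simps)
    also have "\<dots> \<le> s + t" using that by (intro norm_triangle_le) auto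
    finally show ?thesis using that r by (auto simp: subset_iff)
  qed
  have \<Delta>: "\<exists>\<xi> \<eta>. 0 < \<xi> \<and> \<xi> < h \<and> 0 < \<eta> \<and> \<eta> < h \<and>
      f (?p j h (?p i h x)) - f (?p i h x) - f (?p j h x) + f x = h * h * pd j (pd i f) (?p j \<eta> (?p i \<xi> x))"
    if h: "0 < h" "h < r/2" for h i j
  proof -
    have sw: "?p j h (?p i s x) = ?p i s (?p j h x)" for s h by (simp add: algebra_simps)
    have "\<exists>\<xi>. 0 < \<xi> \<and> \<xi> < h \<and> (f (?p i h (?p j h x)) - f (?p i h x)) - (f (?p i 0 (?p j h x)) - f (?p i 0 x))
        = (h - 0) * (pd i f (?p i \<xi> (?p j h x)) - pd i f (?p i \<xi> x))"
    proof (intro MVT2[where f="\<lambda>s. f (?p i s (?p j h x)) - f (?p i s x)"])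
      fix s assume s: "0 \<le> s" "s \<le> h"
      have "?p i s (?p j h x) \<in> S" using h s by (intro inS) auto
      moreover have "?p i s x \<in> S" using h s inS[of s 0 i i] by auto
      ultimately show "((\<lambda>s. f (?p i s (?p j h x)) - f (?p i s x)) has_real_derivative
          pd i f (?p i s (?p j h x)) - pd i f (?p i s x)) (at s)"
        by (intro DERIV_diff d1)
    qed (use h in auto)
    then obtain \<xi> where \<xi>: "0 < \<xi>" "\<xi> < h" "(f (?p i h (?p j h x)) - f (?p i h x)) - (f (?p j h x) - f x)
        = h * (pd i f (?p i \<xi> (?p j h x)) - pd i f (?p i \<xi> x))" by auto
    have "\<exists>\<eta>. 0 < \<eta> \<and> \<eta> < h \<and> pd i f (?p j h (?p i \<xi> x)) - pd i f (?p j 0 (?p i \<xi> x))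
        = (h - 0) * pd j (pd i f) (?p j \<eta> (?p i \<xi> x))"
      using h \<xi> inS[of \<xi> _ i j]
      by (intro MVT2[where f="\<lambda>t. pd i f (?p j t (?p i \<xi> x))"]) (auto intro!: d2)
    then obtain \<eta> where "0 < \<eta>" "\<eta> < h" "pd i f (?p j h (?p i \<xi> x)) - pd i f (?p i \<xi> x)
        = h * pd j (pd i f) (?p j \<eta> (?p i \<xi> x))" by auto
    thus ?thesis using \<xi> by (intro exI[of _ \<xi>] exI[of _ \<eta>]) (auto simp: sw algebra_simps)
  qed
  have cont: "continuous_on S (pd j (pd i f))" for i j using f by (auto simp: numeral_2_eq_2)
  have lim: "(\<lambda>m. pd j (pd i f) (?p j (\<eta> m) (?p i (\<xi> m) x))) \<longlonglongrightarrow> pd j (pd i f) x"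
    if "\<And>m. 0 < \<xi> m \<and> \<xi> m < h m \<and> 0 < \<eta> m \<and> \<eta> m < h m" "h \<longlonglongrightarrow> 0" "\<And>m. h m < r/2" for i j \<xi> \<eta> and h :: "nat \<Rightarrow> real"
  proof -
    have z: "\<xi> \<longlonglongrightarrow> 0" "\<eta> \<longlonglongrightarrow> 0"
      by (rule tendsto_sandwich[OF _ _ tendsto_const that(2)]; use that(1) in \<open>auto intro!: always_eventually less_imp_le\<close>)+
    have "(\<lambda>m. ?p j (\<eta> m) (?p i (\<xi> m) x)) \<longlonglongrightarrow> ?p j 0 (?p i 0 x)"
      by (intro tendsto_intros z)
    hence "(\<lambda>m. ?p j (\<eta> m) (?p i (\<xi> m) x)) \<longlonglongrightarrow> x" by simp
    moreover have "?p j (\<eta> m) (?p i (\<xi> m) x) \<in> S" for m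
      using that(1)[of m] that(3)[of m] by (intro inS) auto
    ultimately show ?thesis using S by (intro continuous_on_tendsto_compose[OF cont]) auto
  qed
  \<comment> \<open>The factor 1/4 keeps both increments below r/2.\<close>
  define h where "h = (\<lambda>m::nat. r / 4 * inverse (real (Suc m)))"
  have h: "0 < h m" "h m < r/2" for m
  proof -
    have "inverse (real (Suc m)) \<le> 1" by (auto simp: field_simps)
    hence "h m \<le> r/4 * 1" unfolding h_def using r by (intro mult_left_mono) auto
    thus "h m < r/2" using r by auto
    show "0 < h m" using r by (auto simp: h_def)
  qed
  have h0: "h \<longlonglongrightarrow> 0" unfolding h_def
    using tendsto_mult_right_zero[OF LIMSEQ_inverse_real_of_nat] by blast
  obtain \<xi> \<eta> where 1: "\<And>m. 0 < \<xi> m \<and> \<xi> m < h m \<and> 0 < \<eta> m \<and> \<eta> m < h m \<and>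
     f (?p j (h m) (?p i (h m) x)) - f (?p i (h m) x) - f (?p j (h m) x) + f x = h m * h m * pd j (pd i f) (?p j (\<eta> m) (?p i (\<xi> m) x))"
    using \<Delta>[where i=i and j=j, OF h] by metis
  obtain \<xi>' \<eta>' where 2: "\<And>m. 0 < \<xi>' m \<and> \<xi>' m < h m \<and> 0 < \<eta>' m \<and> \<eta>' m < h m \<and>
     f (?p i (h m) (?p j (h m) x)) - f (?p j (h m) x) - f (?p i (h m) x) + f x = h m * h m * pd i (pd j f) (?p i (\<eta>' m) (?p j (\<xi>' m) x))"
    using \<Delta>[where i=j and j=i, OF h] by metis
  have "pd j (pd i f) (?p j (\<eta> m) (?p i (\<xi> m) x)) = pd i (pd j f) (?p i (\<eta>' m) (?p j (\<xi>' m) x))" for m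
  proof -
    have "?p j (h m) (?p i (h m) x) = ?p i (h m) (?p j (h m) x)" by (simp add: algebra_simps)
    hence "f (?p j (h m) (?p i (h m) x)) = f (?p i (h m) (?p j (h m) x))" by (rule arg_cong)
    hence "h m * h m * pd j (pd i f) (?p j (\<eta> m) (?p i (\<xi> m) x)) = h m * h m * pd i (pd j f) (?p i (\<eta>' m) (?p j (\<xi>' m) x))"
      using 1[of m] 2[of m] by linarith
    thus ?thesis using h[of m] by auto
  qed
  hence eq: "(\<lambda>m. pd j (pd i f) (?p j (\<eta> m) (?p i (\<xi> m) x))) = (\<lambda>m. pd i (pd j f) (?p i (\<eta>' m) (?p j (\<xi>' m) x)))"
    by (rule ext)
  have l1: "(\<lambda>m. pd j (pd i f) (?p j (\<eta> m) (?p i (\<xi> m) x))) \<longlonglongrightarrow> pd j (pd i f) x"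
    by (rule lim[of _ h]) (use 1 h0 h in auto)
  have l2: "(\<lambda>m. pd i (pd j f) (?p i (\<eta>' m) (?p j (\<xi>' m) x))) \<longlonglongrightarrow> pd i (pd j f) x"
    by (rule lim[of _ h]) (use 2 h0 h in auto)
  show ?thesis by (rule LIMSEQ_unique[OF l2 l1[unfolded eq]])
qed

section \<open>Matrix-valued functions\<close>

text \<open>Fields are differentiated entrywise, so that index computations turn into identities of
  matrix algebra.\<close>

definition pdV :: "'n::finite \<Rightarrow> (real^'n \<Rightarrow> real^'m) \<Rightarrow> real^'n \<Rightarrow> real^'m" where
  "pdV k w x = (\<chi> i. pd k (\<lambda>x. w x $ i) x)"

definition pdM :: "'n::finite \<Rightarrow> (real^'n \<Rightarrow> real^'m^'l) \<Rightarrow> real^'n \<Rightarrow> real^'m^'l" where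
  "pdM k T x = (\<chi> i j. pd k (\<lambda>x. T x $ i $ j) x)"

definition diffV :: "(real^'n::finite \<Rightarrow> real^'m) \<Rightarrow> real^'n \<Rightarrow> bool" where
  "diffV w x \<longleftrightarrow> (\<forall>i. (\<lambda>x. w x $ i) differentiable (at x))"

definition diffM :: "(real^'n::finite \<Rightarrow> real^'m^'l) \<Rightarrow> real^'n \<Rightarrow> bool" where
  "diffM T x \<longleftrightarrow> (\<forall>i j. (\<lambda>x. T x $ i $ j) differentiable (at x))"

lemma diffV_matrix_mult:
  "diffM T x \<Longrightarrow> diffV w x \<Longrightarrow> diffV (\<lambda>x. T x *v w x) x"
  by (auto simp: diffV_def diffM_def matrix_vector_mult_def intro!: differentiable_sum differentiable_mult)

lemma diffM_matrix_mult:
  "diffM T x \<Longrightarrow> diffM R x \<Longrightarrow> diffM (\<lambda>x. T x ** R x) x"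
  by (auto simp: diffM_def matrix_matrix_mult_def intro!: differentiable_sum differentiable_mult)

lemma diff_inner: "diffV u x \<Longrightarrow> diffV w x \<Longrightarrow> (\<lambda>x. u x \<bullet> w x) differentiable (at x)"
  by (auto simp: diffV_def inner_vec_def intro!: differentiable_sum differentiable_mult)

lemma pd_sum_mult:
  assumes "\<And>j. j \<in> J \<Longrightarrow> f j differentiable (at x)" "\<And>j. j \<in> J \<Longrightarrow> g j differentiable (at x)"
  shows "pd i (\<lambda>x. \<Sum>j\<in>J. f j x * g j x) x = (\<Sum>j\<in>J. pd i (f j) x * g j x) + (\<Sum>j\<in>J. f j x * pd i (g j) x)"
proof -
  have "pd i (\<lambda>x. \<Sum>j\<in>J. f j x * g j x) x = (\<Sum>j\<in>J. pd i (\<lambda>x. f j x * g j x) x)"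
    by (rule pd_sum) (intro differentiable_mult assms)
  also have "\<dots> = (\<Sum>j\<in>J. pd i (f j) x * g j x + f j x * pd i (g j) x)"
    by (intro sum.cong refl pd_mult assms)
  finally show ?thesis by (simp add: sum.distrib)
qed

lemma pdV_matrix_mult:
  assumes "diffM T x" "diffV w x"
  shows "pdV k (\<lambda>x. T x *v w x) x = pdM k T x *v w x + T x *v pdV k w x"
proof -
  have "pd k (\<lambda>x. \<Sum>j\<in>UNIV. T x $ i $ j * w x $ j) x =
      (\<Sum>j\<in>UNIV. pd k (\<lambda>x. T x $ i $ j) x * w x $ j) + (\<Sum>j\<in>UNIV. T x $ i $ j * pd k (\<lambda>x. w x $ j) x)" for i
    using assms by (intro pd_sum_mult) (auto simp: diffM_def diffV_def)
  thus ?thesis by (simp add: vec_eq_iff pdV_def pdM_def matrix_vector_mult_def)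
qed

lemma pdM_matrix_mult:
  assumes "diffM T x" "diffM R x"
  shows "pdM k (\<lambda>x. T x ** R x) x = pdM k T x ** R x + T x ** pdM k R x"
proof -
  have "pd k (\<lambda>x. \<Sum>j\<in>UNIV. T x $ i $ j * R x $ j $ l) x =
      (\<Sum>j\<in>UNIV. pd k (\<lambda>x. T x $ i $ j) x * R x $ j $ l) + (\<Sum>j\<in>UNIV. T x $ i $ j * pd k (\<lambda>x. R x $ j $ l) x)" for i l
    using assms by (intro pd_sum_mult) (auto simp: diffM_def)
  thus ?thesis by (simp add: vec_eq_iff pdM_def matrix_matrix_mult_def)
qed

lemma pd_inner:
  assumes "diffV u x" "diffV w x"
  shows "pd k (\<lambda>x. u x \<bullet> w x) x = pdV k u x \<bullet> w x + u x \<bullet> pdV k w x"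
proof -
  have "pd k (\<lambda>x. \<Sum>j\<in>UNIV. u x $ j * w x $ j) x =
      (\<Sum>j\<in>UNIV. pd k (\<lambda>x. u x $ j) x * w x $ j) + (\<Sum>j\<in>UNIV. u x $ j * pd k (\<lambda>x. w x $ j) x)"
    using assms by (intro pd_sum_mult) (auto simp: diffV_def)
  thus ?thesis by (simp add: pdV_def inner_vec_def)
qed

lemma pdV_cong:
  assumes "open S" "x \<in> S" "\<And>z. z \<in> S \<Longrightarrow> f z = g z"
  shows "pdV i f x = pdV i g x"
proof -
  have "pd i (\<lambda>x. f x $ k) x = pd i (\<lambda>x. g x $ k) x" for k
    by (rule pd_cong[OF assms(1,2)]) (simp add: assms(3))
  thus ?thesis by (simp add: pdV_def vec_eq_iff)
qed

lemma pdM_cong: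
  assumes "open S" "x \<in> S" "\<And>z. z \<in> S \<Longrightarrow> f z = g z"
  shows "pdM i f x = pdM i g x"
proof -
  have "pd i (\<lambda>x. f x $ k $ l) x = pd i (\<lambda>x. g x $ k $ l) x" for k l
    by (rule pd_cong[OF assms(1,2)]) (simp add: assms(3))
  thus ?thesis by (simp add: pdM_def vec_eq_iff)
qed

lemma lin_inner: "lin w y = w \<bullet> y"
  by (simp add: lin_def inner_vec_def)

lemma quad_inner: "quad T y = y \<bullet> (T *v y)"
  by (simp add: quad_def inner_vec_def matrix_vector_mult_def sum_distrib_left mult_ac)

lemma inner_transpose: "(x::real^'n) \<bullet> (T *v y) = (transpose T *v x) \<bullet> y"
  by (simp add: dot_lmul_matrix[symmetric] vector_transpose_matrix)

lemma transpose_sym_iff: "transpose T = T \<longleftrightarrow> (\<forall>i j. T $ i $ j = T $ j $ i)"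
  by (auto simp: vec_eq_iff transpose_def)

lemma transpose_add: "transpose (T + R) = transpose T + transpose (R :: real^'n^'m)"
  by (simp add: vec_eq_iff transpose_def)

lemma transpose_diff: "transpose (T - R) = transpose T - transpose (R :: real^'n^'m)"
  by (simp add: vec_eq_iff transpose_def)

lemma transpose_scaleR: "transpose (c *\<^sub>R T) = c *\<^sub>R transpose (T :: real^'n^'m)"
  by (simp add: vec_eq_iff transpose_def)

lemma matrix_add_rdistrib: "(T + T') ** R = T ** R + T' ** (R :: real^'k^'n)"
  by (simp add: vec_eq_iff matrix_matrix_mult_def sum.distrib algebra_simps)

lemmas matrix_linear_simps =
  matrix_vector_mult_add_rdistrib matrix_vector_mult_diff_rdistrib
  matrix_vector_right_distrib matrix_vector_mult_diff_distrib
  matrix_add_ldistrib matrix_add_rdistrib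

lemma matrix_mult_minus: "(- T) *v x = - (T *v (x::real^'n))" "T *v (- x) = - (T *v x)"
  "(- T) ** R = - (T ** (R :: real^'k^'n))" "T ** (- R) = - (T ** R)"
  by (simp_all add: vec_eq_iff matrix_vector_mult_def matrix_matrix_mult_def sum_negf)

lemma matrix_diff_distrib: "(T - T') ** R = T ** R - T' ** (R :: real^'k^'n)"
  "T ** (R - R') = T ** R - T ** (R' :: real^'k^'n)"
  by (simp_all add: vec_eq_iff matrix_matrix_mult_def sum_subtractf algebra_simps)

lemma matrix_mult_eq_1:
  "A ** B = mat 1 \<Longrightarrow> (\<Sum>j\<in>UNIV. A $ i $ j * B $ j $ k) = (if i = k then 1 else (0::real))"
  by (auto simp: vec_eq_iff matrix_matrix_mult_def mat_def)


section \<open>Riemannian geometry in a chart\<close>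

locale riemann_chart =
  fixes U :: "(real^'n::finite) set" and a :: "real^'n \<Rightarrow> real^'n^'n"
  assumes open_U: "open U"
    and a_Ck: "\<And>k i j. Ck_on k U (\<lambda>x. a x $ i $ j)"
    and a_sym: "\<And>x. x \<in> U \<Longrightarrow> transpose (a x) = a x"
    and a_pos: "\<And>x y. x \<in> U \<Longrightarrow> y \<noteq> 0 \<Longrightarrow> 0 < quad (a x) y"
begin

lemma a_sym_nth: "x \<in> U \<Longrightarrow> a x $ i $ j = a x $ j $ i"
  using a_sym transpose_sym_iff by blast

lemma a_invertible: assumes "x \<in> U" shows "invertible (a x)"
proof -
  have "y = 0" if "a x *v y = 0" for y
    using a_pos[OF assms, of y] that by (auto simp: quad_inner)
  thus ?thesis using matrix_left_invertible_ker invertible_left_inverse by blast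
qed

lemma ainv_a: "x \<in> U \<Longrightarrow> ainv a x ** a x = mat 1" and a_ainv: "x \<in> U \<Longrightarrow> a x ** ainv a x = mat 1"
  using someI_ex[OF a_invertible[unfolded invertible_def]] by (simp_all add: ainv_def matrix_inv_def)

lemma ainv_a_vec: "x \<in> U \<Longrightarrow> ainv a x *v (a x *v y) = y"
  and a_ainv_vec: "x \<in> U \<Longrightarrow> a x *v (ainv a x *v y) = y"
  by (simp_all add: matrix_vector_mul_assoc ainv_a a_ainv)

lemma ainv_sym: "x \<in> U \<Longrightarrow> transpose (ainv a x) = ainv a x"
proof -
  assume x: "x \<in> U"
  have "transpose (ainv a x) ** a x = transpose (a x ** ainv a x)"
    using a_sym[OF x] by (simp add: matrix_transpose_mul)
  hence "transpose (ainv a x) ** a x = mat 1" by (simp add: a_ainv x)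
  hence "transpose (ainv a x) ** (a x ** ainv a x) = ainv a x" by (simp add: matrix_mul_assoc)
  thus ?thesis by (simp add: a_ainv x)
qed

lemma ainv_sym_nth: "x \<in> U \<Longrightarrow> ainv a x $ i $ j = ainv a x $ j $ i"
  using ainv_sym transpose_sym_iff by blast

lemma ainv_pos: assumes "x \<in> U" "w \<noteq> 0" shows "0 < quad (ainv a x) w"
proof -
  have "ainv a x *v w \<noteq> 0" using a_ainv_vec[OF assms(1), of w] assms(2) by auto
  from a_pos[OF assms(1) this] show ?thesis
    by (simp add: quad_inner a_ainv_vec assms inner_commute)
qed

text \<open>By Cramer's rule the entries of the inverse are quotients of determinants, and a
  determinant is a polynomial in the entries.\<close>

lemma ainv_Ck: "Ck_on k U (\<lambda>x. ainv a x $ i $ j)"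
proof -
  let ?C = "\<lambda>x. \<chi> p q. if q = i then axis j 1 $ p else a x $ p $ q"
  have det: "Ck_on k U (\<lambda>x. det (M x))" if "\<And>p q. Ck_on k U (\<lambda>x. M x $ p $ q)" for M :: "real^'n \<Rightarrow> real^'n^'n"
    unfolding det_def by (intro Ck_intros that open_U)
  have det_nz: "det (a x) \<noteq> 0" if "x \<in> U" for x using a_invertible[OF that] by (simp add: invertible_det_nz)
  have *: "ainv a x $ i $ j = det (?C x) / det (a x)" if x: "x \<in> U" for x
  proof -
    have "a x *v (ainv a x *v axis j 1) = axis j 1" using a_ainv_vec[OF x] .
    hence "ainv a x *v axis j 1 = (\<chi> k. det (\<chi> p q. if q = k then axis j 1 $ p else a x $ p $ q) / det (a x))"
      using cramer[OF det_nz[OF x]] by blast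
    hence "(ainv a x *v axis j 1) $ i = det (?C x) / det (a x)" by simp
    thus ?thesis by (simp add: matrix_vector_mult_basis column_def)
  qed
  have "Ck_on k U (\<lambda>x. det (?C x) / det (a x))"
  proof (intro Ck_on_divide det open_U det_nz a_Ck)
    show "Ck_on k U (\<lambda>x. ?C x $ p $ q)" for p q
      by (cases "q = i") (auto intro: Ck_on_const a_Ck)
  qed
  thus ?thesis by (rule Ck_on_cong_imp[OF open_U, rotated]) (simp add: *)
qed

lemma christoffel_Ck: "Ck_on k U (christoffel a l i j)"
  unfolding christoffel_def[abs_def] 
  by (intro Ck_intros open_U ainv_Ck Ck_on_pd a_Ck)

lemma christoffel_sym: assumes "x \<in> U" shows "christoffel a k i j x = christoffel a k j i x"
proof -
  have "pd l (\<lambda>x. a x $ i $ j) x = pd l (\<lambda>x. a x $ j $ i) x" for l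
    by (rule pd_cong[OF open_U assms]) (rule a_sym_nth)
  thus ?thesis by (simp add: christoffel_def algebra_simps)
qed

text \<open>The connection matrix in the direction of the k-th coordinate: a vector field v has the
  covariant derivative \<open>pdV k v x + Nk k x *v v x\<close>.\<close>

definition Nk :: "'n \<Rightarrow> real^'n \<Rightarrow> real^'n^'n" where
  "Nk k x = (\<chi> i j. christoffel a i k j x)"

text \<open>Lowering the upper index of a Christoffel symbol leaves half of the three-term sum
  \<open>?h\<close>; in the sum of two of these, everything but the wanted derivative cancels by the
  symmetry of a. This says that the metric is parallel.\<close>

lemma pdM_a: assumes x: "x \<in> U" shows "pdM k a x = transpose (Nk k x) ** a x + a x ** Nk k x"
proof -
  let ?h = "\<lambda>i j l. pd i (\<lambda>x. a x $ j $ l) x + pd j (\<lambda>x. a x $ i $ l) x - pd l (\<lambda>x. a x $ i $ j) x"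
  have low: "(\<Sum>m\<in>UNIV. a x $ p $ m * christoffel a m i j x) = ?h i j p / 2" for p i j
  proof -
    have "(\<Sum>m\<in>UNIV. a x $ p $ m * christoffel a m i j x) = (\<Sum>m\<in>UNIV. \<Sum>l\<in>UNIV. (a x $ p $ m * ainv a x $ m $ l) * (?h i j l / 2))"
      by (simp add: christoffel_def sum_distrib_left mult_ac)
    also have "\<dots> = (\<Sum>l\<in>UNIV. (\<Sum>m\<in>UNIV. a x $ p $ m * ainv a x $ m $ l) * (?h i j l / 2))"
      by (subst sum.swap) (simp add: sum_distrib_right sum_divide_distrib)
    also have "\<dots> = ?h i j p / 2"
      by (simp add: matrix_mult_eq_1[OF a_ainv[OF x]] if_distrib if_distribR cong: if_cong)
    finally show ?thesis .
  qed
  have s: "pd l (\<lambda>x. a x $ i $ j) x = pd l (\<lambda>x. a x $ j $ i) x" for i j l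
    by (rule pd_cong[OF open_U x]) (rule a_sym_nth)
  have "pd k (\<lambda>x. a x $ i $ j) x = (\<Sum>m\<in>UNIV. christoffel a m k i x * a x $ m $ j) + (\<Sum>m\<in>UNIV. a x $ i $ m * christoffel a m k j x)" for i j
  proof -
    have "(\<Sum>m\<in>UNIV. christoffel a m k i x * a x $ m $ j) = (\<Sum>m\<in>UNIV. a x $ j $ m * christoffel a m k i x)"
      by (rule sum.cong) (auto simp: a_sym_nth[OF x] mult.commute)
    moreover have "pd k (\<lambda>x. a x $ i $ j) x = ?h k i j / 2 + ?h k j i / 2"
      using s[of k i j] by (simp add: field_simps)
    ultimately show ?thesis by (simp only: low)
  qed
  thus ?thesis by (simp add: vec_eq_iff pdM_def Nk_def transpose_def matrix_matrix_mult_def)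
qed

lemma diff_a: "x \<in> U \<Longrightarrow> diffM a x"
  using a_Ck[of 1] by (auto simp: diffM_def)

lemma diff_ainv: "x \<in> U \<Longrightarrow> diffM (ainv a) x"
  using ainv_Ck[of 1] by (auto simp: diffM_def)

text \<open>Obtained by differentiating \<open>a x ** ainv a x = mat 1\<close>.\<close>

lemma pdM_ainv: assumes x: "x \<in> U"
  shows "pdM k (ainv a) x = - (Nk k x ** ainv a x) - ainv a x ** transpose (Nk k x)"
proof -
  have "pdM k (\<lambda>x. a x ** ainv a x) x = pdM k (\<lambda>_. mat 1 :: real^'n^'n) x"
    by (rule pdM_cong[OF open_U x]) (simp add: a_ainv)
  hence "pdM k a x ** ainv a x + a x ** pdM k (ainv a) x = 0"
    by (simp add: pdM_matrix_mult diff_a diff_ainv x) (simp add: pdM_def vec_eq_iff)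
  hence "a x ** pdM k (ainv a) x = - (pdM k a x ** ainv a x)"
    by (simp add: eq_neg_iff_add_eq_0 add.commute)
  hence "ainv a x ** (a x ** pdM k (ainv a) x) = - (ainv a x ** (pdM k a x ** ainv a x))"
    by (simp add: matrix_mult_minus)
  moreover have "ainv a x ** (a x ** pdM k (ainv a) x) = pdM k (ainv a) x"
    by (simp add: matrix_mul_assoc ainv_a x)
  moreover have "ainv a x ** (pdM k a x ** ainv a x) = ainv a x ** transpose (Nk k x) + Nk k x ** ainv a x"
    by (simp add: pdM_a x matrix_linear_simps matrix_mul_assoc[symmetric] a_ainv)
      (simp add: matrix_mul_assoc ainv_a x)
  ultimately show ?thesis by simp
qed

text \<open>The covariant derivative of a covector field in the direction of the k-th coordinate;
  \<open>covM\<close> is its analogue for tensors with two lower indices. With the direction as a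
  parameter, the Leibniz rules become matrix identities.\<close>

definition covV :: "'n \<Rightarrow> (real^'n \<Rightarrow> real^'n) \<Rightarrow> real^'n \<Rightarrow> real^'n" where
  "covV k w x = pdV k w x - transpose (Nk k x) *v w x"

definition covM :: "'n \<Rightarrow> (real^'n \<Rightarrow> real^'n^'n) \<Rightarrow> real^'n \<Rightarrow> real^'n^'n" where
  "covM k T x = pdM k T x - transpose (Nk k x) ** T x - T x ** Nk k x"

lemma cov_covV: "x \<in> U \<Longrightarrow> cov a w x $ i $ j = covV j w x $ i"
  by (simp add: cov_def covV_def pdV_def Nk_def transpose_def matrix_vector_mult_def christoffel_sym[of x _ i j])

lemma covM_a: "x \<in> U \<Longrightarrow> covM k a x = 0"
  by (simp add: covM_def pdM_a)

text \<open>Raising an index commutes with covariant differentiation because the metric is parallel;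
  the last term converts the covariant derivative of a vector field back into a partial
  derivative.\<close>

lemma pdV_raise:
  assumes "x \<in> U" "diffV w x"
  shows "pdV k (raise a w) x = ainv a x *v covV k w x - Nk k x *v raise a w x"
proof -
  have r: "raise a w = (\<lambda>x. ainv a x *v w x)" by (auto simp: raise_def vec_eq_iff matrix_vector_mult_def)
  show ?thesis unfolding r
    by (simp add: pdV_matrix_mult diff_ainv assms pdM_ainv covV_def matrix_linear_simps matrix_mult_minus
        matrix_vector_mul_assoc[symmetric])
qed

lemma raise_eq: "raise a w x = ainv a x *v w x"
  by (auto simp: raise_def vec_eq_iff matrix_vector_mult_def)

lemma diffV_raise: "x \<in> U \<Longrightarrow> diffV w x \<Longrightarrow> diffV (raise a w) x"
  by (simp add: raise_eq[abs_def] diffV_matrix_mult diff_ainv)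

lemma pd_inner_raise:
  assumes "x \<in> U" "diffV u x" "diffV w x"
  shows "pd k (\<lambda>x. u x \<bullet> raise a w x) x = covV k u x \<bullet> raise a w x + u x \<bullet> (ainv a x *v covV k w x)"
  using assms by (simp add: pd_inner diffV_raise pdV_raise covV_def inner_diff inner_transpose[of "u x"])

lemma covV_matrix_raise:
  assumes "x \<in> U" "diffM T x" "diffV w x"
  shows "covV k (\<lambda>x. T x *v raise a w x) x = covM k T x *v raise a w x + T x *v (ainv a x *v covV k w x)"
  using assms
  by (simp add: covV_def[of k "\<lambda>x. T x *v raise a w x"] pdV_matrix_mult diffV_raise pdV_raise covM_def matrix_linear_simps
      matrix_vector_mul_assoc[symmetric])

end

section \<open>Curvature\<close>

lemma quad_zero_imp_skew:
  assumes "\<And>y. quad T y = 0"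
  shows "T $ i $ j = - T $ j $ i"
proof -
  have ii: "T $ k $ k = 0" for k
    using assms[of "axis k 1"] by (simp add: quad_inner inner_axis' matrix_vector_mult_basis column_def)
  have "quad T (axis i 1 + axis j 1) = T $ i $ i + T $ i $ j + T $ j $ i + T $ j $ j"
    by (simp add: quad_inner inner_axis' matrix_vector_mult_basis column_def matrix_linear_simps inner_add)
  thus ?thesis using assms ii by simp
qed

lemma trace_transpose: "trace (transpose T) = trace (T :: real^'n^'n)"
  by (simp add: trace_def transpose_def)

lemma trace_sym_skew:
  fixes P Q :: "real^'n^'n"
  assumes "transpose P = P" "transpose Q = - Q"
  shows "trace (P ** Q) = 0"
proof -
  have "trace (P ** Q) = trace (transpose (P ** Q))" by (simp add: trace_transpose)
  also have "\<dots> = - trace (Q ** P)"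
    by (simp add: matrix_transpose_mul assms matrix_mult_minus) (simp add: trace_def sum_negf)
  finally show ?thesis by (simp add: trace_mul_sym[of Q])
qed

context riemann_chart
begin

text \<open>The curvature tensor, with its indices ordered so that contraction of m with k gives
  \<open>ric_tensor\<close>.\<close>

definition Rm :: "'n \<Rightarrow> 'n \<Rightarrow> 'n \<Rightarrow> 'n \<Rightarrow> real^'n \<Rightarrow> real" where
  "Rm m i k j x = pd k (christoffel a m i j) x - pd j (christoffel a m i k) x +
     (\<Sum>l\<in>UNIV. christoffel a m k l x * christoffel a l i j x - christoffel a m j l x * christoffel a l i k x)"

lemma christoffel_diff: "x \<in> U \<Longrightarrow> christoffel a m i j differentiable (at x)"
  using christoffel_Ck[of 1] by simp

lemma christoffel_sym_pd: "x \<in> U \<Longrightarrow> pd k (christoffel a m i j) x = pd k (christoffel a m j i) x"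
  by (rule pd_cong[OF open_U]) (auto intro: christoffel_sym)

lemma cov_diff:
  assumes w: "\<And>i. Ck_on 2 U (\<lambda>x. w x $ i)" and x: "x \<in> U"
  shows "diffM (cov a w) x"
proof -
  have "Ck_on 1 U (\<lambda>x. pd j (\<lambda>x. w x $ i) x - (\<Sum>k\<in>UNIV. christoffel a k i j x * w x $ k))" for i j
  proof -
    have "Ck_on 1 U (\<lambda>x. w x $ k)" for k by (rule Ck_on_le[OF _ w]) simp
    moreover have "Ck_on 1 U (pd j (\<lambda>x. w x $ i))"
      by (rule Ck_on_pd) (use w in \<open>simp add: numeral_2_eq_2\<close>)
    ultimately show ?thesis by (intro Ck_intros open_U christoffel_Ck)
  qed
  thus ?thesis using x by (simp add: diffM_def cov_def)
qed

lemma covM_cov: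
  assumes w: "\<And>i. Ck_on 2 U (\<lambda>x. w x $ i)" and x: "x \<in> U"
  shows "covM k (cov a w) x $ i $ j = pd k (pd j (\<lambda>x. w x $ i)) x
    - (\<Sum>m\<in>UNIV. pd k (christoffel a m i j) x * w x $ m)
    - (\<Sum>m\<in>UNIV. christoffel a m i j x * pd k (\<lambda>x. w x $ m) x)
    - (\<Sum>m\<in>UNIV. christoffel a m k i x * pd j (\<lambda>x. w x $ m) x)
    + (\<Sum>m\<in>UNIV. \<Sum>l\<in>UNIV. christoffel a m k i x * christoffel a l m j x * w x $ l)
    - (\<Sum>m\<in>UNIV. cov a w x $ i $ m * christoffel a m k j x)"
proof -
  have wd: "(\<lambda>x. w x $ i) differentiable (at x)" "pd j (\<lambda>x. w x $ i) differentiable (at x)" for i j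
    using w x by (auto simp: numeral_2_eq_2)
  have "pd k (\<lambda>x. pd j (\<lambda>x. w x $ i) x - (\<Sum>m\<in>UNIV. christoffel a m i j x * w x $ m)) x
     = pd k (pd j (\<lambda>x. w x $ i)) x - pd k (\<lambda>x. \<Sum>m\<in>UNIV. christoffel a m i j x * w x $ m) x"
    by (intro pd_diff wd differentiable_sum ballI differentiable_mult christoffel_diff x finite_class.finite_UNIV)
  also have "pd k (\<lambda>x. \<Sum>m\<in>UNIV. christoffel a m i j x * w x $ m) x =
      (\<Sum>m\<in>UNIV. pd k (christoffel a m i j) x * w x $ m) + (\<Sum>m\<in>UNIV. christoffel a m i j x * pd k (\<lambda>x. w x $ m) x)"
    by (intro pd_sum_mult wd christoffel_diff x)
  finally have 1: "pdM k (cov a w) x $ i $ j = pd k (pd j (\<lambda>x. w x $ i)) x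
    - (\<Sum>m\<in>UNIV. pd k (christoffel a m i j) x * w x $ m)
    - (\<Sum>m\<in>UNIV. christoffel a m i j x * pd k (\<lambda>x. w x $ m) x)"
    by (simp add: pdM_def cov_def)
  have 2: "(transpose (Nk k x) ** cov a w x) $ i $ j = (\<Sum>m\<in>UNIV. christoffel a m k i x * pd j (\<lambda>x. w x $ m) x)
     - (\<Sum>m\<in>UNIV. \<Sum>l\<in>UNIV. christoffel a m k i x * christoffel a l m j x * w x $ l)"
    by (simp add: matrix_matrix_mult_def transpose_def Nk_def cov_def right_diff_distrib sum_subtractf
       sum_distrib_left mult.assoc)
  have 3: "(cov a w x ** Nk k x) $ i $ j = (\<Sum>m\<in>UNIV. cov a w x $ i $ m * christoffel a m k j x)"
    by (simp add: matrix_matrix_mult_def Nk_def)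
  show ?thesis by (simp add: covM_def 1 2 3)
qed

text \<open>Second partial derivatives commute, the two terms with first derivatives of w are
  exchanged by j and k, and the last term of \<open>covM_cov\<close> is symmetric since the
  connection is torsion-free. Only the curvature remains.\<close>

lemma ricci_identity:
  assumes w: "\<And>i. Ck_on 2 U (\<lambda>x. w x $ i)" and x: "x \<in> U"
  shows "covM k (cov a w) x $ i $ j - covM j (cov a w) x $ i $ k = - (\<Sum>m\<in>UNIV. w x $ m * Rm m i k j x)"
proof -
  have c: "pd k (pd j (\<lambda>x. w x $ i)) x = pd j (pd k (\<lambda>x. w x $ i)) x"
    by (rule pd_commute[OF open_U x w])
  have sw: "(\<Sum>m\<in>UNIV. \<Sum>l\<in>UNIV. christoffel a m k i x * christoffel a l m j x * w x $ l)
    = (\<Sum>m\<in>UNIV. w x $ m * (\<Sum>l\<in>UNIV. christoffel a m j l x * christoffel a l i k x))" for j k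
    by (subst sum.swap) (simp add: sum_distrib_left mult_ac christoffel_sym[OF x, of _ j] christoffel_sym[OF x, of _ i k])
  have e: "(\<Sum>m\<in>UNIV. christoffel a m k i x * pd j (\<lambda>x. w x $ m) x) = (\<Sum>m\<in>UNIV. christoffel a m i k x * pd j (\<lambda>x. w x $ m) x)" for j k
    by (simp add: christoffel_sym[OF x, of _ k i])
  have e': "(\<Sum>m\<in>UNIV. cov a w x $ i $ m * christoffel a m k j x) = (\<Sum>m\<in>UNIV. cov a w x $ i $ m * christoffel a m j k x)"
    by (simp add: christoffel_sym[OF x, of _ k j])
  have "(\<Sum>m\<in>UNIV. w x $ m * Rm m i k j x) = (\<Sum>m\<in>UNIV. pd k (christoffel a m i j) x * w x $ m) - (\<Sum>m\<in>UNIV. pd j (christoffel a m i k) x * w x $ m)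
    + (\<Sum>m\<in>UNIV. w x $ m * (\<Sum>l\<in>UNIV. christoffel a m k l x * christoffel a l i j x))
    - (\<Sum>m\<in>UNIV. w x $ m * (\<Sum>l\<in>UNIV. christoffel a m j l x * christoffel a l i k x))"
    by (simp add: Rm_def sum_subtractf sum.distrib algebra_simps)
  thus ?thesis
    unfolding covM_cov[OF w x] sw e' c by (simp add: e)
qed

text \<open>The squared length of w is a function, so its second derivatives commute. Its first
  derivative is twice \<open>w^i w_{i;j}\<close>; comparing the second derivatives in both orders
  leaves exactly this contraction of the commutator.\<close>

lemma inner_ricci_identity:
  assumes w: "\<And>i. Ck_on 2 U (\<lambda>x. w x $ i)" and x: "x \<in> U"
  shows "(\<Sum>i\<in>UNIV. raise a w x $ i * (covM k (cov a w) x $ i $ j - covM j (cov a w) x $ i $ k)) = 0"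
proof -
  let ?z = "\<lambda>j x. \<chi> i. cov a w x $ i $ j"
  let ?B = "\<lambda>x. w x \<bullet> raise a w x"
  have dw: "diffV w x" if "x \<in> U" for x using w that by (auto simp: diffV_def numeral_2_eq_2)
  have dz: "diffV (?z j) x" for j using cov_diff[OF w x] by (auto simp: diffM_def diffV_def)
  have pB: "pd j ?B z = 2 * (?z j z \<bullet> raise a w z)" if z: "z \<in> U" for j z
  proof -
    have zz: "?z j z = covV j w z" by (simp add: vec_eq_iff cov_covV[OF z])
    have "w z \<bullet> (ainv a z *v covV j w z) = covV j w z \<bullet> raise a w z"
      by (subst inner_transpose) (simp add: raise_eq ainv_sym z inner_commute)
    thus ?thesis unfolding zz using pd_inner_raise[OF z dw[OF z] dw[OF z]] by simp
  qed
  have "Ck_on 2 U (\<lambda>x. \<Sum>i\<in>UNIV. w x $ i * (\<Sum>j\<in>UNIV. ainv a x $ i $ j * w x $ j))"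
    by (intro Ck_intros open_U w ainv_Ck)
  hence CB: "Ck_on 2 U ?B" by (simp add: inner_vec_def raise_def)
  have ppB: "pd k (pd j ?B) x = 2 * (covV k (?z j) x \<bullet> raise a w x + ?z j x \<bullet> (ainv a x *v ?z k x))" for j k
  proof -
    have zz: "?z k x = covV k w x" by (simp add: vec_eq_iff cov_covV[OF x])
    have "pd k (pd j ?B) x = pd k (\<lambda>x. 2 * (?z j x \<bullet> raise a w x)) x"
      by (rule pd_cong[OF open_U x]) (rule pB)
    also have "\<dots> = 2 * pd k (\<lambda>x. ?z j x \<bullet> raise a w x) x"
      by (subst pd_mult) (auto intro!: diff_inner diffV_raise dw dz x)
    finally show ?thesis unfolding pd_inner_raise[OF x dz dw[OF x]] zz .
  qed
  have "covV k (?z j) x $ i = covM k (cov a w) x $ i $ j + (\<Sum>m\<in>UNIV. cov a w x $ i $ m * christoffel a m k j x)" for i j k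
    by (simp add: covV_def covM_def pdV_def pdM_def matrix_vector_mult_def matrix_matrix_mult_def transpose_def Nk_def)
  moreover have "?z j x \<bullet> (ainv a x *v ?z k x) = ?z k x \<bullet> (ainv a x *v ?z j x)"
    by (subst inner_transpose) (simp add: ainv_sym x inner_commute)
  moreover have "pd k (pd j ?B) x = pd j (pd k ?B) x" by (rule pd_commute[OF open_U x CB])
  ultimately show ?thesis
    unfolding ppB by (simp add: inner_vec_def algebra_simps sum_subtractf sum.distrib christoffel_sym[OF x, of _ k j])
qed

text \<open>For covector fields with constant components c, the two preceding identities say that a
  quadratic form in c vanishes; hence its matrix is skew.\<close>

lemma Rm_skew:
  assumes x: "x \<in> U"
  shows "(\<Sum>i\<in>UNIV. ainv a x $ p $ i * Rm m i k j x) = - (\<Sum>i\<in>UNIV. ainv a x $ m $ i * Rm p i k j x)"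
proof -
  let ?Q = "\<chi> p m. \<Sum>i\<in>UNIV. ainv a x $ p $ i * Rm m i k j x"
  have "quad ?Q c = 0" for c
  proof -
    have w: "Ck_on 2 U (\<lambda>x. (\<lambda>_. c) x $ i)" for i by (rule Ck_on_const)
    have "(\<Sum>i\<in>UNIV. raise a (\<lambda>_. c) x $ i * (\<Sum>m\<in>UNIV. c $ m * Rm m i k j x)) = 0"
      using inner_ricci_identity[OF w x, of k j] by (simp add: ricci_identity[OF w x] sum_negf)
    moreover have "(\<Sum>i\<in>UNIV. raise a (\<lambda>_. c) x $ i * (\<Sum>m\<in>UNIV. c $ m * Rm m i k j x)) =
       (\<Sum>i\<in>UNIV. \<Sum>m\<in>UNIV. \<Sum>p\<in>UNIV. ainv a x $ p $ i * Rm m i k j x * c $ p * c $ m)"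
      by (simp add: raise_def sum_distrib_left sum_distrib_right mult_ac ainv_sym_nth[OF x, of _ "_::'n"])
    moreover have "\<dots> = quad ?Q c"
    proof -
      have "quad ?Q c = (\<Sum>p\<in>UNIV. \<Sum>m\<in>UNIV. \<Sum>i\<in>UNIV. ainv a x $ p $ i * Rm m i k j x * c $ p * c $ m)"
        by (simp add: quad_def sum_distrib_right)
      also have "\<dots> = (\<Sum>m\<in>UNIV. \<Sum>p\<in>UNIV. \<Sum>i\<in>UNIV. ainv a x $ p $ i * Rm m i k j x * c $ p * c $ m)"
        by (rule sum.swap)
      also have "\<dots> = (\<Sum>m\<in>UNIV. \<Sum>i\<in>UNIV. \<Sum>p\<in>UNIV. ainv a x $ p $ i * Rm m i k j x * c $ p * c $ m)"
        by (rule sum.cong[OF refl], rule sum.swap)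
      also have "\<dots> = (\<Sum>i\<in>UNIV. \<Sum>m\<in>UNIV. \<Sum>p\<in>UNIV. ainv a x $ p $ i * Rm m i k j x * c $ p * c $ m)"
        by (rule sum.swap)
      finally show ?thesis by simp
    qed
    ultimately show ?thesis by simp
  qed
  from quad_zero_imp_skew[OF this, of p m] show ?thesis by simp
qed

lemma ric_tensor_Rm: "ric_tensor a x $ i $ j = (\<Sum>k\<in>UNIV. Rm k i k j x)"
  by (simp add: ric_tensor_def Rm_def sum.distrib)

text \<open>The trace of the Ricci identity contracts the derivative index with the lower index of
  w. \<open>Rm_skew\<close> exchanges the first two indices of the curvature, after which the
  contraction is the Ricci tensor.\<close>

lemma ric_identity:
  assumes w: "\<And>i. Ck_on 2 U (\<lambda>x. w x $ i)" and x: "x \<in> U"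
  shows "(\<Sum>i\<in>UNIV. \<Sum>k\<in>UNIV. ainv a x $ i $ k * (covM k (cov a w) x $ i $ j - covM j (cov a w) x $ i $ k))
    = (\<Sum>i\<in>UNIV. raise a w x $ i * ric_tensor a x $ i $ j)"
proof -
  have "(\<Sum>i\<in>UNIV. \<Sum>k\<in>UNIV. ainv a x $ i $ k * (covM k (cov a w) x $ i $ j - covM j (cov a w) x $ i $ k))
    = - (\<Sum>i\<in>UNIV. \<Sum>k\<in>UNIV. \<Sum>m\<in>UNIV. w x $ m * (ainv a x $ k $ i * Rm m i k j x))"
    by (simp add: ricci_identity[OF w x] sum_negf sum_distrib_left mult_ac ainv_sym_nth[OF x, of _ "_::'n"])
  also have "(\<Sum>i\<in>UNIV. \<Sum>k\<in>UNIV. \<Sum>m\<in>UNIV. w x $ m * (ainv a x $ k $ i * Rm m i k j x))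
     = (\<Sum>k\<in>UNIV. \<Sum>m\<in>UNIV. w x $ m * (\<Sum>i\<in>UNIV. ainv a x $ k $ i * Rm m i k j x))"
  proof -
    have "(\<Sum>i\<in>UNIV. \<Sum>m\<in>UNIV. w x $ m * (ainv a x $ k $ i * Rm m i k j x))
       = (\<Sum>m\<in>UNIV. w x $ m * (\<Sum>i\<in>UNIV. ainv a x $ k $ i * Rm m i k j x))" for k
      by (subst sum.swap) (simp add: sum_distrib_left)
    thus ?thesis by (subst sum.swap) simp
  qed
  also have "\<dots> = (\<Sum>k\<in>UNIV. \<Sum>m\<in>UNIV. w x $ m * - (\<Sum>i\<in>UNIV. ainv a x $ m $ i * Rm k i k j x))"
    by (intro sum.cong refl arg_cong[where f="(*) _"] Rm_skew x)
  also have "\<dots> = - (\<Sum>k\<in>UNIV. \<Sum>m\<in>UNIV. \<Sum>i\<in>UNIV. ainv a x $ i $ m * w x $ m * Rm k i k j x)"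
    by (simp add: sum_negf sum_distrib_left mult_ac ainv_sym_nth[OF x, of _ "_::'n"])
  also have "(\<Sum>k\<in>UNIV. \<Sum>m\<in>UNIV. \<Sum>i\<in>UNIV. ainv a x $ i $ m * w x $ m * Rm k i k j x)
     = (\<Sum>k\<in>UNIV. \<Sum>i\<in>UNIV. \<Sum>m\<in>UNIV. ainv a x $ i $ m * w x $ m * Rm k i k j x)"
    by (rule sum.cong[OF refl], rule sum.swap)
  also have "\<dots> = (\<Sum>i\<in>UNIV. raise a w x $ i * ric_tensor a x $ i $ j)"
  proof -
    have "raise a w x $ i * ric_tensor a x $ i $ j
      = (\<Sum>k\<in>UNIV. (\<Sum>m\<in>UNIV. ainv a x $ i $ m * w x $ m) * Rm k i k j x)" for i
      by (simp add: raise_def ric_tensor_Rm sum_distrib_left)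
    hence "(\<Sum>i\<in>UNIV. raise a w x $ i * ric_tensor a x $ i $ j)
      = (\<Sum>i\<in>UNIV. \<Sum>k\<in>UNIV. \<Sum>m\<in>UNIV. ainv a x $ i $ m * w x $ m * Rm k i k j x)"
      by (simp only: sum_distrib_right)
    moreover have "\<dots> = (\<Sum>k\<in>UNIV. \<Sum>i\<in>UNIV. \<Sum>m\<in>UNIV. ainv a x $ i $ m * w x $ m * Rm k i k j x)"
      by (rule sum.swap)
    ultimately show ?thesis by simp
  qed
  finally show ?thesis by (simp only: minus_minus)
qed

text \<open>Since the connection is torsion-free, the skew part of the Ricci tensor is the trace of
  the curvature endomorphism; that endomorphism is skew with respect to a, so its trace is
  0.\<close>

lemma ric_tensor_sym:
  assumes x: "x \<in> U"
  shows "transpose (ric_tensor a x) = ric_tensor a x"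
proof -
  have "ric_tensor a x $ i $ j = ric_tensor a x $ j $ i" for i j
  proof -
    let ?R = "\<chi> p m. Rm m p i j x"
    let ?Q = "ainv a x ** ?R"
    have "transpose ?Q = - ?Q"
      by (simp add: vec_eq_iff transpose_def matrix_matrix_mult_def, intro allI, rule Rm_skew[OF x])
    hence "trace (a x ** ?Q) = 0" using trace_sym_skew[OF a_sym[OF x]] by blast
    hence "trace ?R = 0" by (simp add: matrix_mul_assoc a_ainv x)
    hence "(\<Sum>k\<in>UNIV. Rm k k i j x) = 0" by (simp add: trace_def)
    moreover have "Rm k i k j x - Rm k j k i x = Rm k k i j x" for k
    proof -
      have "(\<Sum>l\<in>UNIV. christoffel a k k l x * christoffel a l i j x) = (\<Sum>l\<in>UNIV. christoffel a k k l x * christoffel a l j i x)"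
        by (simp add: christoffel_sym[OF x, of _ i j])
      moreover have "(\<Sum>l\<in>UNIV. christoffel a k j l x * christoffel a l i k x) = (\<Sum>l\<in>UNIV. christoffel a k j l x * christoffel a l k i x)" for i j
        by (simp add: christoffel_sym[OF x, of _ i k])
      ultimately show ?thesis
        unfolding Rm_def sum_subtractf
        using christoffel_sym_pd[OF x, of k k i j] christoffel_sym_pd[OF x, of j k i k] christoffel_sym_pd[OF x, of i k j k]
        by simp
    qed
    ultimately have "(\<Sum>k\<in>UNIV. Rm k i k j x - Rm k j k i x) = 0" by simp
    thus ?thesis by (simp add: ric_tensor_Rm sum_subtractf)
  qed
  thus ?thesis by (simp add: transpose_sym_iff)
qed

end

section \<open>Linear algebra behind the divergence of s\<close>

declare transpose_matrix_vector [simp del]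

lemma column_inner: "column k (M :: real^'n^'m) \<bullet> v = (transpose M *v v) $ k"
  by (simp add: column_def inner_vec_def transpose_def matrix_vector_mult_def)

lemma column_nth: "column k M $ j = M $ j $ k"
  by (simp add: column_def)

lemma sum_column: "(\<Sum>k\<in>UNIV. v $ k * (M :: real^'n^'m) $ i $ k) = (M *v v) $ i"
  by (simp add: matrix_vector_mult_def mult.commute)

lemma skew_inner: "transpose S = - S \<Longrightarrow> v \<bullet> (S *v (w::real^'n)) = - (w \<bullet> (S *v v))"
  by (subst inner_transpose) (simp add: matrix_mult_minus inner_commute)

lemma skew_inner_self: "transpose S = - S \<Longrightarrow> v \<bullet> (S *v (v::real^'n)) = 0"
  using skew_inner[of S v v] by simp

lemma sym_inner: "transpose S = S \<Longrightarrow> v \<bullet> (S *v (w::real^'n)) = (S *v v) \<bullet> w"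
  by (subst inner_transpose) simp

lemma trace_columns:
  fixes g M :: "real^'n^'n"
  assumes "transpose g = g"
  shows "(\<Sum>k\<in>UNIV. column k M \<bullet> column k g) = trace (g ** M)"
proof -
  have "column k M \<bullet> column k g = (\<Sum>i\<in>UNIV. g $ k $ i * M $ i $ k)" for k
    using assms by (simp add: column_def inner_vec_def transpose_sym_iff mult.commute)
  thus ?thesis by (simp add: trace_def matrix_matrix_mult_def)
qed

text \<open>A computation at one point: T is \<open>b_{i;j}\<close> with symmetric part R and skew
  part S, Sd is \<open>s_{i;j}\<close>, while \<open>Rd k\<close> and \<open>Sdd k\<close> are the
  derivatives of R and S in the direction k, and q is the divergence of S. The traced Ricci identity
  \<open>H4\<close> expresses q by the Ricci tensor and by traces of Rd, which involve
  \<open>u = s_{j;k} b^k\<close>; the contraction of \<open>H3\<close> with \<open>b^k\<close>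
  determines u. The divergence of s brings q back in, so the result has to be solved once more for
  the part of q along b.\<close>

lemma divergence_formula:
  fixes g gi T R S Sd Ric :: "real^'n^'n" and b s \<sigma>d X q bu su :: "real^'n"
    and Rd Sdd :: "'n \<Rightarrow> real^'n^'n" and n \<sigma> K t B S0 :: real
  assumes gi: "transpose gi = gi" and ggi: "g ** gi = mat 1"
    and bu: "bu = gi *v b" and su: "su = gi *v s" and B: "B = b \<bullet> bu" and B1: "0 \<le> B" "B < 1" and S0: "S0 = s \<bullet> su"
    and n: "n = real CARD('n)"
    and T: "T = R + S" and S_skew: "transpose S = - S" and R_sym: "transpose R = R"
    and R: "\<And>v. R *v v = (2*\<sigma>) *\<^sub>R (g *v v - (b \<bullet> v) *\<^sub>R b) - (s \<bullet> v) *\<^sub>R b - (b \<bullet> v) *\<^sub>R s"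
    and s: "s = - (S *v bu)"
    and Rd: "\<And>k v. Rd k *v v = (2*\<sigma>d $ k) *\<^sub>R (g *v v - (b \<bullet> v) *\<^sub>R b)
        - (2*\<sigma>) *\<^sub>R ((b \<bullet> v) *\<^sub>R column k T + (column k T \<bullet> v) *\<^sub>R b)
        - (s \<bullet> v) *\<^sub>R column k T - (column k Sd \<bullet> v) *\<^sub>R b - (b \<bullet> v) *\<^sub>R column k Sd - (column k T \<bullet> v) *\<^sub>R s"
    and Rd_sym: "\<And>k. transpose (Rd k) = Rd k" and Sdd_skew: "\<And>k. transpose (Sdd k) = - Sdd k"
    and Sd: "\<And>k. column k Sd = - (Sdd k *v bu) - S *v (gi *v column k T)"
    and H3: "\<And>j k. (\<Sum>i\<in>UNIV. bu $ i * ((Rd k + Sdd k) $ i $ j - (Rd j + Sdd j) $ i $ k)) = 0"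
    and H4: "\<And>j. (\<Sum>i\<in>UNIV. \<Sum>k\<in>UNIV. gi $ i $ k * ((Rd k + Sdd k) $ i $ j - (Rd j + Sdd j) $ i $ k)) = (Ric *v bu) $ j"
    and Ric: "\<And>v. Ric *v v = K *\<^sub>R (g *v v + (b \<bullet> v) *\<^sub>R b) + t *\<^sub>R (g *v v) + 2 *\<^sub>R (S *v (gi *v (S *v v)))
        - ((n-1)*\<sigma>\<^sup>2) *\<^sub>R (3 *\<^sub>R (g *v v) - (b \<bullet> v) *\<^sub>R b) + (n-1) *\<^sub>R ((b \<bullet> v) *\<^sub>R \<sigma>d + (\<sigma>d \<bullet> v) *\<^sub>R b)
        - (n-1) *\<^sub>R ((s \<bullet> v) *\<^sub>R s + (1/2) *\<^sub>R (Sd *v v + transpose Sd *v v))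
        - (1/2) *\<^sub>R ((X \<bullet> v) *\<^sub>R b + (b \<bullet> v) *\<^sub>R X)"
    and t: "t = trace (gi ** (S ** (gi ** S)))"
    and q: "\<And>j. q $ j = (\<Sum>i\<in>UNIV. \<Sum>k\<in>UNIV. gi $ i $ k * Sdd k $ i $ j)"
  shows "q = (n-1) *\<^sub>R (2 *\<^sub>R \<sigma>d + \<sigma>\<^sup>2 *\<^sub>R b + (2*\<sigma>) *\<^sub>R s - S *v su) + K *\<^sub>R b
     - (1/2) *\<^sub>R (B *\<^sub>R X + (X \<bullet> bu) *\<^sub>R b) + (B / (1+B) * (X \<bullet> bu)) *\<^sub>R b"
proof -
  define \<tau> where "\<tau> = - (S *v su)"
  define u where "u = Sd *v bu"
  define G where "G = \<sigma>d \<bullet> bu"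
  define c where "c = (2*\<sigma>*(1-B)) *\<^sub>R b + (1-B) *\<^sub>R s"
  define w where "w = (2*\<sigma>) *\<^sub>R s - S0 *\<^sub>R b + \<tau>"
  have gbu: "g *v bu = b" and gsu: "g *v su = s" unfolding bu su by (simp_all add: matrix_vector_mul_assoc ggi)
  have Sbu: "S *v bu = - s" and Ssu: "S *v su = - \<tau>" using s by (simp_all add: \<tau>_def)
  have sbu: "s \<bullet> bu = 0" using skew_inner_self[OF S_skew, of bu] by (simp add: s inner_commute)
  have bsu: "b \<bullet> su = 0"
    using sym_inner[OF gi, of b s] sbu by (simp add: su bu inner_commute)
  have \<tau>bu: "\<tau> \<bullet> bu = - S0"
    using skew_inner[OF S_skew, of bu su] Sbu by (simp add: \<tau>_def S0 inner_commute)
  have Rbu: "R *v bu = (2*\<sigma>*(1-B)) *\<^sub>R b - B *\<^sub>R s"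
    by (simp add: R gbu sbu B[symmetric] algebra_simps)
  have Rsu: "R *v su = (2*\<sigma>) *\<^sub>R s - S0 *\<^sub>R b"
    by (simp add: R gsu bsu S0[symmetric] algebra_simps)
  have TT: "transpose T *v v = R *v v - S *v v" for v
    by (simp add: T transpose_add R_sym S_skew matrix_linear_simps matrix_mult_minus)
  have Tbu: "T *v bu = (2*\<sigma>*(1-B)) *\<^sub>R b - (1+B) *\<^sub>R s"
    by (simp add: T matrix_linear_simps Rbu Sbu algebra_simps)
  have Tsu: "T *v su = (2*\<sigma>) *\<^sub>R s - S0 *\<^sub>R b - \<tau>"
    by (simp add: T matrix_linear_simps Rsu Ssu)
  have cT: "column k T \<bullet> bu = c $ k" for k
    by (simp add: column_inner TT Rbu Sbu c_def algebra_simps)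
  have wT: "column k T \<bullet> su = w $ k" for k
    by (simp add: column_inner TT Rsu Ssu w_def)
  have cbu: "c \<bullet> bu = 2*\<sigma>*(1-B)*B" by (simp add: c_def inner_add_left sbu B[symmetric])
  have wbu: "w \<bullet> bu = - (1+B)*S0"
    by (simp add: w_def inner_add_left inner_diff_left sbu B[symmetric] \<tau>bu algebra_simps)
  \<comment> \<open>This is the derivative of the identity \<open>s_i b^i = 0\<close>.\<close>
  have Sdbu: "column k Sd \<bullet> bu = - w $ k" for k
  proof -
    have 1: "(Sdd k *v bu) \<bullet> bu = 0" using skew_inner_self[OF Sdd_skew] by (simp add: inner_commute)
    have "(S *v (gi *v column k T)) \<bullet> bu = - ((S *v bu) \<bullet> (gi *v column k T))"
      using skew_inner[OF S_skew, of bu] by (simp add: inner_commute)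
    also have "\<dots> = column k T \<bullet> su"
      using sym_inner[OF gi, of s "column k T"] by (simp add: Sbu su inner_commute)
    finally show ?thesis by (simp add: Sd inner_diff_left 1 wT)
  qed
  \<comment> \<open>contraction of the Ricci identity with \<open>b\<^sup>i b\<^sup>k\<close>\<close>
  define Y where "Y = (\<Sum>k\<in>UNIV. bu $ k *\<^sub>R (Sdd k *v bu))"
  define Z where "Z = (\<Sum>k\<in>UNIV. bu $ k *\<^sub>R (Rd k *v bu))"
  have ZY: "Z $ j - Y $ j = bu \<bullet> (Rd j *v bu)" for j
  proof -
    have "0 = (\<Sum>k\<in>UNIV. bu $ k * (\<Sum>i\<in>UNIV. bu $ i * ((Rd k + Sdd k) $ i $ j - (Rd j + Sdd j) $ i $ k)))"
      by (simp only: H3 mult_zero_right sum.neutral_const)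
    also have "\<dots> = (\<Sum>k\<in>UNIV. bu $ k * ((Rd k *v bu) $ j - (Sdd k *v bu) $ j)) - bu \<bullet> ((Rd j + Sdd j) *v bu)"
    proof -
      have 1: "(\<Sum>i\<in>UNIV. bu $ i * (Rd k + Sdd k) $ i $ j) = (Rd k *v bu) $ j - (Sdd k *v bu) $ j" for k
      proof -
        have "(\<Sum>i\<in>UNIV. bu $ i * (Rd k + Sdd k) $ i $ j) = (transpose (Rd k + Sdd k) *v bu) $ j"
          by (simp add: matrix_vector_mult_def transpose_def mult.commute)
        thus ?thesis by (simp add: transpose_add Rd_sym Sdd_skew matrix_linear_simps matrix_mult_minus)
      qed
      have 2: "bu \<bullet> (M *v bu) = (\<Sum>k\<in>UNIV. bu $ k * (\<Sum>i\<in>UNIV. bu $ i * M $ i $ k))" for M :: "real^'n^'n"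
        by (subst inner_transpose) (simp add: inner_vec_def matrix_vector_mult_def transpose_def mult_ac)
      show ?thesis unfolding 2 by (simp only: right_diff_distrib sum_subtractf 1)
    qed
    also have "bu \<bullet> ((Rd j + Sdd j) *v bu) = bu \<bullet> (Rd j *v bu)"
      by (simp add: matrix_linear_simps inner_add_right skew_inner_self[OF Sdd_skew])
    finally show ?thesis by (simp add: Z_def Y_def sum_subtractf right_diff_distrib)
  qed
  have uY: "u = - Y - S *v (gi *v (T *v bu))"
  proof -
    have "u = (\<Sum>k\<in>UNIV. bu $ k *\<^sub>R column k Sd)"
      unfolding u_def by (simp add: vec_eq_iff sum_column[symmetric] column_def)
    also have "\<dots> = - Y - (\<Sum>k\<in>UNIV. bu $ k *\<^sub>R (S *v (gi *v column k T)))"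
      by (simp add: Sd Y_def scaleR_diff_right sum_subtractf sum_negf)
    also have "(\<Sum>k\<in>UNIV. bu $ k *\<^sub>R (S *v (gi *v column k T))) = S *v (gi *v (\<Sum>k\<in>UNIV. bu $ k *\<^sub>R column k T))"
      by (simp add: linear_sum[OF matrix_vector_mul_linear] matrix_vector_mult_scaleR)
    also have "(\<Sum>k\<in>UNIV. bu $ k *\<^sub>R column k T) = T *v bu"
      by (simp add: vec_eq_iff sum_column[symmetric] column_def)
    finally show ?thesis .
  qed
  have sbu': "bu \<bullet> s = 0" and bbu': "bu \<bullet> b = B" using sbu B by (simp_all add: inner_commute)
  have bRd: "bu \<bullet> (Rd j *v bu) = 2*B*(1-B)*\<sigma>d $ j - 4*\<sigma>*B*c $ j + 2*B*w $ j" for j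
    by (simp add: Rd gbu sbu sbu' B[symmetric] bbu' cT Sdbu inner_diff_right inner_add_right inner_commute[of bu "column _ _"] algebra_simps)
  have Z: "Z = (2*G*(1-B)) *\<^sub>R b - (2*\<sigma>) *\<^sub>R (B *\<^sub>R (T *v bu) + (c \<bullet> bu) *\<^sub>R b) + (w \<bullet> bu) *\<^sub>R b - B *\<^sub>R u - (c \<bullet> bu) *\<^sub>R s"
  proof -
    have "Z $ j = (\<Sum>k\<in>UNIV. (2*(1-B)*b $ j) * (\<sigma>d $ k * bu $ k) - (2*\<sigma>*B) * (bu $ k * T $ j $ k) - (2*\<sigma>*b $ j) * (c $ k * bu $ k)
        + b $ j * (w $ k * bu $ k) - B * (bu $ k * Sd $ j $ k) - s $ j * (c $ k * bu $ k))" for j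
      by (simp add: Z_def Rd gbu sbu B[symmetric] cT Sdbu column_nth algebra_simps)
    also have "\<dots> j = (2*(1-B)*b $ j) * G - (2*\<sigma>*B) * (T *v bu) $ j - (2*\<sigma>*b $ j) * (c \<bullet> bu)
        + b $ j * (w \<bullet> bu) - B * u $ j - s $ j * (c \<bullet> bu)" for j
      by (simp only: sum_subtractf sum.distrib sum_distrib_left[symmetric] sum_column u_def G_def inner_vec_def inner_real_def)
    finally show ?thesis by (simp add: vec_eq_iff algebra_simps)
  qed
  have SgT: "S *v (gi *v (T *v bu)) = (1+B) *\<^sub>R \<tau> - (2*\<sigma>*(1-B)) *\<^sub>R s"
    by (simp add: Tbu matrix_vector_mult_diff_distrib matrix_vector_mult_scaleR bu[symmetric] su[symmetric] Sbu Ssu)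
  \<comment> \<open>The three relations between u, Y and Z are linear; elimination of Y and Z leaves
    the factor 1 - B, which is positive.\<close>
  have "(1-B) * u $ j = (1-B) * (- \<tau> $ j + 2*B*\<sigma>d $ j - 2*G*b $ j + S0*b $ j + 2*\<sigma>* s $ j)" for j
  proof -
    have cj: "c $ j = 2*\<sigma>*(1-B)*b $ j + (1-B)* s $ j" and wj: "w $ j = 2*\<sigma>* s $ j - S0*b $ j + \<tau> $ j"
      by (simp_all add: c_def w_def)
    have "u $ j = - Y $ j - ((1+B)*\<tau> $ j - 2*\<sigma>*(1-B)* s $ j)"
      by (subst uY, subst SgT) simp
    moreover have "Z $ j = 2*G*(1-B)*b $ j - 2*\<sigma>*(B*(2*\<sigma>*(1-B)*b $ j - (1+B)* s $ j) + 2*\<sigma>*(1-B)*B*b $ j)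
        - (1+B)*S0*b $ j - B*u $ j - 2*\<sigma>*(1-B)*B* s $ j"
      by (subst Z) (simp add: Tbu cbu wbu algebra_simps)
    moreover have "Y $ j = Z $ j - (2*B*(1-B)*\<sigma>d $ j - 4*\<sigma>*B*c $ j + 2*B*w $ j)"
      using ZY[of j] bRd[of j] by simp
    ultimately show ?thesis unfolding cj wj by algebra
  qed
  hence u: "u $ j = - \<tau> $ j + 2*B*\<sigma>d $ j - 2*G*b $ j + S0*b $ j + 2*\<sigma>* s $ j" for j
    using B1 by (metis diff_gt_0_iff_gt less_irrefl mult_left_cancel)
  \<comment> \<open>The divergences of b and of s.\<close>
  define \<theta> where "\<theta> = trace (gi ** T)"
  define d where "d = (\<Sum>k\<in>UNIV. column k Sd \<bullet> column k gi)"
  have ggk: "g *v column k gi = axis k 1" for k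
    using ggi by (auto simp: vec_eq_iff matrix_matrix_mult_def matrix_vector_mult_def column_def mat_def axis_def)
  have vgk: "v \<bullet> column k gi = (gi *v v) $ k" for v k using column_inner[of k gi v] gi by (simp add: inner_commute)
  have bgk: "b \<bullet> column k gi = bu $ k" and sgk: "s \<bullet> column k gi = su $ k" for k
    by (simp_all add: vgk bu su)
  have \<theta>: "\<theta> = 2*\<sigma>*(n-B)"
  proof -
    have "trace (gi ** S) = 0" by (rule trace_sym_skew[OF gi S_skew])
    hence "\<theta> = trace (gi ** R)" by (simp add: \<theta>_def T matrix_add_ldistrib trace_add)
    also have "\<dots> = trace (R ** gi)" by (rule trace_mul_sym)
    also have "\<dots> = (\<Sum>k\<in>UNIV. (R *v column k gi) $ k)"
      by (simp add: trace_def matrix_matrix_mult_def matrix_vector_mult_def column_def)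
    also have "\<dots> = (\<Sum>k\<in>UNIV. 2*\<sigma> - (2*\<sigma>) * (b $ k * bu $ k) - b $ k * su $ k - s $ k * bu $ k)"
      by (simp add: R ggk bgk sgk algebra_simps)
    also have "\<dots> = 2*\<sigma>*n - 2*\<sigma>*B - b \<bullet> su - s \<bullet> bu"
      by (simp add: sum_subtractf sum_distrib_left[symmetric] inner_vec_def B n)
    finally show ?thesis by (simp add: bsu sbu algebra_simps)
  qed
  \<comment> \<open>Differentiating s = -(S b) gives one term with the divergence of S and one with
    S times T. In the latter the symmetric part of T drops out of the trace and the skew part gives
    t.\<close>
  have d: "d = - (q \<bullet> bu) - t"
  proof -
    have 1: "(\<Sum>k\<in>UNIV. (Sdd k *v bu) \<bullet> column k gi) = q \<bullet> bu"
    proof -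
      have "(\<Sum>k\<in>UNIV. (Sdd k *v bu) \<bullet> column k gi) = (\<Sum>k\<in>UNIV. \<Sum>i\<in>UNIV. \<Sum>j\<in>UNIV. gi $ i $ k * Sdd k $ i $ j * bu $ j)"
        by (simp add: inner_vec_def matrix_vector_mult_def column_def sum_distrib_left sum_distrib_right mult_ac)
      also have "\<dots> = (\<Sum>k\<in>UNIV. \<Sum>j\<in>UNIV. \<Sum>i\<in>UNIV. gi $ i $ k * Sdd k $ i $ j * bu $ j)"
        by (rule sum.cong[OF refl], rule sum.swap)
      also have "\<dots> = (\<Sum>j\<in>UNIV. \<Sum>k\<in>UNIV. \<Sum>i\<in>UNIV. gi $ i $ k * Sdd k $ i $ j * bu $ j)"
        by (rule sum.swap)
      also have "\<dots> = (\<Sum>j\<in>UNIV. \<Sum>i\<in>UNIV. \<Sum>k\<in>UNIV. gi $ i $ k * Sdd k $ i $ j * bu $ j)"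
        by (rule sum.cong[OF refl], rule sum.swap)
      finally show ?thesis by (simp add: inner_vec_def q sum_distrib_right)
    qed
    have 2: "(\<Sum>k\<in>UNIV. (S *v (gi *v column k T)) \<bullet> column k gi) = t"
    proof -
      have "S *v (gi *v column k T) = column k (S ** (gi ** T))" for k
        by (simp add: vec_eq_iff matrix_matrix_mult_def matrix_vector_mult_def column_def)
      hence "(\<Sum>k\<in>UNIV. (S *v (gi *v column k T)) \<bullet> column k gi) = trace (gi ** (S ** (gi ** T)))"
        by (simp add: trace_columns[OF gi])
      also have "\<dots> = trace (gi ** (S ** (gi ** R))) + t" 
        by (simp add: T t matrix_add_ldistrib trace_add)
      also have "trace (gi ** (S ** (gi ** R))) = trace ((gi ** R ** gi) ** S)"
        using trace_mul_sym[of "gi ** S" "gi ** R"] by (simp add: matrix_mul_assoc)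
      also have "\<dots> = 0"
        by (rule trace_sym_skew[OF _ S_skew]) (simp add: matrix_transpose_mul gi R_sym matrix_mul_assoc)
      finally show ?thesis by simp
    qed
    show ?thesis by (simp add: d_def Sd inner_diff_left sum_subtractf sum_negf 1 2)
  qed
  have CR: "(\<Sum>i\<in>UNIV. \<Sum>k\<in>UNIV. gi $ i $ k * Rd k $ i $ j)
     = 2*\<sigma>d $ j - 2*G*b $ j - 2*\<sigma>*((T *v bu) $ j + \<theta>*b $ j) - (T *v su) $ j - d*b $ j - u $ j - \<theta>* s $ j" for j
  proof -
    have "(\<Sum>i\<in>UNIV. \<Sum>k\<in>UNIV. gi $ i $ k * Rd k $ i $ j) = (\<Sum>k\<in>UNIV. \<Sum>i\<in>UNIV. gi $ i $ k * Rd k $ i $ j)"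
      by (rule sum.swap)
    also have "\<dots> = (\<Sum>k\<in>UNIV. (Rd k *v column k gi) $ j)"
    proof (rule sum.cong[OF refl])
      fix k
      have "(\<Sum>i\<in>UNIV. gi $ i $ k * Rd k $ i $ j) = (transpose (Rd k) *v column k gi) $ j"
        by (simp add: matrix_vector_mult_def column_def transpose_def mult.commute)
      thus "(\<Sum>i\<in>UNIV. gi $ i $ k * Rd k $ i $ j) = (Rd k *v column k gi) $ j" by (simp add: Rd_sym)
    qed
    also have "\<dots> = (\<Sum>k\<in>UNIV. 2*(\<sigma>d $ k * axis k 1 $ j) - (2*b $ j)*(\<sigma>d $ k * bu $ k) - (2*\<sigma>)*(bu $ k * T $ j $ k)
         - (2*\<sigma>*b $ j)*(column k T \<bullet> column k gi) - su $ k * T $ j $ k - b $ j * (column k Sd \<bullet> column k gi)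
         - bu $ k * Sd $ j $ k - s $ j * (column k T \<bullet> column k gi))"
      by (rule sum.cong[OF refl]) (simp add: Rd ggk bgk sgk column_nth algebra_simps)
    also have "\<dots> = 2*(\<Sum>k\<in>UNIV. \<sigma>d $ k * axis k 1 $ j) - (2*b $ j)*G - (2*\<sigma>)*(T *v bu) $ j
         - (2*\<sigma>*b $ j)*\<theta> - (T *v su) $ j - b $ j * d - u $ j - s $ j * \<theta>"
      by (simp only: sum_subtractf sum.distrib sum_distrib_left[symmetric] sum_column u_def G_def d_def
         inner_vec_def[of \<sigma>d] inner_real_def trace_columns[OF gi] \<theta>_def)
    also have "(\<Sum>k\<in>UNIV. \<sigma>d $ k * axis k 1 $ j) = \<sigma>d $ j"
      by (simp add: axis_def if_distrib cong: if_cong)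
    finally show ?thesis by (simp add: algebra_simps)
  qed
  have TR: "(\<Sum>i\<in>UNIV. \<Sum>k\<in>UNIV. gi $ i $ k * Rd j $ i $ k) = 2*(n-B)*\<sigma>d $ j - 4*\<sigma>*c $ j" for j
  proof -
    have "(\<Sum>i\<in>UNIV. \<Sum>k\<in>UNIV. gi $ i $ k * Rd j $ i $ k) = (\<Sum>i\<in>UNIV. (Rd j *v column i gi) $ i)"
      using gi by (simp add: matrix_vector_mult_def column_def transpose_sym_iff mult.commute)
    also have "\<dots> = (\<Sum>k\<in>UNIV. 2*\<sigma>d $ j - (2*\<sigma>d $ j)*(b $ k * bu $ k) - (2*\<sigma>)*(column j T $ k * bu $ k)
         - (2*\<sigma>)*((gi *v column j T) $ k * b $ k) - column j T $ k * su $ k - (gi *v column j Sd) $ k * b $ k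
         - column j Sd $ k * bu $ k - (gi *v column j T) $ k * s $ k)"
      by (simp add: Rd ggk bgk sgk vgk[of "column _ _"] algebra_simps)
    also have "\<dots> = 2*n*\<sigma>d $ j - (2*\<sigma>d $ j)*B - (2*\<sigma>)*(column j T \<bullet> bu) - (2*\<sigma>)*((gi *v column j T) \<bullet> b)
         - column j T \<bullet> su - (gi *v column j Sd) \<bullet> b - column j Sd \<bullet> bu - (gi *v column j T) \<bullet> s"
      by (simp add: sum_subtractf sum_distrib_left[symmetric] inner_vec_def B n)
    finally show ?thesis by (simp add: sym_inner[OF gi, symmetric] bu[symmetric] su[symmetric] cT wT Sdbu algebra_simps)
  qed
  have TS: "(\<Sum>i\<in>UNIV. \<Sum>k\<in>UNIV. gi $ i $ k * Sdd j $ i $ k) = 0" for j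
  proof -
    have "(\<Sum>i\<in>UNIV. \<Sum>k\<in>UNIV. gi $ i $ k * Sdd j $ i $ k) = - trace (gi ** Sdd j)"
    proof -
      have e: "Sdd j $ i $ k = - Sdd j $ k $ i" for i k
        using arg_cong[OF Sdd_skew[of j], of "\<lambda>M. M $ k $ i"] by (simp add: transpose_def)
      have "gi $ i $ k * Sdd j $ i $ k = - (gi $ i $ k * Sdd j $ k $ i)" for i k
        by (subst e) simp
      hence "(\<Sum>i\<in>UNIV. \<Sum>k\<in>UNIV. gi $ i $ k * Sdd j $ i $ k) = (\<Sum>i\<in>UNIV. \<Sum>k\<in>UNIV. - (gi $ i $ k * Sdd j $ k $ i))"
        by (simp only:)
      thus ?thesis by (simp only: trace_def matrix_matrix_mult_def sum_negf vec_lambda_beta)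
    qed
    thus ?thesis by (simp add: trace_sym_skew[OF gi Sdd_skew])
  qed
  have qR: "q $ j = 2*(n-B)*\<sigma>d $ j - 4*\<sigma>*c $ j - (\<Sum>i\<in>UNIV. \<Sum>k\<in>UNIV. gi $ i $ k * Rd k $ i $ j) + (Ric *v bu) $ j" for j
  proof -
    have "(Ric *v bu) $ j = (\<Sum>i\<in>UNIV. \<Sum>k\<in>UNIV. gi $ i $ k * Rd k $ i $ j) + q $ j
       - (\<Sum>i\<in>UNIV. \<Sum>k\<in>UNIV. gi $ i $ k * Rd j $ i $ k) - (\<Sum>i\<in>UNIV. \<Sum>k\<in>UNIV. gi $ i $ k * Sdd j $ i $ k)"
      unfolding H4[symmetric] q by (simp add: algebra_simps sum.distrib sum_subtractf)
    thus ?thesis by (simp add: TR TS)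
  qed
  have TSd: "(transpose Sd *v bu) $ j = - w $ j" for j using Sdbu by (simp add: column_inner)
  have Ricbu: "(Ric *v bu) $ j = K*(1+B)*b $ j + t*b $ j + 2*\<tau> $ j - (n-1)*\<sigma>\<^sup>2*(3-B)*b $ j + (n-1)*(G*b $ j + B*\<sigma>d $ j)
      - (n-1)/2*(u $ j - w $ j) - (1/2)*((X \<bullet> bu)*b $ j + B*X $ j)" for j
    unfolding Ric gbu Sbu sbu B[symmetric] G_def[symmetric]
    by (simp add: TSd u_def[symmetric] matrix_mult_minus su[symmetric] Ssu algebra_simps add_divide_distrib diff_divide_distrib)
  \<comment> \<open>Through the divergence d of s, the unknown q still occurs on the right side, but
    only in its pairing Q with b. Pairing the equation with b determines Q because 1 + B is
    positive.\<close>
  define Q where "Q = q \<bullet> bu"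
  define L where "L = (n-1) *\<^sub>R (2 *\<^sub>R \<sigma>d + (2*G) *\<^sub>R b + (\<sigma>\<^sup>2*(1+B)) *\<^sub>R b + (2*\<sigma>) *\<^sub>R s + \<tau> - S0 *\<^sub>R b) + (K*(1+B)) *\<^sub>R b
      - (1/2) *\<^sub>R (B *\<^sub>R X + (X \<bullet> bu) *\<^sub>R b)"
  have qL: "q = L - Q *\<^sub>R b"
  proof (subst vec_eq_iff, rule allI)
    fix j
    show "q $ j = (L - Q *\<^sub>R b) $ j"
      unfolding qR CR Ricbu u d \<theta> by (simp add: L_def Tbu Tsu c_def w_def Q_def field_simps power2_eq_square)
  qed
  have "Q * (1+B) = L \<bullet> bu"
    using arg_cong[OF qL, of "\<lambda>v. v \<bullet> bu"] by (simp add: Q_def[symmetric] inner_diff_left B[symmetric] algebra_simps)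
  also have "L \<bullet> bu = (1+B) * ((n-1) * (2*G + \<sigma>\<^sup>2*B - S0) + K*B) - B*(X \<bullet> bu)"
    by (simp add: L_def inner_add_left inner_diff_left sbu \<tau>bu B[symmetric] G_def[symmetric] algebra_simps)
  finally have Q: "Q = (n-1) * (2*G + \<sigma>\<^sup>2*B - S0) + K*B - B/(1+B)*(X \<bullet> bu)"
    using B1 by (simp add: field_simps)
  show ?thesis unfolding qL Q
    by (simp add: L_def vec_eq_iff \<tau>_def algebra_simps)
qed

section \<open>Leibniz rules for tensor fields\<close>

definition outer :: "real^'n \<Rightarrow> real^'m \<Rightarrow> real^'m^'n" where
  "outer u v = (\<chi> i j. u $ i * v $ j)"

lemma outer_mult: "outer u v *v w = (v \<bullet> w) *\<^sub>R u"
  by (simp add: vec_eq_iff outer_def matrix_vector_mult_def inner_vec_def sum_distrib_left mult_ac)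

lemma quad_outer: "quad (outer u v) y = (u \<bullet> y) * (v \<bullet> y)"
  by (simp add: quad_inner outer_mult inner_commute mult.commute)

lemma quad_add: "quad (T + R) y = quad T y + quad R y"
  and quad_diff: "quad (T - R) y = quad T y - quad R y"
  and quad_scaleR: "quad (c *\<^sub>R T) y = c * quad T y"
  and quad_minus: "quad (- T) y = - quad T y"
  and quad_transpose: "quad (transpose T) y = quad T y"
proof -
  show "quad (transpose T) y = quad T y"
    using inner_transpose[of y T y] by (simp add: quad_inner inner_commute)
qed (simp_all add: quad_inner matrix_linear_simps matrix_mult_minus inner_diff inner_add inner_diff_right
    scaleR_matrix_vector_assoc[symmetric])

lemma transpose_outer: "transpose (outer u v) = outer v u"
  by (simp add: outer_def transpose_def vec_eq_iff mult.commute)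

lemma quad_eq_imp_eq:
  assumes "\<And>y. quad T y = quad R y" "transpose T = T" "transpose R = R"
  shows "T = R"
proof -
  have "(T - R) $ i $ j = - (T - R) $ j $ i" for i j
    by (rule quad_zero_imp_skew) (simp add: quad_diff assms)
  moreover have "(T - R) $ i $ j = (T - R) $ j $ i" for i j
    using assms(2,3) by (simp add: transpose_sym_iff)
  ultimately have "(T - R) $ i $ j = 0" for i j by (metis equal_neg_zero)
  thus ?thesis by (simp add: vec_eq_iff)
qed

lemma matrix_eq_vecI: "(\<And>v. T *v v = R *v v) \<Longrightarrow> T = (R :: real^'n^'m)"
  by (simp add: matrix_eq)

context riemann_chart
begin

lemma covM_cong:
  assumes "x \<in> U" "\<And>z. z \<in> U \<Longrightarrow> T z = R z"
  shows "covM k T x = covM k R x"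
proof -
  have "pdM k T x = pdM k R x" by (rule pdM_cong[OF open_U assms(1)]) (rule assms(2))
  thus ?thesis by (simp add: covM_def assms)
qed

lemma covM_add: "diffM T x \<Longrightarrow> diffM R x \<Longrightarrow> covM k (\<lambda>x. T x + R x) x = covM k T x + covM k R x"
  and covM_diff: "diffM T x \<Longrightarrow> diffM R x \<Longrightarrow> covM k (\<lambda>x. T x - R x) x = covM k T x - covM k R x"
proof -
  assume d: "diffM T x" "diffM R x"
  have "pd k (\<lambda>x. T x $ i $ j + R x $ i $ j) x = pd k (\<lambda>x. T x $ i $ j) x + pd k (\<lambda>x. R x $ i $ j) x" for i j
    by (rule pd_add) (use d in \<open>auto simp: diffM_def\<close>)
  hence "pdM k (\<lambda>x. T x + R x) x = pdM k T x + pdM k R x"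
    by (simp add: pdM_def vec_eq_iff)
  thus "covM k (\<lambda>x. T x + R x) x = covM k T x + covM k R x"
    by (simp add: covM_def matrix_linear_simps)
  have "pd k (\<lambda>x. T x $ i $ j - R x $ i $ j) x = pd k (\<lambda>x. T x $ i $ j) x - pd k (\<lambda>x. R x $ i $ j) x" for i j
    by (rule pd_diff) (use d in \<open>auto simp: diffM_def\<close>)
  hence "pdM k (\<lambda>x. T x - R x) x = pdM k T x - pdM k R x"
    by (simp add: pdM_def vec_eq_iff)
  thus "covM k (\<lambda>x. T x - R x) x = covM k T x - covM k R x"
    by (simp add: covM_def matrix_diff_distrib)
qed

lemma covM_scaleR:
  assumes "f differentiable (at x)" "diffM T x"
  shows "covM k (\<lambda>x. f x *\<^sub>R T x) x = pd k f x *\<^sub>R T x + f x *\<^sub>R covM k T x"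
proof -
  have "pd k (\<lambda>x. f x * T x $ i $ j) x = pd k f x * T x $ i $ j + f x * pd k (\<lambda>x. T x $ i $ j) x" for i j
    by (rule pd_mult) (use assms in \<open>auto simp: diffM_def\<close>)
  hence "pdM k (\<lambda>x. f x *\<^sub>R T x) x = pd k f x *\<^sub>R T x + f x *\<^sub>R pdM k T x"
    by (simp add: pdM_def vec_eq_iff)
  moreover have "P ** (c *\<^sub>R Q) = c *\<^sub>R (P ** Q)" "(c *\<^sub>R Q) ** P = c *\<^sub>R (Q ** P)" for c and P Q :: "real^'n^'n"
    by (simp_all add: vec_eq_iff matrix_matrix_mult_def sum_distrib_left mult_ac)
  ultimately show ?thesis by (simp add: covM_def algebra_simps)
qed

lemma covM_outer:
  assumes "diffV u x" "diffV v x"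
  shows "covM k (\<lambda>x. outer (u x) (v x)) x = outer (covV k u x) (v x) + outer (u x) (covV k v x)"
proof -
  have "pd k (\<lambda>x. u x $ i * v x $ j) x = pd k (\<lambda>x. u x $ i) x * v x $ j + u x $ i * pd k (\<lambda>x. v x $ j) x" for i j
    by (rule pd_mult) (use assms in \<open>auto simp: diffV_def\<close>)
  hence "pdM k (\<lambda>x. outer (u x) (v x)) x = outer (pdV k u x) (v x) + outer (u x) (pdV k v x)"
    by (simp add: pdM_def pdV_def vec_eq_iff outer_def)
  moreover have "P ** outer u v = outer (P *v u) v" for u v :: "real^'n" and P :: "real^'n^'n"
    by (simp add: vec_eq_iff matrix_matrix_mult_def matrix_vector_mult_def outer_def sum_distrib_right mult.assoc)
  moreover have "outer u v ** P = outer u (transpose P *v v)" for u v :: "real^'n" and P :: "real^'n^'n"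
    by (simp add: vec_eq_iff matrix_matrix_mult_def matrix_vector_mult_def outer_def transpose_def sum_distrib_left mult_ac)
  moreover have "outer (u - u') v = outer u v - outer u' v" "outer v (u - u') = outer v u - outer v u'" for u u' v :: "real^'n"
    by (simp_all add: vec_eq_iff outer_def algebra_simps)
  ultimately show ?thesis by (simp add: covM_def covV_def)
qed

lemma covM_transpose:
  "covM k (\<lambda>x. transpose (T x)) x = transpose (covM k T x)"
proof -
  have "pdM k (\<lambda>x. transpose (T x)) x = transpose (pdM k T x)"
    by (simp add: pdM_def transpose_def vec_eq_iff)
  thus ?thesis by (simp add: covM_def transpose_diff matrix_transpose_mul)
qed

lemma covM_minus: "diffM T x \<Longrightarrow> covM k (\<lambda>x. - T x) x = - covM k T x"
  using covM_scaleR[of "\<lambda>_. -1" x T k] by simp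

lemma cov_column: "x \<in> U \<Longrightarrow> column k (cov a w x) = covV k w x"
  by (simp add: vec_eq_iff column_nth cov_covV)

end

lemma diffM_scaleR: "f differentiable (at x) \<Longrightarrow> diffM T x \<Longrightarrow> diffM (\<lambda>x. f x *\<^sub>R T x) x"
  and diffM_diff: "diffM T x \<Longrightarrow> diffM R x \<Longrightarrow> diffM (\<lambda>x. T x - R x) x"
  and diffM_outer: "diffV u x \<Longrightarrow> diffV v x \<Longrightarrow> diffM (\<lambda>x. outer (u x) (v x)) x"
  by (simp_all add: diffM_def diffV_def outer_def)

section \<open>The tensors of a Randers metric in one chart\<close>

locale randers_chart = riemann_chart U a for U :: "(real^'n::finite) set" and a +
  fixes b :: "real^'n \<Rightarrow> real^'n"
  assumes b_Ck: "\<And>k i. Ck_on k U (\<lambda>x. b x $ i)"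
    and b_norm: "\<And>x. x \<in> U \<Longrightarrow> norm_beta a b x < 1"
begin

lemma cov_b_Ck: "Ck_on k U (\<lambda>x. cov a b x $ i $ j)"
proof -
  have "Ck_on k U (\<lambda>x. pd j (\<lambda>x. b x $ i) x - (\<Sum>m\<in>UNIV. christoffel a m i j x * b x $ m))"
    by (intro Ck_intros open_U christoffel_Ck b_Ck Ck_on_pd)
  thus ?thesis by (simp add: cov_def)
qed

lemma r_lo_Ck: "Ck_on k U (\<lambda>x. r_lo a b x $ i $ j)"
  by (simp only: r_lo_def vec_lambda_beta, intro Ck_intros open_U cov_b_Ck)

lemma s_lo_Ck: "Ck_on k U (\<lambda>x. s_lo a b x $ i $ j)"
  by (simp only: s_lo_def vec_lambda_beta, intro Ck_intros open_U cov_b_Ck)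

lemma raise_Ck: "Ck_on k U (\<lambda>x. raise a b x $ i)"
  by (simp only: raise_def vec_lambda_beta, intro Ck_intros open_U ainv_Ck b_Ck)

lemma s_vec_Ck: "Ck_on k U (\<lambda>x. s_vec a b x $ i)"
  by (simp only: s_vec_def vec_lambda_beta, intro Ck_intros open_U raise_Ck s_lo_Ck)

lemma s_up_Ck: "Ck_on k U (\<lambda>x. s_up a b x $ i $ j)"
  by (simp only: s_up_def vec_lambda_beta, intro Ck_intros open_U ainv_Ck s_lo_Ck)

lemma e_lo_Ck: "Ck_on k U (\<lambda>x. e_lo a b x $ i $ j)"
  by (simp only: e_lo_def vec_lambda_beta, intro Ck_intros open_U r_lo_Ck b_Ck s_vec_Ck)

lemma diffs:
  assumes "x \<in> U"
  shows "diffV b x" "diffV (s_vec a b) x" "diffM (r_lo a b) x" "diffM (s_lo a b) x" "diffM (cov a b) x"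
    "diffM (e_lo a b) x" "diffM (s_up a b) x"
  using assms b_Ck[of 1] s_vec_Ck[of 1] r_lo_Ck[of 1] s_lo_Ck[of 1] cov_b_Ck[of 1] e_lo_Ck[of 1] s_up_Ck[of 1]
  by (auto simp: diffM_def diffV_def)

lemma cov_b: "cov a b x = r_lo a b x + s_lo a b x"
  by (simp add: vec_eq_iff r_lo_def s_lo_def field_simps)

lemma r_lo_sym: "transpose (r_lo a b x) = r_lo a b x"
  by (simp add: transpose_sym_iff r_lo_def add.commute)

lemma s_lo_skew: "transpose (s_lo a b x) = - s_lo a b x"
  by (simp add: vec_eq_iff transpose_def s_lo_def field_simps)

lemma s_vec_eq: "s_vec a b x = - (s_lo a b x *v raise a b x)"
proof -
  have "s_vec a b x = transpose (s_lo a b x) *v raise a b x"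
    by (simp add: vec_eq_iff s_vec_def transpose_def matrix_vector_mult_def mult.commute)
  thus ?thesis by (simp add: s_lo_skew matrix_mult_minus)
qed

lemma s_up_eq: "s_up a b x = ainv a x ** s_lo a b x"
  by (simp add: vec_eq_iff s_up_def matrix_matrix_mult_def)

lemma t_lo_eq: "t_lo a b x = s_lo a b x ** (ainv a x ** s_lo a b x)"
  unfolding s_up_eq[symmetric] by (simp add: vec_eq_iff t_lo_def matrix_matrix_mult_def)

lemma t_trace_eq: "t_trace a b x = trace (ainv a x ** (s_lo a b x ** (ainv a x ** s_lo a b x)))"
  unfolding t_lo_eq[symmetric] by (simp add: t_trace_def t_up_def trace_def matrix_matrix_mult_def)

lemma e_lo_eq: "e_lo a b x = r_lo a b x + outer (b x) (s_vec a b x) + outer (s_vec a b x) (b x)"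
  by (simp add: vec_eq_iff e_lo_def outer_def)

lemma e_lo_sym: "transpose (e_lo a b x) = e_lo a b x"
  by (simp add: e_lo_eq transpose_add r_lo_sym transpose_outer)

definition bsq :: "real^'n \<Rightarrow> real" where "bsq x = b x \<bullet> raise a b x"

lemma bsq_bounds: assumes "x \<in> U" shows "0 \<le> bsq x" "bsq x < 1"
proof -
  have e: "bsq x = quad (ainv a x) (b x)" by (simp add: bsq_def raise_eq quad_inner)
  show "0 \<le> bsq x"
    by (cases "b x = 0") (use ainv_pos[OF assms, of "b x"] in \<open>auto simp: e quad_inner\<close>)
  have "sqrt (bsq x) < 1" using b_norm[OF assms] by (simp add: norm_beta_def e)
  thus "bsq x < 1" by simp
qed

text \<open>The divergence \<open>s^i_{j;i}\<close>.\<close>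

definition divS :: "real^'n \<Rightarrow> real^'n" where
  "divS x = (\<chi> j. \<Sum>i\<in>UNIV. \<Sum>k\<in>UNIV. ainv a x $ i $ k * covM k (s_lo a b) x $ i $ j)"

lemma e_lo_conformal:
  assumes "\<And>y. e00 a b x y = 2 * \<sigma> * ((alpha a x y)\<^sup>2 - (beta b x y)\<^sup>2)" "x \<in> U"
  shows "e_lo a b x = (2 * \<sigma>) *\<^sub>R (a x - outer (b x) (b x))"
proof (rule quad_eq_imp_eq)
  fix y
  have "0 \<le> quad (a x) y" by (cases "y = 0") (use a_pos[OF assms(2)] in \<open>auto simp: quad_inner less_imp_le\<close>)
  thus "quad (e_lo a b x) y = quad ((2 * \<sigma>) *\<^sub>R (a x - outer (b x) (b x))) y"
    using assms(1)[of y]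
    by (simp add: e00_def quad_scaleR quad_diff quad_outer alpha_def beta_def lin_inner power2_eq_square)
qed (simp_all add: e_lo_sym transpose_scaleR transpose_diff a_sym assms transpose_outer)

text \<open>The equation for e is assumed on all of U because it is differentiated, the one for the
  Ricci tensor only at x. The covector X is left arbitrary; it will be the defect of the equation
  for \<sigma>, before that defect is known to vanish.\<close>

lemma divS_formula:
  fixes \<sigma> :: "real^'n \<Rightarrow> real" and n K :: real and X :: "real^'n"
  assumes n: "n = real CARD('n)" and x: "x \<in> U" and \<sigma>: "\<sigma> differentiable (at x)"
    and e: "\<And>z. z \<in> U \<Longrightarrow> e_lo a b z = (2 * \<sigma> z) *\<^sub>R (a z - outer (b z) (b z))"
    and Ric: "\<And>y. quad (ric_tensor a x) y = K * (quad (a x) y + (b x \<bullet> y)\<^sup>2) + t_trace a b x * quad (a x) y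
       + 2 * quad (t_lo a b x) y - (n-1) * (\<sigma> x)\<^sup>2 * (3 * quad (a x) y - (b x \<bullet> y)\<^sup>2)
       + 2 * (n-1) * (pdsig \<bullet> y) * (b x \<bullet> y) - (n-1) * ((s_vec a b x \<bullet> y)\<^sup>2 + quad (cov a (s_vec a b) x) y)
       - (X \<bullet> y) * (b x \<bullet> y)"
    and pdsig: "pdsig = (\<chi> k. pd k \<sigma> x)"
  shows "divS x = (n-1) *\<^sub>R (2 *\<^sub>R pdsig + (\<sigma> x)\<^sup>2 *\<^sub>R b x + (2 * \<sigma> x) *\<^sub>R s_vec a b x
       - s_lo a b x *v (ainv a x *v s_vec a b x)) + K *\<^sub>R b x
     - (1/2) *\<^sub>R (bsq x *\<^sub>R X + (X \<bullet> raise a b x) *\<^sub>R b x) + (bsq x / (1 + bsq x) * (X \<bullet> raise a b x)) *\<^sub>R b x"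
proof (rule divergence_formula[where g="a x" and gi="ainv a x" and T="cov a b x" and R="r_lo a b x" and S="s_lo a b x"
      and Ric="ric_tensor a x" and Rd="\<lambda>k. covM k (r_lo a b) x" and Sdd="\<lambda>k. covM k (s_lo a b) x" and Sd="cov a (s_vec a b) x"
      and t="t_trace a b x" and ?S0.0="s_vec a b x \<bullet> (ainv a x *v s_vec a b x)"])
  have rlo: "r_lo a b z = (2 * \<sigma> z) *\<^sub>R (a z - outer (b z) (b z)) - outer (b z) (s_vec a b z) - outer (s_vec a b z) (b z)" if "z \<in> U" for z
    using e[OF that] by (simp add: e_lo_eq algebra_simps)
  show "r_lo a b x *v v = (2 * \<sigma> x) *\<^sub>R (a x *v v - (b x \<bullet> v) *\<^sub>R b x) - (s_vec a b x \<bullet> v) *\<^sub>R b x - (b x \<bullet> v) *\<^sub>R s_vec a b x" for v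
    by (subst rlo[OF x]) (simp add: matrix_linear_simps outer_mult scaleR_matrix_vector_assoc[symmetric])
  have d2: "(\<lambda>x. 2 * \<sigma> x) differentiable (at x)" using \<sigma> by simp
  have dO: "diffM (\<lambda>x. a x - outer (b x) (b x)) x" by (intro diffM_diff diffM_outer diff_a diffs x)
  have p2: "pd k (\<lambda>x. 2 * \<sigma> x) x = 2 * pd k \<sigma> x" for k
    using pd_mult[OF _ \<sigma>, of "\<lambda>_. 2"] by simp
  have Rd: "covM k (r_lo a b) x = (2 * pdsig $ k) *\<^sub>R (a x - outer (b x) (b x))
      + (2 * \<sigma> x) *\<^sub>R (- (outer (covV k b x) (b x) + outer (b x) (covV k b x)))
      - (outer (covV k b x) (s_vec a b x) + outer (b x) (covV k (s_vec a b) x))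
      - (outer (covV k (s_vec a b) x) (b x) + outer (s_vec a b x) (covV k b x))" for k
  proof -
    have "covM k (r_lo a b) x = covM k (\<lambda>z. (2 * \<sigma> z) *\<^sub>R (a z - outer (b z) (b z)) - outer (b z) (s_vec a b z) - outer (s_vec a b z) (b z)) x"
      by (rule covM_cong[OF x rlo])
    also have "\<dots> = covM k (\<lambda>z. (2 * \<sigma> z) *\<^sub>R (a z - outer (b z) (b z))) x - covM k (\<lambda>z. outer (b z) (s_vec a b z)) x - covM k (\<lambda>z. outer (s_vec a b z) (b z)) x"
      by (simp only: covM_diff diffM_diff diffM_scaleR d2 dO diffM_outer diffs[OF x])
    also have "covM k (\<lambda>z. (2 * \<sigma> z) *\<^sub>R (a z - outer (b z) (b z))) x
        = (2 * pd k \<sigma> x) *\<^sub>R (a x - outer (b x) (b x)) + (2 * \<sigma> x) *\<^sub>R covM k (\<lambda>z. a z - outer (b z) (b z)) x"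
      by (simp add: covM_scaleR[OF d2 dO] p2)
    also have "covM k (\<lambda>z. a z - outer (b z) (b z)) x = - (outer (covV k b x) (b x) + outer (b x) (covV k b x))"
      by (simp add: covM_diff diff_a diffM_outer diffs x covM_a covM_outer)
    finally show ?thesis by (simp add: covM_outer diffs x pdsig)
  qed
  show "covM k (r_lo a b) x *v v = (2 * pdsig $ k) *\<^sub>R (a x *v v - (b x \<bullet> v) *\<^sub>R b x)
        - (2 * \<sigma> x) *\<^sub>R ((b x \<bullet> v) *\<^sub>R column k (cov a b x) + (column k (cov a b x) \<bullet> v) *\<^sub>R b x)
        - (s_vec a b x \<bullet> v) *\<^sub>R column k (cov a b x) - (column k (cov a (s_vec a b) x) \<bullet> v) *\<^sub>R b x
        - (b x \<bullet> v) *\<^sub>R column k (cov a (s_vec a b) x) - (column k (cov a b x) \<bullet> v) *\<^sub>R s_vec a b x" for k v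
    unfolding Rd cov_column[OF x]
    by (simp add: matrix_linear_simps matrix_mult_minus outer_mult scaleR_matrix_vector_assoc[symmetric] algebra_simps)
  show "transpose (covM k (r_lo a b) x) = covM k (r_lo a b) x" for k
    by (simp add: covM_transpose[symmetric] r_lo_sym)
  show "transpose (covM k (s_lo a b) x) = - covM k (s_lo a b) x" for k
    by (simp add: covM_transpose[symmetric] s_lo_skew covM_minus diffs x)
  show "column k (cov a (s_vec a b) x) = - (covM k (s_lo a b) x *v raise a b x) - s_lo a b x *v (ainv a x *v column k (cov a b x))" for k
  proof -
    have s: "s_vec a b = (\<lambda>x. (- s_lo a b x) *v raise a b x)" by (simp add: fun_eq_iff s_vec_eq matrix_mult_minus)
    have "diffM (\<lambda>x. - s_lo a b x) x" using diffs(4)[OF x] by (simp add: diffM_def)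
    hence "covV k (s_vec a b) x = covM k (\<lambda>x. - s_lo a b x) x *v raise a b x + (- s_lo a b x) *v (ainv a x *v covV k b x)"
      by (subst s) (rule covV_matrix_raise[OF x _ diffs(1)[OF x]])
    thus ?thesis unfolding cov_column[OF x] covM_minus[OF diffs(4)[OF x]] matrix_mult_minus by simp
  qed
  have sum: "covM k (cov a b) x = covM k (r_lo a b) x + covM k (s_lo a b) x" for k
    by (simp add: covM_add[symmetric] diffs x cov_b[symmetric])
  show "(\<Sum>i\<in>UNIV. raise a b x $ i * ((covM k (r_lo a b) x + covM k (s_lo a b) x) $ i $ j
       - (covM j (r_lo a b) x + covM j (s_lo a b) x) $ i $ k)) = 0" for j k
    unfolding sum[symmetric] by (rule inner_ricci_identity[OF b_Ck x])
  show "(\<Sum>i\<in>UNIV. \<Sum>k\<in>UNIV. ainv a x $ i $ k * ((covM k (r_lo a b) x + covM k (s_lo a b) x) $ i $ j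
       - (covM j (r_lo a b) x + covM j (s_lo a b) x) $ i $ k)) = (ric_tensor a x *v raise a b x) $ j" for j
  proof -
    have "(\<Sum>i\<in>UNIV. raise a b x $ i * ric_tensor a x $ i $ j) = (transpose (ric_tensor a x) *v raise a b x) $ j"
      by (simp add: transpose_def matrix_vector_mult_def mult.commute)
    thus ?thesis unfolding sum[symmetric] ric_identity[OF b_Ck x] by (simp add: ric_tensor_sym x)
  qed
  let ?S = "cov a (s_vec a b) x"
  have "ric_tensor a x = K *\<^sub>R (a x + outer (b x) (b x)) + t_trace a b x *\<^sub>R a x + 2 *\<^sub>R t_lo a b x
       - ((n-1) * (\<sigma> x)\<^sup>2) *\<^sub>R (3 *\<^sub>R a x - outer (b x) (b x)) + (n-1) *\<^sub>R (outer pdsig (b x) + outer (b x) pdsig)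
       - (n-1) *\<^sub>R (outer (s_vec a b x) (s_vec a b x) + (1/2) *\<^sub>R (?S + transpose ?S))
       - (1/2) *\<^sub>R (outer (b x) X + outer X (b x))"
  proof (rule quad_eq_imp_eq)
    show "transpose (ric_tensor a x) = ric_tensor a x" by (rule ric_tensor_sym[OF x])
  next
    have "transpose (t_lo a b x) = t_lo a b x"
      by (simp add: t_lo_eq matrix_transpose_mul s_lo_skew ainv_sym x matrix_mult_minus matrix_mul_assoc)
    moreover have "transpose ?S + ?S = ?S + transpose ?S" by (rule add.commute)
    moreover have "outer X (b x) + outer (b x) X = outer (b x) X + outer X (b x)" "outer (b x) pdsig + outer pdsig (b x) = outer pdsig (b x) + outer (b x) pdsig"
      by (simp_all add: add.commute)
    ultimately show "transpose (K *\<^sub>R (a x + outer (b x) (b x)) + t_trace a b x *\<^sub>R a x + 2 *\<^sub>R t_lo a b x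
       - ((n-1) * (\<sigma> x)\<^sup>2) *\<^sub>R (3 *\<^sub>R a x - outer (b x) (b x)) + (n-1) *\<^sub>R (outer pdsig (b x) + outer (b x) pdsig)
       - (n-1) *\<^sub>R (outer (s_vec a b x) (s_vec a b x) + (1/2) *\<^sub>R (?S + transpose ?S))
       - (1/2) *\<^sub>R (outer (b x) X + outer X (b x))) = K *\<^sub>R (a x + outer (b x) (b x)) + t_trace a b x *\<^sub>R a x + 2 *\<^sub>R t_lo a b x
       - ((n-1) * (\<sigma> x)\<^sup>2) *\<^sub>R (3 *\<^sub>R a x - outer (b x) (b x)) + (n-1) *\<^sub>R (outer pdsig (b x) + outer (b x) pdsig)
       - (n-1) *\<^sub>R (outer (s_vec a b x) (s_vec a b x) + (1/2) *\<^sub>R (?S + transpose ?S))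
       - (1/2) *\<^sub>R (outer (b x) X + outer X (b x))"
      by (simp only: transpose_add transpose_diff transpose_scaleR transpose_outer a_sym[OF x] transpose_transpose)
  next
    fix y show "quad (ric_tensor a x) y = quad (K *\<^sub>R (a x + outer (b x) (b x)) + t_trace a b x *\<^sub>R a x + 2 *\<^sub>R t_lo a b x
       - ((n-1) * (\<sigma> x)\<^sup>2) *\<^sub>R (3 *\<^sub>R a x - outer (b x) (b x)) + (n-1) *\<^sub>R (outer pdsig (b x) + outer (b x) pdsig)
       - (n-1) *\<^sub>R (outer (s_vec a b x) (s_vec a b x) + (1/2) *\<^sub>R (?S + transpose ?S))
       - (1/2) *\<^sub>R (outer (b x) X + outer X (b x))) y"
      unfolding Ric by (simp only: quad_add quad_diff quad_scaleR quad_outer quad_transpose) (simp add: power2_eq_square algebra_simps)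
  qed
  thus "ric_tensor a x *v v = K *\<^sub>R (a x *v v + (b x \<bullet> v) *\<^sub>R b x) + t_trace a b x *\<^sub>R (a x *v v)
       + 2 *\<^sub>R (s_lo a b x *v (ainv a x *v (s_lo a b x *v v)))
       - ((n-1) * (\<sigma> x)\<^sup>2) *\<^sub>R (3 *\<^sub>R (a x *v v) - (b x \<bullet> v) *\<^sub>R b x) + (n-1) *\<^sub>R ((b x \<bullet> v) *\<^sub>R pdsig + (pdsig \<bullet> v) *\<^sub>R b x)
       - (n-1) *\<^sub>R ((s_vec a b x \<bullet> v) *\<^sub>R s_vec a b x + (1/2) *\<^sub>R (?S *v v + transpose ?S *v v))
       - (1/2) *\<^sub>R ((X \<bullet> v) *\<^sub>R b x + (b x \<bullet> v) *\<^sub>R X)" for v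
    by (simp only: matrix_linear_simps outer_mult scaleR_matrix_vector_assoc[symmetric] t_lo_eq matrix_vector_mul_assoc[symmetric])
qed (simp_all add: ainv_sym x a_ainv raise_eq bsq_def n cov_b s_lo_skew r_lo_sym s_vec_eq t_trace_eq divS_def
    bsq_bounds[OF x, unfolded bsq_def raise_eq])

end

section \<open>Total derivatives on the tangent bundle\<close>

text \<open>The total derivative at (x, y), as a function of a base direction \<xi> and a fibre
  direction \<eta>. It keeps derivatives along the spray and along complete lifts in one piece
  instead of splitting them into \<open>dx\<close> and \<open>dy\<close>.\<close>

definition TDer :: "(real^'n::finite \<Rightarrow> real^'n \<Rightarrow> real) \<Rightarrow> (real^'n \<Rightarrow> real^'n \<Rightarrow> real) \<Rightarrow> real^'n \<Rightarrow> real^'n \<Rightarrow> bool" where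
  "TDer f f' x y \<longleftrightarrow> ((\<lambda>p. f (fst p) (snd p)) has_derivative (\<lambda>h. f' (fst h) (snd h))) (at (x, y))"

lemma TDer_const: "TDer (\<lambda>x y. c) (\<lambda>\<xi> \<eta>. 0) x y"
  by (simp add: TDer_def)

lemma TDer_fibre: "TDer (\<lambda>x y. y $ i) (\<lambda>\<xi> \<eta>. \<eta> $ i) x y"
  unfolding TDer_def by (rule bounded_linear_imp_has_derivative)
    (intro bounded_linear_compose[OF bounded_linear_vec_nth] bounded_linear_snd)

lemma TDer_base:
  assumes "f differentiable (at x)"
  shows "TDer (\<lambda>x y. f x) (\<lambda>\<xi> \<eta>. \<Sum>k\<in>UNIV. \<xi> $ k * pd k f x) x y"
  unfolding TDer_def
  by (rule has_derivative_compose[where f=fst and g=f])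
    (auto intro: has_derivative_pd assms bounded_linear_imp_has_derivative bounded_linear_fst)

lemma TDer_add: "TDer f f' x y \<Longrightarrow> TDer g g' x y \<Longrightarrow> TDer (\<lambda>x y. f x y + g x y) (\<lambda>\<xi> \<eta>. f' \<xi> \<eta> + g' \<xi> \<eta>) x y"
  unfolding TDer_def by (rule has_derivative_add)

lemma TDer_diff: "TDer f f' x y \<Longrightarrow> TDer g g' x y \<Longrightarrow> TDer (\<lambda>x y. f x y - g x y) (\<lambda>\<xi> \<eta>. f' \<xi> \<eta> - g' \<xi> \<eta>) x y"
  unfolding TDer_def by (rule has_derivative_diff)

lemma TDer_mult: "TDer f f' x y \<Longrightarrow> TDer g g' x y \<Longrightarrow>
    TDer (\<lambda>x y. f x y * g x y) (\<lambda>\<xi> \<eta>. f x y * g' \<xi> \<eta> + f' \<xi> \<eta> * g x y) x y"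
  unfolding TDer_def using has_derivative_mult by fastforce

lemma TDer_sum: "(\<And>j. j \<in> J \<Longrightarrow> TDer (f j) (f' j) x y) \<Longrightarrow>
    TDer (\<lambda>x y. \<Sum>j\<in>J. f j x y) (\<lambda>\<xi> \<eta>. \<Sum>j\<in>J. f' j \<xi> \<eta>) x y"
  unfolding TDer_def by (rule has_derivative_sum)

lemma TDer_divide: "TDer f f' x y \<Longrightarrow> TDer g g' x y \<Longrightarrow> g x y \<noteq> 0 \<Longrightarrow>
    TDer (\<lambda>x y. f x y / g x y) (\<lambda>\<xi> \<eta>. (f' \<xi> \<eta> * g x y - f x y * g' \<xi> \<eta>) / (g x y * g x y)) x y"
  unfolding TDer_def
  using has_derivative_divide'[of "\<lambda>p. f (fst p) (snd p)" "\<lambda>h. f' (fst h) (snd h)" "(x, y)" UNIV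
    "\<lambda>p. g (fst p) (snd p)" "\<lambda>h. g' (fst h) (snd h)"] by simp

lemma TDer_sqrt:
  assumes "TDer f f' x y" "f x y > 0"
  shows "TDer (\<lambda>x y. sqrt (f x y)) (\<lambda>\<xi> \<eta>. f' \<xi> \<eta> / (2 * sqrt (f x y))) x y"
  using assms unfolding TDer_def
  by (auto intro!: derivative_eq_intros simp: field_simps)

lemma TDer_cong_derivative: "TDer f f' x y \<Longrightarrow> (\<And>\<xi> \<eta>. f' \<xi> \<eta> = g' \<xi> \<eta>) \<Longrightarrow> TDer f g' x y"
  by (simp add: TDer_def)

lemma TDer_transform:
  fixes x y :: "real^'n::finite"
  assumes "TDer f f' x y" "open S" "x \<in> S" "y \<noteq> 0" "\<And>x y. x \<in> S \<Longrightarrow> y \<noteq> 0 \<Longrightarrow> f x y = g x y"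
  shows "TDer g f' x y"
  unfolding TDer_def
proof (rule has_derivative_transform_within_open[OF assms(1)[unfolded TDer_def], of "S \<times> (- {0})"])
  show "open (S \<times> (- {0 :: real^'n}))" by (intro open_Times assms open_Compl closed_singleton)
  fix p assume "p \<in> S \<times> (- {0 :: real^'n})"
  hence "fst p \<in> S" "snd p \<noteq> 0" by (simp_all add: mem_Times_iff)
  thus "f (fst p) (snd p) = g (fst p) (snd p)" by (rule assms(5))
qed (use assms in simp)

lemma TDer_dx: assumes "TDer f f' x y" shows "dx k f x y = f' (axis k 1) 0"
proof -
  have "((\<lambda>z. (z, y)) has_derivative (\<lambda>h. (h, 0))) (at x)" by (auto intro!: derivative_eq_intros)
  from has_derivative_compose[OF this assms[unfolded TDer_def]]
  have "((\<lambda>z. f z y) has_derivative (\<lambda>h. f' h 0)) (at x)" by simp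
  thus ?thesis unfolding dx_def by (rule pd_frechet)
qed

lemma TDer_dy: assumes "TDer f f' x y" shows "dy k f x y = f' 0 (axis k 1)"
proof -
  have "((\<lambda>z. (x, z)) has_derivative (\<lambda>h. (0, h))) (at y)" by (auto intro!: derivative_eq_intros)
  from has_derivative_compose[OF this assms[unfolded TDer_def]]
  have "((\<lambda>z. f x z) has_derivative (\<lambda>h. f' 0 h)) (at y)" by simp
  thus ?thesis unfolding dy_def by (rule pd_frechet)
qed

lemma TDer_linear:
  assumes "TDer f f' x y"
  shows "f' (\<xi> + \<xi>') (\<eta> + \<eta>') = f' \<xi> \<eta> + f' \<xi>' \<eta>'" and "f' (c *\<^sub>R \<xi>) (c *\<^sub>R \<eta>) = c * f' \<xi> \<eta>"
proof -
  have bl: "bounded_linear (\<lambda>h. f' (fst h) (snd h))"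
    using assms unfolding TDer_def by (rule has_derivative_bounded_linear)
  show "f' (\<xi> + \<xi>') (\<eta> + \<eta>') = f' \<xi> \<eta> + f' \<xi>' \<eta>'"
    using linear_simps(1)[OF bl, of "(\<xi>,\<eta>)" "(\<xi>',\<eta>')"] by simp
  show "f' (c *\<^sub>R \<xi>) (c *\<^sub>R \<eta>) = c * f' \<xi> \<eta>"
    using linear_simps(5)[OF bl, of c "(\<xi>,\<eta>)"] by simp
qed

lemma TDer_expand:
  assumes "TDer f f' x y"
  shows "f' \<xi> \<eta> = (\<Sum>k\<in>UNIV. \<xi> $ k * f' (axis k 1) 0) + (\<Sum>k\<in>UNIV. \<eta> $ k * f' 0 (axis k 1))"
proof -
  have 0: "f' 0 0 = 0" using TDer_linear(2)[OF assms, of 0 0 0] by simp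
  have "f' (\<Sum>k\<in>K. \<xi> $ k *\<^sub>R axis k 1) 0 = (\<Sum>k\<in>K. \<xi> $ k * f' (axis k 1) 0)" if "finite K" for K
    using that
  proof induction
    case (insert k K)
    thus ?case using TDer_linear(1)[OF assms, of "\<xi> $ k *\<^sub>R axis k 1" _ 0 0] TDer_linear(2)[OF assms, of "\<xi> $ k" "axis k 1" 0]
      by simp
  qed (simp add: 0)
  moreover have "f' 0 (\<Sum>k\<in>K. \<eta> $ k *\<^sub>R axis k 1) = (\<Sum>k\<in>K. \<eta> $ k * f' 0 (axis k 1))" if "finite K" for K
    using that
  proof induction
    case (insert k K)
    thus ?case using TDer_linear(1)[OF assms, of 0 0 "\<eta> $ k *\<^sub>R axis k 1"] TDer_linear(2)[OF assms, of "\<eta> $ k" 0 "axis k 1"]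
      by simp
  qed (simp add: 0)
  ultimately have "f' (\<Sum>k\<in>UNIV. \<xi> $ k *\<^sub>R axis k 1) 0 + f' 0 (\<Sum>k\<in>UNIV. \<eta> $ k *\<^sub>R axis k 1)
     = (\<Sum>k\<in>UNIV. \<xi> $ k * f' (axis k 1) 0) + (\<Sum>k\<in>UNIV. \<eta> $ k * f' 0 (axis k 1))" by simp
  thus ?thesis using TDer_linear(1)[OF assms, of \<xi> 0 0 \<eta>] by (simp add: vec_eq_sum_axis[symmetric])
qed

lemma TDer_unique: assumes "TDer f f' x y" "TDer f g' x y" shows "f' \<xi> \<eta> = g' \<xi> \<eta>"
  unfolding TDer_expand[OF assms(1), of \<xi> \<eta>] TDer_expand[OF assms(2), of \<xi> \<eta>]
  by (simp add: TDer_dx[OF assms(1), symmetric] TDer_dx[OF assms(2), symmetric]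
      TDer_dy[OF assms(1), symmetric] TDer_dy[OF assms(2), symmetric])

definition pdVd :: "real^'n \<Rightarrow> (real^'n::finite \<Rightarrow> real^'m) \<Rightarrow> real^'n \<Rightarrow> real^'m" where
  "pdVd \<xi> w x = (\<Sum>k\<in>UNIV. \<xi> $ k *\<^sub>R pdV k w x)"

definition pdMd :: "real^'n \<Rightarrow> (real^'n::finite \<Rightarrow> real^'m^'l) \<Rightarrow> real^'n \<Rightarrow> real^'m^'l" where
  "pdMd \<xi> T x = (\<Sum>k\<in>UNIV. \<xi> $ k *\<^sub>R pdM k T x)"

lemma TDer_lin:
  assumes "diffV w x"
  shows "TDer (\<lambda>x y. w x \<bullet> y) (\<lambda>\<xi> \<eta>. pdVd \<xi> w x \<bullet> y + w x \<bullet> \<eta>) x y"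
proof -
  have "TDer (\<lambda>x y. \<Sum>i\<in>UNIV. w x $ i * y $ i)
      (\<lambda>\<xi> \<eta>. \<Sum>i\<in>UNIV. w x $ i * \<eta> $ i + (\<Sum>k\<in>UNIV. \<xi> $ k * pd k (\<lambda>x. w x $ i) x) * y $ i) x y"
    using assms by (intro TDer_sum TDer_mult TDer_base TDer_fibre) (auto simp: diffV_def)
  thus ?thesis
    by (simp add: inner_vec_def pdVd_def pdV_def sum.distrib add.commute)
qed

lemma TDer_quad:
  assumes "diffM T x"
  shows "TDer (\<lambda>x y. y \<bullet> (T x *v y)) (\<lambda>\<xi> \<eta>. y \<bullet> (pdMd \<xi> T x *v y) + \<eta> \<bullet> (T x *v y) + y \<bullet> (T x *v \<eta>)) x y"
proof -
  have "TDer (\<lambda>x y. \<Sum>i\<in>UNIV. y $ i * (\<Sum>j\<in>UNIV. T x $ i $ j * y $ j))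
      (\<lambda>\<xi> \<eta>. \<Sum>i\<in>UNIV. y $ i * (\<Sum>j\<in>UNIV. T x $ i $ j * \<eta> $ j + (\<Sum>k\<in>UNIV. \<xi> $ k * pd k (\<lambda>x. T x $ i $ j) x) * y $ j)
         + \<eta> $ i * (\<Sum>j\<in>UNIV. T x $ i $ j * y $ j)) x y"
    using assms by (intro TDer_sum TDer_mult TDer_base TDer_fibre) (auto simp: diffM_def)
  thus ?thesis
    by (simp add: inner_vec_def matrix_vector_mult_def pdMd_def pdM_def sum.distrib distrib_left add_ac)
qed


section \<open>The spray of a Randers metric\<close>

context riemann_chart
begin

text \<open>The nonlinear connection of \<alpha>: its entries are
  \<Gamma>\<open>^i_{kj} y^j\<close>.\<close>

definition Ny :: "real^'n \<Rightarrow> real^'n \<Rightarrow> real^'n^'n" where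
  "Ny x y = (\<chi> i k. (Nk k x *v y) $ i)"

lemma column_Ny: "column k (Ny x y) = Nk k x *v y"
  by (simp add: vec_eq_iff column_nth Ny_def)

lemma Ny_mult: "Ny x y *v \<xi> = (\<Sum>k\<in>UNIV. \<xi> $ k *\<^sub>R (Nk k x *v y))"
  by (subst vec_eq_iff, rule allI, subst sum_column[symmetric]) (simp add: Ny_def)

lemma Ny_commute: assumes "x \<in> U" shows "Ny x y *v \<xi> = Ny x \<xi> *v y"
proof -
  have "(Ny x y *v \<xi>) $ i = (\<Sum>k\<in>UNIV. \<Sum>j\<in>UNIV. christoffel a i k j x * \<xi> $ k * y $ j)" for y \<xi> i
    unfolding Ny_mult by (simp add: Nk_def matrix_vector_mult_def sum_distrib_left mult_ac)
  moreover have "(\<Sum>k\<in>UNIV. \<Sum>j\<in>UNIV. christoffel a i k j x * \<xi> $ k * y $ j) = (\<Sum>j\<in>UNIV. \<Sum>k\<in>UNIV. christoffel a i j k x * y $ j * \<xi> $ k)" for i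
    by (subst sum.swap) (simp add: christoffel_sym[OF assms, of i _ "_ :: 'n"] mult_ac)
  ultimately show ?thesis by (simp add: vec_eq_iff)
qed

text \<open>The spray coefficients of \<alpha>.\<close>

definition Gam :: "real^'n \<Rightarrow> real^'n \<Rightarrow> real^'n" where
  "Gam x y = (1/2) *\<^sub>R (Ny x y *v y)"

text \<open>Splitting a tangent vector \<open>(\<xi>, \<eta>)\<close> of the tangent bundle into its horizontal part \<open>\<xi>\<close> and its
  vertical part \<open>\<eta> + N \<xi>\<close> replaces partial by covariant derivatives.\<close>

lemma TDer_lin_cov:
  assumes x: "x \<in> U" and w: "diffV w x"
  shows "TDer (\<lambda>x y. w x \<bullet> y) (\<lambda>\<xi> \<eta>. y \<bullet> (cov a w x *v \<xi>) + w x \<bullet> (\<eta> + Ny x y *v \<xi>)) x y"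
proof (rule TDer_cong_derivative[OF TDer_lin[OF w]])
  fix \<xi> \<eta>
  have "pdVd \<xi> w x = (\<Sum>k\<in>UNIV. \<xi> $ k *\<^sub>R column k (cov a w x)) + (\<Sum>k\<in>UNIV. \<xi> $ k *\<^sub>R (transpose (Nk k x) *v w x))"
    by (simp add: pdVd_def cov_column[OF x] covV_def sum.distrib[symmetric] scaleR_add_right[symmetric])
  moreover have "(\<Sum>k\<in>UNIV. \<xi> $ k *\<^sub>R column k (cov a w x)) = cov a w x *v \<xi>"
    by (simp add: vec_eq_iff sum_column[symmetric] column_nth)
  moreover have "(\<Sum>k\<in>UNIV. \<xi> $ k *\<^sub>R (transpose (Nk k x) *v w x)) \<bullet> y = w x \<bullet> (Ny x y *v \<xi>)"
    by (simp add: Ny_mult inner_sum_left inner_sum_right inner_transpose)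
  ultimately show "pdVd \<xi> w x \<bullet> y + w x \<bullet> \<eta> = y \<bullet> (cov a w x *v \<xi>) + w x \<bullet> (\<eta> + Ny x y *v \<xi>)"
    by (simp add: inner_add_left inner_add_right inner_commute)
qed

lemma quad_a_pos: "x \<in> U \<Longrightarrow> y \<noteq> 0 \<Longrightarrow> 0 < y \<bullet> (a x *v y)"
  using a_pos by (simp add: quad_inner)

lemma quad_a_nonneg: "x \<in> U \<Longrightarrow> 0 \<le> y \<bullet> (a x *v y)"
  using quad_a_pos[of x y] by (cases "y = 0") auto

lemma alpha_sq: "x \<in> U \<Longrightarrow> (alpha a x y)\<^sup>2 = y \<bullet> (a x *v y)"
  by (simp add: alpha_def quad_inner quad_a_nonneg)

lemma alpha_pos: "x \<in> U \<Longrightarrow> y \<noteq> 0 \<Longrightarrow> 0 < alpha a x y"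
  by (simp add: alpha_def quad_inner quad_a_pos)

lemma a_inner_commute: "x \<in> U \<Longrightarrow> y \<bullet> (a x *v z) = (a x *v y) \<bullet> z"
  by (rule sym_inner[OF a_sym])

lemma TDer_quad_cov:
  assumes x: "x \<in> U" and T: "diffM T x"
  shows "TDer (\<lambda>x y. y \<bullet> (T x *v y)) (\<lambda>\<xi> \<eta>. y \<bullet> ((\<Sum>k\<in>UNIV. \<xi> $ k *\<^sub>R covM k T x) *v y)
     + (\<eta> + Ny x y *v \<xi>) \<bullet> (T x *v y) + y \<bullet> (T x *v (\<eta> + Ny x y *v \<xi>))) x y"
proof (rule TDer_cong_derivative[OF TDer_quad[OF T]])
  fix \<xi> \<eta>
  have sm: "(\<Sum>k\<in>UNIV. \<xi> $ k *\<^sub>R M k) *v z = (\<Sum>k\<in>UNIV. \<xi> $ k *\<^sub>R (M k *v z))" for M :: "'n \<Rightarrow> real^'n^'n" and z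
  proof -
    have "(\<Sum>k\<in>K. \<xi> $ k *\<^sub>R M k) *v z = (\<Sum>k\<in>K. \<xi> $ k *\<^sub>R (M k *v z))" if "finite K" for K
      using that by induction (simp_all add: matrix_vector_mult_add_rdistrib scaleR_matrix_vector_assoc)
    thus ?thesis by simp
  qed
  have e: "pdM k T x = covM k T x + transpose (Nk k x) ** T x + T x ** Nk k x" for k
    by (simp add: covM_def)
  have "pdMd \<xi> T x *v y = (\<Sum>k\<in>UNIV. \<xi> $ k *\<^sub>R covM k T x) *v y
     + (\<Sum>k\<in>UNIV. \<xi> $ k *\<^sub>R (transpose (Nk k x) *v (T x *v y))) + T x *v (Ny x y *v \<xi>)"
    by (simp add: pdMd_def sm e matrix_linear_simps scaleR_add_right sum.distrib matrix_vector_mul_assoc[symmetric] Ny_mult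
        linear_sum[OF matrix_vector_mul_linear] matrix_vector_mult_scaleR)
  moreover have "y \<bullet> (\<Sum>k\<in>UNIV. \<xi> $ k *\<^sub>R (transpose (Nk k x) *v (T x *v y))) = (Ny x y *v \<xi>) \<bullet> (T x *v y)"
    by (simp add: Ny_mult inner_sum_left inner_sum_right inner_transpose[of y])
  ultimately show "y \<bullet> (pdMd \<xi> T x *v y) + \<eta> \<bullet> (T x *v y) + y \<bullet> (T x *v \<eta>) =
     y \<bullet> ((\<Sum>k\<in>UNIV. \<xi> $ k *\<^sub>R covM k T x) *v y)
     + (\<eta> + Ny x y *v \<xi>) \<bullet> (T x *v y) + y \<bullet> (T x *v (\<eta> + Ny x y *v \<xi>))"
    by (simp add: inner_add_left inner_add_right matrix_vector_right_distrib)
qed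

text \<open>Since the metric is parallel, \<alpha> is constant in horizontal directions; only the
  vertical part of the direction contributes.\<close>

lemma TDer_alpha:
  assumes x: "x \<in> U" and y: "y \<noteq> 0"
  shows "TDer (alpha a) (\<lambda>\<xi> \<eta>. (a x *v y) \<bullet> (\<eta> + Ny x y *v \<xi>) / alpha a x y) x y"
proof -
  have e: "alpha a = (\<lambda>x y. sqrt (y \<bullet> (a x *v y)))" by (simp add: alpha_def quad_inner fun_eq_iff)
  have "TDer (\<lambda>x y. sqrt (y \<bullet> (a x *v y))) (\<lambda>\<xi> \<eta>. (y \<bullet> ((\<Sum>k\<in>UNIV. \<xi> $ k *\<^sub>R covM k a x) *v y)
     + (\<eta> + Ny x y *v \<xi>) \<bullet> (a x *v y) + y \<bullet> (a x *v (\<eta> + Ny x y *v \<xi>))) / (2 * sqrt (y \<bullet> (a x *v y)))) x y"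
    by (intro TDer_sqrt TDer_quad_cov diff_a x quad_a_pos y)
  thus ?thesis unfolding e
    by (rule TDer_cong_derivative) (simp add: covM_a x a_inner_commute[OF x, of y] inner_commute[of _ "a x *v y"])
qed

end

section \<open>The fundamental tensor and the spray of F\<close>

context randers_chart
begin

definition FF :: "real^'n \<Rightarrow> real^'n \<Rightarrow> real" where
  "FF x y = alpha a x y + b x \<bullet> y"

definition PP :: "real^'n \<Rightarrow> real^'n \<Rightarrow> real" where
  "PP x y = (y \<bullet> (e_lo a b x *v y)) / (2 * FF x y) - s_vec a b x \<bullet> y"

definition GG :: "real^'n \<Rightarrow> real^'n \<Rightarrow> real^'n" where
  "GG x y = Gam x y + PP x y *\<^sub>R y + alpha a x y *\<^sub>R (s_up a b x *v y)"

text \<open>The fibre gradient of F.\<close>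

definition ll :: "real^'n \<Rightarrow> real^'n \<Rightarrow> real^'n" where
  "ll x y = (1 / alpha a x y) *\<^sub>R (a x *v y) + b x"

text \<open>The form a is nonnegative at \<open>?w\<close>, which is \<open>bsq x\<close> times the
  part of y orthogonal to the vector dual to b.\<close>

lemma cauchy_schwarz_b:
  assumes x: "x \<in> U"
  shows "(b x \<bullet> y)\<^sup>2 \<le> bsq x * (y \<bullet> (a x *v y))"
proof (cases "b x = 0")
  case False
  let ?w = "bsq x *\<^sub>R y - (b x \<bullet> y) *\<^sub>R raise a b x"
  have r: "a x *v raise a b x = b x" by (simp add: raise_eq a_ainv_vec x)
  have pos: "0 < bsq x" using ainv_pos[OF x False] by (simp add: bsq_def raise_eq quad_inner)
  have "raise a b x \<bullet> (a x *v y) = b x \<bullet> y" using a_inner_commute[OF x, of "raise a b x" y] r by simp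
  hence "?w \<bullet> (a x *v ?w) = bsq x * (bsq x * (y \<bullet> (a x *v y)) - (b x \<bullet> y)\<^sup>2)"
    by (simp add: matrix_linear_simps matrix_vector_mult_scaleR r inner_diff_left inner_diff_right
        bsq_def[symmetric] inner_commute[of y] inner_commute[of "raise a b x" "b x"] power2_eq_square algebra_simps)
  hence "0 \<le> bsq x * (bsq x * (y \<bullet> (a x *v y)) - (b x \<bullet> y)\<^sup>2)"
    using quad_a_nonneg[OF x, of ?w] by simp
  thus ?thesis using pos by (simp add: zero_le_mult_iff)
qed (simp add: bsq_bounds x quad_a_nonneg)

lemma beta_lt_alpha: assumes "x \<in> U" "y \<noteq> 0" shows "\<bar>b x \<bullet> y\<bar> < alpha a x y"
proof -
  have "(b x \<bullet> y)\<^sup>2 < 1 * (y \<bullet> (a x *v y))"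
    by (rule le_less_trans[OF cauchy_schwarz_b[OF assms(1)]]) 
      (intro mult_strict_right_mono bsq_bounds quad_a_pos assms)
  hence "(b x \<bullet> y)\<^sup>2 < (alpha a x y)\<^sup>2" by (simp add: alpha_sq assms)
  thus ?thesis using alpha_pos[OF assms] by (simp add: abs_less_iff power2_less_imp_less real_sqrt_less_iff abs_le_square_iff[symmetric] flip: not_le)
qed

lemma FF_pos: "x \<in> U \<Longrightarrow> y \<noteq> 0 \<Longrightarrow> 0 < FF x y"
  using beta_lt_alpha[of x y] by (auto simp: FF_def abs_less_iff)

lemma ll_inner: "x \<in> U \<Longrightarrow> y \<noteq> 0 \<Longrightarrow> ll x y \<bullet> y = FF x y"
  using alpha_sq[of x y] alpha_pos[of x y]
  by (simp add: ll_def inner_add_left FF_def inner_commute[of "a x *v y"] power2_eq_square field_simps)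

lemma TDer_FF:
  assumes x: "x \<in> U" and y: "y \<noteq> 0"
  shows "TDer FF (\<lambda>\<xi> \<eta>. y \<bullet> (cov a b x *v \<xi>) + ll x y \<bullet> (\<eta> + Ny x y *v \<xi>)) x y"
proof -
  have "TDer (\<lambda>x y. alpha a x y + b x \<bullet> y) (\<lambda>\<xi> \<eta>. (a x *v y) \<bullet> (\<eta> + Ny x y *v \<xi>) / alpha a x y +
      (y \<bullet> (cov a b x *v \<xi>) + b x \<bullet> (\<eta> + Ny x y *v \<xi>))) x y"
    by (intro TDer_add TDer_alpha TDer_lin_cov x y diffs)
  thus ?thesis unfolding FF_def[abs_def]
    by (rule TDer_cong_derivative) (simp add: ll_def inner_add_left)
qed

text \<open>The fundamental tensor in closed form: the square of the fibre gradient of F plus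
  F/\<alpha> times the angular metric of \<alpha>.\<close>

definition gg :: "real^'n \<Rightarrow> real^'n \<Rightarrow> real^'n^'n" where
  "gg x y = outer (ll x y) (ll x y) + (FF x y / alpha a x y) *\<^sub>R (a x - (1 / (alpha a x y)\<^sup>2) *\<^sub>R outer (a x *v y) (a x *v y))"

lemma gg_mult: "gg x y *v v = (ll x y \<bullet> v) *\<^sub>R ll x y +
    (FF x y / alpha a x y) *\<^sub>R (a x *v v - (((a x *v y) \<bullet> v) / (alpha a x y)\<^sup>2) *\<^sub>R (a x *v y))"
  by (simp add: gg_def matrix_linear_simps outer_mult scaleR_matrix_vector_assoc[symmetric])

text \<open>The quadratic form at v is the square of its pairing with \<open>ll\<close> plus a
  positive multiple of the squared length of the part of v orthogonal to y. If both vanish, v is a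
  multiple of y, and on y the covector \<open>ll\<close> takes the value F > 0.\<close>

lemma gg_invertible:
  assumes x: "x \<in> U" and y: "y \<noteq> 0"
  shows "invertible (gg x y)"
proof -
  note al = alpha_pos[OF x y] alpha_sq[OF x, of y]
  have "v = 0" if v: "gg x y *v v = 0" for v
  proof -
    define c where "c = ((a x *v y) \<bullet> v) / (alpha a x y)\<^sup>2"
    define z where "z = v - c *\<^sub>R y"
    have c: "c * (y \<bullet> (a x *v y)) = (a x *v y) \<bullet> v" using al quad_a_pos[OF x y] by (simp add: c_def)
    have za: "z \<bullet> (a x *v z) = v \<bullet> (a x *v v) - c * ((a x *v y) \<bullet> v)"
      using c by (simp add: z_def matrix_linear_simps matrix_vector_mult_scaleR inner_diff_left inner_diff_right
        a_inner_commute[OF x, of y v, symmetric] a_inner_commute[OF x, of v y] inner_commute[of "a x *v v" y] algebra_simps)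
    have "0 = v \<bullet> (gg x y *v v)" using v by simp
    also have "\<dots> = (ll x y \<bullet> v)\<^sup>2 + (FF x y / alpha a x y) * (z \<bullet> (a x *v z))"
      unfolding gg_mult za c_def[symmetric]
      by (simp add: inner_add_right inner_diff_right inner_commute[of v] power2_eq_square)
    finally have 1: "(ll x y \<bullet> v)\<^sup>2 + (FF x y / alpha a x y) * (z \<bullet> (a x *v z)) = 0" by simp
    have F: "0 < FF x y / alpha a x y" using FF_pos[OF x y] al by simp
    have "z = 0"
    proof (rule ccontr)
      assume "z \<noteq> 0"
      hence "0 < (FF x y / alpha a x y) * (z \<bullet> (a x *v z))" by (intro mult_pos_pos F quad_a_pos[OF x])
      thus False using 1 zero_le_power2[of "ll x y \<bullet> v"] by linarith
    qed
    hence vy: "v = c *\<^sub>R y" by (simp add: z_def)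
    have "ll x y \<bullet> v = 0" using 1 \<open>z = 0\<close> by simp
    hence "c * FF x y = 0" by (simp add: vy ll_inner x y)
    thus ?thesis using FF_pos[OF x y] by (simp add: vy)
  qed
  thus ?thesis using matrix_left_invertible_ker invertible_left_inverse by blast
qed

lemma dx_F2:
  assumes x: "x \<in> U" and y: "y \<noteq> 0"
  shows "dx k (\<lambda>x y. (FF x y)\<^sup>2) x y = 2 * FF x y * (covV k b x \<bullet> y + ll x y \<bullet> (Nk k x *v y))"
    and "dy k (\<lambda>x y. (FF x y)\<^sup>2) x y = 2 * FF x y * ll x y $ k"
proof -
  have T: "TDer (\<lambda>x y. (FF x y)\<^sup>2) (\<lambda>\<xi> \<eta>. FF x y * (y \<bullet> (cov a b x *v \<xi>) + ll x y \<bullet> (\<eta> + Ny x y *v \<xi>))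
     + (y \<bullet> (cov a b x *v \<xi>) + ll x y \<bullet> (\<eta> + Ny x y *v \<xi>)) * FF x y) x y"
    unfolding power2_eq_square by (intro TDer_mult TDer_FF x y)
  show "dx k (\<lambda>x y. (FF x y)\<^sup>2) x y = 2 * FF x y * (covV k b x \<bullet> y + ll x y \<bullet> (Nk k x *v y))"
    unfolding TDer_dx[OF T] by (simp add: matrix_vector_mult_basis cov_column x column_Ny inner_commute[of y] algebra_simps)
  show "dy k (\<lambda>x y. (FF x y)\<^sup>2) x y = 2 * FF x y * ll x y $ k"
    unfolding TDer_dy[OF T] by (simp add: inner_axis)
qed

lemma has_derivative_alpha:
  assumes "x \<in> U" "y \<noteq> 0"
  shows "(alpha a x has_derivative (\<lambda>\<eta>. ((a x *v y) \<bullet> \<eta>) / alpha a x y)) (at y)"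
    and "(FF x has_derivative (\<lambda>\<eta>. ll x y \<bullet> \<eta>)) (at y)"
proof -
  have i: "((\<lambda>z. (x, z)) has_derivative (\<lambda>h. (0, h))) (at y)" by (auto intro!: derivative_eq_intros)
  show "(alpha a x has_derivative (\<lambda>\<eta>. ((a x *v y) \<bullet> \<eta>) / alpha a x y)) (at y)"
    using has_derivative_compose[OF i TDer_alpha[OF assms, unfolded TDer_def]] by simp
  show "(FF x has_derivative (\<lambda>\<eta>. ll x y \<bullet> \<eta>)) (at y)"
    using has_derivative_compose[OF i TDer_FF[OF assms, unfolded TDer_def]] by simp
qed

lemma has_derivative_matrix: "((\<lambda>y. M *v y) has_derivative (\<lambda>\<eta>. M *v \<eta>)) (at y)"
  for M :: "real^'n^'n"
  by (rule bounded_linear_imp_has_derivative) (rule matrix_vector_mul_bounded_linear)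

lemma has_derivative_ll:
  assumes x: "x \<in> U" and y: "y \<noteq> 0"
  shows "((\<lambda>y. ll x y \<bullet> (M *v y)) has_derivative (\<lambda>\<eta>. ((a x *v \<eta>) \<bullet> (M *v y)) / alpha a x y
     - ((a x *v y) \<bullet> \<eta>) * ((a x *v y) \<bullet> (M *v y)) / (alpha a x y)^3 + ll x y \<bullet> (M *v \<eta>))) (at y)"
    and "((\<lambda>y. ll x y $ i) has_derivative (\<lambda>\<eta>. (a x *v \<eta>) $ i / alpha a x y
     - ((a x *v y) \<bullet> \<eta>) * (a x *v y) $ i / (alpha a x y)^3)) (at y)"
proof -
  note al = alpha_pos[OF x y]
  have h: "((\<lambda>y. ((a x *v y) \<bullet> (M *v y)) / alpha a x y + b x \<bullet> (M *v y)) has_derivative (\<lambda>\<eta>. ((a x *v \<eta>) \<bullet> (M *v y)) / alpha a x y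
     - ((a x *v y) \<bullet> \<eta>) * ((a x *v y) \<bullet> (M *v y)) / (alpha a x y)^3 + ll x y \<bullet> (M *v \<eta>))) (at y)"
    by (rule has_derivative_inner_right[OF has_derivative_matrix] derivative_eq_intros has_derivative_alpha x y has_derivative_matrix refl)+
      (use al in \<open>auto simp: ll_def inner_add_left field_simps power3_eq_cube
          intro!: has_derivative_inner_right has_derivative_matrix\<close>)
  show "((\<lambda>y. ll x y \<bullet> (M *v y)) has_derivative (\<lambda>\<eta>. ((a x *v \<eta>) \<bullet> (M *v y)) / alpha a x y
     - ((a x *v y) \<bullet> \<eta>) * ((a x *v y) \<bullet> (M *v y)) / (alpha a x y)^3 + ll x y \<bullet> (M *v \<eta>))) (at y)"
    using h by (simp add: ll_def inner_add_left)
  have "((\<lambda>y. (a x *v y) \<bullet> axis i 1 / alpha a x y + b x $ i) has_derivative (\<lambda>\<eta>. (a x *v \<eta>) \<bullet> axis i 1 / alpha a x y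
     - ((a x *v y) \<bullet> \<eta>) * ((a x *v y) \<bullet> axis i 1) / (alpha a x y)^3)) (at y)"
    by (rule derivative_eq_intros has_derivative_alpha x y has_derivative_matrix refl)+
      (use al in \<open>auto simp: field_simps power3_eq_cube\<close>)
  thus "((\<lambda>y. ll x y $ i) has_derivative (\<lambda>\<eta>. (a x *v \<eta>) $ i / alpha a x y
     - ((a x *v y) \<bullet> \<eta>) * (a x *v y) $ i / (alpha a x y)^3)) (at y)"
    by (simp add: ll_def inner_axis)
qed

lemma fund_tensor_FF:
  assumes x: "x \<in> U" and y: "y \<noteq> 0"
  shows "fund_tensor FF x y = gg x y"
proof -
  have o: "open (- {0 :: real^'n})" by (intro open_Compl closed_singleton)
  have "dy j (dy i (\<lambda>x y. (FF x y)\<^sup>2)) x y = 2 * gg x y $ i $ j" for i j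
  proof -
    have "dy j (dy i (\<lambda>x y. (FF x y)\<^sup>2)) x y = pd j (\<lambda>y. 2 * FF x y * ll x y $ i) y"
      unfolding dy_def[of j] by (rule pd_cong[OF o]) (use y dx_F2(2)[OF x] in auto)
    also have "\<dots> = 2 * FF x y * ((a x *v axis j 1) $ i / alpha a x y
       - ((a x *v y) \<bullet> axis j 1) * (a x *v y) $ i / (alpha a x y)^3) + 2 * (ll x y \<bullet> axis j 1) * ll x y $ i"
      by (rule pd_frechet) (rule derivative_eq_intros has_derivative_alpha has_derivative_ll x y refl | simp)+
    also have "\<dots> = 2 * gg x y $ i $ j"
      by (simp add: gg_def outer_def inner_axis matrix_vector_mult_basis column_nth power2_eq_square power3_eq_cube algebra_simps)
    finally show ?thesis .
  qed
  thus ?thesis by (simp add: fund_tensor_def vec_eq_iff)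
qed

text \<open>The derivatives of b occur once with y contracted into the direction of differentiation
  and once into the index of b. Only the skew part of \<open>b_{i;j}\<close> survives in the
  difference, which is how s enters the spray.\<close>

lemma spray_rhs:
  assumes x: "x \<in> U" and y: "y \<noteq> 0"
  shows "(\<Sum>k\<in>UNIV. dy l (dx k (\<lambda>x y. (FF x y)\<^sup>2)) x y * y $ k) - dx l (\<lambda>x y. (FF x y)\<^sup>2) x y
    = 2 * (y \<bullet> (cov a b x *v y) + ll x y \<bullet> (2 *\<^sub>R Gam x y)) * ll x y $ l
      + 2 * FF x y * ((a x *v (2 *\<^sub>R Gam x y)) $ l / alpha a x y
         - ((a x *v y) \<bullet> (2 *\<^sub>R Gam x y)) * (a x *v y) $ l / (alpha a x y)^3 + 2 * (s_lo a b x *v y) $ l)"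
proof -
  have o: "open (- {0 :: real^'n})" by (intro open_Compl closed_singleton)
  let ?e = "axis l 1 :: real^'n"
  define H where "H k = covV k b x \<bullet> y + ll x y \<bullet> (Nk k x *v y)" for k
  define D where "D k = covV k b x \<bullet> ?e + (((a x *v ?e) \<bullet> (Nk k x *v y)) / alpha a x y
     - ((a x *v y) \<bullet> ?e) * ((a x *v y) \<bullet> (Nk k x *v y)) / (alpha a x y)^3 + ll x y \<bullet> (Nk k x *v ?e))" for k
  have dd: "dy l (dx k (\<lambda>x y. (FF x y)\<^sup>2)) x y = 2 * FF x y * D k + 2 * ll x y $ l * H k" for k
  proof -
    have "dy l (dx k (\<lambda>x y. (FF x y)\<^sup>2)) x y = pd l (\<lambda>y. 2 * FF x y * (covV k b x \<bullet> y + ll x y \<bullet> (Nk k x *v y))) y"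
      unfolding dy_def by (rule pd_cong[OF o]) (use y dx_F2(1)[OF x] in auto)
    also have "\<dots> = 2 * FF x y * D k + 2 * (ll x y \<bullet> ?e) * H k"
      unfolding D_def H_def
      by (rule pd_frechet) (rule derivative_eq_intros has_derivative_alpha has_derivative_ll x y refl | simp)+
    finally show ?thesis by (simp add: inner_axis)
  qed
  have sN: "(\<Sum>k\<in>UNIV. y $ k *\<^sub>R (Nk k x *v z)) = Ny x z *v y" for z by (simp add: Ny_mult)
  have sT: "(\<Sum>k\<in>UNIV. y $ k *\<^sub>R covV k b x) = cov a b x *v y"
    by (simp add: vec_eq_iff sum_column[symmetric] cov_column[OF x, symmetric] column_nth)
  have G2: "2 *\<^sub>R Gam x y = Ny x y *v y" by (simp add: Gam_def)
  have NN: "Ny x ?e *v y = Nk l x *v y"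
    by (simp add: Ny_commute[OF x, of ?e] matrix_vector_mult_basis column_Ny)
  have 1: "(\<Sum>k\<in>UNIV. H k * y $ k) = y \<bullet> (cov a b x *v y) + ll x y \<bullet> (2 *\<^sub>R Gam x y)"
    unfolding G2 sT[symmetric] sN[symmetric]
    by (simp add: H_def inner_sum_right sum.distrib inner_commute[of y] algebra_simps)
  have 2: "(\<Sum>k\<in>UNIV. D k * y $ k) = (cov a b x *v y) \<bullet> ?e + (((a x *v ?e) \<bullet> (2 *\<^sub>R Gam x y)) / alpha a x y
     - ((a x *v y) \<bullet> ?e) * ((a x *v y) \<bullet> (2 *\<^sub>R Gam x y)) / (alpha a x y)^3 + ll x y \<bullet> (Nk l x *v y))"
    unfolding G2 NN[symmetric] sT[symmetric] sN[symmetric]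
    by (simp add: D_def inner_sum_right inner_sum_left sum.distrib sum_subtractf sum_distrib_left sum_divide_distrib algebra_simps)
  have "(\<Sum>k\<in>UNIV. dy l (dx k (\<lambda>x y. (FF x y)\<^sup>2)) x y * y $ k) = 2 * FF x y * (\<Sum>k\<in>UNIV. D k * y $ k) + 2 * ll x y $ l * (\<Sum>k\<in>UNIV. H k * y $ k)"
    by (simp add: dd sum.distrib sum_distrib_left algebra_simps)
  moreover have "dx l (\<lambda>x y. (FF x y)\<^sup>2) x y = 2 * FF x y * (covV l b x \<bullet> y + ll x y \<bullet> (Nk l x *v y))"
    by (rule dx_F2[OF x y])
  moreover have "(cov a b x *v y) $ l - covV l b x \<bullet> y = 2 * (s_lo a b x *v y) $ l"
  proof -
    have "covV l b x \<bullet> y = (transpose (cov a b x) *v y) $ l"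
      by (simp add: cov_column[OF x, symmetric] column_inner)
    thus ?thesis by (simp add: cov_b transpose_add r_lo_sym s_lo_skew matrix_linear_simps matrix_mult_minus)
  qed
  moreover have "(a x *v ?e) \<bullet> z = (a x *v z) $ l" for z
    using a_inner_commute[OF x, of z ?e] a_inner_commute[OF x, of ?e z]
    by (simp add: inner_commute[of z] inner_axis inner_axis')
  ultimately show ?thesis unfolding 1 2 by (simp add: inner_axis algebra_simps)
qed

lemma s0_up: "x \<in> U \<Longrightarrow> b x \<bullet> (s_up a b x *v y) = s_vec a b x \<bullet> y"
proof -
  assume x: "x \<in> U"
  have "b x \<bullet> (s_up a b x *v y) = raise a b x \<bullet> (s_lo a b x *v y)"
    by (simp add: s_up_eq matrix_vector_mul_assoc[symmetric] sym_inner[OF ainv_sym[OF x]] raise_eq)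
  thus ?thesis using skew_inner[OF s_lo_skew, of "raise a b x" x y] by (simp add: s_vec_eq inner_commute)
qed

lemma a_s_up: "x \<in> U \<Longrightarrow> a x *v (s_up a b x *v y) = s_lo a b x *v y"
  by (simp add: s_up_eq matrix_vector_mul_assoc[symmetric] a_ainv_vec)

lemma ay_s_up: "x \<in> U \<Longrightarrow> (a x *v y) \<bullet> (s_up a b x *v y) = 0"
  by (simp add: a_inner_commute[symmetric] a_s_up skew_inner_self[OF s_lo_skew])

lemma cov_b_quad: "x \<in> U \<Longrightarrow> y \<bullet> (cov a b x *v y) = y \<bullet> (e_lo a b x *v y) - 2 * (b x \<bullet> y) * (s_vec a b x \<bullet> y)"
  by (simp add: cov_b e_lo_eq matrix_linear_simps outer_mult inner_add_right skew_inner_self[OF s_lo_skew] inner_commute[of y])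

text \<open>The fundamental tensor is not inverted explicitly: \<open>gg\<close> is applied to the
  vector \<open>GG\<close>, the result is compared with \<open>spray_rhs\<close>, and invertibility
  does the rest.\<close>

lemma spray_FF:
  assumes x: "x \<in> U" and y: "y \<noteq> 0"
  shows "spray FF i x y = GG x y $ i"
proof -
  note al = alpha_pos[OF x y] and as = alpha_sq[OF x, of y] and Fp = FF_pos[OF x y]
  define W where "W = (\<chi> l. (\<Sum>k\<in>UNIV. dy l (dx k (\<lambda>x y. (FF x y)\<^sup>2)) x y * y $ k) - dx l (\<lambda>x y. (FF x y)\<^sup>2) x y)"
  have lw: "ll x y \<bullet> (s_up a b x *v y) = s_vec a b x \<bullet> y"
    by (simp add: ll_def inner_add_left s0_up ay_s_up x)
  have PF: "PP x y * FF x y = (y \<bullet> (e_lo a b x *v y)) / 2 - FF x y * (s_vec a b x \<bullet> y)"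
    using Fp by (simp add: PP_def field_simps)
  have gy: "gg x y *v y = FF x y *\<^sub>R ll x y"
  proof -
    have "(a x *v y) \<bullet> y = (alpha a x y)\<^sup>2" by (simp add: as inner_commute)
    thus ?thesis using al by (simp add: gg_mult ll_inner x y)
  qed
  have gw: "gg x y *v (s_up a b x *v y) = (s_vec a b x \<bullet> y) *\<^sub>R ll x y + (FF x y / alpha a x y) *\<^sub>R (s_lo a b x *v y)"
    by (simp add: gg_mult lw ay_s_up a_s_up x)
  have gG: "gg x y *v Gam x y = (ll x y \<bullet> Gam x y) *\<^sub>R ll x y +
      (FF x y / alpha a x y) *\<^sub>R (a x *v Gam x y - (((a x *v y) \<bullet> Gam x y) / (alpha a x y)\<^sup>2) *\<^sub>R (a x *v y))"
    by (rule gg_mult)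
  have "W = 4 *\<^sub>R (gg x y *v GG x y)"
  proof (subst vec_eq_iff, rule allI)
    fix l
    have "y \<bullet> (cov a b x *v y) = 2 * PP x y * FF x y + 2 * alpha a x y * (s_vec a b x \<bullet> y)"
      using PF by (simp add: cov_b_quad x FF_def algebra_simps)
    moreover have Wl: "W $ l = 2 * (y \<bullet> (cov a b x *v y) + ll x y \<bullet> (2 *\<^sub>R Gam x y)) * ll x y $ l
      + 2 * FF x y * ((a x *v (2 *\<^sub>R Gam x y)) $ l / alpha a x y
         - ((a x *v y) \<bullet> (2 *\<^sub>R Gam x y)) * (a x *v y) $ l / (alpha a x y)^3 + 2 * (s_lo a b x *v y) $ l)"
      using spray_rhs[OF x y] by (simp add: W_def)
    ultimately show "W $ l = (4 *\<^sub>R (gg x y *v GG x y)) $ l"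
      unfolding Wl GG_def matrix_vector_right_distrib matrix_vector_mult_scaleR gy gw gG
      using al by (simp add: matrix_vector_mult_scaleR field_simps power2_eq_square power3_eq_cube)
  qed
  hence "matrix_inv (gg x y) *v W = 4 *\<^sub>R GG x y"
    using someI_ex[OF gg_invertible[OF x y, unfolded invertible_def]]
    by (simp add: matrix_vector_mult_scaleR matrix_vector_mul_assoc matrix_inv_def)
  hence "(matrix_inv (gg x y) *v W) $ i = 4 * GG x y $ i" by simp
  thus ?thesis unfolding spray_def fund_tensor_FF[OF x y]
    by (simp add: W_def matrix_vector_mult_def)
qed

end

section \<open>The Ricci curvature of a Randers metric\<close>

text \<open>Differentiability alone, for functions whose derivative need not be known in closed
  form.\<close>

definition TD :: "(real^'n::finite \<Rightarrow> real^'n \<Rightarrow> real) \<Rightarrow> real^'n \<Rightarrow> real^'n \<Rightarrow> bool" where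
  "TD f x y \<longleftrightarrow> (\<exists>f'. TDer f f' x y)"

lemma TD_intros:
  "TDer f f' x y \<Longrightarrow> TD f x y"
  "TD (\<lambda>x y. c) x y"
  "TD (\<lambda>x y. y $ i) x y"
  "TD f x y \<Longrightarrow> TD g x y \<Longrightarrow> TD (\<lambda>x y. f x y + g x y) x y"
  "TD f x y \<Longrightarrow> TD g x y \<Longrightarrow> TD (\<lambda>x y. f x y - g x y) x y"
  "TD f x y \<Longrightarrow> TD g x y \<Longrightarrow> TD (\<lambda>x y. f x y * g x y) x y"
  "TD f x y \<Longrightarrow> TD g x y \<Longrightarrow> g x y \<noteq> 0 \<Longrightarrow> TD (\<lambda>x y. f x y / g x y) x y"
  unfolding TD_def by (blast intro: TDer_const TDer_fibre TDer_add TDer_diff TDer_mult TDer_divide)+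

lemma TD_lin: "diffV w x \<Longrightarrow> TD (\<lambda>x y. w x \<bullet> y) x y"
  and TD_quad: "diffM T x \<Longrightarrow> TD (\<lambda>x y. y \<bullet> (T x *v y)) x y"
  unfolding TD_def by (blast intro: TDer_lin TDer_quad)+

lemma TD_matrix: "diffM T x \<Longrightarrow> TD (\<lambda>x y. (T x *v y) $ i) x y"
proof -
  assume "diffM T x"
  hence "TD (\<lambda>x y. T x $ i \<bullet> y) x y" by (intro TD_lin) (simp add: diffM_def diffV_def)
  thus ?thesis by (simp add: matrix_vector_mul_component)
qed

lemma TD_nth: "diffM T x \<Longrightarrow> TD (\<lambda>x y. T x $ i $ j) x y" "diffV w x \<Longrightarrow> TD (\<lambda>x y. w x $ j) x y"
  by (auto simp: TD_def diffM_def diffV_def intro!: exI TDer_base)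

lemma trace_outer_mult: "trace (outer u v ** M) = v \<bullet> (M *v u)" "trace (M ** outer u v) = v \<bullet> (M *v u)"
  for M :: "real^'n^'n"
proof -
  show "trace (M ** outer u v) = v \<bullet> (M *v u)"
    by (simp add: trace_def matrix_matrix_mult_def outer_def inner_vec_def matrix_vector_mult_def sum_distrib_left mult_ac)
  thus "trace (outer u v ** M) = v \<bullet> (M *v u)" by (simp only: trace_mul_sym[of "outer u v"])
qed

lemma trace_outer: "trace (outer u v) = v \<bullet> u"
  by (simp add: trace_def outer_def inner_vec_def mult.commute)

lemma trace_scaleR: "trace (c *\<^sub>R M) = c * trace (M :: real^'n^'n)"
  by (simp add: trace_def sum_distrib_left)

lemma scaleR_matrix_mult: "(c *\<^sub>R M) ** R = c *\<^sub>R (M ** R)" "M ** (c *\<^sub>R R) = c *\<^sub>R (M ** (R :: real^'k^'n))"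
  by (simp_all add: vec_eq_iff matrix_matrix_mult_def sum_distrib_left mult_ac)

context riemann_chart
begin

text \<open>The Christoffel symbols with upper index i as the matrix of a quadratic form in
  y.\<close>

definition G3 :: "'n \<Rightarrow> real^'n \<Rightarrow> real^'n^'n" where
  "G3 i x = (\<chi> j k. christoffel a i j k x)"

text \<open>The contracted symbols \<Gamma>\<open>^i_{ij}\<close>, which give the trace of the
  nonlinear connection.\<close>

definition g0 :: "real^'n \<Rightarrow> real^'n" where
  "g0 x = (\<chi> j. \<Sum>i\<in>UNIV. christoffel a i i j x)"

lemma G3_mult: "(G3 i x *v y) $ k = Ny x y $ i $ k"
  by (simp add: G3_def Ny_def Nk_def matrix_vector_mult_def)

lemma Gam_quad: "Gam x y $ i = (1/2) * (y \<bullet> (G3 i x *v y))"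
proof -
  have "(Ny x y *v y) $ i = (\<Sum>k\<in>UNIV. y $ k * Ny x y $ i $ k)" by (rule sum_column[symmetric])
  thus ?thesis by (simp add: Gam_def inner_vec_def G3_mult)
qed

lemma G3_sym: "x \<in> U \<Longrightarrow> transpose (G3 i x) = G3 i x"
  by (simp add: transpose_sym_iff G3_def christoffel_sym)

lemma diff_G3: "x \<in> U \<Longrightarrow> diffM (G3 i) x"
  by (simp add: diffM_def G3_def christoffel_diff)

lemma diff_g0: "x \<in> U \<Longrightarrow> diffV g0 x"
  by (simp add: diffV_def g0_def christoffel_diff differentiable_sum)

lemma trace_Ny: "trace (Ny x y) = g0 x \<bullet> y"
proof -
  have "trace (Ny x y) = (\<Sum>i\<in>UNIV. \<Sum>j\<in>UNIV. christoffel a i i j x * y $ j)"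
    by (simp add: trace_def Ny_def Nk_def matrix_vector_mult_def)
  also have "\<dots> = g0 x \<bullet> y" by (subst sum.swap) (simp add: g0_def inner_vec_def sum_distrib_right)
  finally show ?thesis .
qed

text \<open>The four terms of the Ricci tensor, each rewritten in the shape in which it arises from
  the trace of the Finsler curvature, so that they can be matched there.\<close>

lemma ric_quad:
  assumes x: "x \<in> U"
  shows "quad (ric_tensor a x) y = (\<Sum>i\<in>UNIV. y \<bullet> (pdM i (G3 i) x *v y)) - pdVd y g0 x \<bullet> y
     + 2 * (g0 x \<bullet> Gam x y) - trace (Ny x y ** Ny x y)"
proof -
  let ?M1 = "\<chi> i j. \<Sum>k\<in>UNIV. pd k (christoffel a k i j) x"
  let ?M2 = "\<chi> i j. \<Sum>k\<in>UNIV. pd j (christoffel a k i k) x"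
  let ?M3 = "\<chi> i j. \<Sum>k\<in>UNIV. \<Sum>l\<in>UNIV. christoffel a k k l x * christoffel a l i j x"
  let ?M4 = "\<chi> i j. \<Sum>k\<in>UNIV. \<Sum>l\<in>UNIV. christoffel a k j l x * christoffel a l i k x"
  have "ric_tensor a x = ?M1 - ?M2 + (?M3 - ?M4)"
    by (simp add: vec_eq_iff ric_tensor_def sum_subtractf)
  hence "quad (ric_tensor a x) y = quad ?M1 y - quad ?M2 y + quad ?M3 y - quad ?M4 y"
    by (simp add: quad_add quad_diff)
  moreover have "quad ?M1 y = (\<Sum>i\<in>UNIV. y \<bullet> (pdM i (G3 i) x *v y))"
  proof -
    have "quad ?M1 y = (\<Sum>i\<in>UNIV. \<Sum>j\<in>UNIV. \<Sum>k\<in>UNIV. pd k (christoffel a k i j) x * y $ i * y $ j)"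
      by (simp add: quad_def sum_distrib_right)
    also have "\<dots> = (\<Sum>i\<in>UNIV. \<Sum>k\<in>UNIV. \<Sum>j\<in>UNIV. pd k (christoffel a k i j) x * y $ i * y $ j)"
      by (rule sum.cong[OF refl], rule sum.swap)
    also have "\<dots> = (\<Sum>k\<in>UNIV. \<Sum>i\<in>UNIV. \<Sum>j\<in>UNIV. pd k (christoffel a k i j) x * y $ i * y $ j)"
      by (rule sum.swap)
    also have "\<dots> = (\<Sum>k\<in>UNIV. quad (pdM k (G3 k) x) y)"
      by (simp add: quad_def pdM_def G3_def)
    finally show ?thesis by (simp add: quad_inner)
  qed
  moreover have "quad ?M2 y = pdVd y g0 x \<bullet> y"
  proof -
    have p: "pd k (\<lambda>x. \<Sum>i\<in>UNIV. christoffel a i i j x) x = (\<Sum>m\<in>UNIV. pd k (christoffel a m j m) x)" for j k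
      using pd_sum[of UNIV "\<lambda>i. christoffel a i i j" x k] christoffel_diff[OF x] christoffel_sym_pd[OF x, of k _ j]
      by simp
    have "pdVd y g0 x \<bullet> y = (\<Sum>j\<in>UNIV. \<Sum>k\<in>UNIV. y $ k * (\<Sum>m\<in>UNIV. pd k (christoffel a m j m) x) * y $ j)"
      by (simp add: pdVd_def pdV_def g0_def p inner_vec_def sum_distrib_right)
    thus ?thesis by (simp add: quad_def mult_ac)
  qed
  moreover have "quad ?M3 y = 2 * (g0 x \<bullet> Gam x y)"
  proof -
    have "quad ?M3 y = (\<Sum>i\<in>UNIV. \<Sum>j\<in>UNIV. (\<Sum>l\<in>UNIV. \<Sum>k\<in>UNIV. christoffel a k k l x * christoffel a l i j x) * y $ i * y $ j)"
      unfolding quad_def vec_lambda_beta by (subst sum.swap[of _ _ UNIV]) (rule refl)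
    also have "\<dots> = (\<Sum>i\<in>UNIV. \<Sum>j\<in>UNIV. \<Sum>l\<in>UNIV. g0 x $ l * (G3 l x $ i $ j * y $ i * y $ j))"
      by (simp add: g0_def G3_def sum_distrib_right mult.assoc)
    also have "\<dots> = (\<Sum>i\<in>UNIV. \<Sum>l\<in>UNIV. \<Sum>j\<in>UNIV. g0 x $ l * (G3 l x $ i $ j * y $ i * y $ j))"
      by (rule sum.cong[OF refl], rule sum.swap)
    also have "\<dots> = (\<Sum>l\<in>UNIV. \<Sum>i\<in>UNIV. \<Sum>j\<in>UNIV. g0 x $ l * (G3 l x $ i $ j * y $ i * y $ j))"
      by (rule sum.swap)
    also have "\<dots> = (\<Sum>l\<in>UNIV. g0 x $ l * quad (G3 l x) y)"
      by (simp add: quad_def sum_distrib_left)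
    finally show ?thesis by (simp add: inner_vec_def[of "g0 x"] Gam_quad quad_inner sum_distrib_left)
  qed
  moreover have "quad ?M4 y = trace (Ny x y ** Ny x y)"
  proof -
    have ny: "Ny x y $ k $ l = (\<Sum>j\<in>UNIV. christoffel a k j l x * y $ j)" "Ny x y $ k $ l = (\<Sum>j\<in>UNIV. christoffel a k l j x * y $ j)" for k l
      by (simp_all add: Ny_def Nk_def matrix_vector_mult_def christoffel_sym[OF x, of k l])
    have "trace (Ny x y ** Ny x y) = (\<Sum>k\<in>UNIV. \<Sum>l\<in>UNIV. (\<Sum>j\<in>UNIV. christoffel a k j l x * y $ j) * (\<Sum>i\<in>UNIV. christoffel a l i k x * y $ i))"
      by (simp only: trace_def matrix_matrix_mult_def vec_lambda_beta ny(1))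
    also have "\<dots> = (\<Sum>k\<in>UNIV. \<Sum>l\<in>UNIV. \<Sum>j\<in>UNIV. \<Sum>i\<in>UNIV. christoffel a k j l x * christoffel a l i k x * y $ i * y $ j)"
      by (simp add: sum_product mult_ac)
    also have "\<dots> = (\<Sum>k\<in>UNIV. \<Sum>l\<in>UNIV. \<Sum>i\<in>UNIV. \<Sum>j\<in>UNIV. christoffel a k j l x * christoffel a l i k x * y $ i * y $ j)"
      by (rule sum.cong[OF refl], rule sum.cong[OF refl], rule sum.swap)
    also have "\<dots> = (\<Sum>k\<in>UNIV. \<Sum>i\<in>UNIV. \<Sum>l\<in>UNIV. \<Sum>j\<in>UNIV. christoffel a k j l x * christoffel a l i k x * y $ i * y $ j)"
      by (rule sum.cong[OF refl], rule sum.swap)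
    also have "\<dots> = (\<Sum>i\<in>UNIV. \<Sum>k\<in>UNIV. \<Sum>l\<in>UNIV. \<Sum>j\<in>UNIV. christoffel a k j l x * christoffel a l i k x * y $ i * y $ j)"
      by (rule sum.swap)
    also have "\<dots> = (\<Sum>i\<in>UNIV. \<Sum>k\<in>UNIV. \<Sum>j\<in>UNIV. \<Sum>l\<in>UNIV. christoffel a k j l x * christoffel a l i k x * y $ i * y $ j)"
      by (rule sum.cong[OF refl], rule sum.cong[OF refl], rule sum.swap)
    also have "\<dots> = (\<Sum>i\<in>UNIV. \<Sum>j\<in>UNIV. \<Sum>k\<in>UNIV. \<Sum>l\<in>UNIV. christoffel a k j l x * christoffel a l i k x * y $ i * y $ j)"
      by (rule sum.cong[OF refl], rule sum.swap)
    finally show ?thesis by (simp add: quad_def sum_distrib_right)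
  qed
  ultimately show ?thesis by simp
qed

end

section \<open>The Jacobian of the spray and the trace of the curvature\<close>

context randers_chart
begin

text \<open>The total derivative of \<open>PP\<close>, split into horizontal and vertical parts by
  the connection of \<alpha>.\<close>

definition PPd :: "real^'n \<Rightarrow> real^'n \<Rightarrow> real^'n \<Rightarrow> real^'n \<Rightarrow> real" where
  "PPd x y \<xi> \<eta> = ((y \<bullet> ((\<Sum>k\<in>UNIV. \<xi> $ k *\<^sub>R covM k (e_lo a b) x) *v y) + (\<eta> + Ny x y *v \<xi>) \<bullet> (e_lo a b x *v y)
       + y \<bullet> (e_lo a b x *v (\<eta> + Ny x y *v \<xi>))) * (2 * FF x y)
     - (y \<bullet> (e_lo a b x *v y)) * (2 * (y \<bullet> (cov a b x *v \<xi>) + ll x y \<bullet> (\<eta> + Ny x y *v \<xi>)))) / ((2 * FF x y) * (2 * FF x y))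
     - (y \<bullet> (cov a (s_vec a b) x *v \<xi>) + s_vec a b x \<bullet> (\<eta> + Ny x y *v \<xi>))"

lemma TDer_PP:
  assumes x: "x \<in> U" and y: "y \<noteq> 0"
  shows "TDer PP (PPd x y) x y"
proof -
  have "TDer (\<lambda>x y. 2 * FF x y) (\<lambda>\<xi> \<eta>. 2 * (y \<bullet> (cov a b x *v \<xi>) + ll x y \<bullet> (\<eta> + Ny x y *v \<xi>))) x y"
    by (rule TDer_cong_derivative[OF TDer_mult[OF TDer_const TDer_FF[OF x y], of 2]]) simp
  thus ?thesis
    unfolding PP_def[abs_def] PPd_def[abs_def] using FF_pos[OF x y]
    by (intro TDer_diff TDer_divide TDer_quad_cov TDer_lin_cov diffs x) auto
qed

definition pp :: "real^'n \<Rightarrow> real^'n \<Rightarrow> real^'n" where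
  "pp x y = (\<chi> k. PPd x y 0 (axis k 1))"

lemma PPd_vertical: assumes "x \<in> U" "y \<noteq> 0" shows "PPd x y 0 \<eta> = pp x y \<bullet> \<eta>"
  using TDer_expand[OF TDer_PP[OF assms], of 0 \<eta>] by (simp add: pp_def inner_vec_def mult.commute)

text \<open>Euler's relation: \<open>PP\<close> is positively homogeneous of degree one in
  y.\<close>

lemma pp_euler: assumes "x \<in> U" "y \<noteq> 0" shows "pp x y \<bullet> y = PP x y"
proof -
  have "PPd x y 0 y = PP x y"
    using FF_pos[OF assms] by (simp add: PPd_def PP_def ll_inner assms field_simps)
  thus ?thesis using PPd_vertical[OF assms] by simp
qed

lemma TD_pp:
  assumes x: "x \<in> U" and y: "y \<noteq> 0"
  shows "TD (\<lambda>x y. pp x y $ k) x y"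
proof -
  have TF: "TD FF x y" and TA: "TD (alpha a) x y" using TD_intros(1)[OF TDer_FF[OF x y]] TD_intros(1)[OF TDer_alpha[OF x y]] .
  have "TD (\<lambda>x y. (((e_lo a b x *v y) $ k + (e_lo a b x *v y) $ k) * (2 * FF x y)
     - (y \<bullet> (e_lo a b x *v y)) * (2 * ((a x *v y) $ k / alpha a x y + b x $ k))) / ((2 * FF x y) * (2 * FF x y))
     - s_vec a b x $ k) x y"
    using FF_pos[OF x y] alpha_pos[OF x y]
    by (intro TD_intros(2-7) TD_matrix TD_quad TD_nth TF TA diffs diff_a x) auto
  moreover have "pp x y $ k = (((e_lo a b x *v y) $ k + (e_lo a b x *v y) $ k) * (2 * FF x y)
     - (y \<bullet> (e_lo a b x *v y)) * (2 * ((a x *v y) $ k / alpha a x y + b x $ k))) / ((2 * FF x y) * (2 * FF x y))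
     - s_vec a b x $ k" for x y
    by (simp add: pp_def PPd_def inner_axis inner_axis' ll_def sym_inner[OF e_lo_sym, of y])
  ultimately show ?thesis by simp
qed

text \<open>The fibre Jacobian of the spray of F; see \<open>dy_spray\<close>.\<close>

definition Jm :: "real^'n \<Rightarrow> real^'n \<Rightarrow> real^'n^'n" where
  "Jm x y = Ny x y + PP x y *\<^sub>R mat 1 + outer y (pp x y) + alpha a x y *\<^sub>R s_up a b x
     + (1 / alpha a x y) *\<^sub>R outer (s_up a b x *v y) (a x *v y)"

definition GGd :: "real^'n \<Rightarrow> real^'n \<Rightarrow> 'n \<Rightarrow> real^'n \<Rightarrow> real^'n \<Rightarrow> real" where
  "GGd x y i \<xi> \<eta> = (1/2) * (y \<bullet> (pdMd \<xi> (G3 i) x *v y) + \<eta> \<bullet> (G3 i x *v y) + y \<bullet> (G3 i x *v \<eta>))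
     + (PP x y * \<eta> $ i + PPd x y \<xi> \<eta> * y $ i)
     + (alpha a x y * (pdVd \<xi> (\<lambda>x. s_up a b x $ i) x \<bullet> y + s_up a b x $ i \<bullet> \<eta>)
        + (a x *v y) \<bullet> (\<eta> + Ny x y *v \<xi>) / alpha a x y * (s_up a b x $ i \<bullet> y))"

lemma TDer_spray:
  assumes x: "x \<in> U" and y: "y \<noteq> 0"
  shows "TDer (spray FF i) (GGd x y i) x y"
proof -
  have d: "diffV (\<lambda>x. s_up a b x $ i) x" using diffs(7)[OF x] by (simp add: diffM_def diffV_def)
  have "TDer (\<lambda>x y. (1/2) * (y \<bullet> (G3 i x *v y))) (\<lambda>\<xi> \<eta>. (1/2) * (y \<bullet> (pdMd \<xi> (G3 i) x *v y) + \<eta> \<bullet> (G3 i x *v y) + y \<bullet> (G3 i x *v \<eta>))) x y"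
    by (rule TDer_cong_derivative[OF TDer_mult[OF TDer_const TDer_quad[OF diff_G3[OF x]], of "1/2"]]) simp
  hence "TDer (\<lambda>x y. (1/2) * (y \<bullet> (G3 i x *v y)) + PP x y * y $ i + alpha a x y * (s_up a b x $ i \<bullet> y)) (GGd x y i) x y"
    unfolding GGd_def[abs_def]
    by (intro TDer_add TDer_mult TDer_PP TDer_fibre TDer_alpha TDer_lin d x y)
  thus ?thesis
    by (rule TDer_transform[OF _ open_U x y]) (simp add: spray_FF GG_def Gam_quad matrix_vector_mul_component)
qed

lemma dy_spray:
  assumes x: "x \<in> U" and y: "y \<noteq> 0"
  shows "dy k (spray FF i) x y = Jm x y $ i $ k"
proof -
  have "y \<bullet> (G3 i x *v axis k 1) = Ny x y $ i $ k"
    by (simp add: sym_inner[OF G3_sym[OF x]] inner_axis G3_mult)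
  moreover have "axis k 1 \<bullet> (G3 i x *v y) = Ny x y $ i $ k" by (simp add: inner_axis' G3_mult)
  moreover have "pdMd 0 (G3 i) x = 0" "pdVd 0 (\<lambda>x. s_up a b x $ i) x = 0" by (simp_all add: pdMd_def pdVd_def)
  ultimately show ?thesis
    unfolding TDer_dy[OF TDer_spray[OF x y]]
    by (simp add: GGd_def Jm_def pp_def outer_def inner_axis mat_def axis_nth_if matrix_vector_mul_component mult.commute)
qed

lemma trace_s_up: assumes "x \<in> U" shows "trace (s_up a b x) = 0"
  by (simp add: s_up_eq trace_sym_skew[OF ainv_sym[OF assms] s_lo_skew])

text \<open>\<open>PP\<close> is counted n times by the identity matrix and once more, through
  Euler's relation, by the rank-one term. The terms with s are trace-free by skewness.\<close>

lemma trace_Jm: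
  assumes x: "x \<in> U" and y: "y \<noteq> 0"
  shows "trace (Jm x y) = g0 x \<bullet> y + (real CARD('n) + 1) * PP x y"
  by (simp add: Jm_def trace_add trace_scaleR trace_Ny trace_I trace_s_up x pp_euler y ay_s_up distrib_right trace_outer)

text \<open>The coefficient n + 3 of the square of \<open>PP\<close> is made up of n from the
  identity matrix, 1 from the rank-one term and 2 from their product. The product of the two terms
  with s gives the summand \<open>t_lo\<close>.\<close>

lemma trace_Jm_sq:
  assumes x: "x \<in> U" and y: "y \<noteq> 0"
  shows "trace (Jm x y ** Jm x y) = trace (Ny x y ** Ny x y) + (real CARD('n) + 3) * (PP x y)\<^sup>2
     + (alpha a x y)\<^sup>2 * t_trace a b x + 2 * (2 * (pp x y \<bullet> Gam x y) + PP x y * (g0 x \<bullet> y)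
     + (a x *v y) \<bullet> (Ny x y *v (s_up a b x *v y)) / alpha a x y + alpha a x y * trace (s_up a b x ** Ny x y)
     + 2 * alpha a x y * (pp x y \<bullet> (s_up a b x *v y)) + quad (t_lo a b x) y)"
proof -
  let ?w = "s_up a b x *v y"
  let ?m = "a x *v y"
  let ?al = "alpha a x y"
  note al = alpha_pos[OF x y] and as = alpha_sq[OF x, of y]
  have my: "?m \<bullet> y = ?al\<^sup>2" by (simp add: as inner_commute)
  have mZw: "?m \<bullet> (s_up a b x *v ?w) = quad (t_lo a b x) y"
    by (simp add: a_inner_commute[OF x, symmetric] a_ainv_vec x quad_inner t_lo_eq s_up_eq matrix_vector_mul_assoc[symmetric])
  have mw: "?m \<bullet> ?w = 0" by (rule ay_s_up[OF x])
  have py: "pp x y \<bullet> y = PP x y" by (rule pp_euler[OF x y])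
  have tZ: "trace (s_up a b x ** s_up a b x) = t_trace a b x"
    by (simp add: t_trace_eq s_up_eq matrix_mul_assoc)
  have tZN: "trace (Ny x y ** s_up a b x) = trace (s_up a b x ** Ny x y)" by (rule trace_mul_sym)
  have 2: "Ny x y *v y = 2 *\<^sub>R Gam x y" by (simp add: Gam_def)
  show ?thesis
    unfolding Jm_def
    by (simp add: matrix_add_ldistrib matrix_add_rdistrib scaleR_matrix_mult trace_add trace_scaleR trace_outer trace_outer_mult outer_mult
        my mw py tZ tZN 2 mZw trace_Ny trace_I trace_s_up x matrix_vector_mult_scaleR)
      (use al in \<open>simp add: field_simps power2_eq_square\<close>)
qed

text \<open>The trace of the curvature produces the divergence of s with partial derivatives and two
  terms with Christoffel symbols; together these are the covariant divergence.\<close>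

lemma divS_y:
  assumes x: "x \<in> U"
  shows "(\<Sum>i\<in>UNIV. pdV i (\<lambda>x. s_up a b x $ i) x \<bullet> y) + g0 x \<bullet> (s_up a b x *v y) - trace (s_up a b x ** Ny x y) = divS x \<bullet> y"
proof -
  have Z: "s_up a b = (\<lambda>x. ainv a x ** s_lo a b x)" by (simp add: fun_eq_iff s_up_eq)
  have pM: "pdM k (s_up a b) x = - (Nk k x ** s_up a b x) + ainv a x ** covM k (s_lo a b) x + s_up a b x ** Nk k x" for k
  proof -
    have "pdM k (s_up a b) x = pdM k (ainv a) x ** s_lo a b x + ainv a x ** pdM k (s_lo a b) x"
      by (subst Z, rule pdM_matrix_mult[OF diff_ainv[OF x] diffs(4)[OF x]])
    also have "pdM k (s_lo a b) x = covM k (s_lo a b) x + transpose (Nk k x) ** s_lo a b x + s_lo a b x ** Nk k x"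
      by (simp add: covM_def)
    finally show ?thesis
      by (simp add: pdM_ainv x matrix_diff_distrib matrix_add_ldistrib matrix_mult_minus s_up_eq[of x] matrix_mul_assoc)
  qed
  have "(\<Sum>i\<in>UNIV. pdV i (\<lambda>x. s_up a b x $ i) x \<bullet> y) = (\<Sum>i\<in>UNIV. (pdM i (s_up a b) x *v y) $ i)"
    by (simp add: matrix_vector_mul_component pdM_def pdV_def)
  also have "\<dots> = - (\<Sum>i\<in>UNIV. (Nk i x *v (s_up a b x *v y)) $ i) + (\<Sum>i\<in>UNIV. (ainv a x *v (covM i (s_lo a b) x *v y)) $ i)
      + (\<Sum>i\<in>UNIV. (s_up a b x *v (Nk i x *v y)) $ i)"
    by (simp add: pM matrix_linear_simps matrix_mult_minus matrix_vector_mul_assoc[symmetric] sum.distrib sum_negf sum_subtractf)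
  also have "(\<Sum>i\<in>UNIV. (Nk i x *v z) $ i) = g0 x \<bullet> z" for z
    using trace_Ny[of x z] by (simp add: trace_def Ny_def)
  also have "(\<Sum>i\<in>UNIV. (s_up a b x *v (Nk i x *v y)) $ i) = trace (s_up a b x ** Ny x y)"
    unfolding column_Ny[symmetric] by (simp add: trace_def matrix_matrix_mult_def matrix_vector_mult_def column_def)
  also have "(\<Sum>i\<in>UNIV. (ainv a x *v (covM i (s_lo a b) x *v y)) $ i) = divS x \<bullet> y"
  proof -
    have "divS x \<bullet> y = (\<Sum>j\<in>UNIV. \<Sum>i\<in>UNIV. \<Sum>k\<in>UNIV. ainv a x $ k $ i * covM k (s_lo a b) x $ i $ j * y $ j)"
      by (simp add: divS_def inner_vec_def sum_distrib_right ainv_sym_nth[OF x, of _ "_ :: 'n"])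
    also have "\<dots> = (\<Sum>j\<in>UNIV. \<Sum>k\<in>UNIV. \<Sum>i\<in>UNIV. ainv a x $ k $ i * covM k (s_lo a b) x $ i $ j * y $ j)"
      by (rule sum.cong[OF refl], rule sum.swap)
    also have "\<dots> = (\<Sum>k\<in>UNIV. \<Sum>j\<in>UNIV. \<Sum>i\<in>UNIV. ainv a x $ k $ i * covM k (s_lo a b) x $ i $ j * y $ j)"
      by (rule sum.swap)
    also have "\<dots> = (\<Sum>k\<in>UNIV. \<Sum>i\<in>UNIV. \<Sum>j\<in>UNIV. ainv a x $ k $ i * covM k (s_lo a b) x $ i $ j * y $ j)"
      by (rule sum.cong[OF refl], rule sum.swap)
    finally show ?thesis by (simp add: matrix_vector_mult_def sum_distrib_left mult.assoc)
  qed
  finally show ?thesis by simp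
qed

text \<open>The second and third terms of \<open>riem_curv\<close> combine into minus the derivative
  of a diagonal entry of the Jacobian in the direction (y, -2G) of the spray. After summation this
  is the derivative of the trace of the Jacobian, known from \<open>trace_Jm\<close>; the
  derivatives K of the single entries never have to be computed.\<close>

lemma finsler_Ric_trace:
  assumes x: "x \<in> U" and y: "y \<noteq> 0"
  shows "finsler_Ric FF x y = 2 * (\<Sum>i\<in>UNIV. GGd x y i (axis i 1) 0)
     - (pdVd y g0 x \<bullet> y - 2 * (g0 x \<bullet> GG x y) + (real CARD('n) + 1) * PPd x y y (-2 *\<^sub>R GG x y)) - trace (Jm x y ** Jm x y)"
proof -
  let ?n = "real CARD('n)"
  have TDJ: "TD (dy i (spray FF i)) x y" for i
  proof -
    have TA: "TD (alpha a) x y" and TP: "TD PP x y" using TD_intros(1)[OF TDer_alpha[OF x y]] TD_intros(1)[OF TDer_PP[OF x y]] .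
    have "TD (\<lambda>x y. (G3 i x *v y) $ i + PP x y + y $ i * pp x y $ i + alpha a x y * s_up a b x $ i $ i
       + (s_up a b x *v y) $ i * (a x *v y) $ i / alpha a x y) x y"
      using alpha_pos[OF x y]
      by (intro TD_intros(2-7) TD_matrix TD_nth TA TP TD_pp diffs diff_a diff_G3 x y) auto
    then obtain f' where "TDer (\<lambda>x y. (G3 i x *v y) $ i + PP x y + y $ i * pp x y $ i + alpha a x y * s_up a b x $ i $ i
       + (s_up a b x *v y) $ i * (a x *v y) $ i / alpha a x y) f' x y" unfolding TD_def by blast
    hence "TDer (dy i (spray FF i)) f' x y"
      by (rule TDer_transform[OF _ open_U x y]) (simp add: dy_spray Jm_def G3_mult outer_def mat_def)
    thus ?thesis unfolding TD_def by blast
  qed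
  then obtain K where K: "TDer (dy i (spray FF i)) (K i) x y" for i unfolding TD_def by metis
  have 1: "TDer (\<lambda>x y. \<Sum>i\<in>UNIV. dy i (spray FF i) x y) (\<lambda>\<xi> \<eta>. \<Sum>i\<in>UNIV. K i \<xi> \<eta>) x y"
    by (rule TDer_sum) (rule K)
  have "TDer (\<lambda>x y. (?n + 1) * PP x y) (\<lambda>\<xi> \<eta>. (?n + 1) * PPd x y \<xi> \<eta>) x y"
    by (rule TDer_cong_derivative[OF TDer_mult[OF TDer_const TDer_PP[OF x y], of "?n + 1"]]) simp
  hence "TDer (\<lambda>x y. g0 x \<bullet> y + (?n + 1) * PP x y) (\<lambda>\<xi> \<eta>. pdVd \<xi> g0 x \<bullet> y + g0 x \<bullet> \<eta> + (?n + 1) * PPd x y \<xi> \<eta>) x y"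
    by (intro TDer_add TDer_lin diff_g0 x)
  hence 2: "TDer (\<lambda>x y. \<Sum>i\<in>UNIV. dy i (spray FF i) x y) (\<lambda>\<xi> \<eta>. pdVd \<xi> g0 x \<bullet> y + g0 x \<bullet> \<eta> + (?n + 1) * PPd x y \<xi> \<eta>) x y"
    by (rule TDer_transform[OF _ open_U x y]) (simp add: dy_spray trace_Jm[symmetric], simp add: trace_def)
  have sK: "(\<Sum>i\<in>UNIV. K i \<xi> \<eta>) = pdVd \<xi> g0 x \<bullet> y + g0 x \<bullet> \<eta> + (?n + 1) * PPd x y \<xi> \<eta>" for \<xi> \<eta>
    by (rule TDer_unique[OF 1 2])
  have "riem_curv FF i i x y = 2 * GGd x y i (axis i 1) 0 - (\<Sum>j\<in>UNIV. y $ j * K i (axis j 1) 0) + 2 * (\<Sum>j\<in>UNIV. GG x y $ j * K i 0 (axis j 1))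
     - (\<Sum>j\<in>UNIV. Jm x y $ i $ j * Jm x y $ j $ i)" for i
    by (simp add: riem_curv_def TDer_dx[OF TDer_spray[OF x y]] TDer_dx[OF K] TDer_dy[OF K] dy_spray x y spray_FF mult.commute)
  moreover have "- (\<Sum>j\<in>UNIV. y $ j * K i (axis j 1) 0) + 2 * (\<Sum>j\<in>UNIV. GG x y $ j * K i 0 (axis j 1)) = - K i y (-2 *\<^sub>R GG x y)" for i
    using TDer_expand[OF K[of i], of y "-2 *\<^sub>R GG x y"] by (simp add: sum_distrib_left sum_negf mult.assoc)
  ultimately have "riem_curv FF i i x y = 2 * GGd x y i (axis i 1) 0 - K i y (-2 *\<^sub>R GG x y)
     - (\<Sum>j\<in>UNIV. Jm x y $ i $ j * Jm x y $ j $ i)" for i by (metis (no_types, lifting) add.commute add_diff_eq diff_minus_eq_add uminus_add_conv_diff)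
  hence "finsler_Ric FF x y = 2 * (\<Sum>i\<in>UNIV. GGd x y i (axis i 1) 0) - (\<Sum>i\<in>UNIV. K i y (-2 *\<^sub>R GG x y)) - trace (Jm x y ** Jm x y)"
    by (simp add: finsler_Ric_def sum_subtractf sum_distrib_left trace_def matrix_matrix_mult_def)
  thus ?thesis by (simp add: sK)
qed

text \<open>The factor n - 1 comes about as (n + 1) - 2 for the derivative of \<open>PP\<close>
  along the spray and as (n + 3) - 4 for its square. All terms with Christoffel symbols are
  collected into the Ricci tensor of \<alpha> and the covariant divergence.\<close>

theorem finsler_Ric_FF:
  assumes x: "x \<in> U" and y: "y \<noteq> 0"
  shows "finsler_Ric FF x y = quad (ric_tensor a x) y + 2 * alpha a x y * (divS x \<bullet> y) - 2 * quad (t_lo a b x) y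
     - (alpha a x y)\<^sup>2 * t_trace a b x - (real CARD('n) - 1) * (PPd x y y (-2 *\<^sub>R GG x y) + (PP x y)\<^sup>2)"
proof -
  let ?w = "s_up a b x *v y"
  have p1: "pdMd (axis i 1) T x = pdM i T x" for T :: "real^'n \<Rightarrow> real^'n^'n" and i
    by (simp add: pdMd_def axis_nth_if if_distrib if_distribR cong: if_cong)
  have p2: "pdVd (axis i 1) T x = pdV i T x" for T :: "real^'n \<Rightarrow> real^'n" and i
    by (simp add: pdVd_def axis_nth_if if_distrib if_distribR cong: if_cong)
  have e: "(\<Sum>i\<in>UNIV. PPd x y (axis i 1) 0 * y $ i) = PPd x y y (-2 *\<^sub>R GG x y) + 2 * (pp x y \<bullet> GG x y)"
    using TDer_expand[OF TDer_PP[OF x y], of y "-2 *\<^sub>R GG x y"]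
    by (simp add: pp_def inner_vec_def mult.commute sum_distrib_left sum_negf mult.assoc mult.left_commute)
  have "(\<Sum>i\<in>UNIV. (a x *v y) \<bullet> (Ny x y *v axis i 1) / alpha a x y * ?w $ i) = (a x *v y) \<bullet> (Ny x y *v ?w) / alpha a x y"
    by (simp add: Ny_mult[of x y ?w] matrix_vector_mult_basis column_Ny inner_sum_right sum_divide_distrib mult.commute)
  hence "(\<Sum>i\<in>UNIV. GGd x y i (axis i 1) 0) = (1/2) * (\<Sum>i\<in>UNIV. y \<bullet> (pdM i (G3 i) x *v y)) + (PPd x y y (-2 *\<^sub>R GG x y) + 2 * (pp x y \<bullet> GG x y))
     + alpha a x y * (\<Sum>i\<in>UNIV. pdV i (\<lambda>x. s_up a b x $ i) x \<bullet> y) + (a x *v y) \<bullet> (Ny x y *v ?w) / alpha a x y"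
    unfolding e[symmetric]
    by (simp add: GGd_def p1 p2 sum.distrib sum_distrib_left matrix_vector_mul_component sum_divide_distrib)
  moreover have "pp x y \<bullet> GG x y = pp x y \<bullet> Gam x y + (PP x y)\<^sup>2 + alpha a x y * (pp x y \<bullet> ?w)"
    by (simp add: GG_def inner_add_right pp_euler x y power2_eq_square)
  moreover have "g0 x \<bullet> GG x y = g0 x \<bullet> Gam x y + PP x y * (g0 x \<bullet> y) + alpha a x y * (g0 x \<bullet> ?w)"
    by (simp add: GG_def inner_add_right)
  ultimately show ?thesis
    unfolding finsler_Ric_trace[OF x y] trace_Jm_sq[OF x y] ric_quad[OF x] divS_y[OF x, symmetric]
    by (simp add: algebra_simps)
qed

end

section \<open>Separating the powers of \<open>\<alpha>\<close>\<close>

text \<open>A real function that is a polynomial, represented over the complex numbers so that it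
  can be evaluated at \<i>.\<close>

definition polyfun :: "(real \<Rightarrow> real) \<Rightarrow> bool" where
  "polyfun f \<longleftrightarrow> (\<exists>p :: complex poly. \<forall>\<tau>. poly p (of_real \<tau>) = of_real (f \<tau>))"

lemma polyfun_const: "polyfun (\<lambda>\<tau>. c)"
  unfolding polyfun_def by (rule exI[of _ "[:of_real c:]"]) simp

lemma polyfun_affine: "polyfun (\<lambda>\<tau>. c + \<tau> * d)"
  unfolding polyfun_def by (rule exI[of _ "[:of_real c, of_real d:]"]) simp

lemma polyfun_add: "polyfun f \<Longrightarrow> polyfun g \<Longrightarrow> polyfun (\<lambda>\<tau>. f \<tau> + g \<tau>)"
  unfolding polyfun_def by (metis of_real_add poly_add)

lemma polyfun_diff: "polyfun f \<Longrightarrow> polyfun g \<Longrightarrow> polyfun (\<lambda>\<tau>. f \<tau> - g \<tau>)"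
  unfolding polyfun_def by (metis of_real_diff poly_diff)

lemma polyfun_mult: "polyfun f \<Longrightarrow> polyfun g \<Longrightarrow> polyfun (\<lambda>\<tau>. f \<tau> * g \<tau>)"
  unfolding polyfun_def by (metis of_real_mult poly_mult)

lemma polyfun_uminus: "polyfun f \<Longrightarrow> polyfun (\<lambda>\<tau>. - f \<tau>)"
  unfolding polyfun_def by (metis of_real_minus poly_minus)

lemma polyfun_divide: "polyfun f \<Longrightarrow> polyfun (\<lambda>\<tau>. f \<tau> / c)"
  unfolding divide_inverse by (intro polyfun_mult polyfun_const)

lemma polyfun_power: "polyfun f \<Longrightarrow> polyfun (\<lambda>\<tau>. f \<tau> ^ k)"
  by (induction k) (auto intro: polyfun_const polyfun_mult)

lemma polyfun_sum: "(\<And>j. j \<in> J \<Longrightarrow> polyfun (f j)) \<Longrightarrow> polyfun (\<lambda>\<tau>. \<Sum>j\<in>J. f j \<tau>)"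
  by (induction J rule: infinite_finite_induct) (auto intro: polyfun_const polyfun_add)

lemma polyfun_lin: "polyfun (\<lambda>\<tau>. w \<bullet> (u + \<tau> *\<^sub>R v))"
  by (simp add: inner_add_right polyfun_affine)

lemma polyfun_nth: "polyfun (\<lambda>\<tau>. (u + \<tau> *\<^sub>R v) $ i)"
  by (simp add: polyfun_affine)

lemma polyfun_quad: "polyfun (\<lambda>\<tau>. (u + \<tau> *\<^sub>R v) \<bullet> (T *v (u + \<tau> *\<^sub>R v)))" for T :: "real^'n^'n"
proof -
  have e: "(u + \<tau> *\<^sub>R v) \<bullet> (T *v (u + \<tau> *\<^sub>R v)) = (\<Sum>i\<in>UNIV. \<Sum>j\<in>UNIV. T $ i $ j * (u + \<tau> *\<^sub>R v) $ i * (u + \<tau> *\<^sub>R v) $ j)" for \<tau>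
    by (simp only: quad_def quad_inner[symmetric])
  show ?thesis unfolding e by (intro polyfun_sum polyfun_mult polyfun_nth polyfun_const)
qed

lemma complex_poly_zero_on_reals:
  fixes p :: "complex poly"
  assumes "\<And>\<tau> :: real. poly p (of_real \<tau>) = 0"
  shows "p = 0"
proof (rule ccontr)
  assume "p \<noteq> 0"
  hence "finite {z. poly p z = 0}" by (rule poly_roots_finite)
  moreover have "range complex_of_real \<subseteq> {z. poly p z = 0}" using assms by auto
  ultimately have "finite (range complex_of_real)" by (rule finite_subset[rotated])
  thus False using finite_imageD[of complex_of_real UNIV] infinite_UNIV_char_0[where 'a=real] by (auto simp: inj_on_def)
qed

text \<open>The form \<open>Q\<close> vanishes at the complex isotropic vectors \<open>z + \<i> v\<close> of \<open>H\<close>.\<close>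

lemma quad_divisible_imp_proportional:
  fixes H Q :: "real^'n^'n" and w z :: "real^'n"
  assumes H: "transpose H = H" "\<And>y. y \<noteq> 0 \<Longrightarrow> 0 < y \<bullet> (H *v y)" and Q: "transpose Q = Q"
    and z: "H *v z = w" "z \<noteq> 0"
    and j: "0 < j" and c: "c \<noteq> 0"
    and dv: "\<And>y. y \<noteq> 0 \<Longrightarrow> c * (w \<bullet> y) ^ i * (y \<bullet> (Q *v y)) ^ j = (y \<bullet> (H *v y)) * K y"
    and K: "\<And>u v. polyfun (\<lambda>\<tau>. K (u + \<tau> *\<^sub>R v))"
  shows "\<exists>\<mu>. Q = \<mu> *\<^sub>R H"
proof -
  define h where "h = z \<bullet> (H *v z)"
  have h: "0 < h" using H(2)[OF z(2)] by (simp only: h_def)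
  \<comment> \<open>On the line z + \<tau>v the form H equals h(1 + \<tau>\<open>\<^sup>2\<close>)
    and w has the constant value h. The divisibility holds for all real \<tau>, hence as an identity
    of polynomials, and at \<tau> = \<i> it makes Q vanish; the real and the imaginary part are the
    two claims.\<close>
  have main: "v \<bullet> (Q *v v) = z \<bullet> (Q *v z) \<and> z \<bullet> (Q *v v) = 0" if v: "v \<bullet> (H *v v) = h" "w \<bullet> v = 0" for v
  proof -
    let ?y = "\<lambda>\<tau>. z + \<tau> *\<^sub>R v"
    have zv: "z \<bullet> (H *v v) = 0" using sym_inner[OF H(1), of z v] z v by simp
    have vz: "v \<bullet> (H *v z) = 0" using z v by (simp add: inner_commute)
    have Hy: "?y \<tau> \<bullet> (H *v ?y \<tau>) = h * (1 + \<tau>\<^sup>2)" for \<tau>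
      using v zv vz by (simp add: matrix_linear_simps matrix_vector_mult_scaleR inner_add_left inner_add_right h_def[symmetric] power2_eq_square algebra_simps)
    have ynz: "?y \<tau> \<noteq> 0" for \<tau>
    proof
      assume "?y \<tau> = 0"
      hence "h * (1 + \<tau>\<^sup>2) = 0" using Hy[of \<tau>] by simp
      thus False using h by (simp add: add_nonneg_eq_0_iff)
    qed
    have wy: "w \<bullet> ?y \<tau> = h" for \<tau> using v z(1) by (simp add: inner_add_right h_def inner_commute)
    have vQz: "v \<bullet> (Q *v z) = z \<bullet> (Q *v v)" using sym_inner[OF Q, of v z] by (simp add: inner_commute)
    have Qy: "?y \<tau> \<bullet> (Q *v ?y \<tau>) = z \<bullet> (Q *v z) + \<tau> * (2 * (z \<bullet> (Q *v v)) + \<tau> * (v \<bullet> (Q *v v)))" for \<tau>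
      by (simp add: matrix_linear_simps matrix_vector_mult_scaleR inner_add_left inner_add_right vQz algebra_simps)
    obtain k :: "complex poly" where k: "\<And>\<tau>. poly k (of_real \<tau>) = of_real (K (?y \<tau>))"
      using K[of z v] unfolding polyfun_def by blast
    define q :: "complex poly" where "q = [:of_real (z \<bullet> (Q *v z)), of_real (2 * (z \<bullet> (Q *v v))), of_real (v \<bullet> (Q *v v)):]"
    have q: "poly q (of_real \<tau>) = of_real (?y \<tau> \<bullet> (Q *v ?y \<tau>))" for \<tau>
      unfolding Qy by (simp add: q_def)
    have "[:of_real (c * h ^ i):] * q ^ j - [:of_real h, 0, of_real h:] * k = 0"
    proof (rule complex_poly_zero_on_reals)
      fix \<tau> :: real
      have "complex_of_real (c * (w \<bullet> ?y \<tau>) ^ i * (?y \<tau> \<bullet> (Q *v ?y \<tau>)) ^ j) = of_real ((?y \<tau> \<bullet> (H *v ?y \<tau>)) * K (?y \<tau>))"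
        by (simp only: dv[OF ynz])
      thus "poly ([:of_real (c * h ^ i):] * q ^ j - [:of_real h, 0, of_real h:] * k) (of_real \<tau>) = 0"
        unfolding Hy wy of_real_mult of_real_power q[symmetric] k[symmetric]
        by (simp add: algebra_simps power2_eq_square)
    qed
    hence "poly ([:of_real (c * h ^ i):] * q ^ j - [:of_real h, 0, of_real h:] * k) \<i> = 0" by simp
    hence "poly q \<i> = 0" using h c j by (simp add: algebra_simps)
    hence "z \<bullet> (Q *v z) = v \<bullet> (Q *v v) \<and> z \<bullet> (Q *v v) = 0"
      by (simp add: q_def complex_eq_iff)
    thus ?thesis by simp
  qed
  define \<mu> where "\<mu> = (z \<bullet> (Q *v z)) / h"
  have "quad Q y = quad (\<mu> *\<^sub>R H) y" for y
  proof -
    define m where "m = (w \<bullet> y) / h"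
    define y' where "y' = y - m *\<^sub>R z"
    have wz: "w \<bullet> z = h" using z(1) by (simp add: h_def inner_commute)
    have wy': "w \<bullet> y' = 0" using h by (simp add: y'_def inner_diff_right wz m_def)
    have y: "y = m *\<^sub>R z + y'" by (simp add: y'_def)
    have Hzy': "z \<bullet> (H *v y') = 0" "y' \<bullet> (H *v z) = 0"
      using sym_inner[OF H(1), of z y'] z wy' by (simp_all add: inner_commute)
    have "z \<bullet> (Q *v y') = 0 \<and> y' \<bullet> (Q *v y') = \<mu> * (y' \<bullet> (H *v y'))"
    proof (cases "y' = 0")
      case False
      \<comment> \<open>Rescales y', the part of y that is H-orthogonal to z, to the H-length of z,
        as \<open>main\<close> requires.\<close>
      define \<rho> where "\<rho> = sqrt (h / (y' \<bullet> (H *v y')))"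
      have \<rho>: "\<rho>\<^sup>2 * (y' \<bullet> (H *v y')) = h" "\<rho> \<noteq> 0" using h H(2)[OF False] by (simp_all add: \<rho>_def)
      have "(\<rho> *\<^sub>R y') \<bullet> (H *v (\<rho> *\<^sub>R y')) = h" using \<rho> by (simp add: matrix_vector_mult_scaleR power2_eq_square mult.assoc)
      from main[OF this] wy' have 1: "\<rho>\<^sup>2 * (y' \<bullet> (Q *v y')) = z \<bullet> (Q *v z)" "\<rho> * (z \<bullet> (Q *v y')) = 0"
        by (simp_all add: matrix_vector_mult_scaleR power2_eq_square mult.assoc)
      have "\<rho>\<^sup>2 * (\<mu> * (y' \<bullet> (H *v y'))) = z \<bullet> (Q *v z)" using \<rho> h by (simp add: \<mu>_def mult.left_commute[of "\<rho>\<^sup>2"])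
      hence "\<rho>\<^sup>2 * (y' \<bullet> (Q *v y')) = \<rho>\<^sup>2 * (\<mu> * (y' \<bullet> (H *v y')))" using 1 by simp
      thus ?thesis using \<rho> 1 by simp
    qed simp
    moreover have "y' \<bullet> (Q *v z) = z \<bullet> (Q *v y')" using sym_inner[OF Q, of y' z] by (simp add: inner_commute)
    moreover have "z \<bullet> (Q *v z) = \<mu> * h" using h by (simp add: \<mu>_def)
    ultimately show ?thesis
      unfolding quad_inner by (subst (1 2 3 4) y)
        (simp add: matrix_linear_simps matrix_vector_mult_scaleR inner_add_left inner_add_right Hzy' h_def[symmetric]
          scaleR_matrix_vector_assoc[symmetric] algebra_simps)
  qed
  thus ?thesis using quad_eq_imp_eq[OF _ Q, of "\<mu> *\<^sub>R H"] H by (auto simp: transpose_scaleR)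
qed

text \<open>A polynomial psi in z that vanishes at \<alpha> and -\<alpha> is divisible by
  \<open>z\<^sup>2 - A\<close>. So its value at 0 is divisible by A and its value at -\<beta> by
  \<open>A - \<beta>\<^sup>2\<close>; the cofactors are written out because they have to be
  polynomial in y as well.\<close>

lemma even_odd_divisible:
  fixes A \<beta> \<alpha> :: real
  defines "psi \<equiv> \<lambda>(c0::real) c1 c2 c3 c4 c5 z::real. c0 + c1*z + c2*z^2 + c3*z^3 + c4*z^4 + c5*z^5"
  assumes "psi c0 c1 c2 c3 c4 c5 \<alpha> = 0" "psi c0 c1 c2 c3 c4 c5 (- \<alpha>) = 0" "\<alpha>\<^sup>2 = A" "\<alpha> \<noteq> 0"
  shows "c0 = A * (- c2 - c4 * A)"
    and "- psi c0 c1 c2 c3 c4 c5 (- \<beta>) = (A - \<beta>\<^sup>2) * (c2 + c4 * (A + \<beta>\<^sup>2) - \<beta> * (c3 + c5 * (A + \<beta>\<^sup>2)))"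
proof -
  have p4: "\<alpha>^4 = A * A" by (simp add: assms(4)[symmetric] power4_eq_xxxx power2_eq_square mult.assoc)
  have "c0 + c2*\<alpha>^2 + c4*\<alpha>^4 = 0" using assms(2,3) by (simp add: psi_def)
  hence e: "c0 + c2*A + c4*(A*A) = 0" by (simp only: p4 assms(4))
  have "\<alpha> * (c1 + c3*\<alpha>^2 + c5*\<alpha>^4) = 0" using assms(2,3) by (simp add: psi_def algebra_simps eval_nat_numeral)
  hence "c1 + c3*\<alpha>^2 + c5*\<alpha>^4 = 0" using assms(5) by simp
  hence o: "c1 + c3*A + c5*(A*A) = 0" by (simp only: p4 assms(4))
  show "c0 = A * (- c2 - c4 * A)" using e by (simp add: algebra_simps)
  have c0: "c0 = - c2*A - c4*(A*A)" and c1: "c1 = - c3*A - c5*(A*A)" using e o by simp_all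
  show "- psi c0 c1 c2 c3 c4 c5 (- \<beta>) = (A - \<beta>\<^sup>2) * (c2 + c4 * (A + \<beta>\<^sup>2) - \<beta> * (c3 + c5 * (A + \<beta>\<^sup>2)))"
    unfolding psi_def c0 c1 by (simp add: algebra_simps eval_nat_numeral)
qed

section \<open>The soliton equation as a polynomial identity in \<alpha>\<close>

context randers_chart
begin

text \<open>The contraction \<open>e_{ij;k} y^i y^j y^k\<close>.\<close>

definition E3 :: "real^'n \<Rightarrow> real^'n \<Rightarrow> real" where
  "E3 x y = (\<Sum>k\<in>UNIV. y $ k * (y \<bullet> (covM k (e_lo a b) x *v y)))"

lemma finsler_Ric_general:
  assumes x: "x \<in> U" and y: "y \<noteq> 0"
  shows "finsler_Ric FF x y = y \<bullet> (ric_tensor a x *v y) + 2 * alpha a x y * (divS x \<bullet> y) - 2 * (y \<bullet> (t_lo a b x *v y))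
     - (alpha a x y)\<^sup>2 * t_trace a b x
     - (real CARD('n) - 1) * ((E3 x y - 4 * alpha a x y * ((s_up a b x *v y) \<bullet> (e_lo a b x *v y))) / (2 * FF x y)
       - 3 * (y \<bullet> (e_lo a b x *v y))\<^sup>2 / (4 * (FF x y)\<^sup>2) + 2 * (y \<bullet> (e_lo a b x *v y)) * (s_vec a b x \<bullet> y) / FF x y
       - (s_vec a b x \<bullet> y)\<^sup>2 - y \<bullet> (cov a (s_vec a b) x *v y) + 2 * alpha a x y * (s_vec a b x \<bullet> (s_up a b x *v y)))"
proof -
  let ?w = "s_up a b x *v y" and ?al = "alpha a x y" and ?E = "y \<bullet> (e_lo a b x *v y)" and ?s0 = "s_vec a b x \<bullet> y"
  have F: "FF x y \<noteq> 0" using FF_pos[OF x y] by simp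
  \<comment> \<open>The vertical part of the spray direction (y, -2G) relative to the connection of
    \<alpha>: only the difference of the two sprays remains.\<close>
  have \<kappa>: "-2 *\<^sub>R GG x y + Ny x y *v y = (-2) *\<^sub>R (PP x y *\<^sub>R y + ?al *\<^sub>R ?w)"
    by (simp add: GG_def Gam_def algebra_simps)
  have lw: "ll x y \<bullet> ?w = ?s0" by (simp add: ll_def inner_add_left s0_up ay_s_up x)
  have PF: "PP x y * FF x y = ?E / 2 - FF x y * ?s0" using F by (simp add: PP_def field_simps)
  \<comment> \<open>F is constant along its own geodesics, so the denominator of \<open>PP\<close>
    contributes nothing to the derivative along the spray.\<close>
  have DF: "y \<bullet> (cov a b x *v y) + ll x y \<bullet> ((-2) *\<^sub>R (PP x y *\<^sub>R y + ?al *\<^sub>R ?w)) = 0"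
    using PF by (simp add: cov_b_quad x FF_def inner_add_right lw ll_inner y algebra_simps)
  have E3: "y \<bullet> ((\<Sum>k\<in>UNIV. y $ k *\<^sub>R covM k (e_lo a b) x) *v y) = E3 x y"
  proof -
    have "y \<bullet> ((\<Sum>k\<in>J. y $ k *\<^sub>R covM k (e_lo a b) x) *v y) = (\<Sum>k\<in>J. y $ k * (y \<bullet> (covM k (e_lo a b) x *v y)))" if "finite J" for J
      using that by induction (simp_all add: matrix_linear_simps inner_add_right scaleR_matrix_vector_assoc[symmetric])
    thus ?thesis by (simp add: E3_def)
  qed
  have "PPd x y y (-2 *\<^sub>R GG x y) = (E3 x y + 2 * (((-2) *\<^sub>R (PP x y *\<^sub>R y + ?al *\<^sub>R ?w)) \<bullet> (e_lo a b x *v y))) / (2 * FF x y)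
     - (y \<bullet> (cov a (s_vec a b) x *v y) + s_vec a b x \<bullet> ((-2) *\<^sub>R (PP x y *\<^sub>R y + ?al *\<^sub>R ?w)))"
  proof -
    define K where "K = (-2) *\<^sub>R (PP x y *\<^sub>R y + ?al *\<^sub>R ?w)"
    have s1: "y \<bullet> (e_lo a b x *v K) = K \<bullet> (e_lo a b x *v y)"
      using sym_inner[OF e_lo_sym, of y x K] by (simp only: inner_commute)
    show ?thesis
      unfolding PPd_def \<kappa> E3 K_def[symmetric] s1 DF[folded K_def] using F by (simp add: field_simps)
  qed
  also have "\<dots> = (E3 x y - 4 * ?al * (?w \<bullet> (e_lo a b x *v y)) - 4 * PP x y * ?E) / (2 * FF x y)
     - y \<bullet> (cov a (s_vec a b) x *v y) + 2 * PP x y * ?s0 + 2 * ?al * (s_vec a b x \<bullet> ?w)"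
    by (simp add: inner_add_left inner_add_right algebra_simps)
  finally have D: "PPd x y y (-2 *\<^sub>R GG x y) = (E3 x y - 4 * ?al * (?w \<bullet> (e_lo a b x *v y)) - 4 * PP x y * ?E) / (2 * FF x y)
     - y \<bullet> (cov a (s_vec a b) x *v y) + 2 * PP x y * ?s0 + 2 * ?al * (s_vec a b x \<bullet> ?w)" .
  have P: "PP x y = ?E / (2 * FF x y) - ?s0" by (simp add: PP_def)
  have "PPd x y y (-2 *\<^sub>R GG x y) + (PP x y)\<^sup>2 = (E3 x y - 4 * ?al * (?w \<bullet> (e_lo a b x *v y))) / (2 * FF x y)
       - 3 * ?E\<^sup>2 / (4 * (FF x y)\<^sup>2) + 2 * ?E * ?s0 / FF x y
       - ?s0\<^sup>2 - y \<bullet> (cov a (s_vec a b) x *v y) + 2 * ?al * (s_vec a b x \<bullet> ?w)"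
    unfolding D P using F by (simp add: field_simps power2_eq_square)
  thus ?thesis unfolding finsler_Ric_FF[OF x y] quad_inner by (simp only:)
qed

text \<open>The components of the Lie derivative of the 1-form \<beta> along V.\<close>

definition lieB :: "(real^'n \<Rightarrow> real^'n) \<Rightarrow> real^'n \<Rightarrow> real^'n" where
  "lieB V x = pdVd (V x) b x + (\<chi> j. b x \<bullet> pdV j V x)"

text \<open>The complete lift is the tangent vector of TM with base part V and fibre part the
  derivative of V in the direction y.\<close>

lemma lie_lift_TDer:
  assumes "TDer f f' x y"
  shows "lie_lift V f x y = f' (V x) (pdVd y V x)"
proof -
  have "(\<Sum>i\<in>UNIV. \<Sum>j\<in>UNIV. y $ j * pd j (\<lambda>x. V x $ i) x * dy i f x y) = (\<Sum>i\<in>UNIV. pdVd y V x $ i * dy i f x y)"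
    by (simp add: pdVd_def pdV_def sum_distrib_right)
  thus ?thesis
    unfolding TDer_expand[OF assms, of "V x" "pdVd y V x"] lie_lift_def by (simp add: TDer_dx[OF assms] TDer_dy[OF assms])
qed

lemma inner_pdVd: "v \<bullet> pdVd y V x = (\<chi> j. v \<bullet> pdV j V x) \<bullet> y"
  by (simp add: pdVd_def inner_sum_right inner_vec_def[of "\<chi> j. v \<bullet> pdV j V x"] mult.commute)

lemma lie_lift_beta:
  assumes x: "x \<in> U"
  shows "lie_lift V (beta b) x y = lieB V x \<bullet> y"
proof -
  have "beta b = (\<lambda>x y. b x \<bullet> y)" by (simp add: beta_def lin_inner fun_eq_iff)
  thus ?thesis
    using lie_lift_TDer[OF TDer_lin[OF diffs(1)[OF x]], of V y]
    by (simp add: lieB_def inner_add_left inner_pdVd)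
qed

lemma lower_eq: "lower a V x = a x *v V x"
  by (simp add: lower_def vec_eq_iff matrix_vector_mult_def)

lemma cov_lower:
  assumes x: "x \<in> U" and V: "diffV V x"
  shows "cov a (lower a V) x *v y = a x *v (pdVd y V x + Ny x y *v V x)"
proof -
  have c: "column k (cov a (lower a V) x) = a x *v (pdV k V x + Nk k x *v V x)" for k
    unfolding cov_column[OF x] covV_def lower_eq[abs_def]
    by (simp add: pdV_matrix_mult diff_a x V pdM_a matrix_linear_simps matrix_vector_mul_assoc[symmetric])
  have "cov a (lower a V) x *v y = (\<Sum>k\<in>UNIV. y $ k *\<^sub>R column k (cov a (lower a V) x))"
    by (simp add: vec_eq_iff sum_column[symmetric] column_nth)
  also have "\<dots> = a x *v (\<Sum>k\<in>UNIV. y $ k *\<^sub>R (pdV k V x + Nk k x *v V x))"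
    by (simp add: c linear_sum[OF matrix_vector_mul_linear] matrix_vector_mult_scaleR)
  also have "(\<Sum>k\<in>UNIV. y $ k *\<^sub>R (pdV k V x + Nk k x *v V x)) = pdVd y V x + Ny x (V x) *v y"
    by (simp add: pdVd_def Ny_mult scaleR_add_right sum.distrib)
  finally show ?thesis by (simp add: Ny_commute[OF x, of "V x"])
qed

lemma lie_lift_F2:
  assumes x: "x \<in> U" and y: "y \<noteq> 0" and V: "diffV V x"
  shows "lie_lift V (\<lambda>x y. (FF x y)\<^sup>2) x y = 2 * FF x y * ((y \<bullet> (cov a (lower a V) x *v y)) / alpha a x y + lieB V x \<bullet> y)"
proof -
  have "TDer (\<lambda>x y. alpha a x y + b x \<bullet> y) (\<lambda>\<xi> \<eta>. (a x *v y) \<bullet> (\<eta> + Ny x y *v \<xi>) / alpha a x y +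
      (pdVd \<xi> b x \<bullet> y + b x \<bullet> \<eta>)) x y"
    by (intro TDer_add TDer_alpha TDer_lin x y diffs)
  hence T: "TDer FF (\<lambda>\<xi> \<eta>. (a x *v y) \<bullet> (\<eta> + Ny x y *v \<xi>) / alpha a x y + (pdVd \<xi> b x \<bullet> y + b x \<bullet> \<eta>)) x y"
    by (simp add: FF_def[abs_def])
  show ?thesis
    unfolding power2_eq_square lie_lift_TDer[OF TDer_mult[OF T T]]
    by (simp add: cov_lower x V a_inner_commute lieB_def inner_add_left inner_pdVd algebra_simps)
qed

definition soliton_at :: "real \<Rightarrow> (real^'n \<Rightarrow> real^'n) \<Rightarrow> real^'n \<Rightarrow> bool" where
  "soliton_at k V x \<longleftrightarrow> (\<forall>y. y \<noteq> 0 \<longrightarrow>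
     2 * finsler_Ric FF x y + lie_lift V (\<lambda>x y. (FF x y)\<^sup>2) x y = 2 * k * (FF x y)\<^sup>2)"

lemma alpha_minus: "alpha a x (- y) = alpha a x y"
  by (simp add: alpha_def quad_inner matrix_mult_minus)

lemma E3_minus: "E3 x (- y) = - E3 x y"
  by (simp add: E3_def matrix_mult_minus sum_negf)

text \<open>Half the equation, multiplied by \<open>\<alpha> F\<^sup>2\<close>, is a polynomial of
  degree five in \<alpha> whose coefficients c0 to c5 are polynomials in y. It vanishes at \<alpha>
  and, by the equation at -y, also at -\<alpha>; the two conclusions are its divisibility by
  \<open>z\<^sup>2 - A\<close>, read off at z = 0 and at z = -\<beta>.\<close>

lemma soliton_polynomial:
  assumes x: "x \<in> U" and V: "diffV V x" and sol: "soliton_at k V x" and y: "y \<noteq> 0"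
  defines "n1 \<equiv> real CARD('n) - 1" and "A \<equiv> y \<bullet> (a x *v y)" and "\<beta> \<equiv> b x \<bullet> y" and "E \<equiv> y \<bullet> (e_lo a b x *v y)"
    and "h00 \<equiv> y \<bullet> (cov a (lower a V) x *v y)"
  defines "R1 \<equiv> y \<bullet> (ric_tensor a x *v y) - 2 * (y \<bullet> (t_lo a b x *v y)) - A * t_trace a b x
      + n1 * ((s_vec a b x \<bullet> y)\<^sup>2 + y \<bullet> (cov a (s_vec a b) x *v y))"
    and "m \<equiv> 2 * (divS x \<bullet> y - n1 * (s_vec a b x \<bullet> (s_up a b x *v y)))"
    and "g \<equiv> E3 x y / 2 + 2 * E * (s_vec a b x \<bullet> y)"
    and "f \<equiv> (s_up a b x *v y) \<bullet> (e_lo a b x *v y)" and "l \<equiv> lieB V x \<bullet> y"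
  defines "c0 \<equiv> \<beta>^3 * h00" and "c1 \<equiv> \<beta>^2 * R1 - n1*\<beta>*g + 3/4*n1*E^2 + 3*\<beta>^2*h00 + \<beta>^3*l - k*\<beta>^4"
    and "c2 \<equiv> 2*\<beta>*R1 + \<beta>^2*m - n1*(g - 2*\<beta>*f) + 3*\<beta>*h00 + 3*\<beta>^2*l - 4*k*\<beta>^3"
    and "c3 \<equiv> R1 + 2*\<beta>*m + 2*n1*f + h00 + 3*\<beta>*l - 6*k*\<beta>^2" and "c4 \<equiv> m + l - 4*k*\<beta>" and "c5 \<equiv> - k"
  shows "\<beta>^3 * h00 = A * (- c2 - c4 * A)"
    and "3/4*n1 * \<beta> * E^2 = (A - \<beta>\<^sup>2) * (c2 + c4 * (A + \<beta>\<^sup>2) - \<beta> * (c3 + c5 * (A + \<beta>\<^sup>2)))"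
proof -
  define \<alpha> where "\<alpha> = alpha a x y"
  have \<alpha>: "\<alpha> > 0" "\<alpha>\<^sup>2 = A" using alpha_pos[OF x y] alpha_sq[OF x, of y] by (simp_all add: \<alpha>_def A_def)
  have psi: "c0 + c1*z + c2*z^2 + c3*z^3 + c4*z^4 + c5*z^5 =
     z*(z+\<beta>)^2*(R1 + z*m) - n1*z*(z+\<beta>)*(g - 2*z*f) + 3/4*n1*z*E^2 + (z+\<beta>)^3*(h00 + z*l) - k*z*(z+\<beta>)^4" for z
    unfolding c0_def c1_def c2_def c3_def c4_def c5_def by (simp add: algebra_simps eval_nat_numeral)
  \<comment> \<open>Stated for an arbitrary z, since it is used with z = \<alpha> and with z =
    -\<alpha>.\<close>
  have key: "z*(z+\<beta>)^2*(R1 + z*m) - n1*z*(z+\<beta>)*(g - 2*z*f) + 3/4*n1*z*E^2 + (z+\<beta>)^3*(h00 + z*l) - k*z*(z+\<beta>)^4 = 0"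
    if z: "z \<noteq> 0" "z + \<beta> \<noteq> 0" and eq: "2 * (R1 + z*m - n1*((g - 2*z*f)/(z+\<beta>) - 3*E^2/(4*(z+\<beta>)^2))) + 2*(z+\<beta>)*(h00/z + l) = 2*k*(z+\<beta>)^2" for z
  proof -
    define p where "p = (g - 2*z*f)/(z+\<beta>)"
    define q where "q = 3*E^2/(4*(z+\<beta>)^2)"
    define r where "r = h00/z"
    have e: "g - 2*z*f = p*(z+\<beta>)" "3/4*E^2 = q*(z+\<beta>)^2" "h00 = r*z"
      using z by (simp_all add: p_def q_def r_def)
    have D: "R1 + z*m - n1*(p - q) + (z+\<beta>)*(r+l) - k*(z+\<beta>)^2 = 0"
      using eq unfolding p_def[symmetric] q_def[symmetric] r_def[symmetric] by (simp add: algebra_simps)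
    have "z*(z+\<beta>)^2*(R1 + z*m) - n1*z*(z+\<beta>)*(g - 2*z*f) + 3/4*n1*z*E^2 + (z+\<beta>)^3*(h00 + z*l) - k*z*(z+\<beta>)^4
      = z*(z+\<beta>)^2*(R1 + z*m) - n1*z*(z+\<beta>)*(p*(z+\<beta>)) + n1*z*(q*(z+\<beta>)^2) + (z+\<beta>)^3*(r*z + z*l) - k*z*(z+\<beta>)^4"
      unfolding e[symmetric] by simp
    also have "\<dots> = z*(z+\<beta>)^2 * (R1 + z*m - n1*(p - q) + (z+\<beta>)*(r+l) - k*(z+\<beta>)^2)"
      by (simp add: algebra_simps eval_nat_numeral)
    finally show ?thesis unfolding D by simp
  qed
  have half: "(e - 4 * z * h) / (2 * D) = (e / 2 - 2 * z * h) / D" for e z h D :: real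
    by (simp add: diff_divide_distrib)
  have k1: "c0 + c1*\<alpha> + c2*\<alpha>^2 + c3*\<alpha>^3 + c4*\<alpha>^4 + c5*\<alpha>^5 = 0"
    unfolding psi
  proof (rule key)
    show "\<alpha> \<noteq> 0" using \<alpha> by simp
    have F: "FF x y = \<alpha> + \<beta>" by (simp add: FF_def \<alpha>_def \<beta>_def)
    show nz: "\<alpha> + \<beta> \<noteq> 0" using FF_pos[OF x y] F by simp
    have Ric: "finsler_Ric FF x y = R1 + \<alpha>*m - n1*((g - 2*\<alpha>*f)/(\<alpha>+\<beta>) - 3*E^2/(4*(\<alpha>+\<beta>)^2))"
      unfolding finsler_Ric_general[OF x y] half F R1_def m_def g_def f_def E_def A_def[symmetric] \<alpha>_def[symmetric] \<alpha>(2) n1_def[symmetric]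
      by (simp add: add_divide_distrib diff_divide_distrib algebra_simps)
    show "2 * (R1 + \<alpha>*m - n1*((g - 2*\<alpha>*f)/(\<alpha>+\<beta>) - 3*E^2/(4*(\<alpha>+\<beta>)^2))) + 2*(\<alpha>+\<beta>)*(h00/\<alpha> + l) = 2*k*(\<alpha>+\<beta>)^2"
    proof -
      have "2 * finsler_Ric FF x y + lie_lift V (\<lambda>x y. (FF x y)\<^sup>2) x y = 2 * k * (FF x y)\<^sup>2"
        using sol y by (simp add: soliton_at_def)
      thus ?thesis unfolding lie_lift_F2[OF x y V] h00_def[symmetric] l_def[symmetric] \<alpha>_def[symmetric] Ric F .
    qed
  qed
  \<comment> \<open>Under y \<mapsto> -y the quantities \<beta>, g, m and l change sign, while
    \<alpha>, R1, E, f and h00 do not. The equation at -y is therefore the one at y with \<alpha>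
    replaced by -\<alpha>.\<close>
  have k2: "c0 + c1*(-\<alpha>) + c2*(-\<alpha>)^2 + c3*(-\<alpha>)^3 + c4*(-\<alpha>)^4 + c5*(-\<alpha>)^5 = 0"
    unfolding psi
  proof (rule key)
    show "-\<alpha> \<noteq> 0" using \<alpha> by simp
    have y': "- y \<noteq> 0" using y by simp
    have F: "FF x (-y) = \<alpha> - \<beta>" by (simp add: FF_def \<alpha>_def \<beta>_def alpha_minus)
    have nz: "\<alpha> - \<beta> \<noteq> 0" using FF_pos[OF x y'] F by simp
    thus nz': "-\<alpha> + \<beta> \<noteq> 0" by simp
    have Ric: "finsler_Ric FF x (-y) = R1 - \<alpha>*m - n1*((- g - 2*\<alpha>*f)/(\<alpha>-\<beta>) - 3*E^2/(4*(\<alpha>-\<beta>)^2))"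
      unfolding finsler_Ric_general[OF x y'] half F R1_def m_def g_def f_def E_def matrix_mult_minus inner_minus_left inner_minus_right
        minus_minus A_def[symmetric] alpha_minus E3_minus \<alpha>_def[symmetric] \<alpha>(2) n1_def[symmetric] power2_minus
      by (simp add: add_divide_distrib diff_divide_distrib algebra_simps)
    have "2 * finsler_Ric FF x (-y) + 2*(\<alpha>-\<beta>)*(h00/\<alpha> - l) = 2*k*(\<alpha>-\<beta>)^2"
    proof -
      have "2 * finsler_Ric FF x (-y) + lie_lift V (\<lambda>x y. (FF x y)\<^sup>2) x (-y) = 2 * k * (FF x (-y))\<^sup>2"
        using sol y' by (simp add: soliton_at_def)
      moreover have "lieB V x \<bullet> (-y) = - l" "(-y) \<bullet> (cov a (lower a V) x *v (-y)) = h00"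
        by (simp_all add: l_def h00_def matrix_mult_minus)
      ultimately show ?thesis
        unfolding lie_lift_F2[OF x y' V] alpha_minus \<alpha>_def[symmetric] F by (simp only:) simp
    qed
    moreover have "(- g - 2*\<alpha>*f)/(\<alpha>-\<beta>) = (g - 2*(-\<alpha>)*f)/(-\<alpha>+\<beta>)" using nz nz' by (simp add: field_simps)
    moreover have "(\<alpha>-\<beta>)^2 = (-\<alpha>+\<beta>)^2" by (simp add: power2_eq_square algebra_simps)
    moreover have "2*(\<alpha>-\<beta>)*(h00/\<alpha> - l) = 2*(-\<alpha>+\<beta>)*(h00/(-\<alpha>) + l)" by (simp add: algebra_simps)
    ultimately show "2 * (R1 + (-\<alpha>)*m - n1*((g - 2*(-\<alpha>)*f)/(-\<alpha>+\<beta>) - 3*E^2/(4*(-\<alpha>+\<beta>)^2))) + 2*(-\<alpha>+\<beta>)*(h00/(-\<alpha>) + l) = 2*k*(-\<alpha>+\<beta>)^2"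
      unfolding Ric by simp
  qed
  have nz: "\<alpha> \<noteq> 0" using \<alpha> by simp
  show "\<beta>^3 * h00 = A * (- c2 - c4 * A)"
    using even_odd_divisible(1)[OF k1 k2 \<alpha>(2) nz] by (simp add: c0_def)
  \<comment> \<open>At z = -\<beta> every term with a factor z + \<beta> drops out, and only the one
    with the square of E is left.\<close>
  have "- (c0 + c1*(-\<beta>) + c2*(-\<beta>)^2 + c3*(-\<beta>)^3 + c4*(-\<beta>)^4 + c5*(-\<beta>)^5) = 3/4*n1*\<beta>*E^2"
    unfolding psi by simp
  thus "3/4*n1 * \<beta> * E^2 = (A - \<beta>\<^sup>2) * (c2 + c4 * (A + \<beta>\<^sup>2) - \<beta> * (c3 + c5 * (A + \<beta>\<^sup>2)))"
    using even_odd_divisible(2)[OF k1 k2 \<alpha>(2) nz, of \<beta>] by simp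
qed

lemma polyfun_intros_chart:
  "polyfun (\<lambda>\<tau>. E3 x (u + \<tau> *\<^sub>R v))"
  "polyfun (\<lambda>\<tau>. s_vec a b x \<bullet> (s_up a b x *v (u + \<tau> *\<^sub>R v)))"
  "polyfun (\<lambda>\<tau>. (s_up a b x *v (u + \<tau> *\<^sub>R v)) \<bullet> (e_lo a b x *v (u + \<tau> *\<^sub>R v)))"
  unfolding E3_def
  by (intro polyfun_sum polyfun_mult polyfun_nth polyfun_quad)
    (use polyfun_lin[of "transpose (s_up a b x) *v s_vec a b x" u v]
       polyfun_quad[of u v "transpose (s_up a b x) ** e_lo a b x"] in
     \<open>simp_all add: inner_transpose[of "s_vec a b x"] matrix_vector_mul_assoc[symmetric] inner_transpose[of "u + _ *\<^sub>R v" "transpose (s_up a b x)"]\<close>)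

text \<open>By \<open>soliton_polynomial\<close>, \<open>\<beta>\<^sup>3 V_{0;0}\<close> is
  divisible by \<open>\<alpha>\<^sup>2\<close>, and \<beta> times the square of e00 by
  \<open>\<alpha>\<^sup>2 - \<beta>\<^sup>2\<close>. Both divisors are positive definite, the second
  because b < 1, so \<open>quad_divisible_imp_proportional\<close> applies with w = b; it needs a
  nonzero vector that is dual to b for the form in question, and this is where b \<noteq> 0
  enters.\<close>

theorem soliton_imp_conformal:
  assumes x: "x \<in> U" and V: "diffV V x" and sol: "soliton_at k V x" and bx: "b x \<noteq> 0" and n: "CARD('n) \<ge> 2"
  shows "\<exists>\<sigma>. e_lo a b x = (2 * \<sigma>) *\<^sub>R (a x - outer (b x) (b x))"
    and "\<exists>c. cov a (lower a V) x + transpose (cov a (lower a V) x) = (4 * c) *\<^sub>R a x"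
proof -
  let ?W = "cov a (lower a V) x + transpose (cov a (lower a V) x)"
  have r: "a x *v raise a b x = b x" by (simp add: raise_eq a_ainv_vec x)
  have rz: "raise a b x \<noteq> 0" using r bx by auto
  have Wsym: "transpose ?W = ?W" by (simp add: transpose_add add.commute)
  have Wq: "y \<bullet> (?W *v y) = 2 * (y \<bullet> (cov a (lower a V) x *v y))" for y
    using quad_transpose[of "cov a (lower a V) x" y] by (simp add: matrix_linear_simps inner_add_right quad_inner)
  \<comment> \<open>\<open>?W\<close> is twice the symmetric part of \<open>V_{i;j}\<close>, hence
    the constant 1/2.\<close>
  have d: "1/2 * (b x \<bullet> y) ^ 3 * (y \<bullet> (?W *v y)) ^ 1 = (b x \<bullet> y) ^ 3 * (y \<bullet> (cov a (lower a V) x *v y))" for y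
    by (simp add: Wq)
  have "\<exists>\<mu>. ?W = \<mu> *\<^sub>R a x"
    by (rule quad_divisible_imp_proportional[OF a_sym[OF x] quad_a_pos[OF x] Wsym r rz, where j=1 and i=3 and c="1/2"])
      (assumption, simp, simp, subst d, rule soliton_polynomial(1)[OF x V sol], assumption,
        (rule polyfun_const polyfun_intros_chart polyfun_lin polyfun_quad polyfun_add polyfun_diff polyfun_mult polyfun_uminus polyfun_divide polyfun_power)+)
  then obtain \<mu> where "?W = \<mu> *\<^sub>R a x" ..
  thus "\<exists>c. ?W = (4 * c) *\<^sub>R a x" by (intro exI[of _ "\<mu> / 4"]) simp
  let ?H = "a x - outer (b x) (b x)"
  have Hs: "transpose ?H = ?H" by (simp add: transpose_diff a_sym x transpose_outer)
  have Hq: "y \<bullet> (?H *v y) = y \<bullet> (a x *v y) - (b x \<bullet> y)\<^sup>2" for y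
    by (simp add: matrix_linear_simps outer_mult inner_diff_right inner_commute[of y "b x"] power2_eq_square)
  have Hp: "0 < y \<bullet> (?H *v y)" if "y \<noteq> 0" for y
  proof -
    have "\<bar>b x \<bullet> y\<bar>\<^sup>2 < (alpha a x y)\<^sup>2" by (intro power_strict_mono beta_lt_alpha x that) auto
    thus ?thesis by (simp add: Hq alpha_sq x)
  qed
  have B: "1 - bsq x \<noteq> 0" using bsq_bounds[OF x] by simp
  \<comment> \<open>The dual vector of b for the form \<open>?H\<close>: \<open>?H\<close> maps the
    raised b to (1 - \<open>bsq x\<close>) b.\<close>
  let ?z = "(1 / (1 - bsq x)) *\<^sub>R raise a b x"
  have z: "?H *v ?z = b x"
  proof -
    have "?H *v raise a b x = (1 - bsq x) *\<^sub>R b x"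
      by (simp add: matrix_linear_simps r outer_mult bsq_def[symmetric] scaleR_diff_left)
    thus ?thesis using B by (simp add: matrix_vector_mult_scaleR)
  qed
  have z0: "?z \<noteq> 0" using rz B by simp
  \<comment> \<open>The dimension enters here: in dimension one the square of e00 would disappear
    from the identity.\<close>
  have n1: "3/4 * (real CARD('n) - 1) \<noteq> 0" using n by simp
  have "\<exists>\<mu>. e_lo a b x = \<mu> *\<^sub>R ?H"
    by (rule quad_divisible_imp_proportional[OF Hs Hp e_lo_sym z z0 _ n1, where j=2 and i=1])
      (assumption, simp, unfold Hq power_one_right, rule soliton_polynomial(2)[OF x V sol], assumption,
        (rule polyfun_const polyfun_intros_chart polyfun_lin polyfun_quad polyfun_add polyfun_diff polyfun_mult polyfun_uminus polyfun_divide polyfun_power)+)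
  then obtain \<mu> where "e_lo a b x = \<mu> *\<^sub>R ?H" ..
  thus "\<exists>\<sigma>. e_lo a b x = (2 * \<sigma>) *\<^sub>R ?H" by (intro exI[of _ "\<mu> / 2"]) simp
qed

end

section \<open>The soliton equation for conformal \<open>V\<close> and \<open>e\<^sub>0\<^sub>0 = 2\<sigma>(\<alpha>\<^sup>2 - \<beta>\<^sup>2)\<close>\<close>

context randers_chart
begin

definition grad :: "(real^'n \<Rightarrow> real) \<Rightarrow> real^'n \<Rightarrow> real^'n" where
  "grad \<sigma> x = (\<chi> k. pd k \<sigma> x)"

text \<open>As e00 = 2\<sigma>(\<alpha> - \<beta>)F, all denominators F cancel. What is left is of
  degree one in \<alpha> with coefficients polynomial in y, so that even and odd parts can be read
  off.\<close>

lemma finsler_Ric_conformal: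
  fixes \<sigma> :: "real^'n \<Rightarrow> real"
  assumes x: "x \<in> U" and y: "y \<noteq> 0" and \<sigma>: "\<sigma> differentiable (at x)"
    and e: "\<And>z. z \<in> U \<Longrightarrow> e_lo a b z = (2 * \<sigma> z) *\<^sub>R (a z - outer (b z) (b z))"
  defines "\<beta> \<equiv> b x \<bullet> y" and "A \<equiv> y \<bullet> (a x *v y)" and "sy \<equiv> s_vec a b x \<bullet> y"
  shows "finsler_Ric FF x y = y \<bullet> (ric_tensor a x *v y) + 2 * alpha a x y * (divS x \<bullet> y) - 2 * (y \<bullet> (t_lo a b x *v y))
     - A * t_trace a b x
     - (real CARD('n) - 1) * ((grad \<sigma> x \<bullet> y) * (alpha a x y - \<beta>) - (\<sigma> x)\<^sup>2 * (3 * A - 2 * alpha a x y * \<beta> - \<beta>\<^sup>2)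
       + 4 * \<sigma> x * alpha a x y * sy - sy\<^sup>2 - y \<bullet> (cov a (s_vec a b) x *v y)
       + 2 * alpha a x y * (s_vec a b x \<bullet> (s_up a b x *v y)))"
proof -
  define \<alpha> where "\<alpha> = alpha a x y"
  have A: "A = \<alpha>\<^sup>2" using alpha_sq[OF x, of y] by (simp add: \<alpha>_def A_def)
  have F: "FF x y = \<alpha> + \<beta>" by (simp add: FF_def \<alpha>_def \<beta>_def)
  have nz: "\<alpha> + \<beta> \<noteq> 0" using FF_pos[OF x y] F by simp
  have dO: "diffM (\<lambda>x. a x - outer (b x) (b x)) x" by (intro diffM_diff diffM_outer diff_a diffs x)
  have p2: "pd k (\<lambda>x. 2 * \<sigma> x) x = 2 * pd k \<sigma> x" for k
    using pd_mult[OF _ \<sigma>, of "\<lambda>_. 2"] by simp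
  have d2: "(\<lambda>x. 2 * \<sigma> x) differentiable (at x)" using \<sigma> by simp
  have ey: "e_lo a b x *v v = (2 * \<sigma> x) *\<^sub>R (a x *v v - (b x \<bullet> v) *\<^sub>R b x)" for v
    by (simp add: e[OF x] matrix_linear_simps outer_mult scaleR_matrix_vector_assoc[symmetric])
  have E: "y \<bullet> (e_lo a b x *v y) = 2 * \<sigma> x * (\<alpha>\<^sup>2 - \<beta>\<^sup>2)"
    by (simp add: ey inner_diff_right A_def[symmetric] A \<beta>_def inner_commute[of y "b x"] power2_eq_square)
  have f: "(s_up a b x *v y) \<bullet> (e_lo a b x *v y) = - 2 * \<sigma> x * \<beta> * sy"
    using ay_s_up[OF x, of y] s0_up[OF x, of y]
    by (simp add: ey inner_diff_right \<beta>_def sy_def inner_commute[of "s_up a b x *v y"])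
  have ck: "covM k (e_lo a b) x = (2 * pd k \<sigma> x) *\<^sub>R (a x - outer (b x) (b x))
      + (2 * \<sigma> x) *\<^sub>R (- (outer (covV k b x) (b x) + outer (b x) (covV k b x)))" for k
  proof -
    have "covM k (e_lo a b) x = covM k (\<lambda>z. (2 * \<sigma> z) *\<^sub>R (a z - outer (b z) (b z))) x"
      by (rule covM_cong[OF x e])
    also have "covM k (\<lambda>z. (2 * \<sigma> z) *\<^sub>R (a z - outer (b z) (b z))) x
        = (2 * pd k \<sigma> x) *\<^sub>R (a x - outer (b x) (b x)) + (2 * \<sigma> x) *\<^sub>R covM k (\<lambda>z. a z - outer (b z) (b z)) x"
      by (simp add: covM_scaleR[OF d2 dO] p2)
    also have "covM k (\<lambda>z. a z - outer (b z) (b z)) x = - (outer (covV k b x) (b x) + outer (b x) (covV k b x))"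
      by (simp add: covM_diff diff_a diffM_outer diffs x covM_a covM_outer)
    finally show ?thesis .
  qed
  have yk: "y \<bullet> (covM k (e_lo a b) x *v y) = 2 * pd k \<sigma> x * (\<alpha>\<^sup>2 - \<beta>\<^sup>2) - 4 * \<sigma> x * \<beta> * (column k (cov a b x) \<bullet> y)" for k
    unfolding ck by (simp add: matrix_linear_simps matrix_mult_minus outer_mult scaleR_matrix_vector_assoc[symmetric] inner_diff_right inner_add_right
        A_def[symmetric] A \<beta>_def inner_commute[of y "b x"] inner_commute[of y "covV k b x"] cov_column[OF x] power2_eq_square algebra_simps)
  have "E3 x y = (\<Sum>k\<in>UNIV. 2 * (\<alpha>\<^sup>2 - \<beta>\<^sup>2) * (pd k \<sigma> x * y $ k) - 4 * \<sigma> x * \<beta> * (y $ k * (column k (cov a b x) \<bullet> y)))"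
    unfolding E3_def yk by (rule sum.cong[OF refl]) (simp add: algebra_simps)
  also have "\<dots> = 2 * (\<alpha>\<^sup>2 - \<beta>\<^sup>2) * (grad \<sigma> x \<bullet> y) - 4 * \<sigma> x * \<beta> * (\<Sum>k\<in>UNIV. y $ k * (column k (cov a b x) \<bullet> y))"
    by (simp only: sum_subtractf sum_distrib_left[symmetric] grad_def inner_vec_def inner_real_def vec_lambda_beta)
  also have "(\<Sum>k\<in>UNIV. y $ k * (column k (cov a b x) \<bullet> y)) = y \<bullet> (cov a b x *v y)"
  proof -
    have "(\<Sum>k\<in>UNIV. y $ k * (column k (cov a b x) \<bullet> y)) = y \<bullet> (transpose (cov a b x) *v y)"
      by (simp only: column_inner inner_vec_def[of y "transpose (cov a b x) *v y"] inner_real_def)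
    thus ?thesis using quad_transpose[of "cov a b x" y] by (simp only: quad_inner)
  qed
  also have "y \<bullet> (cov a b x *v y) = 2 * \<sigma> x * (\<alpha>\<^sup>2 - \<beta>\<^sup>2) - 2 * \<beta> * sy"
    by (simp add: cov_b_quad x E \<beta>_def sy_def)
  finally have E3: "E3 x y = 2 * (\<alpha>\<^sup>2 - \<beta>\<^sup>2) * (grad \<sigma> x \<bullet> y) - 4 * \<sigma> x * \<beta> * (2 * \<sigma> x * (\<alpha>\<^sup>2 - \<beta>\<^sup>2) - 2 * \<beta> * sy)" .
  have "(E3 x y - 4 * \<alpha> * (- 2 * \<sigma> x * \<beta> * sy)) / (2 * (\<alpha> + \<beta>)) - 3 * (2 * \<sigma> x * (\<alpha>\<^sup>2 - \<beta>\<^sup>2))\<^sup>2 / (4 * (\<alpha> + \<beta>)\<^sup>2) + 2 * (2 * \<sigma> x * (\<alpha>\<^sup>2 - \<beta>\<^sup>2)) * sy / (\<alpha> + \<beta>)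
     = (grad \<sigma> x \<bullet> y) * (\<alpha> - \<beta>) - (\<sigma> x)\<^sup>2 * (3 * \<alpha>\<^sup>2 - 2 * \<alpha> * \<beta> - \<beta>\<^sup>2) + 4 * \<sigma> x * \<alpha> * sy"
  proof -
    \<comment> \<open>Neither summand is divisible by F alone; the terms with \<sigma>\<beta>s
      combine to a multiple of \<alpha> + \<beta>.\<close>
    have "E3 x y - 4 * \<alpha> * (- 2 * \<sigma> x * \<beta> * sy) = (2 * (\<alpha> + \<beta>)) * ((grad \<sigma> x \<bullet> y) * (\<alpha> - \<beta>) - 4 * (\<sigma> x)\<^sup>2 * \<beta> * (\<alpha> - \<beta>) + 4 * \<sigma> x * \<beta> * sy)"
      unfolding E3 by (simp add: algebra_simps power2_eq_square)
    hence 1: "(E3 x y - 4 * \<alpha> * (- 2 * \<sigma> x * \<beta> * sy)) / (2 * (\<alpha> + \<beta>)) = (grad \<sigma> x \<bullet> y) * (\<alpha> - \<beta>) - 4 * (\<sigma> x)\<^sup>2 * \<beta> * (\<alpha> - \<beta>) + 4 * \<sigma> x * \<beta> * sy"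
      using nz by simp
    have "3 * (2 * \<sigma> x * (\<alpha>\<^sup>2 - \<beta>\<^sup>2))\<^sup>2 = (4 * (\<alpha> + \<beta>)\<^sup>2) * (3 * (\<sigma> x)\<^sup>2 * (\<alpha> - \<beta>)\<^sup>2)"
      by (simp add: algebra_simps power2_eq_square)
    hence 2: "3 * (2 * \<sigma> x * (\<alpha>\<^sup>2 - \<beta>\<^sup>2))\<^sup>2 / (4 * (\<alpha> + \<beta>)\<^sup>2) = 3 * (\<sigma> x)\<^sup>2 * (\<alpha> - \<beta>)\<^sup>2"
      using nz by simp
    have "2 * (2 * \<sigma> x * (\<alpha>\<^sup>2 - \<beta>\<^sup>2)) * sy = (\<alpha> + \<beta>) * (4 * \<sigma> x * (\<alpha> - \<beta>) * sy)"
      by (simp add: algebra_simps power2_eq_square)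
    hence 3: "2 * (2 * \<sigma> x * (\<alpha>\<^sup>2 - \<beta>\<^sup>2)) * sy / (\<alpha> + \<beta>) = 4 * \<sigma> x * (\<alpha> - \<beta>) * sy"
      using nz by (metis nonzero_mult_div_cancel_left)
    show ?thesis unfolding 1 2 3 by (simp add: algebra_simps power2_eq_square)
  qed
  thus ?thesis
    unfolding finsler_Ric_general[OF x y] F E f \<alpha>_def[symmetric] sy_def[symmetric] A by (simp only:)
qed

text \<open>The equation at x has the form ev + \<alpha> od = 0 with ev even and od odd in y, so
  both vanish. Each still contains the covector X, and the two stated identities amount to the even
  part together with X = 0.\<close>

theorem soliton_iff:
  fixes \<sigma> :: "real^'n \<Rightarrow> real" and n k c :: real
  assumes n: "n = real CARD('n)" and x: "x \<in> U" and \<sigma>: "\<sigma> differentiable (at x)"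
    and e: "\<And>z. z \<in> U \<Longrightarrow> e_lo a b z = (2 * \<sigma> z) *\<^sub>R (a z - outer (b z) (b z))"
    and V: "diffV V x" and conf: "cov a (lower a V) x + transpose (cov a (lower a V) x) = (4 * c) *\<^sub>R a x"
  shows "soliton_at k V x \<longleftrightarrow>
     (\<forall>y. quad (ric_tensor a x) y = (k - 2 * c) * (quad (a x) y + (b x \<bullet> y)\<^sup>2) + t_trace a b x * quad (a x) y
       + 2 * quad (t_lo a b x) y - (n-1) * (\<sigma> x)\<^sup>2 * (3 * quad (a x) y - (b x \<bullet> y)\<^sup>2)
       + 2 * (n-1) * (grad \<sigma> x \<bullet> y) * (b x \<bullet> y) - (n-1) * ((s_vec a b x \<bullet> y)\<^sup>2 + quad (cov a (s_vec a b) x) y)) \<and>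
     (3 * (n-1)) *\<^sub>R grad \<sigma> x = (2 * c) *\<^sub>R b x - lieB V x"
    (is "_ \<longleftrightarrow> (\<forall>y. ?ric y = ?rhs y) \<and> _")
proof -
  \<comment> \<open>The defect of the equation for \<sigma>.\<close>
  define X where "X = (3 * (n-1)) *\<^sub>R grad \<sigma> x - (2 * c) *\<^sub>R b x + lieB V x"
  define B where "B = bsq x"
  define bu where "bu = raise a b x"
  have B: "0 \<le> B" "B < 1" unfolding B_def by (rule bsq_bounds[OF x])+
  have Bb: "b x \<bullet> bu = B" by (simp add: B_def bu_def bsq_def)
  define odn where "odn y \<longleftrightarrow> 2 * (divS x \<bullet> y) = (n-1) * (4 * (grad \<sigma> x \<bullet> y) + 2 * (\<sigma> x)\<^sup>2 * (b x \<bullet> y) + 4 * \<sigma> x * (s_vec a b x \<bullet> y)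
     + 2 * (s_vec a b x \<bullet> (s_up a b x *v y))) - X \<bullet> y + 2 * (k - 2 * c) * (b x \<bullet> y)" for y
  define evn where "evn y \<longleftrightarrow> ?ric y = ?rhs y - (X \<bullet> y) * (b x \<bullet> y)" for y
  define ev where "ev y = ?ric y - 2 * quad (t_lo a b x) y - t_trace a b x * quad (a x) y
     + (n-1) * ((grad \<sigma> x \<bullet> y) * (b x \<bullet> y) + (\<sigma> x)\<^sup>2 * (3 * quad (a x) y - (b x \<bullet> y)\<^sup>2) + (s_vec a b x \<bullet> y)\<^sup>2 + quad (cov a (s_vec a b) x) y)
     + 2 * c * quad (a x) y + (b x \<bullet> y) * (lieB V x \<bullet> y) - k * (quad (a x) y + (b x \<bullet> y)\<^sup>2)" for y
  define od where "od y = 2 * (divS x \<bullet> y) - (n-1) * (grad \<sigma> x \<bullet> y + 2 * (\<sigma> x)\<^sup>2 * (b x \<bullet> y) + 4 * \<sigma> x * (s_vec a b x \<bullet> y)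
     + 2 * (s_vec a b x \<bullet> (s_up a b x *v y))) + lieB V x \<bullet> y + 2 * c * (b x \<bullet> y) - 2 * k * (b x \<bullet> y)" for y
  have eo: "evn y \<longleftrightarrow> ev y = 0" "odn y \<longleftrightarrow> od y = 0" for y
    by (auto simp: evn_def odn_def ev_def od_def X_def inner_add_left inner_diff_left power2_eq_square algebra_simps)
  have cov2: "y \<bullet> (cov a (lower a V) x *v y) = 2 * c * quad (a x) y" for y
  proof -
    have "quad (cov a (lower a V) x + transpose (cov a (lower a V) x)) y = 4 * c * quad (a x) y"
      by (simp add: conf quad_scaleR)
    thus ?thesis by (simp add: quad_add quad_transpose quad_inner[symmetric])
  qed
  have eq: "2 * finsler_Ric FF x y + lie_lift V (\<lambda>x y. (FF x y)\<^sup>2) x y - 2 * k * (FF x y)\<^sup>2 = 2 * (ev y + alpha a x y * od y)" if y: "y \<noteq> 0" for y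
  proof -
    define \<alpha> where "\<alpha> = alpha a x y"
    have al: "\<alpha> \<noteq> 0" using alpha_pos[OF x y] by (simp add: \<alpha>_def)
    have A: "quad (a x) y = \<alpha>\<^sup>2" "y \<bullet> (a x *v y) = \<alpha>\<^sup>2" using alpha_sq[OF x, of y] by (simp_all add: \<alpha>_def quad_inner)
    have h: "2 * c * \<alpha>\<^sup>2 / \<alpha> = 2 * c * \<alpha>" using al by (simp add: power2_eq_square)
    have F: "FF x y = \<alpha> + b x \<bullet> y" by (simp add: FF_def \<alpha>_def)
    have Ric: "finsler_Ric FF x y = y \<bullet> (ric_tensor a x *v y) + 2 * alpha a x y * (divS x \<bullet> y) - 2 * (y \<bullet> (t_lo a b x *v y))
       - (y \<bullet> (a x *v y)) * t_trace a b x
       - (real CARD('n) - 1) * ((grad \<sigma> x \<bullet> y) * (alpha a x y - b x \<bullet> y) - (\<sigma> x)\<^sup>2 * (3 * (y \<bullet> (a x *v y)) - 2 * alpha a x y * (b x \<bullet> y) - (b x \<bullet> y)\<^sup>2)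
       + 4 * \<sigma> x * alpha a x y * (s_vec a b x \<bullet> y) - (s_vec a b x \<bullet> y)\<^sup>2 - y \<bullet> (cov a (s_vec a b) x *v y)
       + 2 * alpha a x y * (s_vec a b x \<bullet> (s_up a b x *v y)))"
      by (rule finsler_Ric_conformal[OF x y \<sigma>]) (rule e)
    show ?thesis
      unfolding Ric lie_lift_F2[OF x y V] cov2 \<alpha>_def[symmetric] A h F ev_def od_def n[symmetric]
      by (simp add: quad_inner[symmetric] A power2_eq_square algebra_simps)
  qed
  have evm: "ev (- y) = ev y" and odm: "od (- y) = - od y" for y
    by (simp_all add: ev_def od_def quad_inner matrix_mult_minus algebra_simps)
  have sol: "soliton_at k V x \<longleftrightarrow> (\<forall>y. evn y \<and> odn y)"
  proof
    assume s: "soliton_at k V x"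
    show "\<forall>y. evn y \<and> odn y"
    proof
      fix y show "evn y \<and> odn y"
      proof (cases "y = 0")
        case True thus ?thesis unfolding eo by (simp add: ev_def od_def quad_inner)
      next
        case False
        hence "- y \<noteq> 0" by simp
        have "2 * (ev y + alpha a x y * od y) = 0" "2 * (ev (-y) + alpha a x (-y) * od (-y)) = 0"
          unfolding eq[OF False, symmetric] eq[OF \<open>- y \<noteq> 0\<close>, symmetric] using s False by (auto simp: soliton_at_def)
        hence "ev y + alpha a x y * od y = 0" "ev y - alpha a x y * od y = 0" by (simp_all add: evm odm alpha_minus)
        hence "ev y = 0" "alpha a x y * od y = 0" by linarith+
        thus ?thesis unfolding eo using alpha_pos[OF x False] by simp
      qed
    qed
  next
    assume "\<forall>y. evn y \<and> odn y"
    hence z: "ev y = 0" "od y = 0" for y using eo by auto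
    show "soliton_at k V x" unfolding soliton_at_def
    proof (intro allI impI)
      fix y :: "real^'n" assume "y \<noteq> 0"
      from eq[OF this] z show "2 * finsler_Ric FF x y + lie_lift V (\<lambda>x y. (FF x y)\<^sup>2) x y = 2 * k * (FF x y)\<^sup>2" by simp
    qed
  qed
  \<comment> \<open>The contracted Ricci identity, applied to the even part with its X-term: an
    expression for the divergence independent of the odd part. For X = 0 it is the odd part.\<close>
  have div: "2 * (divS x \<bullet> y) = (n-1) * (4 * (grad \<sigma> x \<bullet> y) + 2 * (\<sigma> x)\<^sup>2 * (b x \<bullet> y) + 4 * \<sigma> x * (s_vec a b x \<bullet> y)
     + 2 * (s_vec a b x \<bullet> (s_up a b x *v y))) + 2 * (k - 2 * c) * (b x \<bullet> y)
     - (B * (X \<bullet> y) + (X \<bullet> bu) * (b x \<bullet> y)) + 2 * (B / (1 + B) * (X \<bullet> bu)) * (b x \<bullet> y)" if ev: "\<And>y. evn y" for y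
  proof -
    have \<tau>: "s_vec a b x \<bullet> (s_up a b x *v y) = - ((s_lo a b x *v (ainv a x *v s_vec a b x)) \<bullet> y)"
    proof -
      have "s_vec a b x \<bullet> (s_up a b x *v y) = (ainv a x *v s_vec a b x) \<bullet> (s_lo a b x *v y)"
        by (subst s_up_eq, subst matrix_vector_mul_assoc[symmetric], rule sym_inner[OF ainv_sym[OF x]])
      also have "\<dots> = - (y \<bullet> (s_lo a b x *v (ainv a x *v s_vec a b x)))" by (rule skew_inner[OF s_lo_skew])
      finally show ?thesis by (simp only: inner_commute)
    qed
    have dS: "divS x = (n-1) *\<^sub>R (2 *\<^sub>R grad \<sigma> x + (\<sigma> x)\<^sup>2 *\<^sub>R b x + (2 * \<sigma> x) *\<^sub>R s_vec a b x
       - s_lo a b x *v (ainv a x *v s_vec a b x)) + (k - 2 * c) *\<^sub>R b x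
     - (1/2) *\<^sub>R (bsq x *\<^sub>R X + (X \<bullet> raise a b x) *\<^sub>R b x) + (bsq x / (1 + bsq x) * (X \<bullet> raise a b x)) *\<^sub>R b x"
      by (rule divS_formula[OF n x \<sigma> e]) (use ev in \<open>simp_all add: evn_def grad_def\<close>)
    show ?thesis unfolding \<tau> B_def bu_def dS
      by (simp add: inner_add_left inner_diff_left algebra_simps)
  qed
  have "(\<forall>y. evn y \<and> odn y) \<longleftrightarrow> (\<forall>y. evn y) \<and> X = 0"
  proof safe
    fix y assume ev: "\<forall>y. evn y" "X = 0"
    thus "odn y" unfolding odn_def using div[of y] by simp
  next
    assume eo: "\<forall>y. evn y \<and> odn y"
    \<comment> \<open>The difference of the two expressions for the divergence. Evaluated at the
      raised b it is X(b) times (1 - B)/(1 + B), so X(b) = 0; what then remains is (1 - B)X =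
      0.\<close>
    have Xy: "X \<bullet> y = B * (X \<bullet> y) + (X \<bullet> bu) * (b x \<bullet> y) - 2 * (B / (1 + B) * (X \<bullet> bu)) * (b x \<bullet> y)" for y
      using div[of y] eo unfolding odn_def by auto
    have "X \<bullet> bu = B * (X \<bullet> bu) + (X \<bullet> bu) * B - 2 * (B / (1 + B) * (X \<bullet> bu)) * B"
      using Xy[of bu] by (simp add: Bb)
    hence "(X \<bullet> bu) * (1 - 2 * B + 2 * B * (B / (1 + B))) = 0" by (simp add: algebra_simps)
    moreover have "1 - 2 * B + 2 * B * (B / (1 + B)) = (1 - B) / (1 + B)" using B by (simp add: field_simps)
    ultimately have "X \<bullet> bu = 0" using B by simp
    hence "(1 - B) * (X \<bullet> X) = 0" using Xy[of X] by (simp add: algebra_simps)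
    thus "X = 0" using B by simp
  qed auto
  also have "\<dots> \<longleftrightarrow> (\<forall>y. ?ric y = ?rhs y) \<and> X = 0" by (auto simp: evn_def)
  also have "X = 0 \<longleftrightarrow> (3 * (n-1)) *\<^sub>R grad \<sigma> x = (2 * c) *\<^sub>R b x - lieB V x"
    by (auto simp: X_def algebra_simps eq_neg_iff_add_eq_0)
  finally show ?thesis unfolding sol .
qed

end

section \<open>Unique continuation\<close>

lemma gronwall_zero:
  fixes f :: "real \<Rightarrow> real"
  assumes d: "\<And>t. 0 \<le> t \<Longrightarrow> t \<le> 1 \<Longrightarrow> (f has_real_derivative f' t) (at t)"
    and le: "\<And>t. 0 \<le> t \<Longrightarrow> t \<le> 1 \<Longrightarrow> f' t \<le> C * f t" and f0: "f 0 = 0"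
  shows "f 1 \<le> 0"
proof -
  have "f 1 * exp (- C * 1) \<le> f 0 * exp (- C * 0)"
  proof (rule DERIV_nonpos_imp_nonincreasing[where f="\<lambda>t. f t * exp (- C * t)"])
    fix t :: real assume t: "0 \<le> t" "t \<le> 1"
    have "((\<lambda>t. f t * exp (- C * t)) has_real_derivative (f' t - C * f t) * exp (- C * t)) (at t)"
      by (auto intro!: derivative_eq_intros d[OF t] simp: algebra_simps)
    moreover have "(f' t - C * f t) * exp (- C * t) \<le> 0" using le[OF t] by (intro mult_nonpos_nonneg) auto
    ultimately show "\<exists>y. ((\<lambda>t. f t * exp (- C * t)) has_real_derivative y) (at t) \<and> y \<le> 0" by blast
  qed simp
  thus ?thesis using f0 by (simp add: mult_le_0_iff)
qed

text \<open>Along the segment from q to x, the sum of the squares of all functions in Z satisfies a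
  linear differential inequality and starts at 0.\<close>

lemma linear_system_zero:
  fixes Z :: "(real^'n::finite \<Rightarrow> real) set"
  assumes fin: "finite Z" and conv: "convex S" and diff: "\<And>z x. z \<in> Z \<Longrightarrow> x \<in> S \<Longrightarrow> z differentiable (at x)"
    and bd: "\<And>z x k. z \<in> Z \<Longrightarrow> x \<in> S \<Longrightarrow> \<bar>pd k z x\<bar> \<le> C * (\<Sum>w\<in>Z. \<bar>w x\<bar>)"
    and q: "q \<in> S" "\<And>z. z \<in> Z \<Longrightarrow> z q = 0" and x: "x \<in> S" and z: "z \<in> Z"
  shows "z x = 0"
proof -
  let ?l = "\<lambda>t. q + t *\<^sub>R (x - q)"
  let ?f = "\<lambda>t. \<Sum>z\<in>Z. (z (?l t))\<^sup>2"
  let ?d = "\<lambda>z t. \<Sum>k\<in>UNIV. (x - q) $ k * pd k z (?l t)"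
  have l: "?l t \<in> S" if "0 \<le> t" "t \<le> 1" for t
  proof -
    have "(1 - t) *\<^sub>R q + t *\<^sub>R x \<in> S" by (rule convexD_alt[OF conv q(1) x that])
    thus ?thesis by (simp add: algebra_simps)
  qed
  have dz: "((\<lambda>t. z (?l t)) has_real_derivative ?d z t) (at t)" if "z \<in> Z" "0 \<le> t" "t \<le> 1" for z t
  proof -
    have "(?l has_derivative (\<lambda>h. h *\<^sub>R (x - q))) (at t)" by (auto intro!: derivative_eq_intros)
    from has_derivative_compose[OF this has_derivative_pd[OF diff[OF that(1) l[OF that(2,3)]]]]
    have "((\<lambda>t. z (?l t)) has_derivative (\<lambda>h. h * ?d z t)) (at t)"
      by (simp add: sum_distrib_left mult_ac)
    moreover have "(\<lambda>h. h * ?d z t) = (*) (?d z t)" by (rule ext) (rule mult.commute)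
    ultimately show ?thesis unfolding has_field_derivative_def by (simp only:)
  qed
  define C1 where "C1 = (\<Sum>k\<in>UNIV. \<bar>(x - q) $ k\<bar>)"
  define C2 where "C2 = 2 * C1 * \<bar>C\<bar> * card Z"
  have "?f 1 \<le> 0"
  proof (rule gronwall_zero)
    fix t :: real assume t: "0 \<le> t" "t \<le> 1"
    show "(?f has_real_derivative (\<Sum>z\<in>Z. 2 * z (?l t) * ?d z t)) (at t)"
      by (intro DERIV_sum) (auto intro!: derivative_eq_intros dz t simp: power2_eq_square)
    let ?m = "\<Sum>w\<in>Z. \<bar>w (?l t)\<bar>"
    have m0: "0 \<le> ?m" by (intro sum_nonneg) auto
    have dl: "\<bar>?d z t\<bar> \<le> C1 * (\<bar>C\<bar> * ?m)" if "z \<in> Z" for z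
    proof -
      have "\<bar>?d z t\<bar> \<le> (\<Sum>k\<in>UNIV. \<bar>(x - q) $ k * pd k z (?l t)\<bar>)" by (rule sum_abs)
      also have "\<dots> \<le> (\<Sum>k\<in>UNIV. \<bar>(x - q) $ k\<bar> * (\<bar>C\<bar> * ?m))"
      proof (rule sum_mono)
        fix k
        have "\<bar>pd k z (?l t)\<bar> \<le> C * ?m" by (rule bd[OF that l[OF t]])
        also have "\<dots> \<le> \<bar>C\<bar> * ?m" by (intro mult_right_mono m0) simp
        finally show "\<bar>(x - q) $ k * pd k z (?l t)\<bar> \<le> \<bar>(x - q) $ k\<bar> * (\<bar>C\<bar> * ?m)"
          unfolding abs_mult by (intro mult_left_mono) auto
      qed
      finally show ?thesis by (simp add: C1_def sum_distrib_right)
    qed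
    have "(\<Sum>z\<in>Z. 2 * z (?l t) * ?d z t) \<le> (\<Sum>z\<in>Z. 2 * \<bar>z (?l t)\<bar> * (C1 * (\<bar>C\<bar> * ?m)))"
    proof (rule sum_mono)
      fix z assume "z \<in> Z"
      have "2 * z (?l t) * ?d z t \<le> 2 * \<bar>z (?l t)\<bar> * \<bar>?d z t\<bar>"
        using abs_ge_self[of "2 * z (?l t) * ?d z t"] by (simp only: abs_mult abs_numeral)
      also have "\<dots> \<le> 2 * \<bar>z (?l t)\<bar> * (C1 * (\<bar>C\<bar> * ?m))" by (intro mult_left_mono dl[OF \<open>z \<in> Z\<close>]) auto
      finally show "2 * z (?l t) * ?d z t \<le> 2 * \<bar>z (?l t)\<bar> * (C1 * (\<bar>C\<bar> * ?m))" .
    qed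
    also have "\<dots> = 2 * C1 * \<bar>C\<bar> * ?m\<^sup>2"
      by (simp only: sum_distrib_right[symmetric] sum_distrib_left[symmetric] power2_eq_square) (simp add: mult_ac)
    \<comment> \<open>Cauchy-Schwarz passes from the square of the sum to the sum of the squares, at
      the cost of the factor \<open>card Z\<close>.\<close>
    also have "?m\<^sup>2 \<le> card Z * ?f t"
      using Cauchy_Schwarz_ineq_sum[of "\<lambda>_. 1" "\<lambda>w. \<bar>w (?l t)\<bar>" Z] by simp
    hence "2 * C1 * \<bar>C\<bar> * ?m\<^sup>2 \<le> 2 * C1 * \<bar>C\<bar> * (card Z * ?f t)"
      by (intro mult_left_mono) (auto simp: C1_def sum_nonneg)
    also have "\<dots> = C2 * ?f t" by (simp add: C2_def)
    finally show "(\<Sum>z\<in>Z. 2 * z (?l t) * ?d z t) \<le> C2 * ?f t" .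
  qed (simp add: q)
  hence "(\<Sum>z\<in>Z. (z x)\<^sup>2) = 0" by (simp add: sum_nonneg antisym)
  thus ?thesis using fin z by (simp add: sum_nonneg_eq_0_iff)
qed

text \<open>Bounds up to an unspecified constant. On compact K continuous coefficients are absorbed
  into the constant, so only the structure of an expression in the unknowns matters.\<close>

definition dominated :: "'a set \<Rightarrow> ('a \<Rightarrow> real) \<Rightarrow> ('a \<Rightarrow> real) \<Rightarrow> bool" where
  "dominated K M g \<longleftrightarrow> (\<exists>C. \<forall>x\<in>K. \<bar>g x\<bar> \<le> C * M x)"

lemma dominated_add: "dominated K M f \<Longrightarrow> dominated K M g \<Longrightarrow> dominated K M (\<lambda>x. f x + g x)"
proof -
  assume "dominated K M f" "dominated K M g"
  then obtain C C' where "\<forall>x\<in>K. \<bar>f x\<bar> \<le> C * M x" "\<forall>x\<in>K. \<bar>g x\<bar> \<le> C' * M x" unfolding dominated_def by blast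
  hence "\<forall>x\<in>K. \<bar>f x + g x\<bar> \<le> (C + C') * M x" by (fastforce simp: distrib_right intro: order_trans[OF abs_triangle_ineq] add_mono)
  thus ?thesis unfolding dominated_def by blast
qed

lemma dominated_uminus: "dominated K M f \<Longrightarrow> dominated K M (\<lambda>x. - f x)"
  by (simp add: dominated_def)

lemma dominated_diff: "dominated K M f \<Longrightarrow> dominated K M g \<Longrightarrow> dominated K M (\<lambda>x. f x - g x)"
  using dominated_add[of K M f "\<lambda>x. - g x"] dominated_uminus[of K M g] by simp

lemma dominated_sum:
  assumes "finite J" "\<And>x. x \<in> K \<Longrightarrow> 0 \<le> M x"
  shows "(\<And>j. j \<in> J \<Longrightarrow> dominated K M (f j)) \<Longrightarrow> dominated K M (\<lambda>x. \<Sum>j\<in>J. f j x)"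
  using assms(1)
proof induction
  case empty
  thus ?case unfolding dominated_def by (intro exI[of _ 0]) simp
qed (auto intro: dominated_add)

lemma dominated_mult:
  assumes K: "compact K" and g: "continuous_on K g" and M: "\<And>x. x \<in> K \<Longrightarrow> 0 \<le> M x" and f: "dominated K M f"
  shows "dominated K M (\<lambda>x. g x * f x)" "dominated K M (\<lambda>x. f x * g x)"
proof -
  obtain C where C: "\<forall>x\<in>K. \<bar>f x\<bar> \<le> C * M x" using f unfolding dominated_def by blast
  have "bounded (g ` K)" by (intro compact_imp_bounded compact_continuous_image g K)
  then obtain G where G: "\<forall>x\<in>K. \<bar>g x\<bar> \<le> G" "0 < G" by (auto simp: bounded_pos)
  have "\<bar>g x * f x\<bar> \<le> (G * C) * M x" if "x \<in> K" for x
  proof -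
    have "\<bar>g x\<bar> * \<bar>f x\<bar> \<le> G * (C * M x)" using G C that by (intro mult_mono) auto
    thus ?thesis by (simp add: abs_mult mult.assoc)
  qed
  thus "dominated K M (\<lambda>x. g x * f x)" unfolding dominated_def by blast
  thus "dominated K M (\<lambda>x. f x * g x)" by (simp add: mult.commute)
qed

section \<open>The closed system for \<beta> and \<sigma>\<close>

context randers_chart
begin

text \<open>The variables of the prolonged system: their derivatives can be bounded by the variables
  themselves.\<close>

definition unknowns :: "(real^'n \<Rightarrow> real) \<Rightarrow> (real^'n \<Rightarrow> real) set" where
  "unknowns \<sigma> = insert \<sigma> (range (\<lambda>i x. b x $ i) \<union> range (\<lambda>(i, j). pd j (\<lambda>x. b x $ i)))"

lemma unknowns_mem: "\<sigma> \<in> unknowns \<sigma>" "(\<lambda>x. b x $ i) \<in> unknowns \<sigma>" "pd j (\<lambda>x. b x $ i) \<in> unknowns \<sigma>"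
  by (auto simp: unknowns_def)

lemma unknowns_finite: "finite (unknowns \<sigma>)"
  by (simp add: unknowns_def)

lemma s_lo_pd: assumes "x \<in> U" shows "s_lo a b x $ i $ j = (1/2) * (pd j (\<lambda>x. b x $ i) x - pd i (\<lambda>x. b x $ j) x)"
  by (simp add: s_lo_def cov_def christoffel_sym[OF assms, of _ i j])

text \<open>The only derivatives not bounded at once by the unknowns are the second derivatives of
  b. As all unknowns vanish at p, they are small in a ball around p; there the second derivatives
  can be bounded as well, and \<open>linear_system_zero\<close> applies in that ball.\<close>

theorem unique_continuation:
  fixes \<sigma> c :: "real^'n \<Rightarrow> real" and n1 :: real
  assumes n1: "n1 \<noteq> 0" and \<sigma>: "Ck_on 1 U \<sigma>" and c: "continuous_on U c" and V: "\<And>i. Ck_on 1 U (\<lambda>x. V x $ i)"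
    and e: "\<And>z. z \<in> U \<Longrightarrow> e_lo a b z = (2 * \<sigma> z) *\<^sub>R (a z - outer (b z) (b z))"
    and X: "\<And>z k. z \<in> U \<Longrightarrow> (3 * n1) * pd k \<sigma> z = 2 * c z * b z $ k - lieB V z $ k"
    and p: "p \<in> U" and p0: "\<And>z. z \<in> unknowns \<sigma> \<Longrightarrow> z p = 0"
  shows "\<exists>\<epsilon>>0. ball p \<epsilon> \<subseteq> U \<and> (\<forall>q\<in>ball p \<epsilon>. (\<forall>z\<in>unknowns \<sigma>. z q = 0) \<longrightarrow> (\<forall>x\<in>ball p \<epsilon>. b x = 0))"
proof -
  define m where "m = (\<lambda>x. \<Sum>w\<in>unknowns \<sigma>. \<bar>w x\<bar>)"
  define W where "W = range (\<lambda>(i, j, k). pd k (pd j (\<lambda>x. b x $ i)))"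
  define D where "D = (\<lambda>x. \<Sum>w\<in>W. \<bar>w x\<bar>)"
  \<comment> \<open>\<open>D\<close> measures the second derivatives; the term \<open>m\<^sup>2 D\<close> can be absorbed where \<open>m\<close> is small\<close>
  define M where "M = (\<lambda>x. m x + (m x)\<^sup>2 * D x)"
  have Wmem: "pd k (pd j (\<lambda>x. b x $ i)) \<in> W" for i j k
    unfolding W_def by (rule image_eqI[of _ _ "(i, j, k)"]) simp_all
  have finW: "finite W" by (simp add: W_def)
  obtain r where r: "0 < r" "cball p r \<subseteq> U" using open_U p open_contains_cball by blast
  let ?K = "cball p r"
  have K: "compact ?K" by simp
  have m0: "0 \<le> m x" and D0: "0 \<le> D x" for x by (auto simp: m_def D_def sum_nonneg)
  hence M0: "0 \<le> M x" for x by (simp add: M_def)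
  have mM: "m x \<le> M x" for x using m0 D0 by (simp add: M_def)
  have zm: "\<bar>z x\<bar> \<le> m x" if "z \<in> unknowns \<sigma>" for z x
    unfolding m_def by (rule member_le_sum[OF that]) (auto simp: unknowns_finite)
  have wD: "\<bar>w x\<bar> \<le> D x" if "w \<in> W" for w x
    unfolding D_def by (rule member_le_sum[OF that]) (auto simp: finW)
  have contK: "continuous_on ?K f" if "Ck_on k U f" for f k
    by (rule continuous_on_subset[OF Ck_on_continuous[OF that] r(2)])
  have dz: "dominated ?K M z" if "z \<in> unknowns \<sigma>" for z
    unfolding dominated_def by (rule exI[of _ 1]) (use zm[OF that] mM order_trans in \<open>fastforce\<close>)
  note db = dz[OF unknowns_mem(2)] and dpb = dz[OF unknowns_mem(3)] and ds = dz[OF unknowns_mem(1)]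
  note dmult = dominated_mult[OF K _ M0]
  have dsum: "(\<And>j. dominated ?K M (f j)) \<Longrightarrow> dominated ?K M (\<lambda>x. \<Sum>j\<in>UNIV. f j x)" for f :: "'n \<Rightarrow> _"
    by (rule dominated_sum) (auto simp: M0)
  have dcong: "dominated ?K M f" if "dominated ?K M g" "\<And>x. x \<in> U \<Longrightarrow> f x = g x" for f g
    using that r(2) unfolding dominated_def by (metis subsetD)
  have cpd: "continuous_on ?K (pd k f)" if "Ck_on 1 U f" for f k using contK[of 0] that by simp
  have b2: "Ck_on 2 U (\<lambda>x. b x $ i)" "Ck_on 1 U (pd j (\<lambda>x. b x $ i))" for i j
    using b_Ck[of 2] by (simp_all add: numeral_2_eq_2)
  have d1: "f differentiable (at x)" if "Ck_on 1 U f" "x \<in> U" for f x using that by simp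
  have bd: "(\<lambda>x. b x $ i) differentiable (at x)" if "x \<in> U" for i x by (rule d1[OF b_Ck that])
  have sd: "\<sigma> differentiable (at x)" if "x \<in> U" for x by (rule d1[OF \<sigma> that])
  have svd: "(\<lambda>x. s_vec a b x $ i) differentiable (at x)" if "x \<in> U" for i x by (rule d1[OF s_vec_Ck that])
  have sld: "(\<lambda>x. s_lo a b x $ i $ j) differentiable (at x)" if "x \<in> U" for i j x by (rule d1[OF s_lo_Ck that])
  have rad: "(\<lambda>x. raise a b x $ i) differentiable (at x)" if "x \<in> U" for i x by (rule d1[OF raise_Ck that])
  have aad: "(\<lambda>x. a x $ i $ j) differentiable (at x)" if "x \<in> U" for i j x by (rule d1[OF a_Ck that])
  have grad: "dominated ?K M (pd k \<sigma>)" for k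
  proof (rule dcong)
    fix z assume z: "z \<in> U"
    have "lieB V z $ k = (\<Sum>i\<in>UNIV. V z $ i * pd i (\<lambda>x. b x $ k) z) + (\<Sum>i\<in>UNIV. b z $ i * pd k (\<lambda>x. V x $ i) z)"
      by (simp add: lieB_def pdVd_def pdV_def inner_vec_def)
    with X[OF z, of k] show "pd k \<sigma> z = (1 / (3 * n1)) * (2 * c z * b z $ k - ((\<Sum>i\<in>UNIV. V z $ i * pd i (\<lambda>x. b x $ k) z) + (\<Sum>i\<in>UNIV. b z $ i * pd k (\<lambda>x. V x $ i) z)))"
      using n1 by (simp add: field_simps)
  next
    have "continuous_on ?K c" by (rule continuous_on_subset[OF c r(2)])
    hence c2: "continuous_on ?K (\<lambda>x. 2 * c x)" by (intro continuous_intros)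
    show "dominated ?K M (\<lambda>z. (1 / (3 * n1)) * (2 * c z * b z $ k - ((\<Sum>i\<in>UNIV. V z $ i * pd i (\<lambda>x. b x $ k) z) + (\<Sum>i\<in>UNIV. b z $ i * pd k (\<lambda>x. V x $ i) z))))"
      by (intro dmult(1)[OF continuous_on_const] dominated_diff dominated_add dsum dmult(1)[OF c2] dmult(1)[OF contK[OF V]] dmult(2)[OF cpd[OF V]] db dpb)
  qed
  \<comment> \<open>\<open>b\<^sub>i \<partial>\<^sub>k s\<^sub>j\<close> is the only source of the term \<open>m\<^sup>2 D\<close>\<close>
  have bs: "dominated ?K M (\<lambda>x. b x $ i * pd k (\<lambda>x. s_vec a b x $ j) x)" for i j k
  proof (rule dcong)
    fix x assume x: "x \<in> U"
    have "pd k (\<lambda>x. s_vec a b x $ j) x = (\<Sum>l\<in>UNIV. pd k (\<lambda>x. raise a b x $ l) x * s_lo a b x $ l $ j) + (\<Sum>l\<in>UNIV. raise a b x $ l * pd k (\<lambda>x. s_lo a b x $ l $ j) x)"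
      unfolding s_vec_def vec_lambda_beta by (rule pd_sum_mult) (auto intro: rad sld x)
    thus "b x $ i * pd k (\<lambda>x. s_vec a b x $ j) x = (\<Sum>l\<in>UNIV. b x $ i * (pd k (\<lambda>x. raise a b x $ l) x * s_lo a b x $ l $ j))
      + (\<Sum>l\<in>UNIV. b x $ i * (raise a b x $ l * pd k (\<lambda>x. s_lo a b x $ l $ j) x))"
      by (simp add: distrib_left sum_distrib_left)
  next
    have "dominated ?K M (\<lambda>x. b x $ i * (raise a b x $ l * pd k (\<lambda>x. s_lo a b x $ l $ j) x))" for l
    proof -
      \<comment> \<open>Domination by m and not merely by M: the raised b has to supply the second
        of the two factors m.\<close>
      have "dominated ?K m (\<lambda>x. \<Sum>q\<in>UNIV. ainv a x $ l $ q * b x $ q)"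
        by (rule dominated_sum, simp, simp add: m0, rule dominated_mult(1)[OF K contK[OF ainv_Ck] m0])
          (unfold dominated_def, rule exI[of _ 1], use zm[OF unknowns_mem(2)] in simp)
      then obtain C where C: "\<forall>x\<in>?K. \<bar>raise a b x $ l\<bar> \<le> C * m x" by (auto simp: dominated_def raise_def)
      have "\<bar>b x $ i * (raise a b x $ l * pd k (\<lambda>x. s_lo a b x $ l $ j) x)\<bar> \<le> \<bar>C\<bar> * M x" if xK: "x \<in> ?K" for x
      proof -
        have x: "x \<in> U" using xK r by blast
        have "pd k (\<lambda>x. s_lo a b x $ l $ j) x = pd k (\<lambda>x. (1/2) * (pd j (\<lambda>x. b x $ l) x - pd l (\<lambda>x. b x $ j) x)) x"
          by (rule pd_cong[OF open_U x]) (rule s_lo_pd)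
        also have "\<dots> = (1/2) * (pd k (pd j (\<lambda>x. b x $ l)) x - pd k (pd l (\<lambda>x. b x $ j)) x)"
          by (subst pd_mult) (auto intro!: differentiable_diff d1[OF b2(2) x] simp: pd_diff d1[OF b2(2) x])
        finally have "\<bar>pd k (\<lambda>x. s_lo a b x $ l $ j) x\<bar> \<le> (1/2) * (\<bar>pd k (pd j (\<lambda>x. b x $ l)) x\<bar> + \<bar>pd k (pd l (\<lambda>x. b x $ j)) x\<bar>)"
          by (simp add: abs_triangle_ineq4)
        also have "\<dots> \<le> (1/2) * (D x + D x)"
          by (intro mult_left_mono add_mono wD Wmem) simp
        finally have 1: "\<bar>pd k (\<lambda>x. s_lo a b x $ l $ j) x\<bar> \<le> D x" by simp
        have 2: "\<bar>raise a b x $ l\<bar> \<le> \<bar>C\<bar> * m x"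
          using C xK by (meson abs_ge_self m0 mult_right_mono order_trans)
        have "\<bar>b x $ i\<bar> * (\<bar>raise a b x $ l\<bar> * \<bar>pd k (\<lambda>x. s_lo a b x $ l $ j) x\<bar>) \<le> m x * ((\<bar>C\<bar> * m x) * D x)"
          by (intro mult_mono zm[OF unknowns_mem(2)] 1 2) (auto simp: m0 D0)
        also have "\<dots> = \<bar>C\<bar> * ((m x)\<^sup>2 * D x)" by (simp add: power2_eq_square)
        also have "\<dots> \<le> \<bar>C\<bar> * M x" by (intro mult_left_mono) (auto simp: M_def m0)
        finally show ?thesis by (simp add: abs_mult)
      qed
      thus ?thesis unfolding dominated_def by blast
    qed
    thus "dominated ?K M (\<lambda>x. (\<Sum>l\<in>UNIV. b x $ i * (pd k (\<lambda>x. raise a b x $ l) x * s_lo a b x $ l $ j))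
      + (\<Sum>l\<in>UNIV. b x $ i * (raise a b x $ l * pd k (\<lambda>x. s_lo a b x $ l $ j) x)))"
      by (intro dominated_add dsum dmult(2)[of "\<lambda>x. pd k (\<lambda>x. raise a b x $ l) x * s_lo a b x $ l $ j" for l] db
          continuous_on_mult cpd[OF raise_Ck] contK[OF s_lo_Ck])
  qed
  define \<Phi> where "\<Phi> i j x = (\<Sum>q\<in>UNIV. christoffel a q i j x * b x $ q) + 2 * \<sigma> x * (a x $ i $ j - b x $ i * b x $ j)
      - b x $ i * s_vec a b x $ j - b x $ j * s_vec a b x $ i" for i j x
  have \<Phi>: "pd j (\<lambda>x. b x $ i) x + pd i (\<lambda>x. b x $ j) x = 2 * \<Phi> i j x" if x: "x \<in> U" for i j x
  proof -
    have "e_lo a b x $ i $ j = 2 * \<sigma> x * (a x $ i $ j - b x $ i * b x $ j)" by (simp add: e[OF x] outer_def)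
    thus ?thesis
      by (simp add: e_lo_def r_lo_def cov_def \<Phi>_def christoffel_sym[OF x, of _ j i] algebra_simps)
  qed
  have \<Phi>d: "dominated ?K M (pd k (\<Phi> i j))" for i j k
  proof (rule dcong)
    fix x assume x: "x \<in> U"
    have "((\<lambda>t. \<Phi> i j (x + t *\<^sub>R axis k 1)) has_real_derivative
      (\<Sum>q\<in>UNIV. pd k (christoffel a q i j) x * b x $ q + christoffel a q i j x * pd k (\<lambda>x. b x $ q) x)
      + (2 * pd k \<sigma> x * (a x $ i $ j - b x $ i * b x $ j) + 2 * \<sigma> x * (pd k (\<lambda>x. a x $ i $ j) x - (pd k (\<lambda>x. b x $ i) x * b x $ j + b x $ i * pd k (\<lambda>x. b x $ j) x)))
      - (pd k (\<lambda>x. b x $ i) x * s_vec a b x $ j + b x $ i * pd k (\<lambda>x. s_vec a b x $ j) x)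
      - (pd k (\<lambda>x. b x $ j) x * s_vec a b x $ i + b x $ j * pd k (\<lambda>x. s_vec a b x $ i) x)) (at 0)"
      unfolding \<Phi>_def
      by (rule derivative_eq_intros pd_has_real_derivative[OF christoffel_diff[OF x]] pd_has_real_derivative[OF bd[OF x]]
            pd_has_real_derivative[OF sd[OF x]] pd_has_real_derivative[OF svd[OF x]] pd_has_real_derivative[OF aad[OF x]] refl)+
        (simp add: algebra_simps)
    thus "pd k (\<Phi> i j) x = (\<Sum>q\<in>UNIV. pd k (christoffel a q i j) x * b x $ q + christoffel a q i j x * pd k (\<lambda>x. b x $ q) x)
      + (2 * (pd k \<sigma> x * (a x $ i $ j - b x $ i * b x $ j)) + 2 * (\<sigma> x * (pd k (\<lambda>x. a x $ i $ j) x - (pd k (\<lambda>x. b x $ i) x * b x $ j + b x $ i * pd k (\<lambda>x. b x $ j) x))))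
      - (pd k (\<lambda>x. b x $ i) x * s_vec a b x $ j + b x $ i * pd k (\<lambda>x. s_vec a b x $ j) x)
      - (pd k (\<lambda>x. b x $ j) x * s_vec a b x $ i + b x $ j * pd k (\<lambda>x. s_vec a b x $ i) x)"
      by (subst pd_unique) (auto simp: algebra_simps)
  next
    show "dominated ?K M (\<lambda>x. (\<Sum>q\<in>UNIV. pd k (christoffel a q i j) x * b x $ q + christoffel a q i j x * pd k (\<lambda>x. b x $ q) x)
      + (2 * (pd k \<sigma> x * (a x $ i $ j - b x $ i * b x $ j)) + 2 * (\<sigma> x * (pd k (\<lambda>x. a x $ i $ j) x - (pd k (\<lambda>x. b x $ i) x * b x $ j + b x $ i * pd k (\<lambda>x. b x $ j) x))))
      - (pd k (\<lambda>x. b x $ i) x * s_vec a b x $ j + b x $ i * pd k (\<lambda>x. s_vec a b x $ j) x)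
      - (pd k (\<lambda>x. b x $ j) x * s_vec a b x $ i + b x $ j * pd k (\<lambda>x. s_vec a b x $ i) x))"
      by (intro dominated_diff dominated_add dsum bs
          dmult(1)[OF cpd[OF christoffel_Ck] db] dmult(1)[OF contK[OF christoffel_Ck] dpb]
          dmult(1)[OF continuous_on_const] dmult(2)[OF _ grad] dmult(2)[OF _ ds] dmult(2)[OF contK[OF s_vec_Ck] dpb]
          continuous_on_diff continuous_on_add continuous_on_mult cpd[OF a_Ck] contK[OF a_Ck] contK[OF b_Ck] cpd[OF b_Ck])
  qed
  have \<Phi>diff: "\<Phi> i j differentiable (at x)" if "x \<in> U" for i j x
  proof -
    have "Ck_on 1 U (\<Phi> i j)" unfolding \<Phi>_def[abs_def]
      by (intro Ck_intros open_U christoffel_Ck a_Ck b_Ck s_vec_Ck \<sigma>)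
    thus ?thesis using that by simp
  qed
  have "dominated ?K M w" if wW: "w \<in> W" for w
  proof -
    obtain t where "w = (case t of (i, j, k) \<Rightarrow> pd k (pd j (\<lambda>x. b x $ i)))" using wW unfolding W_def by blast
    then obtain i j k where w: "w = pd k (pd j (\<lambda>x. b x $ i))" by (cases t) simp
    show ?thesis unfolding w
    proof (rule dcong)
      show "dominated ?K M (\<lambda>x. pd k (\<Phi> i j) x + pd j (\<Phi> i k) x - pd i (\<Phi> j k) x)"
        by (intro dominated_add dominated_diff \<Phi>d)
      fix x assume x: "x \<in> U"
      have P: "pd k (pd j (\<lambda>x. b x $ i)) x + pd k (pd i (\<lambda>x. b x $ j)) x = 2 * pd k (\<Phi> i j) x" for i j k
      proof -
        have "pd k (pd j (\<lambda>x. b x $ i)) x + pd k (pd i (\<lambda>x. b x $ j)) x = pd k (\<lambda>x. pd j (\<lambda>x. b x $ i) x + pd i (\<lambda>x. b x $ j) x) x"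
          by (rule pd_add[symmetric]) (rule d1[OF b2(2) x])+
        also have "\<dots> = pd k (\<lambda>x. 2 * \<Phi> i j x) x" by (rule pd_cong[OF open_U x \<Phi>])
        also have "\<dots> = 2 * pd k (\<Phi> i j) x" by (subst pd_mult) (auto simp: \<Phi>diff x)
        finally show ?thesis .
      qed
      have C: "pd k (pd j (\<lambda>x. b x $ i)) x = pd j (pd k (\<lambda>x. b x $ i)) x" for i j k
        by (rule pd_commute[OF open_U x b2(1)])
      \<comment> \<open>The same permutation of indices as in the formula for the Christoffel
        symbols: the symmetrized first derivatives determine all second derivatives.\<close>
      show "pd k (pd j (\<lambda>x. b x $ i)) x = pd k (\<Phi> i j) x + pd j (\<Phi> i k) x - pd i (\<Phi> j k) x"
        using P[of k j i] P[of j k i] P[of i k j] C[of k j i] C[of k i j] C[of j i k] by linarith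
    qed
  qed
  hence "dominated ?K M D'" if "D' = (\<lambda>x. \<Sum>w\<in>W. \<bar>w x\<bar>)" for D'
    unfolding that by (intro dominated_sum finW M0) (auto simp: dominated_def)
  from this[OF D_def] obtain C where "\<forall>x\<in>?K. \<bar>D x\<bar> \<le> C * M x" unfolding dominated_def by blast
  hence C: "\<And>x. x \<in> ?K \<Longrightarrow> \<bar>D x\<bar> \<le> C * M x" by blast
  \<comment> \<open>The summand 1 ensures C1 \<ge> 1, so that the smallness of
    \<open>C1 * (m x)\<^sup>2\<close> carries over to \<open>(m x)\<^sup>2\<close> in the proof of
    \<open>MD\<close>.\<close>
  define C1 where "C1 = \<bar>C\<bar> + 1"
  have CD: "D x \<le> C1 * M x" if "x \<in> ?K" for x
  proof -
    have "D x \<le> C * M x" using C[OF that] by linarith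
    also have "\<dots> \<le> C1 * M x" by (intro mult_right_mono M0) (simp add: C1_def)
    finally show ?thesis .
  qed
  have cm: "continuous_on ?K m"
  proof -
    have "continuous_on ?K z" if "z \<in> unknowns \<sigma>" for z
      using that by (auto simp: unknowns_def intro: contK[OF \<sigma>] contK[OF b_Ck] cpd[OF b_Ck])
    thus ?thesis unfolding m_def by (intro continuous_on_sum continuous_on_rabs)
  qed
  have mp: "m p = 0" by (simp add: m_def p0)
  have "\<exists>\<epsilon>>0. \<forall>x\<in>?K. dist x p < \<epsilon> \<longrightarrow> dist (C1 * (m x)\<^sup>2) (C1 * (m p)\<^sup>2) < 1/2"
  proof -
    have "continuous_on ?K (\<lambda>x. C1 * (m x)\<^sup>2)" by (intro continuous_intros cm)
    thus ?thesis unfolding continuous_on_iff using r(1) by (metis centre_in_cball half_gt_zero_iff less_imp_le zero_less_one)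
  qed
  then obtain \<epsilon> where \<epsilon>0: "0 < \<epsilon>" and \<epsilon>1: "\<forall>x\<in>?K. dist x p < \<epsilon> \<longrightarrow> dist (C1 * (m x)\<^sup>2) (C1 * (m p)\<^sup>2) < 1/2"
    by blast
  have \<epsilon>: "0 < \<epsilon>" "C1 * (m x)\<^sup>2 < 1/2" if "x \<in> ?K" "dist x p < \<epsilon>" for x
  proof -
    have "\<bar>C1 * (m x)\<^sup>2\<bar> < 1/2" using \<epsilon>1 that by (simp add: mp dist_real_def)
    thus "C1 * (m x)\<^sup>2 < 1/2" by linarith
  qed (rule \<epsilon>0)
  define \<delta> where "\<delta> = min \<epsilon> r"
  have \<delta>: "0 < \<delta>" "ball p \<delta> \<subseteq> ?K" using r \<epsilon>0 by (auto simp: \<delta>_def)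
  \<comment> \<open>The absorption: the term with \<open>m\<^sup>2 D\<close> is at most half of D
    and moves to the left side.\<close>
  have Dm: "D x \<le> 2 * C1 * m x" if "x \<in> ball p \<delta>" for x
  proof -
    have "C1 * (m x)\<^sup>2 < 1/2" using that \<delta>(2) by (intro \<epsilon>(2)) (auto simp: \<delta>_def dist_commute)
    hence "(C1 * (m x)\<^sup>2) * D x \<le> (1/2) * D x" by (intro mult_right_mono D0) simp
    moreover have "D x \<le> C1 * m x + (C1 * (m x)\<^sup>2) * D x"
      using CD[of x] that \<delta>(2) by (auto simp: M_def algebra_simps)
    ultimately show ?thesis by linarith
  qed
  have MD: "M x \<le> (1 + C1) * m x" if "x \<in> ball p \<delta>" for x
  proof -
    have "C1 * (m x)\<^sup>2 < 1/2" using that \<delta>(2) by (intro \<epsilon>(2)) (auto simp: \<delta>_def dist_commute)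
    hence "(m x)\<^sup>2 \<le> 1/2" using zero_le_power2[of "m x"] mult_right_mono[of 1 C1 "(m x)\<^sup>2"] by (simp add: C1_def)
    hence "(m x)\<^sup>2 * D x \<le> (1/2) * (2 * C1 * m x)" using Dm[OF that] D0 by (intro mult_mono) auto
    thus ?thesis by (simp add: M_def algebra_simps)
  qed
  have "\<exists>C. \<forall>x\<in>ball p \<delta>. \<bar>pd k z x\<bar> \<le> C * m x" if z: "z \<in> unknowns \<sigma>" for z k
  proof -
    consider "z = \<sigma>" | i where "z = (\<lambda>x. b x $ i)" | i j where "z = pd j (\<lambda>x. b x $ i)"
      using z by (auto simp: unknowns_def)
    thus ?thesis
    proof cases
      case 1
      obtain C where C: "\<forall>x\<in>?K. \<bar>pd k \<sigma> x\<bar> \<le> C * M x" using grad[of k] by (auto simp: dominated_def)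
      have "\<bar>pd k z x\<bar> \<le> (\<bar>C\<bar> * (1 + C1)) * m x" if x: "x \<in> ball p \<delta>" for x
      proof -
        have "\<bar>pd k z x\<bar> \<le> C * M x" unfolding 1 using C x \<delta>(2) by blast
        also have "\<dots> \<le> \<bar>C\<bar> * M x" by (intro mult_right_mono M0) simp
        also have "\<dots> \<le> \<bar>C\<bar> * ((1 + C1) * m x)" by (intro mult_left_mono MD x) simp
        finally show ?thesis by simp
      qed
      thus ?thesis by blast
    next
      case 2
      thus ?thesis using zm[OF unknowns_mem(3)] by (intro exI[of _ 1]) simp
    next
      case 3
      have "\<bar>pd k z x\<bar> \<le> D x" for x unfolding 3 by (rule wD[OF Wmem])
      thus ?thesis using Dm order_trans by blast
    qed
  qed
  then obtain Cf where Cf: "\<And>z k x. z \<in> unknowns \<sigma> \<Longrightarrow> x \<in> ball p \<delta> \<Longrightarrow> \<bar>pd k z x\<bar> \<le> Cf z k * m x" by metis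
  \<comment> \<open>One constant for all unknowns and all directions, of which there are finitely
    many.\<close>
  define C2 where "C2 = (\<Sum>z\<in>unknowns \<sigma>. \<Sum>k\<in>UNIV. \<bar>Cf z k\<bar>)"
  have C2: "\<bar>pd k z x\<bar> \<le> C2 * m x" if z: "z \<in> unknowns \<sigma>" and x: "x \<in> ball p \<delta>" for z k x
  proof -
    have "Cf z k \<le> (\<Sum>k\<in>UNIV. \<bar>Cf z k\<bar>)"
      using member_le_sum[of k UNIV "\<lambda>k. \<bar>Cf z k\<bar>"] by fastforce
    also have "\<dots> \<le> C2" unfolding C2_def by (rule member_le_sum[OF z]) (auto simp: sum_nonneg unknowns_finite)
    finally have "Cf z k * m x \<le> C2 * m x" by (intro mult_right_mono m0)
    thus ?thesis using Cf[OF z x, of k] by linarith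
  qed
  have diffZ: "z differentiable (at x)" if "z \<in> unknowns \<sigma>" "x \<in> ball p \<delta>" for z x
  proof -
    have "x \<in> U" using that \<delta>(2) r(2) by blast
    thus ?thesis using that(1) by (auto simp: unknowns_def intro: sd bd d1[OF b2(2)])
  qed
  have "b x = 0" if q: "q \<in> ball p \<delta>" "\<And>z. z \<in> unknowns \<sigma> \<Longrightarrow> z q = 0" and x: "x \<in> ball p \<delta>" for q x
  proof -
    have "(\<lambda>x. b x $ i) x = 0" for i
      by (rule linear_system_zero[where Z="unknowns \<sigma>" and S="ball p \<delta>" and C=C2 and q=q and x=x and z="\<lambda>x. b x $ i", OF unknowns_finite convex_ball])
        (rule diffZ, assumption, assumption, rule C2[unfolded m_def], assumption, assumption, rule q(1), rule q(2), assumption,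
          rule x, rule unknowns_mem(2))
    thus ?thesis by (simp add: vec_eq_iff)
  qed
  thus ?thesis using \<delta> r(2) by (intro exI[of _ \<delta>]) auto
qed

end

section \<open>Change of coordinates\<close>

lemma sum_scaleR_mult: "(\<Sum>k\<in>UNIV. v $ k *\<^sub>R M k) *v z = (\<Sum>k\<in>UNIV. v $ k *\<^sub>R (M k *v z))"
  for M :: "'k::finite \<Rightarrow> real^'n^'m"
proof -
  have "(\<Sum>k\<in>K. v $ k *\<^sub>R M k) *v z = (\<Sum>k\<in>K. v $ k *\<^sub>R (M k *v z))" if "finite K" for K
    using that by induction (simp_all add: matrix_vector_mult_add_rdistrib scaleR_matrix_vector_assoc)
  thus ?thesis by simp
qed

context riemann_chart
begin

text \<open>The difference of two torsion-free metric connections, with its upper index lowered, is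
  skew in one pair of indices and symmetric in another. Alternating the two symmetries returns to
  the start with the opposite sign, so the difference is 0.\<close>

lemma levi_civita_unique:
  assumes x: "x \<in> U" and sym: "\<And>k j. column j (N k) = column k (N j)"
    and met: "\<And>k. pdM k a x = transpose (N k) ** a x + a x ** N k"
  shows "N k = Nk k x"
proof -
  define D where "D k = a x ** (N k - Nk k x)" for k
  have "transpose (D k) = - D k" for k
  proof -
    have "transpose (N k) ** a x + a x ** N k = transpose (Nk k x) ** a x + a x ** Nk k x"
      using met[of k] pdM_a[OF x, of k] by simp
    hence "transpose (N k) ** a x - transpose (Nk k x) ** a x = - (a x ** N k - a x ** Nk k x)" by (simp add: algebra_simps)
    thus ?thesis by (simp add: D_def matrix_transpose_mul a_sym[OF x] transpose_diff matrix_diff_distrib)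
  qed
  hence sk: "D k $ i $ j = - D k $ j $ i" for i j k
    by (metis (no_types, lifting) transpose_def vec_lambda_beta vector_uminus_component)
  have "Nk k x $ i $ j = Nk j x $ i $ k" for i j k by (simp add: Nk_def christoffel_sym[OF x])
  moreover have "N k $ i $ j = N j $ i $ k" for i j k using sym[of j k] by (simp add: vec_eq_iff column_nth)
  ultimately have sy: "D k $ i $ j = D j $ i $ k" for i j k by (simp add: D_def matrix_matrix_mult_def)
  have "D k $ i $ j = 0" for i j k
  proof -
    have "D k $ i $ j = - D k $ j $ i" by (rule sk)
    also have "\<dots> = - D i $ j $ k" by (simp add: sy[of k j i])
    also have "\<dots> = D i $ k $ j" using sk[of i k j] by simp
    also have "\<dots> = D j $ k $ i" by (rule sy)
    also have "\<dots> = - D j $ i $ k" by (rule sk)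
    also have "\<dots> = - D k $ i $ j" by (simp add: sy[of k i j])
    finally show ?thesis by simp
  qed
  hence "a x ** (N k - Nk k x) = 0" by (simp add: D_def vec_eq_iff)
  hence "ainv a x ** (a x ** (N k - Nk k x)) = 0" by simp
  thus ?thesis by (simp add: matrix_mul_assoc ainv_a x)
qed

end

locale chart_change = riemann_chart U a + R': riemann_chart U' a'
  for U :: "(real^'n::finite) set" and a and U' :: "(real^'n) set" and a' +
  fixes Ov :: "(real^'n) set" and T :: "real^'n \<Rightarrow> real^'n" and J :: "real^'n \<Rightarrow> real^'n^'n"
  assumes Ov: "open Ov" "Ov \<subseteq> U" and T: "\<And>x. x \<in> Ov \<Longrightarrow> T x \<in> U'" "\<And>i. Ck_on 2 Ov (\<lambda>x. T x $ i)"
    and J: "\<And>x i k. J x $ i $ k = pd k (\<lambda>x. T x $ i) x"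
    and a_trans: "\<And>x. x \<in> Ov \<Longrightarrow> a x = transpose (J x) ** a' (T x) ** J x"
begin

lemma Ov_U: "x \<in> Ov \<Longrightarrow> x \<in> U" using Ov by blast

lemma T_diff: "x \<in> Ov \<Longrightarrow> (\<lambda>x. T x $ i) differentiable (at x)"
  using T(2)[of i] by (simp add: numeral_2_eq_2)

lemma diff_J: "x \<in> Ov \<Longrightarrow> diffM J x"
  using T(2) by (simp add: diffM_def J numeral_2_eq_2)

lemma diffM_transpose: "diffM M x \<Longrightarrow> diffM (\<lambda>x. transpose (M x)) x"
  by (simp add: diffM_def transpose_def)

lemma pdM_transpose: "pdM k (\<lambda>x. transpose (M x)) x = transpose (pdM k M x)"
  by (simp add: pdM_def transpose_def vec_eq_iff)

text \<open>The invertible matrix \<open>a x\<close> factors through the Jacobian, which is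
  therefore invertible as well.\<close>

lemma J_vec_inj: assumes "x \<in> Ov" "transpose (J x) *v u = transpose (J x) *v v" shows "u = v"
proof -
  have "invertible (J x)"
  proof -
    have "v = 0" if "J x *v v = 0" for v
    proof -
      have "a x *v v = 0" using that by (simp add: a_trans[OF assms(1)] matrix_vector_mul_assoc[symmetric])
      hence "ainv a x *v (a x *v v) = 0" by simp
      thus ?thesis by (simp add: ainv_a_vec Ov_U assms)
    qed
    thus ?thesis using matrix_left_invertible_ker invertible_left_inverse by blast
  qed
  then obtain K where "J x ** K = mat 1" unfolding invertible_def by blast
  hence "transpose K ** transpose (J x) = mat 1" by (metis matrix_transpose_mul transpose_mat)
  hence "transpose K *v (transpose (J x) *v w) = w" for w by (simp add: matrix_vector_mul_assoc)
  thus ?thesis using assms(2) by metis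
qed

lemma J_inverse: assumes "x \<in> Ov" obtains K where "K ** J x = mat 1" "J x ** K = mat 1"
proof -
  have "v = 0" if "J x *v v = 0" for v
  proof -
    have "a x *v v = 0" using that by (simp add: a_trans[OF assms(1)] matrix_vector_mul_assoc[symmetric])
    hence "ainv a x *v (a x *v v) = 0" by simp
    thus ?thesis by (simp add: ainv_a_vec Ov_U assms)
  qed
  hence "invertible (J x)" using matrix_left_invertible_ker invertible_left_inverse by blast
  thus thesis using that unfolding invertible_def by blast
qed

lemma pdV_T:
  assumes x: "x \<in> Ov" and w: "diffV w (T x)"
  shows "pdV k (\<lambda>x. w (T x)) x = pdVd (column k (J x)) w (T x)" "diffV (\<lambda>x. w (T x)) x"
proof -
  have d: "(\<lambda>x. T x $ i) differentiable (at x)" for i by (rule T_diff[OF x])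
  have w': "(\<lambda>z. w z $ i) differentiable (at (T x))" for i using w by (simp add: diffV_def)
  show "diffV (\<lambda>x. w (T x)) x" unfolding diffV_def using pd_chain(1)[of "\<lambda>z. w z $ i" T x for i, OF w' d] by blast
  show "pdV k (\<lambda>x. w (T x)) x = pdVd (column k (J x)) w (T x)"
    using pd_chain(2)[of "\<lambda>z. w z $ i" T x k for i, OF w' d]
    by (simp add: vec_eq_iff pdV_def pdVd_def column_nth J mult.commute)
qed

lemma pdM_T:
  assumes x: "x \<in> Ov" and M: "diffM M (T x)"
  shows "pdM k (\<lambda>x. M (T x)) x = pdMd (column k (J x)) M (T x)" "diffM (\<lambda>x. M (T x)) x"
proof -
  have d: "(\<lambda>x. T x $ i) differentiable (at x)" for i by (rule T_diff[OF x])
  have M': "(\<lambda>z. M z $ i $ j) differentiable (at (T x))" for i j using M by (simp add: diffM_def)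
  show "diffM (\<lambda>x. M (T x)) x" unfolding diffM_def using pd_chain(1)[of "\<lambda>z. M z $ i $ j" T x for i j, OF M' d] by blast
  show "pdM k (\<lambda>x. M (T x)) x = pdMd (column k (J x)) M (T x)"
    using pd_chain(2)[of "\<lambda>z. M z $ i $ j" T x k for i j, OF M' d]
    by (simp add: vec_eq_iff pdM_def pdMd_def column_nth J mult.commute)
qed

text \<open>The matrices N defined by the right side form the connection pulled back along T. It is
  torsion-free because second derivatives of T commute, and metric because a is the pullback of a',
  so it is the Levi-Civita connection of a.\<close>

lemma christoffel_transform:
  assumes x: "x \<in> Ov"
  shows "J x ** Nk k x = pdM k J x + (\<Sum>q\<in>UNIV. J x $ q $ k *\<^sub>R R'.Nk q (T x)) ** J x"
proof -
  obtain K where K: "K ** J x = mat 1" "J x ** K = mat 1" using J_inverse[OF x] .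
  define N' where "N' k = (\<Sum>q\<in>UNIV. column k (J x) $ q *\<^sub>R R'.Nk q (T x))" for k
  define N where "N k = K ** (pdM k J x + N' k ** J x)" for k
  have JN: "J x ** N k = pdM k J x + N' k ** J x" for k
    by (simp add: N_def matrix_mul_assoc K)
  have Tx: "T x \<in> U'" by (rule T(1)[OF x])
  have sJ: "column j (pdM k J x) = column k (pdM j J x)" for j k
    using pd_commute[OF Ov(1) x T(2)] by (simp add: vec_eq_iff column_nth pdM_def J[abs_def])
  have sN: "column j (N' k ** J x) = column k (N' j ** J x)" for j k
  proof -
    have 1: "N' k *v z = R'.Ny (T x) z *v column k (J x)" for k z
      by (simp add: N'_def sum_scaleR_mult R'.Ny_mult)
    have "column j (M ** J x) = M *v column j (J x)" for M :: "real^'n^'n" and j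
      by (simp add: vec_eq_iff column_nth matrix_matrix_mult_def matrix_vector_mult_def)
    thus ?thesis by (simp add: 1 R'.Ny_commute[OF Tx, of "column j (J x)"])
  qed
  have "column j (N k) = column k (N j)" for j k
  proof -
    have "column j (N k) = K *v column j (pdM k J x + N' k ** J x)" for j k
      by (simp add: N_def vec_eq_iff column_nth matrix_matrix_mult_def matrix_vector_mult_def)
    moreover have "column j (pdM k J x + N' k ** J x) = column k (pdM j J x + N' j ** J x)"
      using sJ[of j k] sN[of j k] by (simp add: vec_eq_iff column_nth)
    ultimately show ?thesis by simp
  qed
  moreover have "pdM k a x = transpose (N k) ** a x + a x ** N k" for k
  proof -
    have da: "diffM a' (T x)" by (rule R'.diff_a[OF Tx])
    have pa: "pdMd (column k (J x)) a' (T x) = transpose (N' k) ** a' (T x) + a' (T x) ** N' k"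
    proof (rule matrix_eq_vecI)
      fix z
      have tr: "transpose (N' k) *v u = (\<Sum>q\<in>UNIV. column k (J x) $ q *\<^sub>R (transpose (R'.Nk q (T x)) *v u))" for u
      proof -
        have "transpose (\<Sum>q\<in>UNIV. column k (J x) $ q *\<^sub>R R'.Nk q (T x)) = (\<Sum>q\<in>UNIV. column k (J x) $ q *\<^sub>R transpose (R'.Nk q (T x)))"
          by (simp add: vec_eq_iff transpose_def)
        thus ?thesis unfolding N'_def by (simp only: sum_scaleR_mult)
      qed
      show "pdMd (column k (J x)) a' (T x) *v z = (transpose (N' k) ** a' (T x) + a' (T x) ** N' k) *v z"
        by (simp add: pdMd_def sum_scaleR_mult R'.pdM_a[OF Tx] matrix_vector_mult_add_rdistrib matrix_vector_mul_assoc[symmetric] tr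
            scaleR_add_right sum.distrib)
          (simp add: N'_def sum_scaleR_mult linear_sum[OF matrix_vector_mul_linear] matrix_vector_mult_scaleR)
    qed
    have dJ: "diffM J x" by (rule diff_J[OF x])
    have "pdM k a x = pdM k (\<lambda>x. transpose (J x) ** a' (T x) ** J x) x"
      by (rule pdM_cong[OF Ov(1) x a_trans])
    also have "\<dots> = (transpose (pdM k J x) ** a' (T x) + transpose (J x) ** (transpose (N' k) ** a' (T x) + a' (T x) ** N' k)) ** J x
       + transpose (J x) ** a' (T x) ** pdM k J x"
      by (simp add: pdM_matrix_mult diffM_matrix_mult diffM_transpose dJ pdM_T[OF x da] pdM_transpose pa)
    also have "\<dots> = transpose (J x ** N k) ** a' (T x) ** J x + transpose (J x) ** a' (T x) ** (J x ** N k)"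
      unfolding JN by (simp add: transpose_add matrix_transpose_mul matrix_add_ldistrib matrix_add_rdistrib matrix_mul_assoc)
    finally show ?thesis by (simp add: a_trans[OF x] matrix_transpose_mul matrix_mul_assoc)
  qed
  ultimately have "N k = Nk k x" by (rule levi_civita_unique[OF Ov_U[OF x]])
  thus ?thesis using JN[of k] by (simp add: N'_def column_nth)
qed

text \<open>The second derivatives of T in the derivative of the Jacobian cancel against those in
  the transformed Christoffel symbols.\<close>

lemma cov_transform:
  assumes x: "x \<in> Ov" and w: "\<And>z. z \<in> Ov \<Longrightarrow> w z = transpose (J z) *v w' (T z)" and d: "diffV w' (T x)"
  shows "cov a w x = transpose (J x) ** cov a' w' (T x) ** J x"
proof -
  have Tx: "T x \<in> U'" by (rule T(1)[OF x])
  have xU: "x \<in> U" by (rule Ov_U[OF x])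
  have "column k (cov a w x) = transpose (J x) *v (cov a' w' (T x) *v column k (J x))" for k
  proof -
    let ?N' = "\<Sum>q\<in>UNIV. J x $ q $ k *\<^sub>R R'.Nk q (T x)"
    have "pdV k w x = pdV k (\<lambda>z. transpose (J z) *v w' (T z)) x" by (rule pdV_cong[OF Ov(1) x w])
    also have "\<dots> = transpose (pdM k J x) *v w' (T x) + transpose (J x) *v pdVd (column k (J x)) w' (T x)"
      by (simp add: pdV_matrix_mult diffM_transpose diff_J x pdV_T[OF x d] pdM_transpose)
    finally have p: "pdV k w x = transpose (pdM k J x) *v w' (T x) + transpose (J x) *v pdVd (column k (J x)) w' (T x)" .
    have "transpose (Nk k x) *v w x = transpose (J x ** Nk k x) *v w' (T x)"
      by (simp add: w[OF x] matrix_transpose_mul matrix_vector_mul_assoc)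
    also have "\<dots> = transpose (pdM k J x) *v w' (T x) + transpose (J x) *v (transpose ?N' *v w' (T x))"
      by (simp add: christoffel_transform[OF x] transpose_add matrix_transpose_mul matrix_linear_simps matrix_vector_mul_assoc)
    finally have "covV k w x = transpose (J x) *v (pdVd (column k (J x)) w' (T x) - transpose ?N' *v w' (T x))"
      by (simp add: covV_def p matrix_vector_mult_diff_distrib)
    moreover have "pdVd (column k (J x)) w' (T x) - transpose ?N' *v w' (T x) = cov a' w' (T x) *v column k (J x)"
    proof -
      have "transpose ?N' = (\<Sum>q\<in>UNIV. column k (J x) $ q *\<^sub>R transpose (R'.Nk q (T x)))"
        by (simp add: vec_eq_iff transpose_def column_nth)
      hence "transpose ?N' *v w' (T x) = (\<Sum>q\<in>UNIV. column k (J x) $ q *\<^sub>R (transpose (R'.Nk q (T x)) *v w' (T x)))"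
        by (simp only: sum_scaleR_mult)
      moreover have "cov a' w' (T x) *v v = (\<Sum>q\<in>UNIV. v $ q *\<^sub>R column q (cov a' w' (T x)))" for v
        by (simp add: vec_eq_iff sum_column[symmetric] column_nth)
      ultimately show ?thesis
        by (simp add: R'.cov_column[OF Tx] R'.covV_def pdVd_def scaleR_diff_right sum_subtractf)
    qed
    ultimately show ?thesis by (simp add: cov_column[OF xU])
  qed
  moreover have "column k (M ** M' ** M'') = M *v (M' *v column k M'')" for k and M M' M'' :: "real^'n^'n"
    by (simp add: matrix_vector_mul_assoc) (simp add: vec_eq_iff column_nth matrix_matrix_mult_def[of "M ** M'"] matrix_vector_mult_def)
  ultimately have "column k (cov a w x) = column k (transpose (J x) ** cov a' w' (T x) ** J x)" for k by simp
  thus ?thesis by (metis (no_types, lifting) column_nth vec_eq_iff)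
qed

lemma lower_transform:
  assumes "x \<in> Ov" "V' (T x) = J x *v V x"
  shows "lower a V x = transpose (J x) *v lower a' V' (T x)"
proof -
  have l: "lower a V z = a z *v V z" for a :: "real^'n \<Rightarrow> real^'n^'n" and V z
    by (simp add: lower_def vec_eq_iff matrix_vector_mult_def)
  show ?thesis by (simp add: l a_trans assms matrix_vector_mul_assoc matrix_mul_assoc)
qed

end

locale randers_chart_change = chart_change U a U' a' Ov T J + B: randers_chart U a b + B': randers_chart U' a' b'
  for U :: "(real^'n::finite) set" and a U' a' Ov T J b b' +
  assumes b_trans: "\<And>x. x \<in> Ov \<Longrightarrow> b x = transpose (J x) *v b' (T x)"
begin

lemma outer_transform: "outer (transpose M *v u) (transpose M *v v) = transpose M ** outer u v ** M" for M :: "real^'n^'n"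
  by (rule matrix_eq_vecI)
    (simp add: outer_mult matrix_vector_mul_assoc[symmetric] matrix_vector_mult_scaleR inner_transpose[of v M])

text \<open>Everything is built from \<open>b_{i;j}\<close>, b and the raised b. The first two are
  pulled back; the raised b is pushed forward by J, which follows by cancelling the transposed
  Jacobian and a'.\<close>

lemma e_lo_transform:
  assumes x: "x \<in> Ov"
  shows "e_lo a b x = transpose (J x) ** e_lo a' b' (T x) ** J x"
    and "a x - outer (b x) (b x) = transpose (J x) ** (a' (T x) - outer (b' (T x)) (b' (T x))) ** J x"
proof -
  have Tx: "T x \<in> U'" by (rule T(1)[OF x])
  have xU: "x \<in> U" by (rule Ov_U[OF x])
  have c: "cov a b x = transpose (J x) ** cov a' b' (T x) ** J x"
    by (rule cov_transform[OF x b_trans B'.diffs(1)[OF Tx]])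
  hence ct: "transpose (cov a b x) = transpose (J x) ** transpose (cov a' b' (T x)) ** J x"
    by (simp add: matrix_transpose_mul matrix_mul_assoc)
  have rl: "r_lo a b z = (1/2) *\<^sub>R (cov a b z + transpose (cov a b z))" "s_lo a b z = (1/2) *\<^sub>R (cov a b z - transpose (cov a b z))"
    for a :: "real^'n \<Rightarrow> real^'n^'n" and b z by (simp_all add: r_lo_def s_lo_def vec_eq_iff transpose_def)
  have r: "r_lo a b x = transpose (J x) ** r_lo a' b' (T x) ** J x" and s: "s_lo a b x = transpose (J x) ** s_lo a' b' (T x) ** J x"
    unfolding rl c ct by (simp_all add: scaleR_matrix_mult matrix_add_ldistrib matrix_add_rdistrib matrix_diff_distrib matrix_transpose_mul matrix_mul_assoc)
  have "transpose (J x) *v (a' (T x) *v (J x *v raise a b x)) = transpose (J x) *v (a' (T x) *v raise a' b' (T x))"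
    using a_ainv_vec[OF xU, of "b x"] R'.a_ainv_vec[OF Tx, of "b' (T x)"]
    by (simp add: raise_eq[of b x] R'.raise_eq a_trans[OF x] b_trans[OF x] matrix_vector_mul_assoc[symmetric])
  hence "a' (T x) *v (J x *v raise a b x) = a' (T x) *v raise a' b' (T x)" by (rule J_vec_inj[OF x])
  hence Jr: "J x *v raise a b x = raise a' b' (T x)" by (metis R'.ainv_a_vec[OF Tx])
  have sv: "s_vec a b x = transpose (J x) *v s_vec a' b' (T x)"
    by (simp add: B.s_vec_eq B'.s_vec_eq s matrix_mult_minus matrix_vector_mul_assoc[symmetric] Jr)
  show "e_lo a b x = transpose (J x) ** e_lo a' b' (T x) ** J x"
    unfolding B.e_lo_eq B'.e_lo_eq r sv b_trans[OF x] outer_transform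
    by (simp add: matrix_add_ldistrib matrix_add_rdistrib)
  show "a x - outer (b x) (b x) = transpose (J x) ** (a' (T x) - outer (b' (T x)) (b' (T x))) ** J x"
    unfolding a_trans[OF x] b_trans[OF x] outer_transform by (simp add: matrix_diff_distrib)
qed

end

section \<open>Points where \<open>\<beta>\<close> vanishes\<close>

context randers_chart
begin

text \<open>Membership in the interior of the zero set of \<beta>, the points that no limit from
  \<beta> \<noteq> 0 can reach.\<close>

definition vanish_near :: "real^'n \<Rightarrow> bool" where
  "vanish_near x \<longleftrightarrow> (\<exists>\<epsilon>>0. ball x \<epsilon> \<subseteq> U \<and> (\<forall>z\<in>ball x \<epsilon>. b z = 0))"

text \<open>The trace of e = 2\<sigma>(a - b b) is 2\<sigma>(n - \<open>bsq x\<close>). Solved for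
  \<sigma>, this makes sense everywhere, is smooth and does not presuppose the equation.\<close>

definition sig :: "real^'n \<Rightarrow> real" where
  "sig x = trace (ainv a x ** e_lo a b x) / (2 * (real CARD('n) - bsq x))"

text \<open>The trace of \<open>V_{i;j} + V_{j;i} = 4c a_{ij}\<close>, solved for c.\<close>

definition cfac :: "(real^'n \<Rightarrow> real^'n) \<Rightarrow> real^'n \<Rightarrow> real" where
  "cfac V x = trace (ainv a x ** cov a (lower a V) x) / (2 * real CARD('n))"

lemma card_pos: "1 \<le> real CARD('n)"
  using zero_less_card_finite[where 'a='n] by linarith

lemma sig_Ck: "Ck_on k U sig"
proof -
  have "Ck_on k U (\<lambda>x. (\<Sum>i\<in>UNIV. \<Sum>j\<in>UNIV. ainv a x $ i $ j * e_lo a b x $ j $ i) / (2 * (real CARD('n) - (\<Sum>i\<in>UNIV. b x $ i * raise a b x $ i))))"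
  proof (intro Ck_intros open_U ainv_Ck e_lo_Ck b_Ck raise_Ck)
    fix x assume "x \<in> U"
    from less_le_trans[OF bsq_bounds(2)[OF this] card_pos]
    have "(\<Sum>i\<in>UNIV. b x $ i * raise a b x $ i) < real CARD('n)" by (simp add: bsq_def inner_vec_def)
    thus "2 * (real CARD('n) - (\<Sum>i\<in>UNIV. b x $ i * raise a b x $ i)) \<noteq> 0" by simp
  qed
  thus ?thesis by (simp add: sig_def[abs_def] trace_def matrix_matrix_mult_def bsq_def inner_vec_def)
qed

lemma trace_ab: assumes "x \<in> U" shows "trace (ainv a x ** (a x - outer (b x) (b x))) = real CARD('n) - bsq x"
  using assms by (simp add: matrix_diff_distrib trace_sub ainv_a trace_I trace_outer_mult raise_eq[symmetric] bsq_def)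

lemma sig_unique:
  assumes "x \<in> U" "e_lo a b x = (2 * \<sigma>) *\<^sub>R (a x - outer (b x) (b x))"
  shows "sig x = \<sigma>"
proof -
  have "real CARD('n) - bsq x \<noteq> 0" using less_le_trans[OF bsq_bounds(2)[OF assms(1)] card_pos] by simp
  moreover have "sig x = 2 * \<sigma> * (real CARD('n) - bsq x) / (2 * (real CARD('n) - bsq x))"
    by (simp only: sig_def assms(2) scaleR_matrix_mult trace_scaleR trace_ab[OF assms(1)])
  ultimately show ?thesis by (simp only: mult.assoc mult_divide_mult_cancel_left_if nonzero_mult_div_cancel_right) simp
qed

lemma cfac_unique:
  assumes "x \<in> U" "cov a (lower a V) x + transpose (cov a (lower a V) x) = (4 * c) *\<^sub>R a x"
  shows "cfac V x = c"
proof -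
  let ?W = "cov a (lower a V) x"
  have "trace (ainv a x ** transpose ?W) = trace (transpose (?W ** ainv a x))"
    by (simp add: matrix_transpose_mul ainv_sym assms(1))
  also have "\<dots> = trace (ainv a x ** ?W)" by (simp only: trace_transpose trace_mul_sym[of ?W])
  finally have "2 * trace (ainv a x ** ?W) = trace (ainv a x ** (?W + transpose ?W))"
    by (simp add: matrix_add_ldistrib trace_add)
  also have "\<dots> = 4 * c * real CARD('n)" by (simp add: assms scaleR_matrix_mult trace_scaleR ainv_a trace_I)
  finally show ?thesis using card_pos by (simp add: cfac_def)
qed

lemma cov_lower_Ck:
  assumes V: "\<And>i. Ck_on 2 U (\<lambda>x. V x $ i)"
  shows "Ck_on 1 U (\<lambda>x. cov a (lower a V) x $ i $ j)"
proof -
  have 2: "Ck_on 2 U (\<lambda>x. lower a V x $ i)" for i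
    by (simp only: lower_def vec_lambda_beta, intro Ck_intros open_U a_Ck V)
  have "Ck_on 1 U (\<lambda>x. pd j (\<lambda>x. lower a V x $ i) x - (\<Sum>k\<in>UNIV. christoffel a k i j x * lower a V x $ k))"
    by (intro Ck_intros open_U christoffel_Ck Ck_on_le[OF _ 2] Ck_on_pd) (use 2[of i] in \<open>simp_all add: numeral_2_eq_2\<close>)
  thus ?thesis by (simp only: cov_def vec_lambda_beta)
qed

lemma cfac_continuous:
  assumes V: "\<And>i. Ck_on 2 U (\<lambda>x. V x $ i)"
  shows "continuous_on U (cfac V)"
proof -
  have "Ck_on 1 U (\<lambda>x. (\<Sum>i\<in>UNIV. \<Sum>j\<in>UNIV. ainv a x $ i $ j * cov a (lower a V) x $ j $ i) / (2 * real CARD('n)))"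
    by (intro Ck_intros open_U ainv_Ck cov_lower_Ck V) (use card_pos in simp)
  from Ck_on_continuous[OF this] show ?thesis
    by (simp add: cfac_def[abs_def] trace_def matrix_matrix_mult_def)
qed

lemma lieB_nth: "lieB V x $ k = (\<Sum>i\<in>UNIV. V x $ i * pd i (\<lambda>x. b x $ k) x) + (\<Sum>i\<in>UNIV. b x $ i * pd k (\<lambda>x. V x $ i) x)"
  by (simp add: lieB_def pdVd_def pdV_def inner_vec_def)

lemma lieB_continuous:
  assumes V: "\<And>i. Ck_on 1 U (\<lambda>x. V x $ i)"
  shows "continuous_on U (\<lambda>x. lieB V x $ k)"
proof -
  have "Ck_on 0 U (\<lambda>x. (\<Sum>i\<in>UNIV. V x $ i * pd i (\<lambda>x. b x $ k) x) + (\<Sum>i\<in>UNIV. b x $ i * pd k (\<lambda>x. V x $ i) x))"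
    by (intro Ck_intros open_U Ck_on_pd b_Ck Ck_on_le[OF _ V]) (use V in auto)
  thus ?thesis by (simp add: lieB_nth)
qed

text \<open>Otherwise f and g differ on a whole ball around x; there b must vanish, and x would be
  an interior zero.\<close>

lemma continuous_extension:
  fixes f g :: "real^'n \<Rightarrow> real"
  assumes c: "continuous_on U f" "continuous_on U g" and eq: "\<And>z. z \<in> U \<Longrightarrow> b z \<noteq> 0 \<Longrightarrow> f z = g z"
    and x: "x \<in> U" "\<not> vanish_near x"
  shows "f x = g x"
proof (rule ccontr)
  assume ne: "f x \<noteq> g x"
  let ?S = "U \<inter> (\<lambda>z. f z - g z) -` (- {0})"
  have "open ?S" by (intro continuous_open_preimage continuous_on_diff c open_U open_Compl closed_singleton)
  moreover have "x \<in> ?S" using ne x by simp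
  ultimately obtain \<epsilon> where \<epsilon>: "\<epsilon> > 0" "ball x \<epsilon> \<subseteq> ?S" using open_contains_ball by blast
  hence "ball x \<epsilon> \<subseteq> U \<and> (\<forall>z\<in>ball x \<epsilon>. b z = 0)" using eq by fastforce
  thus False using x \<epsilon> by (auto simp: vanish_near_def)
qed

lemma vanish_near_zero:
  assumes "vanish_near x"
  shows "x \<in> U" "b x = 0" "pd k (\<lambda>x. b x $ i) x = 0" "e_lo a b x = 0" "sig x = 0" "pd k sig x = 0" "lieB V x = 0"
proof -
  obtain \<epsilon> where \<epsilon>: "\<epsilon> > 0" "ball x \<epsilon> \<subseteq> U" "\<And>z. z \<in> ball x \<epsilon> \<Longrightarrow> b z = 0"
    using assms by (auto simp: vanish_near_def)
  have xb: "x \<in> ball x \<epsilon>" using \<epsilon> by simp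
  have pd0: "pd k (\<lambda>x. b x $ i) z = 0" if "z \<in> ball x \<epsilon>" for z k i
    using pd_cong[OF open_ball that, of "\<lambda>x. b x $ i" "\<lambda>_. 0" k] \<epsilon>(3) by simp
  have e0: "e_lo a b z = 0" if z: "z \<in> ball x \<epsilon>" for z
  proof -
    have "cov a b z = 0" by (simp add: vec_eq_iff cov_def pd0[OF z] \<epsilon>(3)[OF z])
    thus ?thesis by (simp add: vec_eq_iff e_lo_def r_lo_def \<epsilon>(3)[OF z])
  qed
  have s0: "sig z = 0" if "z \<in> ball x \<epsilon>" for z
    by (simp add: sig_def e0[OF that]) (simp add: trace_def)
  show "x \<in> U" "b x = 0" "pd k (\<lambda>x. b x $ i) x = 0" "e_lo a b x = 0" "sig x = 0"
    using xb \<epsilon> pd0 e0 s0 by auto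
  show "pd k sig x = 0" using pd_cong[OF open_ball xb, of sig "\<lambda>_. 0" k] s0 by simp
  show "lieB V x = 0" by (simp add: vec_eq_iff lieB_nth pd0[OF xb] \<epsilon>(3)[OF xb])
qed

section \<open>Extension of the identities across the zeros of \<beta>\<close>

context
  fixes V :: "real^'n \<Rightarrow> real^'n" and k :: "real^'n \<Rightarrow> real"
  assumes n2: "CARD('n) \<ge> 2" and V: "\<And>i. Ck_on 2 U (\<lambda>x. V x $ i)"
    and sol: "\<And>x. x \<in> U \<Longrightarrow> soliton_at (k x) V x"
begin

lemma V1: "Ck_on 1 U (\<lambda>x. V x $ i)"
  by (rule Ck_on_le[OF _ V]) simp

lemma V_diff: "x \<in> U \<Longrightarrow> diffV V x"
  using V1 by (simp add: diffV_def)

text \<open>Known where \<beta> \<noteq> 0, hence by continuity outside the interior of the zero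
  set; in that interior both sides are 0.\<close>

lemma e_lo_sig: assumes x: "x \<in> U" shows "e_lo a b x = (2 * sig x) *\<^sub>R (a x - outer (b x) (b x))"
proof (cases "vanish_near x")
  case True
  thus ?thesis by (simp add: vanish_near_zero)
next
  case False
  have "e_lo a b x $ i $ j = 2 * sig x * (a x $ i $ j - b x $ i * b x $ j)" for i j
  proof (rule continuous_extension[OF _ _ _ x False, where f="\<lambda>x. e_lo a b x $ i $ j" and g="\<lambda>x. 2 * sig x * (a x $ i $ j - b x $ i * b x $ j)"])
    show "continuous_on U (\<lambda>x. e_lo a b x $ i $ j)" by (rule Ck_on_continuous[OF e_lo_Ck])
    have "Ck_on 1 U (\<lambda>x. 2 * sig x * (a x $ i $ j - b x $ i * b x $ j))" by (intro Ck_intros open_U sig_Ck a_Ck b_Ck)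
    thus "continuous_on U (\<lambda>x. 2 * sig x * (a x $ i $ j - b x $ i * b x $ j))" by (rule Ck_on_continuous)
    fix z assume z: "z \<in> U" "b z \<noteq> 0"
    then obtain \<sigma> where \<sigma>: "e_lo a b z = (2 * \<sigma>) *\<^sub>R (a z - outer (b z) (b z))"
      using soliton_imp_conformal(1)[OF z(1) V_diff[OF z(1)] sol[OF z(1)] z(2) n2] by blast
    with sig_unique[OF z(1) \<sigma>] show "e_lo a b z $ i $ j = 2 * sig z * (a z $ i $ j - b z $ i * b z $ j)"
      by (simp add: outer_def)
  qed
  thus ?thesis by (simp add: vec_eq_iff outer_def)
qed

lemma conformal_nonzero:
  assumes z: "z \<in> U" "b z \<noteq> 0"
  shows "cov a (lower a V) z + transpose (cov a (lower a V) z) = (4 * cfac V z) *\<^sub>R a z"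
  using soliton_imp_conformal(2)[OF z(1) V_diff[OF z(1)] sol[OF z(1)] z(2) n2] cfac_unique[OF z(1)] by auto

text \<open>Interior zeros of \<beta> are left out: there F is Riemannian and the soliton equation
  does not make V conformal.\<close>

lemma conformal_cfac:
  assumes x: "x \<in> U" and nv: "\<not> vanish_near x"
  shows "cov a (lower a V) x + transpose (cov a (lower a V) x) = (4 * cfac V x) *\<^sub>R a x"
proof -
  have "cov a (lower a V) x $ i $ j + cov a (lower a V) x $ j $ i = 4 * cfac V x * a x $ i $ j" for i j
  proof (rule continuous_extension[OF _ _ _ x nv, where f="\<lambda>x. cov a (lower a V) x $ i $ j + cov a (lower a V) x $ j $ i" and g="\<lambda>x. 4 * cfac V x * a x $ i $ j"])
    show "continuous_on U (\<lambda>x. cov a (lower a V) x $ i $ j + cov a (lower a V) x $ j $ i)"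
      by (intro continuous_on_add Ck_on_continuous[OF cov_lower_Ck] V)
    show "continuous_on U (\<lambda>x. 4 * cfac V x * a x $ i $ j)"
      by (intro continuous_on_mult continuous_on_const cfac_continuous V Ck_on_continuous[OF a_Ck])
    fix z assume z: "z \<in> U" "b z \<noteq> 0"
    from arg_cong[OF conformal_nonzero[OF z], of "\<lambda>M. M $ i $ j"]
    show "cov a (lower a V) z $ i $ j + cov a (lower a V) z $ j $ i = 4 * cfac V z * a z $ i $ j"
      by (simp add: transpose_def)
  qed
  thus ?thesis by (simp add: vec_eq_iff transpose_def)
qed

text \<open>Holds on all of U, since at interior zeros of \<beta> every term vanishes; this is what
  makes \<open>unique_continuation\<close> applicable there.\<close>

lemma grad_sig:
  assumes x: "x \<in> U"
  shows "(3 * (real CARD('n) - 1)) * pd j sig x = 2 * cfac V x * b x $ j - lieB V x $ j"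
proof (cases "vanish_near x")
  case True
  thus ?thesis by (simp add: vanish_near_zero)
next
  case False
  show ?thesis
  proof (rule continuous_extension[OF _ _ _ x False, where f="\<lambda>x. (3 * (real CARD('n) - 1)) * pd j sig x" and g="\<lambda>x. 2 * cfac V x * b x $ j - lieB V x $ j"])
    show "continuous_on U (\<lambda>x. (3 * (real CARD('n) - 1)) * pd j sig x)"
      by (intro continuous_on_mult continuous_on_const Ck_on_continuous[of 0] Ck_on_pd sig_Ck)
    show "continuous_on U (\<lambda>x. 2 * cfac V x * b x $ j - lieB V x $ j)"
      by (intro continuous_on_diff continuous_on_mult continuous_on_const cfac_continuous V Ck_on_continuous[OF b_Ck] lieB_continuous V1)
    fix z assume z: "z \<in> U" "b z \<noteq> 0"
    have "sig differentiable (at z)" using sig_Ck[of 1] z by simp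
    from soliton_iff[OF refl z(1) this e_lo_sig V_diff[OF z(1)] conformal_nonzero[OF z], of "k z"] sol[OF z(1)]
    have "(3 * (real CARD('n) - 1)) *\<^sub>R grad sig z = (2 * cfac V z) *\<^sub>R b z - lieB V z" by blast
    from arg_cong[OF this, of "\<lambda>v. v $ j"]
    show "(3 * (real CARD('n) - 1)) * pd j sig z = 2 * cfac V z * b z $ j - lieB V z $ j" by (simp add: grad_def)
  qed
qed

text \<open>If all unknowns vanish at x, unique continuation spreads their zeros to a ball.
  Otherwise one of them is nonzero in a ball, which then contains no interior zero of \<beta>, since
  at such a zero all unknowns vanish.\<close>

lemma vanish_near_clopen:
  assumes x: "x \<in> U"
  shows "\<exists>\<delta>>0. ball x \<delta> \<subseteq> U \<and> ((\<exists>q\<in>ball x \<delta>. vanish_near q) \<longrightarrow> (\<forall>z\<in>ball x \<delta>. b z = 0))"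
proof (cases "\<forall>w\<in>unknowns sig. w x = 0")
  case True
  have n1: "real CARD('n) - 1 \<noteq> 0" using n2 by simp
  obtain \<epsilon> where \<epsilon>: "\<epsilon> > 0" "ball x \<epsilon> \<subseteq> U" "\<forall>q\<in>ball x \<epsilon>. (\<forall>z\<in>unknowns sig. z q = 0) \<longrightarrow> (\<forall>x\<in>ball x \<epsilon>. b x = 0)"
    using unique_continuation[OF n1 sig_Ck cfac_continuous[OF V] V1 e_lo_sig grad_sig x] True by blast
  moreover have "\<forall>z\<in>unknowns sig. z q = 0" if "vanish_near q" for q
    using vanish_near_zero[OF that] by (auto simp: unknowns_def)
  ultimately show ?thesis by blast
next
  case False
  then obtain w where w: "w \<in> unknowns sig" "w x \<noteq> 0" by blast
  have "continuous_on U w"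
    using w(1) Ck_on_continuous[OF sig_Ck] Ck_on_continuous[OF b_Ck] Ck_on_continuous[OF Ck_on_pd[OF b_Ck]]
    by (auto simp: unknowns_def)
  hence "open (U \<inter> w -` (- {0}))" by (intro continuous_open_preimage open_U open_Compl closed_singleton)
  moreover have "x \<in> U \<inter> w -` (- {0})" using w x by simp
  ultimately obtain \<delta> where \<delta>: "\<delta> > 0" "ball x \<delta> \<subseteq> U \<inter> w -` (- {0})" using open_contains_ball by blast
  moreover have "w q = 0" if "vanish_near q" for q
    using vanish_near_zero[OF that] w(1) by (auto simp: unknowns_def)
  ultimately show ?thesis by (intro exI[of _ \<delta>]) auto
qed

end

end


section \<open>Passage to the manifold\<close>

text \<open>F equals \<alpha> + \<beta> only over the image of the chart. All operators involved are
  local in x, so agreement over an open set passes to the Ricci curvature and the Lie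
  derivative.\<close>

definition agree :: "(real^'n::finite) set \<Rightarrow> (real^'n \<Rightarrow> real^'n \<Rightarrow> real) \<Rightarrow> (real^'n \<Rightarrow> real^'n \<Rightarrow> real) \<Rightarrow> bool" where
  "agree U f g \<longleftrightarrow> (\<forall>x\<in>U. f x = g x)"

lemma agree_dx: "open U \<Longrightarrow> agree U f g \<Longrightarrow> agree U (dx i f) (dx i g)"
  unfolding agree_def dx_def by (intro ballI ext pd_cong[of U]) auto

lemma agree_dy: "agree U f g \<Longrightarrow> agree U (dy i f) (dy i g)"
  unfolding agree_def dy_def by (intro ballI ext) simp

lemma agree_sq: "agree U f g \<Longrightarrow> agree U (\<lambda>x y. (f x y)\<^sup>2) (\<lambda>x y. (g x y)\<^sup>2)"
  by (simp add: agree_def)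

lemma agreeD: "agree U f g \<Longrightarrow> x \<in> U \<Longrightarrow> f x y = g x y"
  by (simp add: agree_def)

lemma agree_spray:
  assumes "open U" "agree U F F'"
  shows "agree U (spray F i) (spray F' i)"
proof -
  note sq = agree_sq[OF assms(2)]
  have "fund_tensor F x y = fund_tensor F' x y" if "x \<in> U" for x y
    using agreeD[OF agree_dy[OF agree_dy[OF sq]] that] by (simp add: fund_tensor_def vec_eq_iff)
  moreover note agreeD[OF agree_dy[OF agree_dx[OF assms(1) sq]]] agreeD[OF agree_dx[OF assms(1) sq]]
  ultimately show ?thesis by (simp add: agree_def spray_def fun_eq_iff)
qed

lemma agree_finsler_Ric:
  assumes "open U" "agree U F F'" "x \<in> U"
  shows "finsler_Ric F x y = finsler_Ric F' x y"
proof -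
  note sp = agree_spray[OF assms(1,2)]
  note agreeD[OF sp assms(3)] agreeD[OF agree_dx[OF assms(1) sp] assms(3)] agreeD[OF agree_dy[OF sp] assms(3)]
    agreeD[OF agree_dx[OF assms(1) agree_dy[OF sp]] assms(3)] agreeD[OF agree_dy[OF agree_dy[OF sp]] assms(3)]
  thus ?thesis by (simp add: finsler_Ric_def riem_curv_def)
qed

lemma agree_lie_lift:
  assumes "open U" "agree U f g" "x \<in> U"
  shows "lie_lift V f x y = lie_lift V g x y"
  using agreeD[OF agree_dx[OF assms(1,2)] assms(3)] agreeD[OF agree_dy[OF assms(2)] assms(3)]
  by (simp add: lie_lift_def)

lemma (in randers_chart) soliton_at_cong:
  assumes F: "\<And>x y. x \<in> U \<Longrightarrow> F x y = alpha a x y + beta b x y" and x: "x \<in> U"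
  shows "soliton_at k V x \<longleftrightarrow> (\<forall>y. y \<noteq> 0 \<longrightarrow> 2 * finsler_Ric F x y + lie_lift V (\<lambda>x y. (F x y)\<^sup>2) x y = 2 * k * (F x y)\<^sup>2)"
proof -
  have ag: "agree U FF F" using F by (simp add: agree_def fun_eq_iff FF_def beta_def lin_inner)
  show ?thesis
    unfolding soliton_at_def agree_finsler_Ric[OF open_U ag x] agree_lie_lift[OF open_U agree_sq[OF ag] x] agreeD[OF ag x] ..
qed

lemma (in randers_chart) e00_iff:
  assumes x: "x \<in> U"
  shows "(\<forall>y. e00 a b x y = 2 * \<sigma> * ((alpha a x y)\<^sup>2 - (beta b x y)\<^sup>2)) \<longleftrightarrow> e_lo a b x = (2 * \<sigma>) *\<^sub>R (a x - outer (b x) (b x))"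
proof
  assume e: "e_lo a b x = (2 * \<sigma>) *\<^sub>R (a x - outer (b x) (b x))"
  have "quad (a x) y = (alpha a x y)\<^sup>2" for y by (simp add: alpha_sq x quad_inner)
  thus "\<forall>y. e00 a b x y = 2 * \<sigma> * ((alpha a x y)\<^sup>2 - (beta b x y)\<^sup>2)"
    by (simp add: e00_def e quad_scaleR quad_diff quad_outer beta_def lin_inner) (simp add: power2_eq_square)
qed (rule e_lo_conformal[OF _ x], simp)

lemma (in randers_chart) soliton_iff_defs:
  assumes n: "n = real CARD('n)" and x: "x \<in> U" and \<sigma>: "\<sigma> differentiable (at x)"
    and e: "\<And>z. z \<in> U \<Longrightarrow> e_lo a b z = (2 * \<sigma> z) *\<^sub>R (a z - outer (b z) (b z))"
    and V: "diffV V x" and conf: "cov a (lower a V) x + transpose (cov a (lower a V) x) = (4 * c) *\<^sub>R a x"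
  shows "soliton_at k V x \<longleftrightarrow> (\<forall>y. alpha_Ric a x y = (k - 2 * c) * ((alpha a x y)\<^sup>2 + (beta b x y)\<^sup>2)
            + t_trace a b x * (alpha a x y)\<^sup>2 + 2 * t00 a b x y
            - (n - 1) * (\<sigma> x)\<^sup>2 * (3 * (alpha a x y)\<^sup>2 - (beta b x y)\<^sup>2)
            + 2 * (n - 1) * d0 \<sigma> x y * beta b x y - (n - 1) * ((s0 a b x y)\<^sup>2 + s0_cov0 a b x y)) \<and>
     (\<forall>y. 3 * (n - 1) * d0 \<sigma> x y = 2 * c * beta b x y - lie_lift V (beta b) x y)"
proof -
  have d: "d0 \<sigma> x y = grad \<sigma> x \<bullet> y" for y by (simp add: d0_def grad_def inner_vec_def)
  have "(3 * (n-1)) *\<^sub>R grad \<sigma> x = (2 * c) *\<^sub>R b x - lieB V x \<longleftrightarrow>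
     (\<forall>y. 3 * (n - 1) * d0 \<sigma> x y = 2 * c * beta b x y - lie_lift V (beta b) x y)"
    by (subst vector_eq_rdot[symmetric]) (simp add: d lie_lift_beta[OF x] beta_def lin_inner inner_diff_left)
  note I = soliton_iff[OF n x \<sigma> e V conf, of k, unfolded this]
  have q: "(alpha a x y)\<^sup>2 = quad (a x) y" for y by (simp add: alpha_sq x quad_inner)
  note defs = d q alpha_Ric_def beta_def lin_inner t00_def s0_def s0_cov0_def
  show ?thesis unfolding defs by (rule I[unfolded defs])
qed

section \<open>Topology of charts and independence of the chart\<close>

lemma chart_facts:
  assumes "is_chart X \<phi>"
  shows "open (rng_of \<phi>)" "openin X (dom_of \<phi>)"
    and "p \<in> dom_of \<phi> \<Longrightarrow> chart_inv \<phi> (snd \<phi> p) = p"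
    and "x \<in> rng_of \<phi> \<Longrightarrow> chart_inv \<phi> x \<in> dom_of \<phi> \<and> snd \<phi> (chart_inv \<phi> x) = x"
    and "open S \<Longrightarrow> openin X {p \<in> dom_of \<phi>. snd \<phi> p \<in> S}"
    and "openin X N \<Longrightarrow> open (snd \<phi> ` (dom_of \<phi> \<inter> N))"
proof -
  have h: "homeomorphic_map (subtopology X (dom_of \<phi>)) (top_of_set (rng_of \<phi>)) (snd \<phi>)"
    and o: "openin X (dom_of \<phi>)" "open (rng_of \<phi>)" using assms by (auto simp: is_chart_def)
  have ts: "topspace (subtopology X (dom_of \<phi>)) = dom_of \<phi>"
    using o openin_subset[of X "dom_of \<phi>"] by (simp add: topspace_subtopology inf.absorb2)
  show "open (rng_of \<phi>)" "openin X (dom_of \<phi>)" by (rule o)+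
  show "chart_inv \<phi> (snd \<phi> p) = p" if "p \<in> dom_of \<phi>"
    using homeomorphic_imp_injective_map[OF h] that by (simp add: chart_inv_def ts inv_into_f_f del: topspace_subtopology)
  show "chart_inv \<phi> x \<in> dom_of \<phi> \<and> snd \<phi> (chart_inv \<phi> x) = x" if "x \<in> rng_of \<phi>"
    using that by (simp add: chart_inv_def inv_into_into f_inv_into_f)
  show "openin X {p \<in> dom_of \<phi>. snd \<phi> p \<in> S}" if S: "open S"
  proof -
    have "openin (top_of_set (rng_of \<phi>)) (rng_of \<phi> \<inter> S)" using S by (simp add: openin_open_Int)
    from openin_continuous_map_preimage[OF homeomorphic_imp_continuous_map[OF h] this]
    have "openin (subtopology X (dom_of \<phi>)) {p \<in> dom_of \<phi>. snd \<phi> p \<in> rng_of \<phi> \<inter> S}" by (simp only: ts)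
    moreover have "{p \<in> dom_of \<phi>. snd \<phi> p \<in> rng_of \<phi> \<inter> S} = {p \<in> dom_of \<phi>. snd \<phi> p \<in> S}" by auto
    ultimately show ?thesis using openin_trans_full[OF _ o(1)] by metis
  qed
  show "open (snd \<phi> ` (dom_of \<phi> \<inter> N))" if N: "openin X N"
  proof -
    have "openin (subtopology X (dom_of \<phi>)) (dom_of \<phi> \<inter> N)"
      using N by (metis Int_commute openin_subtopology_Int)
    from homeomorphic_imp_open_map[OF h] this
    have "openin (top_of_set (rng_of \<phi>)) (snd \<phi> ` (dom_of \<phi> \<inter> N))" by (simp add: open_map_def)
    thus ?thesis using o(2) openin_open_trans by blast
  qed
qed

lemma (in randers_chart) vanish_near_ball:
  assumes "vanish_near x"
  shows "\<exists>\<epsilon>>0. \<forall>q\<in>ball x \<epsilon>. vanish_near q"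
proof -
  obtain \<epsilon> where \<epsilon>: "\<epsilon> > 0" "ball x \<epsilon> \<subseteq> U" "\<forall>z\<in>ball x \<epsilon>. b z = 0"
    using assms by (auto simp: vanish_near_def)
  have "vanish_near q" if "q \<in> ball x \<epsilon>" for q
  proof -
    note q = that
    obtain \<delta> where "\<delta> > 0" "ball q \<delta> \<subseteq> ball x \<epsilon>" using openE[OF open_ball q] by metis
    thus ?thesis using \<epsilon> unfolding vanish_near_def by (intro exI[of _ \<delta>]) blast
  qed
  thus ?thesis using \<epsilon> by blast
qed

lemma (in randers_chart_change) vanish_near_transform:
  assumes x: "x \<in> Ov" and v: "B'.vanish_near (T x)"
  shows "B.vanish_near x"
proof -
  obtain \<epsilon> where \<epsilon>: "\<epsilon> > 0" "\<forall>z\<in>ball (T x) \<epsilon>. b' z = 0" using v by (auto simp: B'.vanish_near_def)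
  have "continuous_on Ov (\<lambda>z. \<chi> i. T z $ i)"
    by (intro continuous_on_vec_lambda Ck_on_continuous[OF T(2)])
  hence "continuous_on Ov T" by simp
  hence "open (Ov \<inter> T -` ball (T x) \<epsilon>)" by (intro continuous_open_preimage Ov(1) open_ball)
  moreover have "x \<in> Ov \<inter> T -` ball (T x) \<epsilon>" using x \<epsilon> by simp
  ultimately obtain \<delta> where \<delta>: "\<delta> > 0" "ball x \<delta> \<subseteq> Ov \<inter> T -` ball (T x) \<epsilon>" using open_contains_ball by blast
  have "b z = 0" if "z \<in> ball x \<delta>" for z
  proof -
    have z: "z \<in> Ov" "T z \<in> ball (T x) \<epsilon>" using that \<delta>(2) by auto
    hence "b' (T z) = 0" using \<epsilon>(2) by blast
    thus ?thesis using b_trans[OF z(1)] by simp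
  qed
  moreover have "ball x \<delta> \<subseteq> U" using \<delta>(2) Ov(2) by blast
  ultimately show ?thesis using \<delta>(1) by (auto simp: B.vanish_near_def)
qed

lemma (in randers_chart_change) sig_transform:
  assumes x: "x \<in> Ov" and e: "e_lo a' b' (T x) = (2 * \<sigma>) *\<^sub>R (a' (T x) - outer (b' (T x)) (b' (T x)))"
  shows "B.sig x = \<sigma>"
proof (rule B.sig_unique[OF Ov_U[OF x]])
  show "e_lo a b x = (2 * \<sigma>) *\<^sub>R (a x - outer (b x) (b x))"
    unfolding e_lo_transform[OF x] e by (simp add: scaleR_matrix_mult)
qed

lemma (in randers_chart_change) cfac_transform:
  assumes x: "x \<in> Ov" and V: "\<And>z. z \<in> Ov \<Longrightarrow> V' (T z) = J z *v V z" and d: "diffV (lower a' V') (T x)"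
    and c: "cov a' (lower a' V') (T x) + transpose (cov a' (lower a' V') (T x)) = (4 * c) *\<^sub>R a' (T x)"
  shows "B.cfac V x = c"
proof (rule B.cfac_unique[OF Ov_U[OF x]])
  have l: "cov a (lower a V) x = transpose (J x) ** cov a' (lower a' V') (T x) ** J x"
    by (rule cov_transform[OF x _ d]) (rule lower_transform, assumption, rule V)
  have "cov a (lower a V) x + transpose (cov a (lower a V) x) =
      transpose (J x) ** (cov a' (lower a' V') (T x) + transpose (cov a' (lower a' V') (T x))) ** J x"
    unfolding l by (simp add: matrix_transpose_mul matrix_add_ldistrib matrix_add_rdistrib matrix_mul_assoc)
  thus "cov a (lower a V) x + transpose (cov a (lower a V) x) = (4 * c) *\<^sub>R a x"
    by (simp add: c scaleR_matrix_mult a_trans[OF x])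
qed

theorem theorem1p2:
  fixes X :: "'m topology"
    and A :: "('m, 'n::finite) chart set"
    and a :: "('m, 'n) chart \<Rightarrow> real^'n \<Rightarrow> real^'n^'n"
    and b V :: "('m, 'n) chart \<Rightarrow> real^'n \<Rightarrow> real^'n"
    and F :: "('m, 'n) chart \<Rightarrow> real^'n \<Rightarrow> real^'n \<Rightarrow> real"
    and \<kappa> :: "'m \<Rightarrow> real"
    and n :: real
  assumes dim: "CARD('n) \<ge> 2"
    and n_def: "n = real CARD('n)"
    and M: "smooth_manifold X A"
    and F: "randers_metric A a b F"
    and nonR: "non_riemannian X A b"
    and V: "vector_field 2 A V"
  shows "almost_ricci_soliton A F V \<kappa> \<longleftrightarrow>
    (\<exists>c \<sigma> :: 'm \<Rightarrow> real. C1_scalar A \<sigma> \<and> conformal_field A a V c \<and>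
      (\<forall>\<phi>\<in>A. \<forall>x\<in>rng_of \<phi>. \<forall>y.
        e00 (a \<phi>) (b \<phi>) x y
          = 2 * in_chart \<phi> \<sigma> x * ((alpha (a \<phi>) x y)\<^sup>2 - (beta (b \<phi>) x y)\<^sup>2) \<and>
        alpha_Ric (a \<phi>) x y
          = (in_chart \<phi> \<kappa> x - 2 * in_chart \<phi> c x) * ((alpha (a \<phi>) x y)\<^sup>2 + (beta (b \<phi>) x y)\<^sup>2)
            + t_trace (a \<phi>) (b \<phi>) x * (alpha (a \<phi>) x y)\<^sup>2
            + 2 * t00 (a \<phi>) (b \<phi>) x y
            - (n - 1) * (in_chart \<phi> \<sigma> x)\<^sup>2 * (3 * (alpha (a \<phi>) x y)\<^sup>2 - (beta (b \<phi>) x y)\<^sup>2)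
            + 2 * (n - 1) * d0 (in_chart \<phi> \<sigma>) x y * beta (b \<phi>) x y
            - (n - 1) * ((s0 (a \<phi>) (b \<phi>) x y)\<^sup>2 + s0_cov0 (a \<phi>) (b \<phi>) x y) \<and>
        3 * (n - 1) * d0 (in_chart \<phi> \<sigma>) x y
          = 2 * in_chart \<phi> c x * beta (b \<phi>) x y - lie_lift (V \<phi>) (beta (b \<phi>)) x y))"
    (is "_ \<longleftrightarrow> (\<exists>c \<sigma>. C1_scalar A \<sigma> \<and> conformal_field A a V c \<and> (\<forall>\<phi>\<in>A. \<forall>x\<in>rng_of \<phi>. \<forall>y. ?E \<phi> \<sigma> x y \<and> ?R \<phi> c \<sigma> x y \<and> ?D \<phi> c \<sigma> x y))")
proof -
  have riem: "riemannian_metric A a" and form: "one_form A b" using F by (simp_all add: randers_metric_def)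
  have ch: "is_chart X \<phi>" if "\<phi> \<in> A" for \<phi> using M that by (simp add: smooth_manifold_def)
  have R: "randers_chart (rng_of \<phi>) (a \<phi>) (b \<phi>)" if "\<phi> \<in> A" for \<phi>
  proof unfold_locales
    show "open (rng_of \<phi>)" by (rule chart_facts(1)[OF ch[OF that]])
  qed (use F that in \<open>auto simp: randers_metric_def riemannian_metric_def one_form_def smooth_on_def quad_def\<close>)
  have V2: "Ck_on 2 (rng_of \<phi>) (\<lambda>x. V \<phi> x $ i)" if "\<phi> \<in> A" for \<phi> i
    using V that by (simp add: vector_field_def)
  have Vd: "diffV (V \<phi>) x" if "\<phi> \<in> A" "x \<in> rng_of \<phi>" for \<phi> x
    unfolding diffV_def using Ck_on_differentiable[OF V2[OF that(1)] _ that(2)] by simp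
  let ?sol = "\<lambda>\<phi> x. randers_chart.soliton_at (a \<phi>) (b \<phi>) (in_chart \<phi> \<kappa> x) (V \<phi>) x"
  have sol: "almost_ricci_soliton A F V \<kappa> \<longleftrightarrow> (\<forall>\<phi>\<in>A. \<forall>x\<in>rng_of \<phi>. ?sol \<phi> x)"
  proof -
    have "?sol \<phi> x \<longleftrightarrow> (\<forall>y. y \<noteq> 0 \<longrightarrow> 2 * finsler_Ric (F \<phi>) x y + lie_lift (V \<phi>) (\<lambda>x y. (F \<phi> x y)\<^sup>2) x y = 2 * in_chart \<phi> \<kappa> x * (F \<phi> x y)\<^sup>2)"
      if "\<phi> \<in> A" "x \<in> rng_of \<phi>" for \<phi> x
      by (rule randers_chart.soliton_at_cong[OF R[OF that(1)] _ that(2)]) (use F that(1) in \<open>unfold randers_metric_def, blast\<close>)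
    thus ?thesis by (simp add: almost_ricci_soliton_def)
  qed
  have conf: "(\<forall>i j. cov (a \<phi>) (lower (a \<phi>) (V \<phi>)) x $ i $ j + cov (a \<phi>) (lower (a \<phi>) (V \<phi>)) x $ j $ i = 4 * k * a \<phi> x $ i $ j)
      \<longleftrightarrow> cov (a \<phi>) (lower (a \<phi>) (V \<phi>)) x + transpose (cov (a \<phi>) (lower (a \<phi>) (V \<phi>)) x) = (4 * k) *\<^sub>R a \<phi> x" for \<phi> x k
    by (simp add: vec_eq_iff transpose_def)
  \<comment> \<open>Both directions of the equivalence reduce to this pointwise statement, once
    \<sigma> and c are available and e has the required form.\<close>
  have loc: "?sol \<phi> x \<longleftrightarrow> (\<forall>y. ?R \<phi> c \<sigma> x y) \<and> (\<forall>y. ?D \<phi> c \<sigma> x y)"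
    if C1: "C1_scalar A \<sigma>" and cf: "conformal_field A a V c" and \<phi>: "\<phi> \<in> A" and x: "x \<in> rng_of \<phi>"
      and e: "\<And>z. z \<in> rng_of \<phi> \<Longrightarrow> e_lo (a \<phi>) (b \<phi>) z = (2 * in_chart \<phi> \<sigma> z) *\<^sub>R (a \<phi> z - outer (b \<phi> z) (b \<phi> z))" for c \<sigma> \<phi> x
  proof (rule randers_chart.soliton_iff_defs[OF R[OF \<phi>] n_def x _ _ Vd[OF \<phi> x]])
    show "in_chart \<phi> \<sigma> differentiable (at x)" using C1 \<phi> x by (auto simp: C1_scalar_def)
    show "cov (a \<phi>) (lower (a \<phi>) (V \<phi>)) x + transpose (cov (a \<phi>) (lower (a \<phi>) (V \<phi>)) x) = (4 * in_chart \<phi> c x) *\<^sub>R a \<phi> x"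
      using cf \<phi> x conf unfolding conformal_field_def by blast
  qed (rule e)
  show ?thesis
  proof
    assume "\<exists>c \<sigma>. C1_scalar A \<sigma> \<and> conformal_field A a V c \<and> (\<forall>\<phi>\<in>A. \<forall>x\<in>rng_of \<phi>. \<forall>y. ?E \<phi> \<sigma> x y \<and> ?R \<phi> c \<sigma> x y \<and> ?D \<phi> c \<sigma> x y)"
    then obtain c \<sigma> where C1: "C1_scalar A \<sigma>" and cf: "conformal_field A a V c"
      and ids: "\<And>\<phi> x y. \<phi> \<in> A \<Longrightarrow> x \<in> rng_of \<phi> \<Longrightarrow> ?E \<phi> \<sigma> x y \<and> ?R \<phi> c \<sigma> x y \<and> ?D \<phi> c \<sigma> x y" by blast
    have "?sol \<phi> x" if \<phi>: "\<phi> \<in> A" and x: "x \<in> rng_of \<phi>" for \<phi> x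
    proof -
      have e: "e_lo (a \<phi>) (b \<phi>) z = (2 * in_chart \<phi> \<sigma> z) *\<^sub>R (a \<phi> z - outer (b \<phi> z) (b \<phi> z))" if "z \<in> rng_of \<phi>" for z
        using randers_chart.e00_iff[OF R[OF \<phi>] that] ids[OF \<phi> that] by blast
      show ?thesis using loc[OF C1 cf \<phi> x e] ids[OF \<phi> x] by blast
    qed
    thus "almost_ricci_soliton A F V \<kappa>" using sol by blast
  next
    assume "almost_ricci_soliton A F V \<kappa>"
    hence S: "?sol \<phi> x" if "\<phi> \<in> A" "x \<in> rng_of \<phi>" for \<phi> x using sol that by blast
    let ?van = "\<lambda>\<phi> x. randers_chart.vanish_near (rng_of \<phi>) (b \<phi>) x"
    let ?sig = "\<lambda>\<phi>. randers_chart.sig (a \<phi>) (b \<phi>)"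
    let ?cf = "\<lambda>\<phi>. randers_chart.cfac (a \<phi>) (V \<phi>)"
    have tr: "transition \<phi> \<psi> (snd \<phi> p) = snd \<psi> p" if "\<phi> \<in> A" "p \<in> dom_of \<phi>" for \<phi> \<psi> p
      by (simp add: transition_def chart_facts(3)[OF ch[OF that(1)] that(2)])
    have CH: "randers_chart_change (rng_of \<phi>) (a \<phi>) (rng_of \<psi>) (a \<psi>) (overlap \<phi> \<psi>) (transition \<phi> \<psi>) (jac \<phi> \<psi>) (b \<phi>) (b \<psi>)"
      if \<phi>: "\<phi> \<in> A" and \<psi>: "\<psi> \<in> A" for \<phi> \<psi>
    proof -
      interpret B: randers_chart "rng_of \<phi>" "a \<phi>" "b \<phi>" by (rule R[OF \<phi>])
      interpret B': randers_chart "rng_of \<psi>" "a \<psi>" "b \<psi>" by (rule R[OF \<psi>])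
      show ?thesis
      proof unfold_locales
        show "open (overlap \<phi> \<psi>)" unfolding overlap_def
          by (rule chart_facts(6)[OF ch[OF \<phi>] chart_facts(2)[OF ch[OF \<psi>]]])
        show "overlap \<phi> \<psi> \<subseteq> rng_of \<phi>" by (auto simp: overlap_def)
        show "transition \<phi> \<psi> x \<in> rng_of \<psi>" if "x \<in> overlap \<phi> \<psi>" for x
          using that tr[OF \<phi>, where \<psi>=\<psi>] by (auto simp: overlap_def simp del: split_paired_All)
        show "Ck_on 2 (overlap \<phi> \<psi>) (\<lambda>x. transition \<phi> \<psi> x $ i)" for i
          using M \<phi> \<psi> by (simp add: smooth_manifold_def smooth_on_def)
        show "jac \<phi> \<psi> x $ i $ k = pd k (\<lambda>x. transition \<phi> \<psi> x $ i) x" for x i k by (simp add: jac_def)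
        fix x assume x: "x \<in> overlap \<phi> \<psi>"
        have a1: "a \<phi> x $ k $ l = (\<Sum>i\<in>UNIV. \<Sum>j\<in>UNIV. a \<psi> (transition \<phi> \<psi> x) $ i $ j * jac \<phi> \<psi> x $ i $ k * jac \<phi> \<psi> x $ j $ l)" for k l
          by (rule riem[unfolded riemannian_metric_def, THEN conjunct2, THEN conjunct2, rule_format, OF \<phi> \<psi> x])
        have m: "(transpose (jac \<phi> \<psi> x) ** a \<psi> (transition \<phi> \<psi> x) ** jac \<phi> \<psi> x) $ k $ l
          = (\<Sum>j\<in>UNIV. \<Sum>i\<in>UNIV. a \<psi> (transition \<phi> \<psi> x) $ i $ j * jac \<phi> \<psi> x $ i $ k * jac \<phi> \<psi> x $ j $ l)" for k l
          by (simp add: matrix_matrix_mult_def transpose_def sum_distrib_left sum_distrib_right mult_ac)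
        have "(transpose (jac \<phi> \<psi> x) ** a \<psi> (transition \<phi> \<psi> x) ** jac \<phi> \<psi> x) $ k $ l = a \<phi> x $ k $ l" for k l
          unfolding a1 by (rule trans[OF m sum.swap])
        thus "a \<phi> x = transpose (jac \<phi> \<psi> x) ** a \<psi> (transition \<phi> \<psi> x) ** jac \<phi> \<psi> x"
          by (simp add: vec_eq_iff)
        have b1: "b \<phi> x $ k = (\<Sum>i\<in>UNIV. b \<psi> (transition \<phi> \<psi> x) $ i * jac \<phi> \<psi> x $ i $ k)" for k
          by (rule form[unfolded one_form_def, THEN conjunct2, rule_format, OF \<phi> \<psi> x])
        show "b \<phi> x = transpose (jac \<phi> \<psi> x) *v b \<psi> (transition \<phi> \<psi> x)"
          by (simp add: vec_eq_iff b1 matrix_vector_mult_def transpose_def mult.commute)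
      qed
    qed
    have van_indep: "?van \<phi> (snd \<phi> p)" if "\<phi> \<in> A" "\<psi> \<in> A" "p \<in> dom_of \<phi>" "p \<in> dom_of \<psi>" "?van \<psi> (snd \<psi> p)" for \<phi> \<psi> p
    proof -
      have "snd \<phi> p \<in> overlap \<phi> \<psi>" using that by (auto simp: overlap_def)
      from randers_chart_change.vanish_near_transform[OF CH[OF that(1,2)] this] show ?thesis
        using that tr by simp
    qed
    \<comment> \<open>The interior of the zero set of \<beta> on the manifold. Being open and
      closed, it would contain a whole component if it were nonempty.\<close>
    define Z where "Z = {p. \<exists>\<phi>\<in>A. p \<in> dom_of \<phi> \<and> ?van \<phi> (snd \<phi> p)}"
    have cover: "\<exists>\<phi>\<in>A. p \<in> dom_of \<phi>" if "p \<in> topspace X" for p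
    proof -
      have "p \<in> (\<Union>\<phi>\<in>A. dom_of \<phi>)" using M that by (simp add: smooth_manifold_def)
      thus ?thesis by blast
    qed
    have domX: "dom_of \<phi> \<subseteq> topspace X" if "\<phi> \<in> A" for \<phi>
      by (rule openin_subset[OF chart_facts(2)[OF ch[OF that]]])
    have openZ: "openin X Z"
    proof (subst openin_subopen, rule ballI)
      fix p assume "p \<in> Z"
      then obtain \<phi> where \<phi>: "\<phi> \<in> A" "p \<in> dom_of \<phi>" "?van \<phi> (snd \<phi> p)" by (auto simp: Z_def)
      obtain \<epsilon> where \<epsilon>: "\<epsilon> > 0" "\<forall>q\<in>ball (snd \<phi> p) \<epsilon>. ?van \<phi> q"
        using randers_chart.vanish_near_ball[OF R[OF \<phi>(1)] \<phi>(3)] by blast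
      show "\<exists>N. openin X N \<and> p \<in> N \<and> N \<subseteq> Z"
        by (rule exI[of _ "{q \<in> dom_of \<phi>. snd \<phi> q \<in> ball (snd \<phi> p) \<epsilon>}"])
          (use \<phi> \<epsilon> chart_facts(5)[OF ch[OF \<phi>(1)] open_ball] in \<open>auto simp: Z_def\<close>)
    qed
    \<comment> \<open>At a point p outside Z, a point of Z inside the ball of
      \<open>vanish_near_clopen\<close> would make b vanish on that ball and so put p into
      Z.\<close>
    have closedZ: "openin X (topspace X - Z)"
    proof (subst openin_subopen, rule ballI)
      fix p assume p: "p \<in> topspace X - Z"
      then obtain \<phi> where \<phi>: "\<phi> \<in> A" "p \<in> dom_of \<phi>" using cover by blast
      have x: "snd \<phi> p \<in> rng_of \<phi>" using \<phi> by blast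
      obtain \<delta> where \<delta>: "\<delta> > 0" "ball (snd \<phi> p) \<delta> \<subseteq> rng_of \<phi>"
        "(\<exists>q\<in>ball (snd \<phi> p) \<delta>. ?van \<phi> q) \<longrightarrow> (\<forall>z\<in>ball (snd \<phi> p) \<delta>. b \<phi> z = 0)"
        using randers_chart.vanish_near_clopen[OF R[OF \<phi>(1)] dim V2[OF \<phi>(1)] S[OF \<phi>(1)] x] by blast
      have nv: "\<not> ?van \<phi> (snd \<phi> p)" using p \<phi> by (auto simp: Z_def)
      have no: "q \<notin> Z" if q: "q \<in> dom_of \<phi>" "snd \<phi> q \<in> ball (snd \<phi> p) \<delta>" for q
      proof
        assume "q \<in> Z"
        then obtain \<psi> where "\<psi> \<in> A" "q \<in> dom_of \<psi>" "?van \<psi> (snd \<psi> q)" by (auto simp: Z_def)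
        hence "?van \<phi> (snd \<phi> q)" using van_indep \<phi> q by blast
        hence "\<forall>z\<in>ball (snd \<phi> p) \<delta>. b \<phi> z = 0" using \<delta>(3) q(2) by blast
        hence "?van \<phi> (snd \<phi> p)" using \<delta>(1,2) unfolding randers_chart.vanish_near_def[OF R[OF \<phi>(1)]] by blast
        thus False using nv by blast
      qed
      show "\<exists>N. openin X N \<and> p \<in> N \<and> N \<subseteq> topspace X - Z"
        by (rule exI[of _ "{q \<in> dom_of \<phi>. snd \<phi> q \<in> ball (snd \<phi> p) \<delta>}"])
          (use \<phi> \<delta>(1) no domX[OF \<phi>(1)] chart_facts(5)[OF ch[OF \<phi>(1)] open_ball] in \<open>auto\<close>)
    qed
    have "Z = {}"
    proof (rule ccontr)
      assume "Z \<noteq> {}"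
      then obtain p where p: "p \<in> Z" by blast
      hence pX: "p \<in> topspace X" using domX by (auto simp: Z_def)
      let ?C = "connected_component_of_set X p"
      have "?C \<in> connected_components_of X" using pX by (simp add: connected_component_in_connected_components_of)
      then obtain q \<phi> where q: "q \<in> ?C" "\<phi> \<in> A" "q \<in> dom_of \<phi>" "b \<phi> (snd \<phi> q) \<noteq> 0"
        using nonR unfolding non_riemannian_def by blast
      have "q \<notin> Z"
      proof
        assume "q \<in> Z"
        then obtain \<psi> where "\<psi> \<in> A" "q \<in> dom_of \<psi>" "?van \<psi> (snd \<psi> q)" by (auto simp: Z_def)
        hence "?van \<phi> (snd \<phi> q)" using van_indep q by blast
        thus False using randers_chart.vanish_near_zero(2)[OF R[OF q(2)]] q(4) by blast
      qed
      moreover have "q \<in> topspace X" using q domX by blast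
      moreover have "p \<in> ?C" using pX by (simp add: connected_component_of_refl)
      moreover have "connectedin X ?C" by (rule connectedin_connected_component_of)
      moreover have "?C \<subseteq> topspace X" by (rule connected_component_of_subset_topspace)
      ultimately show False using openZ closedZ p q(1) unfolding connectedin by blast
    qed
    hence nv: "\<not> ?van \<phi> x" if "\<phi> \<in> A" "x \<in> rng_of \<phi>" for \<phi> x
      using that by (auto simp: Z_def)
    have conf_cf: "cov (a \<phi>) (lower (a \<phi>) (V \<phi>)) x + transpose (cov (a \<phi>) (lower (a \<phi>) (V \<phi>)) x) = (4 * ?cf \<phi> x) *\<^sub>R a \<phi> x"
      if "\<phi> \<in> A" "x \<in> rng_of \<phi>" for \<phi> x
      by (rule randers_chart.conformal_cfac[OF R[OF that(1)] dim V2[OF that(1)] S[OF that(1)] that(2) nv[OF that]])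
    have e_sig: "e_lo (a \<phi>) (b \<phi>) x = (2 * ?sig \<phi> x) *\<^sub>R (a \<phi> x - outer (b \<phi> x) (b \<phi> x))"
      if "\<phi> \<in> A" "x \<in> rng_of \<phi>" for \<phi> x
      by (rule randers_chart.e_lo_sig[OF R[OF that(1)] dim V2[OF that(1)] S[OF that(1)] that(2)])
    \<comment> \<open>A chart is chosen at each point to define \<sigma> and c on the manifold.
      Since \<open>sig\<close> and \<open>cfac\<close> are determined by tensor equations, any other
      chart gives the same values.\<close>
    define ct where "ct p = (SOME \<phi>. \<phi> \<in> A \<and> p \<in> dom_of \<phi>)" for p
    define \<sigma> where "\<sigma> p = ?sig (ct p) (snd (ct p) p)" for p
    define c where "c p = ?cf (ct p) (snd (ct p) p)" for p
    have ovl: "\<exists>\<psi>\<in>A. x \<in> overlap \<phi> \<psi> \<and> in_chart \<phi> \<sigma> x = ?sig \<psi> (transition \<phi> \<psi> x) \<and> in_chart \<phi> c x = ?cf \<psi> (transition \<phi> \<psi> x) \<and> transition \<phi> \<psi> x \<in> rng_of \<psi>"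
      if \<phi>: "\<phi> \<in> A" and x: "x \<in> rng_of \<phi>" for \<phi> x
    proof -
      define p where "p = chart_inv \<phi> x"
      have p: "p \<in> dom_of \<phi>" "snd \<phi> p = x" using chart_facts(4)[OF ch[OF \<phi>] x] by (simp_all add: p_def)
      have "ct p \<in> A \<and> p \<in> dom_of (ct p)" unfolding ct_def
        by (rule someI_ex) (use \<phi> p in blast)
      thus ?thesis using p
        by (intro bexI[of _ "ct p"]) (auto simp: in_chart_def \<sigma>_def c_def transition_def overlap_def p_def[symmetric])
    qed
    have \<sigma>: "in_chart \<phi> \<sigma> x = ?sig \<phi> x" if \<phi>: "\<phi> \<in> A" and x: "x \<in> rng_of \<phi>" for \<phi> x
    proof -
      obtain \<psi> where \<psi>: "\<psi> \<in> A" "x \<in> overlap \<phi> \<psi>" "in_chart \<phi> \<sigma> x = ?sig \<psi> (transition \<phi> \<psi> x)" "transition \<phi> \<psi> x \<in> rng_of \<psi>"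
        using ovl[OF \<phi> x] by blast
      from randers_chart_change.sig_transform[OF CH[OF \<phi> \<psi>(1)] \<psi>(2) e_sig[OF \<psi>(1,4)]] \<psi>(3) show ?thesis by simp
    qed
    have c: "in_chart \<phi> c x = ?cf \<phi> x" if \<phi>: "\<phi> \<in> A" and x: "x \<in> rng_of \<phi>" for \<phi> x
    proof -
      obtain \<psi> where \<psi>: "\<psi> \<in> A" "x \<in> overlap \<phi> \<psi>" "in_chart \<phi> c x = ?cf \<psi> (transition \<phi> \<psi> x)" "transition \<phi> \<psi> x \<in> rng_of \<psi>"
        using ovl[OF \<phi> x] by blast
      have Vt: "V \<psi> (transition \<phi> \<psi> z) = jac \<phi> \<psi> z *v V \<phi> z" if "z \<in> overlap \<phi> \<psi>" for z
        using V[unfolded vector_field_def, THEN conjunct2, rule_format, OF \<phi> \<psi>(1) that]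
        by (simp add: vec_eq_iff matrix_vector_mult_def)
      have o: "open (rng_of \<psi>)" by (rule chart_facts(1)[OF ch[OF \<psi>(1)]])
      have aC: "Ck_on 1 (rng_of \<psi>) (\<lambda>x. a \<psi> x $ i $ j)" for i j
        using F \<psi>(1) by (simp add: randers_metric_def riemannian_metric_def smooth_on_def del: One_nat_def)
      have "Ck_on 1 (rng_of \<psi>) (\<lambda>x. lower (a \<psi>) (V \<psi>) x $ i)" for i
        by (simp only: lower_def vec_lambda_beta, intro Ck_intros o aC Ck_on_le[OF _ V2[OF \<psi>(1)]]) simp
      hence "diffV (lower (a \<psi>) (V \<psi>)) (transition \<phi> \<psi> x)"
        unfolding diffV_def using Ck_on_differentiable[OF _ zero_less_one \<psi>(4)] by blast
      from randers_chart_change.cfac_transform[OF CH[OF \<phi> \<psi>(1)] \<psi>(2) Vt this conf_cf[OF \<psi>(1,4)]] \<psi>(3) show ?thesis by simp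
    qed
    have C1: "C1_scalar A \<sigma>"
      unfolding C1_scalar_def
    proof
      fix \<phi> assume \<phi>: "\<phi> \<in> A"
      show "Ck_on 1 (rng_of \<phi>) (in_chart \<phi> \<sigma>)"
        by (rule Ck_on_cong_imp[OF chart_facts(1)[OF ch[OF \<phi>]] _ randers_chart.sig_Ck[OF R[OF \<phi>]]]) (simp add: \<sigma>[OF \<phi>])
    qed
    have cf: "conformal_field A a V c"
      unfolding conformal_field_def
    proof (intro ballI)
      fix \<phi> x assume p: "\<phi> \<in> A" "x \<in> rng_of \<phi>"
      show "\<forall>i j. cov (a \<phi>) (lower (a \<phi>) (V \<phi>)) x $ i $ j + cov (a \<phi>) (lower (a \<phi>) (V \<phi>)) x $ j $ i = 4 * in_chart \<phi> c x * a \<phi> x $ i $ j"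
        unfolding conf c[OF p] by (rule conf_cf[OF p])
    qed
    have "?E \<phi> \<sigma> x y \<and> ?R \<phi> c \<sigma> x y \<and> ?D \<phi> c \<sigma> x y" if \<phi>: "\<phi> \<in> A" and x: "x \<in> rng_of \<phi>" for \<phi> x y
    proof -
      have e: "e_lo (a \<phi>) (b \<phi>) z = (2 * in_chart \<phi> \<sigma> z) *\<^sub>R (a \<phi> z - outer (b \<phi> z) (b \<phi> z))" if "z \<in> rng_of \<phi>" for z
        unfolding \<sigma>[OF \<phi> that] by (rule e_sig[OF \<phi> that])
      have "?E \<phi> \<sigma> x y" using randers_chart.e00_iff[OF R[OF \<phi>] x] e[OF x] by blast
      moreover have "?R \<phi> c \<sigma> x y" "?D \<phi> c \<sigma> x y" using loc[OF C1 cf \<phi> x e] S[OF \<phi> x] by blast+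
      ultimately show ?thesis by blast
    qed
    thus "\<exists>c \<sigma>. C1_scalar A \<sigma> \<and> conformal_field A a V c \<and> (\<forall>\<phi>\<in>A. \<forall>x\<in>rng_of \<phi>. \<forall>y. ?E \<phi> \<sigma> x y \<and> ?R \<phi> c \<sigma> x y \<and> ?D \<phi> c \<sigma> x y)"
      using C1 cf by blast
  qed
qed

end
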